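(* (i) Let $n\ge2$ be an integer, $k\in\{2,\dots,n\}$, and let $\omega:[0,1]\to\mathbb{R}$ and $g:[0,1]^2\to\mathbb{R}$ be continuous functions. Then $$\frac{1}{(n-k)!}\Bigl(\int_0^1e^{\omega(s)}\,ds\Bigr)^{n-k}\int\limits_{\{0<s_1<\cdots<s_k<1\}}e^{\omega(s_1)+\cdots+\omega(s_k)}\,g(s_1,s_k)\,ds_1\cdots ds_k$$ $$=\int\limits_{\{0<s_1<\cdots<s_n<1\}}e^{\omega(s_1)+\cdots+\omega(s_n)}\Bigl[\sum_{\substack{1\le i<j\le n\\ j-i\ge k-1}}\binom{j-i-1}{k-2}\,g(s_i,s_j)\Bigr]ds_1\cdots ds_n.$$ (ii) This identity implies the following equality. Let $\omega_{\mu,\varepsilon}$, $r$, $\phi$, $\sigma^2$, $\mathcal{M}$ be as in the context, let $g(s,t)=-\log r(s-t)$, $M_{\mu,\varepsilon}=\int_0^1e^{\omega_{\mu,\varepsilon}(s)}ds$, and $d(m)=\sigma^2+\int_{\mathbb{R}\setminus\{0\}}e^{(m-1)u}(e^u-1)^2\,d\mathcal{M}(u)$ for $m\in\mathbb{N}$. Let $n\ge2$ be an integer with $n-\mu\phi(-in)>1$. Then $$n!\int\limits_{\{0<t_1<\cdots<t_n<1\}}\ \sum_{1\le k<p\le n}d(p-k)\,g(t_p,t_k)\prod_{1\le k<p\le n}r(t_p-t_k)^{-\mu\,d(p-k)}\,dt_1\cdots dt_n$$ $$=\sigma^2n(n-1)\int\limits_{\{0<s_1<s_2<1\}}\lim_{\varepsilon\to0}\mathbf{E}\Bigl[M_{\mu,\varepsilon}^{n-2}e^{\omega_{\mu,\varepsilon}(s_1)+\omega_{\mu,\varepsilon}(s_2)}\Bigr]g(s_1,s_2)\,ds_1ds_2$$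 $$+\sum_{k=2}^n\frac{n!}{(n-k)!}\int_{\mathbb{R}\setminus\{0\}}(e^u-1)^k\,d\mathcal{M}(u)\int\limits_{\{0<s_1<\cdots<s_k<1\}}\lim_{\varepsilon\to0}\mathbf{E}\Bigl[M_{\mu,\varepsilon}^{n-k}e^{\omega_{\mu,\varepsilon}(s_1)+\cdots+\omega_{\mu,\varepsilon}(s_k)}\Bigr]g(s_1,s_k)\,ds_1\cdots ds_k.$$
   Context: **Infinitely divisible exponent.** Let $\sigma^2\ge 0$ and let $\mathcal{M}$ be a Lévy spectral function: continuous and non-decreasing on $(-\infty,0)$ and on $(0,\infty)$, with $\int_{[-1,1]\setminus\{0\}}u^2\,d\mathcal{M}(u)<\infty$ and $\lim_{u\to\pm\infty}\mathcal{M}(u)=0$. It is assumed that $\mathcal{M}$ decays fast enough at infinity that all integrals with respect to $d\mathcal{M}$ that are used converge. (The pure point mass case $d\mathcal{M}(u)=\delta(u-\log c)\,du$, $c>0$, $c\ne1$, is also allowed.) Put $$\phi(q)=-\frac{iq\sigma^2}{2}-\frac{q^2\sigma^2}{2}+\int_{\mathbb{R}\setminus\{0\}}\bigl(e^{iqu}-1-iq(e^u-1)\bigr)\,d\mathcal{M}(u),$$ so that $\phi(-iq)=\frac{\sigma^2}{2}(q^2-q)+\int_{\mathbb{R}\setminus\{0\}}\bigl(e^{qu}-1-q(e^u-1)\bigr)d\mathcal{M}(u)$ and $\phi(-i)=0$. **Intensity measure.** Let $r$ be positive, smooth and even on $(-1,0)\cup(0,1)$ (with the one-sided values of $r$ and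 $r'$ at $1$ existing and $r(1)=1$), with $\lim_{t\to0^+}t\frac{d}{dt}\log r(t)=1$. Define $f(l)=-l^2\frac{d^2}{dl^2}\log r(l)$ for $l\in(0,1)$ and $f(l)=\frac{d}{dz}\big|_{z=1}\log r(z)$ for $l\ge1$, and assume $f>0$. (The Bacry–Muzy case is $r(t)=|t|$, $f=1$.) Let $\rho(dt\,dl)=\frac{f(l)}{l^2}\,dt\,dl$ on $\mathbb{H}_+=\{(t,l):l>0\}$. **The field.** For intermittency $\mu>0$ let $P$ be an infinitely divisible independently scattered random measure on $\mathbb{H}_+$: $P(A)$ and $P(B)$ are independent for disjoint $A,B$, and $\mathbf{E}[e^{iqP(A)}]=e^{\mu\phi(q)\rho(A)}$ for $q\in\mathbb{R}$. For $0<\varepsilon\le1$ let $$\mathcal{A}_\varepsilon(u)=\Bigl\{(t,l): |t-u|\le \tfrac{l}{2}\text{ for }\varepsilon\le l\le 1,\ \ |t-u|\le\tfrac12\text{ for }l\ge1\Bigr\},$$ and $\omega_{\mu,\varepsilon}(u)=P(\mathcal{A}_\varepsilon(u))$. One has $\rho(\mathcal{A}_\varepsilon(u)\cap\mathcal{A}_\varepsilon(v))=\rho_\varepsilon(u-v)$, where $\rho_\varepsilon(u)=-\log r(u)$ if $\varepsilon\le|u|\le1$, $\rho_\varepsilon(u)=-\log r(\varepsilon)+\bigl(1-\frac{|u|}{\varepsilon}\bigr)\varepsilon\frac{d}{d\varepsilon}\log r(\varepsilon)$ if $|u|<\varepsilon$, and $\rho_\varepsilon(u)=0$ if $|u|>1$.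 **Standing assumption (non-degeneracy).** $1-\mu\Bigl(\frac{\sigma^2}{2}+\int_{\mathbb{R}\setminus\{0\}}(ue^u-e^u+1)\,d\mathcal{M}(u)\Bigr)>0$. **Background.** The left-hand side in (ii) is the $\mu$-derivative of the known moment formula $\mathbf{E}[M_\mu^n]=n!\int_{\{0<t_1<\cdots<t_n<1\}}\prod_{k<p}r(t_p-t_k)^{-\mu d(p-k)}dt_1\cdots dt_n$, where $M_\mu=\lim_{\varepsilon\to0}M_{\mu,\varepsilon}$. *)

theory Defs
  imports "HOL-Probability.Probability"
begin

section \<open>Integration over ordered simplices\<close>

text \<open>Points of $k$-dimensional space are functions on the index set \<open>{1..k}\<close>, so that the
  dimension may vary inside a formula.\<close>

abbreviation lborel_vec :: "nat \<Rightarrow> (nat \<Rightarrow> real) measure" where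
  "lborel_vec k \<equiv> (\<Pi>\<^sub>M i\<in>{1..k}. lborel)"

definition ordered_simplex :: "nat \<Rightarrow> (nat \<Rightarrow> real) set" where
  "ordered_simplex k = {s \<in> {1..k} \<rightarrow>\<^sub>E {0<..<1}. strict_mono_on {1..k} s}"


section \<open>The infinitely divisible exponent\<close>

text \<open>\<open>stieltjes_measure \<M> \<nu>\<close>: the Borel measure \<open>\<nu>\<close> is $d\mathcal{M}$ on the punctured line.
  As \<open>\<M>\<close> may be unbounded near 0, \<open>interval_measure\<close> does not apply. The three clauses
  determine \<open>\<nu>\<close> uniquely.\<close>

definition stieltjes_measure :: "(real \<Rightarrow> real) \<Rightarrow> real measure \<Rightarrow> bool" where
  "stieltjes_measure \<M> \<nu> \<longleftrightarrow>
     sets \<nu> = sets borel \<and> emeasure \<nu> {0} = 0 \<and>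
     (\<forall>a b. a \<le> b \<and> (b < 0 \<or> 0 < a) \<longrightarrow> emeasure \<nu> {a<..b} = ennreal (\<M> b - \<M> a))"

definition levy_spectral_function :: "(real \<Rightarrow> real) \<Rightarrow> real measure \<Rightarrow> bool" where
  "levy_spectral_function \<M> \<nu> \<longleftrightarrow>
     continuous_on {..<0} \<M> \<and> mono_on {..<0} \<M> \<and>
     continuous_on {0<..} \<M> \<and> mono_on {0<..} \<M> \<and>
     (\<M> \<longlongrightarrow> 0) at_top \<and> (\<M> \<longlongrightarrow> 0) at_bot \<and>
     stieltjes_measure \<M> \<nu> \<and>
     set_integrable \<nu> ({-1..1} - {0}) (\<lambda>u. u\<^sup>2)"

definition levy_measure :: "real measure \<Rightarrow> bool" where
  "levy_measure \<nu> \<longleftrightarrow>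
     (\<exists>\<M>. levy_spectral_function \<M> \<nu>) \<or>
     (\<exists>c>0. c \<noteq> 1 \<and> \<nu> = return borel (ln c))"

text \<open>All measures \<open>\<nu>\<close> above give no mass to 0, so integrals over the punctured line are
  integrals with respect to \<open>\<nu>\<close>.\<close>

definition id_exponent :: "real \<Rightarrow> real measure \<Rightarrow> complex \<Rightarrow> complex" where
  "id_exponent \<sigma>2 \<nu> q =
     - (\<i> * q * of_real \<sigma>2) / 2 - q\<^sup>2 * of_real \<sigma>2 / 2
     + (CLINT u|\<nu>. exp (\<i> * q * of_real u) - 1 - \<i> * q * of_real (exp u - 1))"

lemma id_exponent_imaginary:
  "id_exponent \<sigma>2 \<nu> (- \<i> * of_real q) =
     of_real (\<sigma>2 / 2 * (q\<^sup>2 - q) + (LINT u|\<nu>. exp (q * u) - 1 - q * (exp u - 1)))"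
proof -
  have "(CLINT u|\<nu>. exp (\<i> * (- \<i> * of_real q) * of_real u) - 1
            - \<i> * (- \<i> * of_real q) * of_real (exp u - 1))
      = (CLINT u|\<nu>. complex_of_real (exp (q * u) - 1 - q * (exp u - 1)))"
    by (intro Bochner_Integration.integral_cong) (auto simp: exp_of_real[symmetric])
  also have "\<dots> = of_real (LINT u|\<nu>. exp (q * u) - 1 - q * (exp u - 1))"
    by (rule integral_complex_of_real)
  finally show ?thesis
    unfolding id_exponent_def by (simp add: field_simps power2_eq_square)
qed

definition d_coeff :: "real \<Rightarrow> real measure \<Rightarrow> nat \<Rightarrow> real" where
  "d_coeff \<sigma>2 \<nu> m = \<sigma>2 + (LINT u|\<nu>. exp ((real m - 1) * u) * (exp u - 1)\<^sup>2)"

definition nondegenerate :: "real \<Rightarrow> real \<Rightarrow> real measure \<Rightarrow> bool" where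
  "nondegenerate \<mu> \<sigma>2 \<nu> \<longleftrightarrow>
     1 - \<mu> * (\<sigma>2 / 2 + (LINT u|\<nu>. u * exp u - exp u + 1)) > 0"


section \<open>The intensity measure\<close>

text \<open>At \<open>l \<ge> 1\<close> the derivative at 1 is the left derivative, \<open>r\<close> being given only up to 1.\<close>

definition intensity :: "(real \<Rightarrow> real) \<Rightarrow> real \<Rightarrow> real" where
  "intensity r l =
     (if l < 1 then - l\<^sup>2 * deriv (deriv (\<lambda>z. ln (r z))) l
      else vector_derivative (\<lambda>z. ln (r z)) (at_left 1))"

definition admissible_scale :: "(real \<Rightarrow> real) \<Rightarrow> bool" where
  "admissible_scale r \<longleftrightarrow>
     (\<forall>t. 0 < \<bar>t\<bar> \<and> \<bar>t\<bar> < 1 \<longrightarrow>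
        0 < r t \<and> r (- t) = r t \<and> (\<forall>j. (deriv ^^ j) r differentiable (at t))) \<and>
     r 1 = 1 \<and> (r \<longlongrightarrow> 1) (at_left 1) \<and> (\<exists>D. (deriv r \<longlongrightarrow> D) (at_left 1)) \<and>
     ((\<lambda>t. t * deriv (\<lambda>z. ln (r z)) t) \<longlongrightarrow> 1) (at_right 0) \<and>
     (\<forall>l>0. intensity r l > 0)"

definition intensity_measure :: "(real \<Rightarrow> real) \<Rightarrow> (real \<times> real) measure" where
  "intensity_measure r =
     density (restrict_space lborel {(t, l). 0 < l}) (\<lambda>(t, l). ennreal (intensity r l / l\<^sup>2))"

definition log_kernel :: "(real \<Rightarrow> real) \<Rightarrow> real \<Rightarrow> real \<Rightarrow> real" where
  "log_kernel r s t = - ln (r (s - t))"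


section \<open>The random measure and the field\<close>

text \<open>\<open>P\<close> is indexed by the sets of finite \<open>\<rho>\<close>-measure. Independent scattering and additivity
  are required, as usual for random measures, for sequences of disjoint sets, additivity
  holding almost surely for each sequence; \<open>\<psi>\<close> is the characteristic exponent per unit
  of \<open>\<rho>\<close>-mass.\<close>

definition id_random_measure ::
    "'a measure \<Rightarrow> 'b measure \<Rightarrow> (complex \<Rightarrow> complex) \<Rightarrow> ('b set \<Rightarrow> 'a \<Rightarrow> real) \<Rightarrow> bool" where
  "id_random_measure \<Omega> \<rho> \<psi> P \<longleftrightarrow>
     prob_space \<Omega> \<and>
     (\<forall>A \<in> sets \<rho>. emeasure \<rho> A < \<infinity> \<longrightarrow>
        P A \<in> borel_measurable \<Omega> \<and>
        (\<forall>q::real. (CLINT x|\<Omega>. exp (\<i> * of_real q * of_real (P A x)))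
                    = exp (\<psi> (of_real q) * of_real (measure \<rho> A)))) \<and>
     (\<forall>A :: nat \<Rightarrow> 'b set.
        disjoint_family A \<and> (\<forall>i. A i \<in> sets \<rho> \<and> emeasure \<rho> (A i) < \<infinity>) \<longrightarrow>
        prob_space.indep_vars \<Omega> (\<lambda>_. borel) (\<lambda>i. P (A i)) UNIV \<and>
        (emeasure \<rho> (\<Union>i. A i) < \<infinity> \<longrightarrow>
           (AE x in \<Omega>. (\<lambda>i. P (A i) x) sums P (\<Union>i. A i) x)))"

definition log_cone :: "real \<Rightarrow> real \<Rightarrow> (real \<times> real) set" where
  "log_cone \<epsilon> u = {(t, l). (\<epsilon> \<le> l \<and> l \<le> 1 \<and> \<bar>t - u\<bar> \<le> l / 2) \<or> (1 \<le> l \<and> \<bar>t - u\<bar> \<le> 1 / 2)}"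

definition omega_field :: "((real \<times> real) set \<Rightarrow> 'a \<Rightarrow> real) \<Rightarrow> real \<Rightarrow> real \<Rightarrow> 'a \<Rightarrow> real" where
  "omega_field P \<epsilon> u = P (log_cone \<epsilon> u)"

text \<open>The field is given only up to a null set for each \<open>u\<close>; a jointly measurable version
  is needed for its pathwise integrals to be random variables.\<close>

definition measurable_field :: "'a measure \<Rightarrow> ((real \<times> real) set \<Rightarrow> 'a \<Rightarrow> real) \<Rightarrow> bool" where
  "measurable_field \<Omega> P \<longleftrightarrow>
     (\<forall>\<epsilon>. 0 < \<epsilon> \<and> \<epsilon> \<le> 1 \<longrightarrow>
        (\<lambda>(s, x). omega_field P \<epsilon> s x) \<in> borel_measurable (restrict_space borel {0..1} \<Otimes>\<^sub>M \<Omega>))"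

definition total_mass :: "((real \<times> real) set \<Rightarrow> 'a \<Rightarrow> real) \<Rightarrow> real \<Rightarrow> 'a \<Rightarrow> real" where
  "total_mass P \<epsilon> x = (LINT s:{0..1}|lborel. exp (omega_field P \<epsilon> s x))"

definition moment_density ::
    "((real \<times> real) set \<Rightarrow> 'a \<Rightarrow> real) \<Rightarrow> nat \<Rightarrow> nat \<Rightarrow> real \<Rightarrow> (nat \<Rightarrow> real) \<Rightarrow> 'a \<Rightarrow> real" where
  "moment_density P n k \<epsilon> s x =
     total_mass P \<epsilon> x ^ (n - k) * exp (\<Sum>i\<in>{1..k}. omega_field P \<epsilon> (s i) x)"

end

(* Part (i): split the cube [0,1]^n into the n! images of the ordered simplex under coordinate permutations. A
   permutation increasing on {1..k} that sends 1 to i and k to j amounts to a choice of k - 2 points strictly between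
   i and j and an arbitrary arrangement of the other n - k indices; this produces the binomial coefficient and
   (n - k)!. Only the symmetry of the weight is used, so the same identity applies in (ii).

   Part (ii): the cones of finitely many points cut the half plane into cells, each lying in a run of consecutive
   cones. As d is the second difference of m |-> phi(-im), which vanishes at 0 and 1, the expectation of
   exp(omega(t_1) + ... + omega(t_n)) is exp(mu * sum d(p - k) * rho(A(t_k) Int A(t_p))). It increases to
   prod r(t_p - t_k)^(-mu d(p-k)) as eps decreases to 0, so monotone convergence identifies the limits. The exponential
   moments of P(A) come from shifting the contour of a Gaussian integral of the characteristic function from Im z = 0
   to Im z = -m. Finiteness follows from a recursion on the largest gap between neighbouring points; convexity
   of m |-> phi(-im) carries n - mu phi(-in) > 1 over to all clusters of m <= n points. Finally
   (e^u - 1)^2 e^((m-1)u) = sum_k binom(m-1, k-2) (e^u - 1)^k matches the coefficients. *)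

theory Submission
  imports Defs "HOL-Complex_Analysis.Complex_Analysis" "HOL-Combinatorics.Permutations"
begin

section \<open>Permutations and ordered simplices\<close>

text \<open>All identities are first proved for nonnegative functions in \<open>ennreal\<close>,
  where Tonelli and monotone convergence ask for no integrability. Finiteness enters late, through
  the integrals \<open>pair_integral i j\<close> of the limit weight against -log r(t_j - t_i): both
  sides of (ii) are linear combinations of these finitely many numbers. The g of (i) may change
  sign; it is bounded, and adding a constant makes it nonnegative. The obstacle in (ii) is that the
  hypotheses speak only of characteristic functions at real arguments, so that even the existence of
  exponential moments has to be proved. Moreover, the limits on the right are themselves integrals
  over the n - k remaining points and may be infinite for exceptional s; Tonelli yields finiteness
  for almost every s only. The strictness of n - \<mu> phi(-in) > 1 leaves room for a small
  \<delta>, which is spent twice: on r(t) \<ge> C t^(1 + \<delta>), all that t (log r)'(t) -> 1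
  provides, and on the logarithm in the integrand, by -log r \<le> r^(-\<delta>) / \<delta>.\<close>

interpretation lborel_PiM: product_sigma_finite "\<lambda>_::nat. lborel :: real measure" by standard

lemma measurable_PiM_component_real:
  "i \<in> I \<Longrightarrow> (\<lambda>t. t i) \<in> borel_measurable (PiM I (\<lambda>_. lborel :: real measure))"
  using measurable_component_singleton[of i I "\<lambda>_. lborel :: real measure"] by simp

text \<open>A product measure is determined by its values on boxes. The preimage of a box under a
  permutation of coordinates is the box with permuted sides, whose volume has the same
  factors.\<close>

lemma distr_lborel_PiM_permute:
  assumes "finite I" "p permutes I"
  shows "distr (PiM I (\<lambda>_. lborel)) (PiM I (\<lambda>_. lborel)) (\<lambda>t. \<lambda>i\<in>I. t (p i)) = PiM I (\<lambda>_::nat. lborel :: real measure)"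
    (is "distr ?P ?P ?f = _")
proof (rule lborel_PiM.PiM_eqI)
  have m: "?f \<in> measurable ?P ?P"
    using permutes_in_image[OF assms(2)] by (intro measurable_restrict measurable_component_singleton) auto
  fix A assume A: "\<And>i. i \<in> I \<Longrightarrow> A i \<in> sets (lborel :: real measure)"
  let ?q = "inv p"
  have q: "?q permutes I" using permutes_inv[OF assms(2)] .
  have "?f -` Pi\<^sub>E I A \<inter> space ?P = Pi\<^sub>E I (\<lambda>i. A (?q i))"
  proof (intro set_eqI iffI)
    fix t assume t: "t \<in> ?f -` Pi\<^sub>E I A \<inter> space ?P"
    then have "t i \<in> A (?q i)" if "i \<in> I" for i
      using that permutes_in_image[OF q, of i] permutes_inverses(1)[OF assms(2), of i]
      by (force simp: PiE_iff)
    then show "t \<in> Pi\<^sub>E I (\<lambda>i. A (?q i))" using t by (auto simp: space_PiM PiE_iff)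
  next
    fix t assume t: "t \<in> Pi\<^sub>E I (\<lambda>i. A (?q i))"
    then have "t (p i) \<in> A i" if "i \<in> I" for i
      using that permutes_in_image[OF assms(2), of i] permutes_inverses(2)[OF assms(2), of i]
      by (force simp: PiE_iff)
    then show "t \<in> ?f -` Pi\<^sub>E I A \<inter> space ?P" using t by (auto simp: space_PiM PiE_iff)
  qed
  then have "emeasure (distr ?P ?P ?f) (Pi\<^sub>E I A) = emeasure ?P (Pi\<^sub>E I (\<lambda>i. A (?q i)))"
    using A assms(1) by (subst emeasure_distr[OF m]) (auto intro!: sets_PiM_I_finite)
  also have "\<dots> = (\<Prod>i\<in>I. emeasure lborel (A (?q i)))"
    using A assms(1) permutes_in_image[OF q] by (subst lborel_PiM.emeasure_PiM) auto
  also have "\<dots> = (\<Prod>i\<in>I. emeasure lborel (A i))"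
    using prod.permute[OF q, of "\<lambda>i. emeasure lborel (A i)"] by (simp add: comp_def)
  finally show "emeasure (distr ?P ?P ?f) (Pi\<^sub>E I A) = (\<Prod>i\<in>I. emeasure lborel (A i))" .
qed (use assms in auto)

lemma nn_integral_lborel_PiM_permute:
  assumes "finite I" "p permutes I" and [measurable]: "f \<in> borel_measurable (PiM I (\<lambda>_. lborel))"
  shows "(\<integral>\<^sup>+t. f (\<lambda>i\<in>I. t (p i)) \<partial>PiM I (\<lambda>_. lborel)) = (\<integral>\<^sup>+t. f t \<partial>PiM I (\<lambda>_::nat. lborel :: real measure))"
proof -
  have m: "(\<lambda>t. \<lambda>i\<in>I. t (p i)) \<in> measurable (PiM I (\<lambda>_. lborel)) (PiM I (\<lambda>_::nat. lborel :: real measure))"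
    using permutes_in_image[OF assms(2)] by (intro measurable_restrict measurable_component_singleton) auto
  show ?thesis
    by (subst (2) distr_lborel_PiM_permute[OF assms(1,2), symmetric]) (simp add: nn_integral_distr[OF m])
qed

text \<open>Position of \<open>t i\<close> in the increasing order of the values, counted from 1.
  For distinct values the sorting permutation is the inverse of the rank.\<close>

definition rank_of :: "'i set \<Rightarrow> ('i \<Rightarrow> real) \<Rightarrow> 'i \<Rightarrow> nat" where
  "rank_of I t i = card {j\<in>I. t j \<le> t i}"

lemma rank_of_less:
  assumes "finite I" "j \<in> I" "t i < t j"
  shows "rank_of I t i < rank_of I t j"
  unfolding rank_of_def
proof (rule psubset_card_mono)
  have "j \<in> {k\<in>I. t k \<le> t j}" "j \<notin> {k\<in>I. t k \<le> t i}" using assms by auto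
  moreover have "{k\<in>I. t k \<le> t i} \<subseteq> {k\<in>I. t k \<le> t j}" using assms(3) by auto
  ultimately show "{k\<in>I. t k \<le> t i} \<subset> {k\<in>I. t k \<le> t j}" by blast
qed (use assms in auto)

text \<open>If t o p increases, the values not exceeding \<open>t (p i)\<close> sit at p 1, ..., p
  i. Conversely the rank is monotone in the value, so a wrong order of values would give a wrong
  order of ranks. Sorting thus means inverting the rank, which yields uniqueness.\<close>

lemma strict_mono_on_comp_perm_iff:
  fixes t :: "nat \<Rightarrow> real"
  assumes p: "p permutes {1..n}"
  shows "strict_mono_on {1..n} (t \<circ> p) \<longleftrightarrow> (\<forall>i\<in>{1..n}. rank_of {1..n} t (p i) = i)"
proof
  assume sm: "strict_mono_on {1..n} (t \<circ> p)"
  show "\<forall>i\<in>{1..n}. rank_of {1..n} t (p i) = i"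
  proof
    fix i assume i: "i \<in> {1..n}"
    have "{j\<in>{1..n}. t j \<le> t (p i)} = {j\<in>p ` {1..n}. t j \<le> t (p i)}"
      unfolding permutes_image[OF p] ..
    also have "\<dots> = p ` {j\<in>{1..n}. t (p j) \<le> t (p i)}" by auto
    also have "{j\<in>{1..n}. t (p j) \<le> t (p i)} = {1..i}"
      using sm i strict_mono_on_leD[OF sm] strict_mono_onD[OF sm]
      by (auto simp: comp_def) (smt (verit) not_less atLeastAtMost_iff less_le_not_le)+
    finally show "rank_of {1..n} t (p i) = i"
      unfolding rank_of_def using card_image[of p "{1..i}"] permutes_inj_on[OF p] by simp
  qed
next
  assume *: "\<forall>i\<in>{1..n}. rank_of {1..n} t (p i) = i"
  show "strict_mono_on {1..n} (t \<circ> p)"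
  proof (rule strict_mono_onI)
    fix i j assume ij: "i \<in> {1..n}" "j \<in> {1..n}" "i < j"
    show "(t \<circ> p) i < (t \<circ> p) j"
    proof (rule ccontr)
      assume "\<not> ?thesis"
      then have "t (p j) \<le> t (p i)" by simp
      then have "rank_of {1..n} t (p j) \<le> rank_of {1..n} t (p i)"
        unfolding rank_of_def by (intro card_mono) auto
      then show False using * ij by auto
    qed
  qed
qed

text \<open>Distinct values make the rank injective, hence a bijection of {1..n}; its inverse sorts,
  and nothing else does.\<close>

lemma ex1_sorting_permutation:
  fixes t :: "nat \<Rightarrow> real"
  assumes inj: "inj_on t {1..n}"
  shows "\<exists>!p. p permutes {1..n} \<and> strict_mono_on {1..n} (t \<circ> p)"
proof -
  let ?r = "rank_of {1..n} t"
  have rinj: "inj_on ?r {1..n}"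
  proof (rule inj_onI)
    fix i j assume ij: "i \<in> {1..n}" "j \<in> {1..n}" "?r i = ?r j"
    then have "\<not> t i < t j" "\<not> t j < t i" 
      using rank_of_less[of "{1..n}" j t i] rank_of_less[of "{1..n}" i t j] by auto
    then have "t i = t j" by simp
    then show "i = j" using inj ij by (auto dest: inj_onD)
  qed
  have "?r i \<in> {1..n}" if "i \<in> {1..n}" for i
  proof -
    have "{i} \<subseteq> {j\<in>{1..n}. t j \<le> t i}" "{j\<in>{1..n}. t j \<le> t i} \<subseteq> {1..n}" using that by auto
    then have "card {i} \<le> ?r i" "?r i \<le> card {1..n}" unfolding rank_of_def by (intro card_mono; auto)+
    then show ?thesis by auto
  qed
  then have "?r ` {1..n} \<subseteq> {1..n}" by auto
  then have rbij: "bij_betw ?r {1..n} {1..n}"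
    using rinj endo_inj_surj[of "{1..n}" ?r] by (auto simp: bij_betw_def)
  \<comment> \<open>\<open>permutes\<close> demands the identity outside {1..n}, which the rank does
    not satisfy.\<close>
  define R where "R i = (if i \<in> {1..n} then ?r i else i)" for i
  have R: "R permutes {1..n}"
  proof (rule bij_imp_permutes)
    show "bij_betw R {1..n} {1..n}"
      using rbij bij_betw_cong[of "{1..n}" R ?r] by (simp add: R_def)
    show "R x = x" if "x \<notin> {1..n}" for x using that unfolding R_def by (rule if_not_P)
  qed
  show ?thesis
  proof (rule ex1I[of _ "inv R"])
    have "\<forall>i\<in>{1..n}. ?r (inv R i) = i"
    proof
      fix i assume "i \<in> {1..n}"
      then have "inv R i \<in> {1..n}" using permutes_in_image[OF permutes_inv[OF R]] by blast
      then have "?r (inv R i) = R (inv R i)" by (simp add: R_def)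
      then show "?r (inv R i) = i" using permutes_inverses(1)[OF R] by simp
    qed
    then show "inv R permutes {1..n} \<and> strict_mono_on {1..n} (t \<circ> inv R)"
      using permutes_inv[OF R] strict_mono_on_comp_perm_iff[OF permutes_inv[OF R]] by blast
  next
    fix p assume p: "p permutes {1..n} \<and> strict_mono_on {1..n} (t \<circ> p)"
    then have *: "\<forall>i\<in>{1..n}. ?r (p i) = i" using strict_mono_on_comp_perm_iff by blast
    have "R (p i) = i" for i
      using * p permutes_in_image[of p "{1..n}" i] permutes_not_in[of p "{1..n}" i]
      by (cases "i \<in> {1..n}") (auto simp: R_def)
    then have "inv R i = p i" for i
      using permutes_inv_eq[OF R] by blast
    then show "p = inv R" by auto
  qed
qed

text \<open>A graph is a null set: with the other coordinates fixed, the exceptional value of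
  \<open>t i\<close> is a single point, and Tonelli integrates zeros.\<close>

lemma AE_lborel_PiM_component_neq:
  fixes f :: "(nat \<Rightarrow> real) \<Rightarrow> real"
  assumes "finite I" "i \<in> I" and [measurable]: "f \<in> borel_measurable (PiM (I - {i}) (\<lambda>_. lborel))"
  shows "AE t in PiM I (\<lambda>_. lborel). t i \<noteq> f (restrict t (I - {i}))"
proof -
  let ?J = "I - {i}"
  let ?P = "PiM I (\<lambda>_::nat. lborel :: real measure)"
  have I: "insert i ?J = I" using assms by auto
  have [measurable]: "(\<lambda>t. t i) \<in> borel_measurable ?P"
    using assms(2) measurable_component_singleton[of i I "\<lambda>_. lborel :: real measure"] by simp
  have [measurable]: "(\<lambda>t. restrict t ?J) \<in> measurable ?P (PiM ?J (\<lambda>_. lborel))"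
    by (intro measurable_restrict_subset) auto
  let ?N = "{t \<in> space ?P. t i = f (restrict t ?J)}"
  have N[measurable]: "?N \<in> sets ?P" by measurable
  then have N': "indicator ?N \<in> borel_measurable (PiM (insert i ?J) (\<lambda>_. lborel :: real measure))"
    unfolding I by (intro borel_measurable_indicator)
  have "emeasure ?P ?N = (\<integral>\<^sup>+t. indicator ?N t \<partial>?P)" using N by simp
  also have "\<dots> = (\<integral>\<^sup>+x. (\<integral>\<^sup>+y. indicator ?N (x(i := y)) \<partial>lborel) \<partial>PiM ?J (\<lambda>_. lborel))"
    using lborel_PiM.product_nn_integral_insert[of ?J i "indicator ?N"] N' assms(1) unfolding I by simp
  also have "\<dots> = (\<integral>\<^sup>+x. (\<integral>\<^sup>+y. indicator {f x} y \<partial>lborel) \<partial>PiM ?J (\<lambda>_. lborel))"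
  proof (intro nn_integral_cong)
    fix x y assume x: "x \<in> space (PiM ?J (\<lambda>_. lborel :: real measure))"
    have "restrict (x(i := y)) ?J = x"
      using x by (auto simp: space_PiM PiE_iff extensional_def fun_eq_iff)
    moreover have "x(i := y) \<in> space ?P"
      using x PiE_fun_upd[of y "\<lambda>_. UNIV" i x ?J] unfolding I by (simp add: space_PiM)
    ultimately show "indicator ?N (x(i := y)) = (indicator {f x} y :: ennreal)"
      by (auto simp: indicator_def)
  qed
  also have "\<dots> = 0" by simp
  finally show ?thesis by (intro AE_I[of _ _ ?N]) auto
qed

text \<open>The set \<open>C\<close> will hold the fixed points s 1, ..., s k while the remaining
  coordinates are integrated, so that old and new points together are almost surely
  distinct.\<close>

lemma AE_lborel_PiM_inj_avoid:
  fixes I :: "nat set"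
  assumes I: "finite I" and C: "finite C"
  shows "AE t in PiM I (\<lambda>_. lborel :: real measure). inj_on t I \<and> (\<forall>i\<in>I. t i \<notin> C)"
proof -
  have 1: "AE t in PiM I (\<lambda>_::nat. lborel :: real measure). t i \<noteq> t j" if "i \<in> I" "j \<in> I" "i \<noteq> j" for i j
  proof -
    have [measurable]: "(\<lambda>t. t j) \<in> borel_measurable (PiM (I - {i}) (\<lambda>_. lborel :: real measure))"
      using that measurable_component_singleton[of j "I-{i}" "\<lambda>_. lborel :: real measure"] by simp
    show ?thesis using AE_lborel_PiM_component_neq[OF I that(1), of "\<lambda>t. t j"] that by simp
  qed
  have 2: "AE t in PiM I (\<lambda>_::nat. lborel :: real measure). t i \<noteq> c" if "i \<in> I" for i c
    using AE_lborel_PiM_component_neq[OF I that(1), of "\<lambda>t. c"] by simp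
  have "AE t in PiM I (\<lambda>_. lborel :: real measure). \<forall>i\<in>I. (\<forall>j\<in>I. i \<noteq> j \<longrightarrow> t i \<noteq> t j) \<and> (\<forall>c\<in>C. t i \<noteq> c)"
    using 1 2 I C by (intro AE_finite_allI AE_conjI AE_impI) auto
  then show ?thesis by (rule eventually_mono) (auto simp: inj_on_def)
qed

section \<open>The ordered simplex as a fundamental domain of the cube\<close>

lemma ordered_simplex_altdef:
  "ordered_simplex n = {t \<in> space (lborel_vec n). (\<forall>i\<in>{1..n}. 0 < t i \<and> t i < 1) \<and>
     (\<forall>i\<in>{1..n}. \<forall>j\<in>{1..n}. i < j \<longrightarrow> t i < t j)}"
  unfolding ordered_simplex_def by (auto simp: space_PiM PiE_iff strict_mono_on_def)

lemma ordered_simplexD: "s \<in> ordered_simplex k \<Longrightarrow> i \<in> {1..k} \<Longrightarrow> 0 < s i \<and> s i < 1"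
  unfolding ordered_simplex_def PiE_iff by auto

lemma sets_ordered_simplex [measurable]: "ordered_simplex n \<in> sets (lborel_vec n)"
proof -
  have c: "(\<lambda>t. t i) \<in> borel_measurable (lborel_vec n)" if "i \<in> {1..n}" for i
    using measurable_component_singleton[OF that, of "\<lambda>_. lborel :: real measure"] by simp
  have 1: "{t \<in> space (lborel_vec n). 0 < t i \<and> t i < 1} \<in> sets (lborel_vec n)" if "i \<in> {1..n}" for i
    using c[OF that] by (intro sets.sets_Collect_conj borel_measurable_less borel_measurable_const)
  have 2: "{t \<in> space (lborel_vec n). i < j \<longrightarrow> t i < t j} \<in> sets (lborel_vec n)"
    if "i \<in> {1..n}" "j \<in> {1..n}" for i j
    using c[OF that(1)] c[OF that(2)] by (intro sets.sets_Collect_imp sets.sets_Collect_const borel_measurable_less)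
  show ?thesis unfolding ordered_simplex_altdef
    using 1 2 by (intro sets.sets_Collect_conj sets.sets_Collect_finite_All) auto
qed

text \<open>The index set is a parameter because the free coordinates carry the indices
  {k+1..n}.\<close>

definition unit_cube :: "nat set \<Rightarrow> (nat \<Rightarrow> real) set" where
  "unit_cube I = (\<Pi>\<^sub>E i\<in>I. {0<..<1})"

lemma sets_unit_cube [measurable]: "finite I \<Longrightarrow> unit_cube I \<in> sets (PiM I (\<lambda>_. lborel))"
  unfolding unit_cube_def by (intro sets_PiM_I_finite) auto

lemma measurable_permute_coords:
  assumes "p permutes I"
  shows "(\<lambda>t. \<lambda>i\<in>I. t (p i)) \<in> measurable (PiM I (\<lambda>_. lborel)) (PiM I (\<lambda>_::nat. lborel :: real measure))"
  using permutes_in_image[OF assms] by (intro measurable_restrict measurable_component_singleton) auto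

text \<open>Away from ties exactly one permutation carries a point of the cube into the simplex, so
  the indicator of the cube is a sum of simplex indicators over all permutations. A change of
  variables then moves the permutation from the simplex to the integrand.\<close>

lemma nn_integral_unit_cube_sort:
  assumes [measurable]: "H \<in> borel_measurable (lborel_vec n)"
  shows "(\<integral>\<^sup>+t. H t * indicator (unit_cube {1..n}) t \<partial>lborel_vec n)
    = (\<Sum>p | p permutes {1..n}. \<integral>\<^sup>+t. H (\<lambda>i\<in>{1..n}. t (p i)) * indicator (ordered_simplex n) t \<partial>lborel_vec n)"
proof -
  let ?T = "\<lambda>p t. (\<lambda>i\<in>{1..n}. t (p i)) :: nat \<Rightarrow> real"
  have ind: "indicator (unit_cube {1..n}) t = (\<Sum>p | p permutes {1..n}. indicator (ordered_simplex n) (?T p t) :: ennreal)"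
    if inj: "inj_on t {1..n}" and t: "t \<in> space (lborel_vec n)" for t
  proof -
    obtain p where p: "p permutes {1..n}" "strict_mono_on {1..n} (t \<circ> p)"
      and uniq: "\<And>q. q permutes {1..n} \<Longrightarrow> strict_mono_on {1..n} (t \<circ> q) \<Longrightarrow> q = p"
      using ex1_sorting_permutation[OF inj] by blast
    have *: "?T q t \<in> ordered_simplex n \<longleftrightarrow> t \<in> unit_cube {1..n} \<and> q = p" if q: "q permutes {1..n}" for q
    proof -
      have sm: "strict_mono_on {1..n} (?T q t) \<longleftrightarrow> strict_mono_on {1..n} (t \<circ> q)"
        by (auto simp: strict_mono_on_def)
      have "(\<forall>i\<in>{1..n}. t (q i) \<in> {0<..<1}) \<longleftrightarrow> (\<forall>i\<in>q ` {1..n}. t i \<in> {0<..<1})" by simp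
      then have "?T q t \<in> {1..n} \<rightarrow>\<^sub>E {0<..<1} \<longleftrightarrow> t \<in> unit_cube {1..n}"
        using t unfolding permutes_image[OF q] unit_cube_def by (auto simp: space_PiM PiE_iff)
      then show ?thesis using sm uniq[OF q] p(2) unfolding ordered_simplex_def by auto
    qed
    have "(\<Sum>q | q permutes {1..n}. indicator (ordered_simplex n) (?T q t) :: ennreal)
      = (\<Sum>q | q permutes {1..n}. if q = p then indicator (unit_cube {1..n}) t else 0)"
    proof (intro sum.cong refl)
      fix q assume "q \<in> {q. q permutes {1..n}}"
      then show "indicator (ordered_simplex n) (?T q t) = (if q = p then indicator (unit_cube {1..n}) t else 0 :: ennreal)"
        using *[of q] unfolding indicator_def by auto
    qed
    also have "\<dots> = indicator (unit_cube {1..n}) t" using p(1) by (simp add: finite_permutations)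
    finally show ?thesis ..
  qed
  have [measurable]: "?T p \<in> measurable (lborel_vec n) (lborel_vec n)" if "p permutes {1..n}" for p
    by (rule measurable_permute_coords[OF that])
  have "(\<integral>\<^sup>+t. H t * indicator (unit_cube {1..n}) t \<partial>lborel_vec n)
      = (\<integral>\<^sup>+t. (\<Sum>p | p permutes {1..n}. H t * indicator (ordered_simplex n) (?T p t)) \<partial>lborel_vec n)"
  proof (rule nn_integral_cong_AE)
    have "AE t in lborel_vec n. inj_on t {1..n}"
      using AE_lborel_PiM_inj_avoid[of "{1..n}" "{}"] by (auto elim: eventually_mono)
    with AE_space show "AE t in lborel_vec n. H t * indicator (unit_cube {1..n}) t =
        (\<Sum>p | p permutes {1..n}. H t * indicator (ordered_simplex n) (?T p t))"
      by eventually_elim (simp only: ind sum_distrib_left)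
  qed
  also have "\<dots> = (\<Sum>p | p permutes {1..n}. \<integral>\<^sup>+t. H t * indicator (ordered_simplex n) (?T p t) \<partial>lborel_vec n)"
    by (intro nn_integral_sum) measurable
  also have "\<dots> = (\<Sum>p | p permutes {1..n}. \<integral>\<^sup>+t. H (?T (inv p) t) * indicator (ordered_simplex n) t \<partial>lborel_vec n)"
  proof (intro sum.cong refl)
    fix p assume "p \<in> {p. p permutes {1..n}}"
    then have p: "p permutes {1..n}" by simp
    have q: "inv p permutes {1..n}" by (rule permutes_inv[OF p])
    have "(\<integral>\<^sup>+t. H (?T (inv p) t) * indicator (ordered_simplex n) t \<partial>lborel_vec n) =
      (\<integral>\<^sup>+t. H (?T (inv p) (?T p t)) * indicator (ordered_simplex n) (?T p t) \<partial>lborel_vec n)"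
      using p q by (intro nn_integral_lborel_PiM_permute[OF _ p, symmetric]) measurable
    also have "\<dots> = (\<integral>\<^sup>+t. H t * indicator (ordered_simplex n) (?T p t) \<partial>lborel_vec n)"
    proof (intro nn_integral_cong)
      fix t assume t: "t \<in> space (lborel_vec n)"
      have "?T (inv p) (?T p t) = t"
        using t permutes_in_image[OF q] permutes_inverses(1)[OF p]
        by (auto simp: fun_eq_iff space_PiM PiE_iff extensional_def restrict_def)
      then show "H (?T (inv p) (?T p t)) * indicator (ordered_simplex n) (?T p t)
        = H t * indicator (ordered_simplex n) (?T p t)" by simp
    qed
    finally show "(\<integral>\<^sup>+t. H t * indicator (ordered_simplex n) (?T p t) \<partial>lborel_vec n)
      = (\<integral>\<^sup>+t. H (?T (inv p) t) * indicator (ordered_simplex n) t \<partial>lborel_vec n)" ..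
  qed
  \<comment> \<open>The substitution leaves the inverse permutation in the integrand; inversion only
    reorders the sum.\<close>
  also have "\<dots> = (\<Sum>p | p permutes {1..n}. \<integral>\<^sup>+t. H (?T p t) * indicator (ordered_simplex n) t \<partial>lborel_vec n)"
    by (rule sum_permutations_inverse[symmetric])
  finally show ?thesis .
qed

section \<open>Counting permutations that increase on an initial segment\<close>

lemma card_atMost_image_strict_mono:
  fixes p :: "nat \<Rightarrow> nat"
  assumes p: "strict_mono_on {1..k} p" and i: "i \<in> {1..k}"
  shows "card {x \<in> p ` {1..k}. x \<le> p i} = i"
proof -
  have "{x \<in> p ` {1..k}. x \<le> p i} = p ` {1..i}"
    using i by (auto simp: strict_mono_on_less_eq[OF p])
  moreover have "inj_on p {1..i}"
    using inj_on_subset[OF strict_mono_on_imp_inj_on[OF p]] i by auto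
  ultimately show ?thesis by (simp add: card_image)
qed

text \<open>An increasing enumeration can be read off its image: the index of a point is the number
  of image points up to it.\<close>

lemma strict_mono_on_image_unique:
  fixes p q :: "nat \<Rightarrow> nat"
  assumes p: "strict_mono_on {1..k} p" and q: "strict_mono_on {1..k} q"
    and im: "p ` {1..k} = q ` {1..k}" and i: "i \<in> {1..k}"
  shows "p i = q i"
proof -
  obtain j where j: "j \<in> {1..k}" "p i = q j" using im i by (metis imageE imageI)
  have "i = card {x \<in> p ` {1..k}. x \<le> p i}" using card_atMost_image_strict_mono[OF p i] by simp
  also have "\<dots> = j" using card_atMost_image_strict_mono[OF q j(1)] im j(2) by simp
  finally show ?thesis using j by simp
qed

text \<open>On {1..k} such a permutation is forced to be the increasing enumeration of
  \<open>J\<close>. Two of them therefore differ by a permutation of {k+1..n} applied first, and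
  \<open>p0\<close> serves as the base point of this parametrisation.\<close>

lemma card_increasing_permutations_with_image:
  assumes J: "J \<subseteq> {1..n}" "card J = k"
  shows "card {p. p permutes {1..n} \<and> strict_mono_on {1..k} p \<and> p ` {1..k} = J} = fact (n - k)"
proof -
  have fJ: "finite J" using J finite_subset by blast
  have kn: "k \<le> n" using card_mono[of "{1..n}" J] J by simp
  obtain h where h: "bij_betw h {..<k} J" "strict_mono_on {..<k} h"
    using ex_bij_betw_strict_mono_card[OF fJ] J(2) by auto
  have "card {k+1..n} = card ({1..n} - J)" using J fJ by (subst card_Diff_subset) auto
  then obtain g where g: "bij_betw g {k+1..n} ({1..n} - J)"
    using finite_same_card_bij[of "{k+1..n}" "{1..n} - J"] by blast
  \<comment> \<open>The enumeration \<open>h\<close> of \<open>J\<close> counts from 0, the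
    coordinates from 1; hence the shift. On the complement any bijection \<open>g\<close> will
    do.\<close>
  define p0 where "p0 i = (if i \<in> {1..k} then h (i - 1) else if i \<in> {k+1..n} then g i else i)" for i
  have "bij_betw (\<lambda>i. i - 1) {1..k} {..<k}"
    by (rule bij_betw_byWitness[of _ Suc]) auto
  from bij_betw_trans[OF this h(1)] have "bij_betw (\<lambda>i. h (i - 1)) {1..k} J" by (simp add: comp_def)
  then have b1: "bij_betw p0 {1..k} J" using bij_betw_cong[of "{1..k}" p0 "\<lambda>i. h (i - 1)"] by (simp add: p0_def)
  have b2: "bij_betw p0 {k+1..n} ({1..n} - J)"
    using g bij_betw_cong[of "{k+1..n}" p0 g] by (simp add: p0_def)
  have "bij_betw p0 ({1..k} \<union> {k+1..n}) (J \<union> ({1..n} - J))"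
    by (rule bij_betw_combine[OF b1 b2]) auto
  moreover have "{1..k} \<union> {k+1..n} = {1..n}" "J \<union> ({1..n} - J) = {1..n}" using kn J by auto
  ultimately have b: "bij_betw p0 {1..n} {1..n}" by simp
  have p0: "p0 permutes {1..n}"
  proof (rule bij_imp_permutes[OF b])
    fix x assume "x \<notin> {1..n}"
    then have "x \<notin> {1..k}" "x \<notin> {k+1..n}" using kn by auto
    then show "p0 x = x" unfolding p0_def by presburger
  qed
  have sm0: "strict_mono_on {1..k} p0"
  proof (rule strict_mono_onI)
    fix i j assume "i \<in> {1..k}" "j \<in> {1..k}" "i < j"
    then show "p0 i < p0 j" unfolding p0_def using strict_mono_onD[OF h(2), of "i - 1" "j - 1"] by auto
  qed
  have im0: "p0 ` {1..k} = J" using b1 by (simp add: bij_betw_def)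
  have "{p. p permutes {1..n} \<and> strict_mono_on {1..k} p \<and> p ` {1..k} = J}
      = (\<lambda>q. p0 \<circ> q) ` {q. q permutes {k+1..n}}" (is "?L = ?R")
  proof (intro set_eqI iffI)
    fix p assume "p \<in> ?L"
    then have p: "p permutes {1..n}" "strict_mono_on {1..k} p" "p ` {1..k} = J" by auto
    have q: "inv p0 \<circ> p permutes {1..n}" by (rule permutes_compose[OF p(1) permutes_inv[OF p0]])
    have "(inv p0 \<circ> p) i = i" if "i \<in> {1..n} - {k+1..n}" for i
    proof -
      from that have "i \<in> {1..k}" by auto
      then have "p i = p0 i" using strict_mono_on_image_unique[OF p(2) sm0 _ , of i] p(3) im0 by simp
      then show ?thesis using permutes_inverses(2)[OF p0] by simp
    qed
    then have "inv p0 \<circ> p permutes {k+1..n}" by (intro permutes_superset[OF q]) auto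
    moreover have "p = p0 \<circ> (inv p0 \<circ> p)" using permutes_inverses(1)[OF p0] by (auto simp: fun_eq_iff)
    ultimately show "p \<in> ?R" by blast
  next
    fix p assume "p \<in> ?R"
    then obtain q where q: "q permutes {k+1..n}" and p: "p = p0 \<circ> q" by auto
    have "q permutes {1..n}" using permutes_subset[OF q] by auto
    then have "p permutes {1..n}" unfolding p by (rule permutes_compose[OF _ p0])
    moreover have eq: "p i = p0 i" if "i \<in> {1..k}" for i
      using that permutes_not_in[OF q, of i] unfolding p by auto
    moreover have "strict_mono_on {1..k} p" using sm0 eq by (auto simp: strict_mono_on_def)
    moreover have "p ` {1..k} = J" using im0 eq by (metis image_cong)
    ultimately show "p \<in> ?L" by auto
  qed
  moreover have "inj_on (\<lambda>q. p0 \<circ> q) {q. q permutes {k+1..n}}"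
    using permutes_inj[OF p0] by (intro inj_onI) (auto simp: fun_eq_iff inj_def)
  ultimately show ?thesis
    by (simp add: card_image card_permutations del: atLeastAtMost_iff)
qed

text \<open>Deleting the two extreme points is a bijection onto the subsets of the open interval
  between i and j with k - 2 elements.\<close>

lemma card_subsets_with_Min_Max:
  assumes ij: "1 \<le> i" "i < j" "j \<le> n" and k: "2 \<le> k"
  shows "card {J. J \<subseteq> {1..n} \<and> card J = k \<and> Min J = i \<and> Max J = j} = (j - i - 1) choose (k - 2)"
proof -
  let ?f = "\<lambda>K. insert i (insert j K)"
  have "bij_betw ?f {K. K \<subseteq> {i<..<j} \<and> card K = k - 2} {J. J \<subseteq> {1..n} \<and> card J = k \<and> Min J = i \<and> Max J = j}"
  proof (rule bij_betw_byWitness[of _ "\<lambda>J. J - {i, j}"])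
    show "\<forall>K\<in>{K. K \<subseteq> {i<..<j} \<and> card K = k - 2}. ?f K - {i, j} = K" by auto
    show "\<forall>J\<in>{J. J \<subseteq> {1..n} \<and> card J = k \<and> Min J = i \<and> Max J = j}. ?f (J - {i, j}) = J"
    proof
      fix J assume J: "J \<in> {J. J \<subseteq> {1..n} \<and> card J = k \<and> Min J = i \<and> Max J = j}"
      then have "finite J" "J \<noteq> {}" using k finite_subset[of J "{1..n}"] by auto
      then have "Min J \<in> J" "Max J \<in> J" by (rule Min_in, rule Max_in)
      then have "i \<in> J" "j \<in> J" using J by auto
      then show "?f (J - {i, j}) = J" by auto
    qed
    show "?f ` {K. K \<subseteq> {i<..<j} \<and> card K = k - 2} \<subseteq> {J. J \<subseteq> {1..n} \<and> card J = k \<and> Min J = i \<and> Max J = j}"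
    proof (intro image_subsetI CollectI conjI)
      fix K assume "K \<in> {K. K \<subseteq> {i<..<j} \<and> card K = k - 2}"
      then have K: "K \<subseteq> {i<..<j}" "card K = k - 2" and fK: "finite K"
        using finite_subset[of K "{i<..<j}"] by auto
      show "?f K \<subseteq> {1..n}" using K ij by auto
      have "i \<notin> insert j K" "j \<notin> K" using K ij by auto
      then show "card (?f K) = k" using K fK k by simp
      show "Min (?f K) = i" using K fK ij by (intro Min_eqI) auto
      show "Max (?f K) = j" using K fK ij by (intro Max_eqI) auto
    qed
    show "(\<lambda>J. J - {i, j}) ` {J. J \<subseteq> {1..n} \<and> card J = k \<and> Min J = i \<and> Max J = j} \<subseteq> {K. K \<subseteq> {i<..<j} \<and> card K = k - 2}"
    proof (intro image_subsetI CollectI conjI)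
      fix J assume J: "J \<in> {J. J \<subseteq> {1..n} \<and> card J = k \<and> Min J = i \<and> Max J = j}"
      then have fJ: "finite J" "J \<noteq> {}" using k finite_subset[of J "{1..n}"] by auto
      then have "Min J \<in> J" "Max J \<in> J" by (rule Min_in, rule Max_in)
      then have ijJ: "i \<in> J" "j \<in> J" using J by auto
      show "J - {i, j} \<subseteq> {i<..<j}"
      proof
        fix x assume x: "x \<in> J - {i, j}"
        then have "Min J \<le> x" "x \<le> Max J" using fJ by auto
        then show "x \<in> {i<..<j}" using x J by auto
      qed
      show "card (J - {i, j}) = k - 2" using ijJ ij J fJ by (subst card_Diff_subset) auto
    qed
  qed
  from bij_betw_same_card[OF this] show ?thesis by (simp add: n_subsets)
qed

text \<open>Group the permutations by the image \<open>J\<close> of {1..k}: they send 1 and k to its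
  minimum and maximum, so the summand depends on \<open>J\<close> alone. Then group the sets
  \<open>J\<close> by their extremes; j - i \<ge> k - 1 says that k points fit between i and j, ends
  included.\<close>

lemma sum_increasing_permutations:
  fixes F :: "nat \<Rightarrow> nat \<Rightarrow> 'a::comm_semiring_1"
  assumes k: "2 \<le> k" "k \<le> n"
  shows "(\<Sum>p | p permutes {1..n} \<and> strict_mono_on {1..k} p. F (p 1) (p k)) =
    of_nat (fact (n - k)) * (\<Sum>(i, j)\<in>{(i, j). 1 \<le> i \<and> i < j \<and> j \<le> n \<and> k - 1 \<le> j - i}.
      of_nat ((j - i - 1) choose (k - 2)) * F i j)"
proof -
  let ?S = "{p. p permutes {1..n} \<and> strict_mono_on {1..k} p}"
  let ?JJ = "{J. J \<subseteq> {1..n} \<and> card J = k}"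
  let ?R = "{(i, j). 1 \<le> i \<and> i < j \<and> j \<le> n \<and> k - 1 \<le> j - i}"
  have fS: "finite ?S" by (rule finite_subset[OF _ finite_permutations[of "{1..n}"]]) auto
  have fJJ: "finite ?JJ" by (rule finite_subset[of _ "Pow {1..n}"]) auto
  have fR: "finite ?R" by (rule finite_subset[of _ "{1..n} \<times> {1..n}"]) auto
  have sub: "(\<lambda>p. p ` {1..k}) ` ?S \<subseteq> ?JJ"
  proof (rule image_subsetI)
    fix p assume p: "p \<in> ?S"
    have "p ` {1..k} \<subseteq> p ` {1..n}" using k by (intro image_mono) auto
    also have "\<dots> = {1..n}" using p permutes_image[of p "{1..n}"] by blast
    finally show "p ` {1..k} \<in> ?JJ"
      using p card_image[OF strict_mono_on_imp_inj_on, of "{1..k}" p] by simp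
  qed
  have "(\<Sum>p\<in>?S. F (p 1) (p k)) = (\<Sum>J\<in>?JJ. \<Sum>p\<in>{p\<in>?S. p ` {1..k} = J}. F (p 1) (p k))"
    by (rule sum.group[OF fS fJJ sub, symmetric])
  also have "\<dots> = (\<Sum>J\<in>?JJ. of_nat (fact (n - k)) * F (Min J) (Max J))"
  proof (intro sum.cong refl)
    fix J assume J: "J \<in> ?JJ"
    have "F (p 1) (p k) = F (Min J) (Max J)" if p: "p \<in> {p\<in>?S. p ` {1..k} = J}" for p
    proof -
      have sm: "strict_mono_on {1..k} p" and im: "J = p ` {1..k}" using p by auto
      have "Min J = p 1" unfolding im using k strict_mono_on_leD[OF sm] by (intro Min_eqI) auto
      moreover have "Max J = p k" unfolding im using k strict_mono_on_leD[OF sm] by (intro Max_eqI) auto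
      ultimately show ?thesis by simp
    qed
    then have "(\<Sum>p\<in>{p\<in>?S. p ` {1..k} = J}. F (p 1) (p k)) = of_nat (card {p\<in>?S. p ` {1..k} = J}) * F (Min J) (Max J)"
      by simp
    moreover have "{p\<in>?S. p ` {1..k} = J} = {p. p permutes {1..n} \<and> strict_mono_on {1..k} p \<and> p ` {1..k} = J}" by auto
    ultimately show "(\<Sum>p\<in>{p\<in>?S. p ` {1..k} = J}. F (p 1) (p k)) = of_nat (fact (n - k)) * F (Min J) (Max J)"
      using card_increasing_permutations_with_image[of J n k] J by simp
  qed
  also have "\<dots> = of_nat (fact (n - k)) * (\<Sum>J\<in>?JJ. F (Min J) (Max J))" by (simp add: sum_distrib_left)
  also have "(\<Sum>J\<in>?JJ. F (Min J) (Max J)) = (\<Sum>r\<in>?R. \<Sum>J\<in>{J\<in>?JJ. (Min J, Max J) = r}. F (Min J) (Max J))"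
  proof (rule sum.group[OF fJJ fR, symmetric], intro image_subsetI)
    fix J assume J: "J \<in> ?JJ"
    then have fJ: "finite J" "J \<noteq> {}" using k finite_subset[of J "{1..n}"] by auto
    have m: "Min J \<in> J" "Max J \<in> J" using fJ by auto
    have "J \<subseteq> {Min J..Max J}" using fJ by auto
    then have "k \<le> Max J + 1 - Min J" using card_mono[of "{Min J..Max J}" J] J by simp
    then show "(Min J, Max J) \<in> ?R" using k m J by auto
  qed
  also have "\<dots> = (\<Sum>(i, j)\<in>?R. of_nat ((j - i - 1) choose (k - 2)) * F i j)"
  proof (intro sum.cong refl, safe)
    fix i j assume ij: "1 \<le> i" "i < j" "j \<le> n"
    have "{J\<in>?JJ. (Min J, Max J) = (i, j)} = {J. J \<subseteq> {1..n} \<and> card J = k \<and> Min J = i \<and> Max J = j}" by auto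
    moreover have "(\<Sum>J\<in>{J\<in>?JJ. (Min J, Max J) = (i, j)}. F (Min J) (Max J)) = of_nat (card {J\<in>?JJ. (Min J, Max J) = (i, j)}) * F i j"
      by simp
    ultimately show "(\<Sum>J\<in>{J\<in>?JJ. (Min J, Max J) = (i, j)}. F (Min J) (Max J)) = of_nat ((j - i - 1) choose (k - 2)) * F i j"
      using card_subsets_with_Min_Max[OF ij k(1)] by simp
  qed
  finally show ?thesis .
qed

text \<open>By Tonelli the left side is the integral over the whole cube of W times G, restricted to
  points whose first k coordinates increase. When the cube is sorted, the symmetric \<open>W\<close>
  is unaffected and the restriction selects the permutations increasing on {1..k}. Keeping
  \<open>W\<close> abstract lets the lemma serve both the exponential weight of (i) and the limit
  weight of (ii).\<close>

lemma nn_integral_ordered_prefix: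
  fixes G :: "real \<Rightarrow> real \<Rightarrow> ennreal" and W :: "(nat \<Rightarrow> real) \<Rightarrow> ennreal"
  assumes k: "2 \<le> k" "k \<le> n"
    and W[measurable]: "W \<in> borel_measurable (lborel_vec n)"
    and sym: "\<And>p t. p permutes {1..n} \<Longrightarrow> t \<in> ordered_simplex n \<Longrightarrow> W (\<lambda>i\<in>{1..n}. t (p i)) = W t"
    and G[measurable]: "(\<lambda>(x, y). G x y) \<in> borel_measurable (borel \<Otimes>\<^sub>M borel)"
  shows "(\<integral>\<^sup>+s. G (s 1) (s k) *
        (\<integral>\<^sup>+t. W (merge {1..k} {k+1..n} (s, t)) * indicator (unit_cube {k+1..n}) t \<partial>PiM {k+1..n} (\<lambda>_. lborel)) *
        indicator (ordered_simplex k) s \<partial>lborel_vec k)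
    = of_nat (fact (n - k)) * (\<integral>\<^sup>+t. W t *
        (\<Sum>(i, j)\<in>{(i, j). 1 \<le> i \<and> i < j \<and> j \<le> n \<and> k - 1 \<le> j - i}.
            of_nat ((j - i - 1) choose (k - 2)) * G (t i) (t j)) *
        indicator (ordered_simplex n) t \<partial>lborel_vec n)"
proof -
  let ?I = "{1..k}" and ?J = "{k+1..n}"
  let ?M = "merge {1..k} {k+1..n}"
  let ?R = "{(i, j). 1 \<le> i \<and> i < j \<and> j \<le> n \<and> k - 1 \<le> j - i}"
  have IJ: "?I \<union> ?J = {1..n}" using k by auto
  have c: "(\<lambda>t. t i) \<in> borel_measurable (lborel_vec m)" if "i \<in> {1..m}" for i m
    using measurable_component_singleton[OF that, of "\<lambda>_. lborel :: real measure"] by simp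
  \<comment> \<open>Only the first k coordinates are ordered, so within the cube this set is the
    product of a k-dimensional simplex with a cube.\<close>
  define Q where "Q = {t \<in> space (lborel_vec n). \<forall>i\<in>{1..k}. \<forall>j\<in>{1..k}. i < j \<longrightarrow> t i < t j}"
  have Q[measurable]: "Q \<in> sets (lborel_vec n)" unfolding Q_def
    using k c[of _ n]
    by (intro sets.sets_Collect_finite_All sets.sets_Collect_imp sets.sets_Collect_const borel_measurable_less) auto
  have GG: "(\<lambda>t. G (t i) (t j)) \<in> borel_measurable (lborel_vec m)" if "i \<in> {1..m}" "j \<in> {1..m}" for i j m
    using measurable_compose[OF measurable_Pair[OF c[OF that(1)] c[OF that(2)]] G] by simp
  define H where "H t = W t * G (t 1) (t k) * indicator Q t" for t
  have [measurable]: "(\<lambda>t. G (t 1) (t k)) \<in> borel_measurable (lborel_vec n)" using GG k by simp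
  have H[measurable]: "H \<in> borel_measurable (lborel_vec n)" unfolding H_def by measurable
  have mm: "(\<lambda>t. ?M (s, t)) \<in> measurable (PiM ?J (\<lambda>_. lborel)) (lborel_vec n)" if "s \<in> space (lborel_vec k)" for s
    using measurable_compose[OF measurable_Pair1'[OF that] measurable_merge[of ?I ?J]] unfolding IJ by simp
  have "(\<integral>\<^sup>+t. H t * indicator (unit_cube {1..n}) t \<partial>lborel_vec n) =
    (\<integral>\<^sup>+s. (\<integral>\<^sup>+t. H (?M (s, t)) * indicator (unit_cube {1..n}) (?M (s, t)) \<partial>PiM ?J (\<lambda>_. lborel)) \<partial>lborel_vec k)"
    using lborel_PiM.product_nn_integral_fold[of ?I ?J "\<lambda>t. H t * indicator (unit_cube {1..n}) t"]
      borel_measurable_times_ennreal[OF H borel_measurable_indicator[OF sets_unit_cube[of "{1..n}"]]]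
    unfolding IJ by simp
  also have "\<dots> = (\<integral>\<^sup>+s. G (s 1) (s k) *
        (\<integral>\<^sup>+t. W (?M (s, t)) * indicator (unit_cube ?J) t \<partial>PiM ?J (\<lambda>_. lborel)) *
        indicator (ordered_simplex k) s \<partial>lborel_vec k)"
  proof (rule nn_integral_cong)
    fix s assume s: "s \<in> space (lborel_vec k)"
    have "H (?M (s, t)) * indicator (unit_cube {1..n}) (?M (s, t)) =
        (G (s 1) (s k) * indicator (ordered_simplex k) s) * (W (?M (s, t)) * indicator (unit_cube ?J) t)"
      if t: "t \<in> space (PiM ?J (\<lambda>_. lborel :: real measure))" for t
    proof -
      have sp: "?M (s, t) \<in> space (lborel_vec n)" using measurable_space[OF mm[OF s] t] .
      have M1: "?M (s, t) i = s i" if "i \<in> ?I" for i using that by (simp add: merge_def)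
      have M2: "?M (s, t) i = t i" if "i \<in> ?J" for i using that by (simp add: merge_def)
      have Q': "?M (s, t) \<in> Q \<longleftrightarrow> (\<forall>i\<in>{1..k}. \<forall>j\<in>{1..k}. i < j \<longrightarrow> s i < s j)"
        unfolding Q_def using sp M1 by simp
      have "?M (s, t) \<in> unit_cube {1..n} \<longleftrightarrow> (\<forall>i\<in>?I \<union> ?J. ?M (s, t) i \<in> {0<..<1})"
        unfolding IJ unit_cube_def using sp by (auto simp: space_PiM PiE_iff)
      also have "\<dots> \<longleftrightarrow> (\<forall>i\<in>?I. s i \<in> {0<..<1}) \<and> t \<in> unit_cube ?J"
        unfolding unit_cube_def using M1 M2 t by (auto simp: space_PiM PiE_iff ball_Un)
      finally have "?M (s, t) \<in> Q \<and> ?M (s, t) \<in> unit_cube {1..n} \<longleftrightarrow> s \<in> ordered_simplex k \<and> t \<in> unit_cube ?J"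
        using Q' s unfolding ordered_simplex_altdef by auto
      moreover have "?M (s, t) 1 = s 1" "?M (s, t) k = s k" using M1 k by auto
      ultimately show ?thesis unfolding H_def by (auto simp: indicator_def ac_simps)
    qed
    then have "(\<integral>\<^sup>+t. H (?M (s, t)) * indicator (unit_cube {1..n}) (?M (s, t)) \<partial>PiM ?J (\<lambda>_. lborel))
      = (\<integral>\<^sup>+t. (G (s 1) (s k) * indicator (ordered_simplex k) s) * (W (?M (s, t)) * indicator (unit_cube ?J) t) \<partial>PiM ?J (\<lambda>_. lborel))"
      by (intro nn_integral_cong) auto
    also have "\<dots> = (G (s 1) (s k) * indicator (ordered_simplex k) s) * (\<integral>\<^sup>+t. W (?M (s, t)) * indicator (unit_cube ?J) t \<partial>PiM ?J (\<lambda>_. lborel))"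
      using mm[OF s] by (intro nn_integral_cmult borel_measurable_times_ennreal measurable_compose[OF _ W]
          borel_measurable_indicator sets_unit_cube) auto
    finally show "(\<integral>\<^sup>+t. H (?M (s, t)) * indicator (unit_cube {1..n}) (?M (s, t)) \<partial>PiM ?J (\<lambda>_. lborel))
      = G (s 1) (s k) * (\<integral>\<^sup>+t. W (?M (s, t)) * indicator (unit_cube ?J) t \<partial>PiM ?J (\<lambda>_. lborel)) *
        indicator (ordered_simplex k) s" by (simp add: ac_simps)
  qed
  finally have 1: "(\<integral>\<^sup>+s. G (s 1) (s k) *
        (\<integral>\<^sup>+t. W (?M (s, t)) * indicator (unit_cube ?J) t \<partial>PiM ?J (\<lambda>_. lborel)) *
        indicator (ordered_simplex k) s \<partial>lborel_vec k) = (\<integral>\<^sup>+t. H t * indicator (unit_cube {1..n}) t \<partial>lborel_vec n)" ..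
  let ?T = "\<lambda>p t. (\<lambda>i\<in>{1..n}. t (p i)) :: nat \<Rightarrow> real"
  have "(\<integral>\<^sup>+t. H t * indicator (unit_cube {1..n}) t \<partial>lborel_vec n) =
    (\<Sum>p | p permutes {1..n}. \<integral>\<^sup>+t. H (?T p t) * indicator (ordered_simplex n) t \<partial>lborel_vec n)"
    by (rule nn_integral_unit_cube_sort[OF H])
  also have "\<dots> = (\<integral>\<^sup>+t. (\<Sum>p | p permutes {1..n}. H (?T p t) * indicator (ordered_simplex n) t) \<partial>lborel_vec n)"
    by (intro nn_integral_sum[symmetric] borel_measurable_times_ennreal
        measurable_compose[OF measurable_permute_coords H] borel_measurable_indicator sets_ordered_simplex) auto
  also have "\<dots> = (\<integral>\<^sup>+t. of_nat (fact (n - k)) * (W t *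
        (\<Sum>(i, j)\<in>?R. of_nat ((j - i - 1) choose (k - 2)) * G (t i) (t j)) *
        indicator (ordered_simplex n) t) \<partial>lborel_vec n)"
  proof (rule nn_integral_cong)
    fix t :: "nat \<Rightarrow> real" assume sp: "t \<in> space (lborel_vec n)"
    show "(\<Sum>p | p permutes {1..n}. H (?T p t) * indicator (ordered_simplex n) t) =
       of_nat (fact (n - k)) * (W t *
        (\<Sum>(i, j)\<in>?R. of_nat ((j - i - 1) choose (k - 2)) * G (t i) (t j)) *
        indicator (ordered_simplex n) t)"
    proof (cases "t \<in> ordered_simplex n")
      case True
      then have sm: "strict_mono_on {1..n} t" by (simp add: ordered_simplex_def)
      have HT: "H (?T p t) = (if strict_mono_on {1..k} p then W t * G (t (p 1)) (t (p k)) else 0)"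
        if p: "p permutes {1..n}" for p
      proof -
        have "?T p t \<in> Q \<longleftrightarrow> strict_mono_on {1..k} p"
        proof -
          have "?T p t \<in> Q \<longleftrightarrow> (\<forall>i\<in>{1..k}. \<forall>j\<in>{1..k}. i < j \<longrightarrow> t (p i) < t (p j))"
            unfolding Q_def using k by (auto simp: space_PiM)
          also have "\<dots> \<longleftrightarrow> strict_mono_on {1..k} p"
          proof -
            \<comment> \<open>Since t itself increases, comparing values of t is comparing
              indices.\<close>
            have "t (p i) < t (p j) \<longleftrightarrow> p i < p j" if "i \<in> {1..k}" "j \<in> {1..k}" for i j
              using that k permutes_in_image[OF p, of i] permutes_in_image[OF p, of j]
              by (intro strict_mono_on_less[OF sm]) auto
            then show ?thesis by (auto simp: strict_mono_on_def)
          qed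
          finally show ?thesis .
        qed
        moreover have "?T p t 1 = t (p 1)" "?T p t k = t (p k)" using k by auto
        ultimately show ?thesis unfolding H_def sym[OF p True] by auto
      qed
      have "(\<Sum>p | p permutes {1..n}. H (?T p t)) = 
        (\<Sum>p | p permutes {1..n} \<and> strict_mono_on {1..k} p. W t * G (t (p 1)) (t (p k)))"
      proof -
        have "(\<Sum>p | p permutes {1..n}. H (?T p t)) = (\<Sum>p | p permutes {1..n}.
            if strict_mono_on {1..k} p then W t * G (t (p 1)) (t (p k)) else 0)"
          using HT by (intro sum.cong refl) blast
        also have "\<dots> = (\<Sum>p \<in> {p \<in> {p. p permutes {1..n}}. strict_mono_on {1..k} p}. W t * G (t (p 1)) (t (p k)))"
          by (rule sum.inter_filter[symmetric, OF finite_permutations]) simp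
        finally show ?thesis by simp
      qed
      also have "\<dots> = W t * (\<Sum>p | p permutes {1..n} \<and> strict_mono_on {1..k} p. G (t (p 1)) (t (p k)))"
        by (simp add: sum_distrib_left)
      also have "\<dots> = W t * (of_nat (fact (n - k)) * (\<Sum>(i, j)\<in>?R. of_nat ((j - i - 1) choose (k - 2)) * G (t i) (t j)))"
        by (subst sum_increasing_permutations[OF k, of "\<lambda>i j. G (t i) (t j)"]) (rule refl)
      finally show ?thesis using True by (simp add: ac_simps)
    qed simp
  qed
  also have "\<dots> = of_nat (fact (n - k)) * (\<integral>\<^sup>+t. W t *
        (\<Sum>(i, j)\<in>?R. of_nat ((j - i - 1) choose (k - 2)) * G (t i) (t j)) *
        indicator (ordered_simplex n) t \<partial>lborel_vec n)"
  proof (intro nn_integral_cmult borel_measurable_times_ennreal W borel_measurable_indicator sets_ordered_simplex)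
    have "(\<lambda>t. case r of (i, j) \<Rightarrow> of_nat ((j - i - 1) choose (k - 2)) * G (t i) (t j)) \<in> borel_measurable (lborel_vec n)"
      if "r \<in> ?R" for r
      using that by (auto intro!: borel_measurable_times_ennreal GG)
    then show "(\<lambda>t. \<Sum>(i, j)\<in>?R. of_nat ((j - i - 1) choose (k - 2)) * G (t i) (t j)) \<in> borel_measurable (lborel_vec n)"
      by (intro borel_measurable_sum) auto
  qed
  finally show ?thesis unfolding 1 .
qed

section \<open>The identity for a deterministic weight\<close>

text \<open>The exponential of a sum is a product over coordinates, so integrating out the n - k
  free coordinates produces a power of the total mass. Borel functions are allowed because \<omega>
  and g will be cut off outside the unit interval, which destroys continuity.\<close>

lemma simplex_exp_identity_nonneg:
  fixes \<omega> :: "real \<Rightarrow> real" and g :: "real \<Rightarrow> real \<Rightarrow> real"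
  assumes k: "2 \<le> k" "k \<le> n" and \<omega>: "\<omega> \<in> borel_measurable borel"
    and g: "(\<lambda>(x, y). g x y) \<in> borel_measurable (borel \<Otimes>\<^sub>M borel)" and g0: "\<And>x y. 0 \<le> g x y"
  shows "(\<integral>\<^sup>+s. ennreal (exp (\<Sum>i\<in>{1..k}. \<omega> (s i)) * g (s 1) (s k)) * indicator (ordered_simplex k) s \<partial>lborel_vec k)
      * (\<integral>\<^sup>+s. ennreal (exp (\<omega> s)) * indicator {0<..<1} s \<partial>lborel) ^ (n - k) =
    of_nat (fact (n - k)) * (\<integral>\<^sup>+t. ennreal (exp (\<Sum>i\<in>{1..n}. \<omega> (t i)) *
        (\<Sum>(i, j)\<in>{(i, j). 1 \<le> i \<and> i < j \<and> j \<le> n \<and> k - 1 \<le> j - i}. real ((j - i - 1) choose (k - 2)) * g (t i) (t j)))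
        * indicator (ordered_simplex n) t \<partial>lborel_vec n)"
proof -
  let ?J = "{k+1..n}"
  define W where "W t = ennreal (exp (\<Sum>i\<in>{1..n}. \<omega> (t i)))" for t :: "nat \<Rightarrow> real"
  define G where "G x y = ennreal (g x y)" for x y
  have comp: "(\<lambda>t. \<omega> (t i)) \<in> borel_measurable (PiM I (\<lambda>_. lborel))" if "i \<in> I" for i and I :: "nat set"
  proof -
    have "(\<lambda>t. t i) \<in> measurable (PiM I (\<lambda>_. lborel)) (lborel :: real measure)" by (rule measurable_component_singleton[OF that])
    moreover have "\<omega> \<in> borel_measurable lborel" using \<omega> by simp
    ultimately show ?thesis by (rule measurable_compose)
  qed
  have W: "W \<in> borel_measurable (lborel_vec n)"
    unfolding W_def[abs_def]
    by (intro measurable_compose[OF _ measurable_ennreal] measurable_compose[OF _ borel_measurable_exp] borel_measurable_sum comp)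
  have sym: "W (\<lambda>i\<in>{1..n}. t (p i)) = W t" if "p permutes {1..n}" for p t
  proof -
    have "(\<Sum>i\<in>{1..n}. \<omega> ((\<lambda>i\<in>{1..n}. t (p i)) i)) = (\<Sum>i\<in>{1..n}. \<omega> (t (p i)))" by (intro sum.cong) auto
    also have "\<dots> = (\<Sum>i\<in>{1..n}. \<omega> (t i))" using sum.permute[OF that, of "\<lambda>i. \<omega> (t i)"] by (simp add: comp_def)
    finally show ?thesis by (simp add: W_def)
  qed
  have G: "(\<lambda>(x, y). G x y) \<in> borel_measurable (borel \<Otimes>\<^sub>M borel)"
    using measurable_compose[OF g measurable_ennreal] by (simp only: G_def case_prod_beta')
  define M where "M = (\<integral>\<^sup>+s. ennreal (exp (\<omega> s)) * indicator {0<..<1} s \<partial>lborel)"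
  have em: "(\<lambda>s. ennreal (exp (\<omega> s)) * indicator {0<..<1} s) \<in> borel_measurable lborel"
    using \<omega> by (intro borel_measurable_times_ennreal measurable_compose[OF _ measurable_ennreal] measurable_compose[OF _ borel_measurable_exp] borel_measurable_indicator) auto
  have inner: "(\<integral>\<^sup>+t. W (merge {1..k} ?J (s, t)) * indicator (unit_cube ?J) t \<partial>PiM ?J (\<lambda>_. lborel)) =
    ennreal (exp (\<Sum>i\<in>{1..k}. \<omega> (s i))) * M ^ (n - k)" for s
  proof -
    have pw: "W (merge {1..k} ?J (s, t)) * indicator (unit_cube ?J) t =
      ennreal (exp (\<Sum>i\<in>{1..k}. \<omega> (s i))) * (\<Prod>j\<in>?J. ennreal (exp (\<omega> (t j))) * indicator {0<..<1} (t j))"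
      if t: "t \<in> space (PiM ?J (\<lambda>_. lborel :: real measure))" for t
    proof -
      have "{1..n} = {1..k} \<union> ?J" using k by auto
      then have "(\<Sum>i\<in>{1..n}. \<omega> (merge {1..k} ?J (s, t) i)) = (\<Sum>i\<in>{1..k}. \<omega> (merge {1..k} ?J (s, t) i)) + (\<Sum>i\<in>?J. \<omega> (merge {1..k} ?J (s, t) i))"
        by (simp only:) (rule sum.union_disjoint; auto)
      also have "(\<Sum>i\<in>{1..k}. \<omega> (merge {1..k} ?J (s, t) i)) = (\<Sum>i\<in>{1..k}. \<omega> (s i))" by (intro sum.cong) (auto simp: merge_def)
      also have "(\<Sum>i\<in>?J. \<omega> (merge {1..k} ?J (s, t) i)) = (\<Sum>i\<in>?J. \<omega> (t i))" by (intro sum.cong) (auto simp: merge_def)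
      finally have "W (merge {1..k} ?J (s, t)) = ennreal (exp (\<Sum>i\<in>{1..k}. \<omega> (s i))) * (\<Prod>j\<in>?J. ennreal (exp (\<omega> (t j))))"
        unfolding W_def by (simp add: exp_add exp_sum ennreal_mult prod_nonneg prod_ennreal)
      moreover have "indicator (unit_cube ?J) t = (\<Prod>j\<in>?J. indicator {0<..<1} (t j) :: ennreal)"
      proof (cases "t \<in> unit_cube ?J")
        case True
        then have "\<And>j. j \<in> ?J \<Longrightarrow> t j \<in> {0<..<1}" unfolding unit_cube_def by (rule PiE_mem)
        then have "(\<Prod>j\<in>?J. indicator {0<..<1} (t j) :: ennreal) = 1" by (intro prod.neutral) auto
        then show ?thesis using True by simp
      next
        case False
        then obtain j where j: "j \<in> ?J" "t j \<notin> {0<..<1}" using t by (auto simp: unit_cube_def PiE_iff space_PiM)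
        then have "(\<Prod>j\<in>?J. indicator {0<..<1} (t j) :: ennreal) = 0" by (intro prod_zero bexI[of _ j]) auto
        then show ?thesis using False by simp
      qed
      ultimately show ?thesis by (simp add: prod.distrib mult.assoc)
    qed
    have "(\<integral>\<^sup>+t. W (merge {1..k} ?J (s, t)) * indicator (unit_cube ?J) t \<partial>PiM ?J (\<lambda>_. lborel)) =
      (\<integral>\<^sup>+t. ennreal (exp (\<Sum>i\<in>{1..k}. \<omega> (s i))) * (\<Prod>j\<in>?J. ennreal (exp (\<omega> (t j))) * indicator {0<..<1} (t j)) \<partial>PiM ?J (\<lambda>_. lborel))"
      by (intro nn_integral_cong pw)
    also have "\<dots> = ennreal (exp (\<Sum>i\<in>{1..k}. \<omega> (s i))) * (\<integral>\<^sup>+t. (\<Prod>j\<in>?J. ennreal (exp (\<omega> (t j))) * indicator {0<..<1} (t j)) \<partial>PiM ?J (\<lambda>_. lborel))"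
    proof (intro nn_integral_cmult borel_measurable_prod_ennreal)
      fix j assume "j \<in> ?J"
      then show "(\<lambda>t. ennreal (exp (\<omega> (t j))) * indicator {0<..<1} (t j)) \<in> borel_measurable (PiM ?J (\<lambda>_. lborel))"
        using measurable_compose[OF measurable_component_singleton[of j ?J "\<lambda>_. lborel"] em] by simp
    qed
    also have "(\<integral>\<^sup>+t. (\<Prod>j\<in>?J. ennreal (exp (\<omega> (t j))) * indicator {0<..<1} (t j)) \<partial>PiM ?J (\<lambda>_. lborel)) = M ^ (n - k)"
      unfolding M_def by (subst lborel_PiM.product_nn_integral_prod) (use em in auto)
    finally show ?thesis .
  qed
  have fm: "(\<lambda>s. ennreal (exp (\<Sum>i\<in>{1..k}. \<omega> (s i)) * g (s 1) (s k)) * indicator (ordered_simplex k) s) \<in> borel_measurable (lborel_vec k)"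
  proof (intro borel_measurable_times_ennreal measurable_compose[OF _ measurable_ennreal] borel_measurable_times borel_measurable_indicator sets_ordered_simplex
      measurable_compose[OF _ borel_measurable_exp] borel_measurable_sum comp)
    have c: "(\<lambda>t. t i) \<in> borel_measurable (lborel_vec k)" if "i \<in> {1..k}" for i
      using measurable_component_singleton[OF that, of "\<lambda>_. lborel :: real measure"] by simp
    show "(\<lambda>s. g (s 1) (s k)) \<in> borel_measurable (lborel_vec k)"
      using measurable_compose[OF measurable_Pair[OF c[of 1] c[of k]] g] k by simp
  qed auto
  have "(\<integral>\<^sup>+s. ennreal (exp (\<Sum>i\<in>{1..k}. \<omega> (s i)) * g (s 1) (s k)) * indicator (ordered_simplex k) s \<partial>lborel_vec k) * M ^ (n - k) =
    (\<integral>\<^sup>+s. G (s 1) (s k) * (\<integral>\<^sup>+t. W (merge {1..k} ?J (s, t)) * indicator (unit_cube ?J) t \<partial>PiM ?J (\<lambda>_. lborel)) * indicator (ordered_simplex k) s \<partial>lborel_vec k)"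
    unfolding nn_integral_multc[OF fm, symmetric] inner G_def
    by (intro nn_integral_cong) (simp add: ennreal_mult g0 ac_simps)
  also have "\<dots> = of_nat (fact (n - k)) * (\<integral>\<^sup>+t. W t *
        (\<Sum>(i, j)\<in>{(i, j). 1 \<le> i \<and> i < j \<and> j \<le> n \<and> k - 1 \<le> j - i}. of_nat ((j - i - 1) choose (k - 2)) * G (t i) (t j)) *
        indicator (ordered_simplex n) t \<partial>lborel_vec n)"
    by (rule nn_integral_ordered_prefix[OF k W sym G])
  also have "(\<lambda>t. W t * (\<Sum>(i, j)\<in>{(i, j). 1 \<le> i \<and> i < j \<and> j \<le> n \<and> k - 1 \<le> j - i}. of_nat ((j - i - 1) choose (k - 2)) * G (t i) (t j)) *
        indicator (ordered_simplex n) t) =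
      (\<lambda>t. ennreal (exp (\<Sum>i\<in>{1..n}. \<omega> (t i)) *
        (\<Sum>(i, j)\<in>{(i, j). 1 \<le> i \<and> i < j \<and> j \<le> n \<and> k - 1 \<le> j - i}. real ((j - i - 1) choose (k - 2)) * g (t i) (t j)))
        * indicator (ordered_simplex n) t)"
  proof
    fix t :: "nat \<Rightarrow> real"
    have "(\<Sum>(i, j)\<in>{(i, j). 1 \<le> i \<and> i < j \<and> j \<le> n \<and> k - 1 \<le> j - i}. of_nat ((j - i - 1) choose (k - 2)) * G (t i) (t j)) =
      ennreal (\<Sum>(i, j)\<in>{(i, j). 1 \<le> i \<and> i < j \<and> j \<le> n \<and> k - 1 \<le> j - i}. real ((j - i - 1) choose (k - 2)) * g (t i) (t j))"
      unfolding G_def case_prod_beta'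
      by (subst sum_ennreal[symmetric]) (auto simp: g0 ennreal_mult ennreal_of_nat_eq_real_of_nat)
    then show "W t * (\<Sum>(i, j)\<in>{(i, j). 1 \<le> i \<and> i < j \<and> j \<le> n \<and> k - 1 \<le> j - i}. of_nat ((j - i - 1) choose (k - 2)) * G (t i) (t j)) *
        indicator (ordered_simplex n) t =
      ennreal (exp (\<Sum>i\<in>{1..n}. \<omega> (t i)) *
        (\<Sum>(i, j)\<in>{(i, j). 1 \<le> i \<and> i < j \<and> j \<le> n \<and> k - 1 \<le> j - i}. real ((j - i - 1) choose (k - 2)) * g (t i) (t j)))
        * indicator (ordered_simplex n) t"
      unfolding W_def by (simp add: ennreal_mult sum_nonneg g0 case_prod_beta')
  qed
  finally show ?thesis unfolding M_def .
qed

text \<open>Compactness bounds \<omega> and g, say by B and C. Both sides are linear in g, and the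
  nonnegative case covers g + C as well as the constant C.\<close>

lemma simplex_exp_identity:
  fixes \<omega> :: "real \<Rightarrow> real" and g :: "real \<Rightarrow> real \<Rightarrow> real"
  assumes k: "2 \<le> k" "k \<le> n" and cw: "continuous_on {0..1} \<omega>" and cg: "continuous_on ({0..1} \<times> {0..1}) (\<lambda>(x, y). g x y)"
  shows "1 / fact (n - k) * (LINT s:{0..1}|lborel. exp (\<omega> s)) ^ (n - k) *
        (LINT s:ordered_simplex k|lborel_vec k. exp (\<Sum>i\<in>{1..k}. \<omega> (s i)) * g (s 1) (s k))
      = (LINT s:ordered_simplex n|lborel_vec n. exp (\<Sum>i\<in>{1..n}. \<omega> (s i)) *
          (\<Sum>(i, j)\<in>{(i, j). 1 \<le> i \<and> i < j \<and> j \<le> n \<and> k - 1 \<le> j - i}.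
             real ((j - i - 1) choose (k - 2)) * g (s i) (s j)))"
proof -
  let ?R = "{(i, j). 1 \<le> i \<and> i < j \<and> j \<le> n \<and> k - 1 \<le> j - i}"
  have fR: "finite ?R" by (rule finite_subset[of _ "{1..n} \<times> {1..n}"]) auto
  obtain B where "\<forall>x\<in>{0..1}. \<bar>\<omega> x\<bar> \<le> B"
    using compact_imp_bounded[OF compact_continuous_image[OF cw compact_Icc]] unfolding bounded_iff by auto
  then have B: "\<And>x. x \<in> {0..1} \<Longrightarrow> \<bar>\<omega> x\<bar> \<le> B" by blast
  obtain C where "\<forall>x\<in>{0..1}. \<forall>y\<in>{0..1}. \<bar>g x y\<bar> \<le> C"
    using compact_imp_bounded[OF compact_continuous_image[OF cg compact_Times[OF compact_Icc compact_Icc]]]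
    unfolding bounded_iff by fastforce
  then have C: "\<And>x y. x \<in> {0..1} \<Longrightarrow> y \<in> {0..1} \<Longrightarrow> \<bar>g x y\<bar> \<le> C" by blast
  have C0: "0 \<le> C" using C[of 0 0] by simp
  \<comment> \<open>Cut-off versions are Borel on the whole line and plane and agree with the given
    functions at all points of the simplex.\<close>
  define w where "w x = indicator {0..1} x *\<^sub>R \<omega> x" for x
  define g1 where "g1 x y = indicator ({0..1} \<times> {0..1}) (x, y) *\<^sub>R g x y" for x y
  have wm: "w \<in> borel_measurable borel"
    unfolding w_def[abs_def] by (rule borel_measurable_continuous_on_indicator[OF _ cw]) simp
  have g1m: "(\<lambda>(x, y). g1 x y) \<in> borel_measurable (borel \<Otimes>\<^sub>M borel)"
  proof -
    have "(\<lambda>z. indicator ({0..1} \<times> {0..1}) z *\<^sub>R (case z of (x, y) \<Rightarrow> g x y)) \<in> borel_measurable borel"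
      by (rule borel_measurable_continuous_on_indicator[OF _ cg]) (intro borel_closed closed_Times closed_atLeastAtMost)
    then show ?thesis unfolding borel_prod g1_def case_prod_beta' by (simp only: prod.collapse)
  qed
  have g1b: "\<bar>g1 x y\<bar> \<le> C" for x y using C[of x y] C0 by (auto simp: g1_def indicator_def)
  have wb: "w x \<le> \<bar>B\<bar>" for x using B[of x] by (auto simp: w_def indicator_def)
  define M where "M = (LINT s:{0..1}|lborel. exp (\<omega> s))"
  define I1 where "I1 h = (LINT s:ordered_simplex k|lborel_vec k. exp (\<Sum>i\<in>{1..k}. w (s i)) * h (s 1) (s k))" for h :: "real \<Rightarrow> real \<Rightarrow> real"
  define q where "q h s = exp (\<Sum>i\<in>{1..n}. w (s i)) * (\<Sum>(i, j)\<in>?R. real ((j - i - 1) choose (k - 2)) * h (s i) (s j))" for h :: "real \<Rightarrow> real \<Rightarrow> real" and s :: "nat \<Rightarrow> real"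
  define I2 where "I2 h = (LINT s:ordered_simplex n|lborel_vec n. q h s)" for h :: "real \<Rightarrow> real \<Rightarrow> real"
  have c: "(\<lambda>t. t i) \<in> borel_measurable (lborel_vec m)" if "i \<in> {1..m}" for i m
    by (rule measurable_PiM_component_real[OF that])
  have expm: "(\<lambda>s. exp (\<Sum>i\<in>{1..m}. w (s i))) \<in> borel_measurable (lborel_vec m)" for m
    by (intro measurable_compose[OF _ borel_measurable_exp] borel_measurable_sum measurable_compose[OF c wm])
  have expb: "exp (\<Sum>i\<in>{1..m}. w (s i)) \<le> exp (real m * \<bar>B\<bar>)" for m and s :: "nat \<Rightarrow> real"
    using sum_bounded_above[of "{1..m}" "\<lambda>i. w (s i)" "\<bar>B\<bar>"] wb by simp
  have hm: "(\<lambda>s. h (s i) (s j)) \<in> borel_measurable (lborel_vec m)"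
    if "(\<lambda>(x, y). h x y) \<in> borel_measurable (borel \<Otimes>\<^sub>M borel)" "i \<in> {1..m}" "j \<in> {1..m}" for h :: "real \<Rightarrow> real \<Rightarrow> real" and i j m
    using measurable_compose[OF measurable_Pair[OF c[OF that(2)] c[OF that(3)]] that(1)] by (simp only: prod.case)
  have simplex_fin: "emeasure (lborel_vec m) (ordered_simplex m) < \<infinity>" for m
  proof -
    have "emeasure (lborel_vec m) (ordered_simplex m) \<le> emeasure (lborel_vec m) (\<Pi>\<^sub>E i\<in>{1..m}. {0<..<1})"
      by (intro emeasure_mono sets_PiM_I_finite) (auto simp: ordered_simplex_def)
    also have "\<dots> = 1" by (subst lborel_PiM.emeasure_PiM) auto
    finally show ?thesis by (rule le_less_trans) simp
  qed
  have bdi: "set_integrable (lborel_vec m) (ordered_simplex m) f"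
    if "f \<in> borel_measurable (lborel_vec m)" "\<And>s. \<bar>f s\<bar> \<le> K" for f :: "(nat \<Rightarrow> real) \<Rightarrow> real" and K m
    unfolding set_integrable_def
  proof (rule Bochner_Integration.integrable_bound)
    show "integrable (lborel_vec m) (\<lambda>s. K * indicator (ordered_simplex m) s)"
      using simplex_fin sets_ordered_simplex by (intro integrable_mult_right integrable_real_indicator) auto
    show "(\<lambda>s. indicator (ordered_simplex m) s *\<^sub>R f s) \<in> borel_measurable (lborel_vec m)"
      by (intro borel_measurable_scaleR borel_measurable_indicator sets_ordered_simplex that(1))
    show "AE s in lborel_vec m. norm (indicator (ordered_simplex m) s *\<^sub>R f s) \<le> norm (K * indicator (ordered_simplex m) s)"
      using that(2) by (intro AE_I2) (auto simp: indicator_def intro: order_trans[OF _ abs_ge_self])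
  qed
  have int1: "set_integrable (lborel_vec k) (ordered_simplex k) (\<lambda>s. exp (\<Sum>i\<in>{1..k}. w (s i)) * h (s 1) (s k))"
    if h: "(\<lambda>(x, y). h x y) \<in> borel_measurable (borel \<Otimes>\<^sub>M borel)" "\<And>x y. \<bar>h x y\<bar> \<le> D" for h :: "real \<Rightarrow> real \<Rightarrow> real" and D
  proof (rule bdi[where K = "exp (real k * \<bar>B\<bar>) * D"])
    show "(\<lambda>s. exp (\<Sum>i\<in>{1..k}. w (s i)) * h (s 1) (s k)) \<in> borel_measurable (lborel_vec k)"
      using k by (intro borel_measurable_times expm hm h(1)) auto
    show "\<bar>exp (\<Sum>i\<in>{1..k}. w (s i)) * h (s 1) (s k)\<bar> \<le> exp (real k * \<bar>B\<bar>) * D" for s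
      unfolding abs_mult by (intro mult_mono h(2)) (use expb in auto)
  qed
  have qm: "q h \<in> borel_measurable (lborel_vec n)"
    if h: "(\<lambda>(x, y). h x y) \<in> borel_measurable (borel \<Otimes>\<^sub>M borel)" for h
    unfolding q_def case_prod_beta'
    by (intro borel_measurable_times expm borel_measurable_sum borel_measurable_const hm h) auto
  have int2: "set_integrable (lborel_vec n) (ordered_simplex n) (q h)"
    if h: "(\<lambda>(x, y). h x y) \<in> borel_measurable (borel \<Otimes>\<^sub>M borel)" "\<And>x y. \<bar>h x y\<bar> \<le> D" for h D
  proof (rule bdi[where K = "exp (real n * \<bar>B\<bar>) * (\<Sum>z\<in>?R. real ((snd z - fst z - 1) choose (k - 2)) * D)", OF qm[OF h(1)]])
    fix s
    have "\<bar>\<Sum>z\<in>?R. real ((snd z - fst z - 1) choose (k - 2)) * h (s (fst z)) (s (snd z))\<bar> \<le> (\<Sum>z\<in>?R. real ((snd z - fst z - 1) choose (k - 2)) * D)"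
      by (rule order_trans[OF sum_abs]) (auto simp: abs_mult intro!: sum_mono mult_left_mono h(2))
    then show "\<bar>q h s\<bar> \<le> exp (real n * \<bar>B\<bar>) * (\<Sum>z\<in>?R. real ((snd z - fst z - 1) choose (k - 2)) * D)"
      unfolding q_def case_prod_beta' abs_mult by (intro mult_mono) (use expb in auto)
  qed
  have M_nn: "(\<integral>\<^sup>+s. ennreal (exp (w s)) * indicator {0<..<1} s \<partial>lborel) = ennreal M" and M0: "0 \<le> M"
  proof -
    have i: "set_integrable lborel {0..1} (\<lambda>s. exp (\<omega> s))"
      by (intro borel_integrable_atLeastAtMost' continuous_intros cw)
    \<comment> \<open>The closed interval of the statement and the open one of the cube differ by
      two points.\<close>
    have "AE s in lborel. ennreal (exp (w s)) * indicator {0<..<1} s = ennreal (indicator {0..1} s *\<^sub>R exp (\<omega> s))"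
      using AE_lborel_singleton[of 0] AE_lborel_singleton[of 1]
      by eventually_elim (auto simp: w_def indicator_def)
    then have "(\<integral>\<^sup>+s. ennreal (exp (w s)) * indicator {0<..<1} s \<partial>lborel) = (\<integral>\<^sup>+s. ennreal (indicator {0..1} s *\<^sub>R exp (\<omega> s)) \<partial>lborel)"
      by (rule nn_integral_cong_AE)
    also have "\<dots> = ennreal M"
      unfolding M_def set_lebesgue_integral_def using i unfolding set_integrable_def
      by (intro nn_integral_eq_integral) (auto simp: indicator_def)
    finally show "(\<integral>\<^sup>+s. ennreal (exp (w s)) * indicator {0<..<1} s \<partial>lborel) = ennreal M" .
    show "0 \<le> M" unfolding M_def set_lebesgue_integral_def by (intro integral_nonneg_AE AE_I2) (auto simp: indicator_def)
  qed
  have main: "I1 h * M ^ (n - k) = fact (n - k) * I2 h"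
    if h: "(\<lambda>(x, y). h x y) \<in> borel_measurable (borel \<Otimes>\<^sub>M borel)" "\<And>x y. \<bar>h x y\<bar> \<le> D" "\<And>x y. 0 \<le> h x y" for h D
  proof -
    have "(\<integral>\<^sup>+s. ennreal (exp (\<Sum>i\<in>{1..k}. w (s i)) * h (s 1) (s k)) * indicator (ordered_simplex k) s \<partial>lborel_vec k) =
      (\<integral>\<^sup>+s. ennreal (indicator (ordered_simplex k) s *\<^sub>R (exp (\<Sum>i\<in>{1..k}. w (s i)) * h (s 1) (s k))) \<partial>lborel_vec k)"
      by (intro nn_integral_cong) (auto simp: indicator_def)
    also have "\<dots> = ennreal (I1 h)"
      unfolding I1_def set_lebesgue_integral_def using int1[OF h(1,2)] h(3) unfolding set_integrable_def
      by (intro nn_integral_eq_integral) (auto simp: indicator_def)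
    finally have a: "(\<integral>\<^sup>+s. ennreal (exp (\<Sum>i\<in>{1..k}. w (s i)) * h (s 1) (s k)) * indicator (ordered_simplex k) s \<partial>lborel_vec k) = ennreal (I1 h)" .
    have q0: "0 \<le> q h s" for s unfolding q_def by (intro mult_nonneg_nonneg sum_nonneg) (auto simp: h(3))
    have "(\<integral>\<^sup>+s. ennreal (q h s) * indicator (ordered_simplex n) s \<partial>lborel_vec n) =
      (\<integral>\<^sup>+s. ennreal (indicator (ordered_simplex n) s *\<^sub>R q h s) \<partial>lborel_vec n)"
      by (intro nn_integral_cong) (auto simp: indicator_def)
    also have "\<dots> = ennreal (I2 h)"
      unfolding I2_def set_lebesgue_integral_def using int2[OF h(1,2)] q0 unfolding set_integrable_def
      by (intro nn_integral_eq_integral) (auto simp: indicator_def)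
    finally have b: "(\<integral>\<^sup>+s. ennreal (q h s) * indicator (ordered_simplex n) s \<partial>lborel_vec n) = ennreal (I2 h)" .
    have "ennreal (I1 h) * ennreal M ^ (n - k) = of_nat (fact (n - k)) * ennreal (I2 h)"
      using simplex_exp_identity_nonneg[OF k wm h(1) h(3)] unfolding a M_nn q_def[symmetric] b .
    moreover have "0 \<le> I1 h" "0 \<le> I2 h"
      unfolding I1_def I2_def set_lebesgue_integral_def using h(3) q0 by (auto intro!: integral_nonneg_AE AE_I2)
    ultimately have "ennreal (I1 h * M ^ (n - k)) = ennreal (real (fact (n - k)) * I2 h)"
      using M0 by (simp only: ennreal_mult ennreal_power zero_le_power ennreal_of_nat_eq_real_of_nat of_nat_0_le_iff)
    then show ?thesis using \<open>0 \<le> I1 h\<close> \<open>0 \<le> I2 h\<close> M0 by (subst (asm) ennreal_inj) auto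
  qed
  \<comment> \<open>Nonnegative and bounded by 2 C, so the case already proved applies; subtracting
    the identity for the constant C returns to \<open>g1\<close>.\<close>
  define h where "h x y = g1 x y + C" for x y
  have hm1: "(\<lambda>(x, y). h x y) \<in> borel_measurable (borel \<Otimes>\<^sub>M borel)"
    using borel_measurable_add[OF g1m borel_measurable_const[of C]] by (simp only: h_def case_prod_beta')
  have hb: "\<bar>h x y\<bar> \<le> 2 * C" "0 \<le> h x y" for x y using g1b[of x y] by (auto simp: h_def)
  have cm: "(\<lambda>(x, y). C) \<in> borel_measurable (borel \<Otimes>\<^sub>M borel :: (real \<times> real) measure)" by simp
  have "I1 h = I1 g1 + I1 (\<lambda>_ _. C)"
    unfolding I1_def h_def distrib_left
    by (rule set_integral_add(2)[OF int1[OF g1m g1b] int1[OF cm]]) (use C0 in auto)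
  moreover have "I2 h = I2 g1 + I2 (\<lambda>_ _. C)"
  proof -
    have qh: "q h = (\<lambda>s. q g1 s + q (\<lambda>_ _. C) s)"
      unfolding q_def h_def by (simp add: fun_eq_iff distrib_left sum.distrib case_prod_beta')
    show ?thesis unfolding I2_def qh
      by (rule set_integral_add(2)[OF int2[OF g1m g1b] int2[OF cm]]) (use C0 in auto)
  qed
  moreover have "I1 h * M ^ (n - k) = fact (n - k) * I2 h" by (rule main[OF hm1 hb])
  moreover have "I1 (\<lambda>_ _. C) * M ^ (n - k) = fact (n - k) * I2 (\<lambda>_ _. C)" by (rule main[OF cm, of C]) (use C0 in auto)
  ultimately have fin: "I1 g1 * M ^ (n - k) = fact (n - k) * I2 g1" by (simp add: algebra_simps)
  have s01: "s i \<in> {0..1}" if "s \<in> ordered_simplex m" "i \<in> {1..m}" for s i m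
    using that unfolding ordered_simplex_def PiE_iff by (auto intro: less_imp_le)
  have ws: "(\<Sum>i\<in>{1..m}. w (s i)) = (\<Sum>i\<in>{1..m}. \<omega> (s i))" if "s \<in> ordered_simplex m" for s m
    using s01[OF that] by (intro sum.cong) (auto simp: w_def)
  have gs: "g1 (s i) (s j) = g (s i) (s j)" if "s \<in> ordered_simplex m" "i \<in> {1..m}" "j \<in> {1..m}" for s i j m
    using s01[OF that(1,2)] s01[OF that(1,3)] by (simp add: g1_def)
  have "I1 g1 = (LINT s:ordered_simplex k|lborel_vec k. exp (\<Sum>i\<in>{1..k}. \<omega> (s i)) * g (s 1) (s k))"
    unfolding I1_def
  proof (rule set_lebesgue_integral_cong[OF sets_ordered_simplex], safe)
    fix s assume s: "s \<in> ordered_simplex k"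
    show "exp (\<Sum>i\<in>{1..k}. w (s i)) * g1 (s 1) (s k) = exp (\<Sum>i\<in>{1..k}. \<omega> (s i)) * g (s 1) (s k)"
      using k ws[OF s] gs[OF s, of 1 k] by simp
  qed
  moreover have "I2 g1 = (LINT s:ordered_simplex n|lborel_vec n. exp (\<Sum>i\<in>{1..n}. \<omega> (s i)) *
          (\<Sum>(i, j)\<in>?R. real ((j - i - 1) choose (k - 2)) * g (s i) (s j)))"
    unfolding I2_def
  proof (rule set_lebesgue_integral_cong[OF sets_ordered_simplex], safe)
    fix s assume s: "s \<in> ordered_simplex n"
    have "(\<Sum>(i, j)\<in>?R. real ((j - i - 1) choose (k - 2)) * g1 (s i) (s j)) = (\<Sum>(i, j)\<in>?R. real ((j - i - 1) choose (k - 2)) * g (s i) (s j))"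
      by (rule sum.cong[OF refl]) (auto simp: gs[OF s])
    then show "q g1 s = exp (\<Sum>i\<in>{1..n}. \<omega> (s i)) * (\<Sum>(i, j)\<in>?R. real ((j - i - 1) choose (k - 2)) * g (s i) (s j))"
      unfolding q_def ws[OF s] by simp
  qed
  ultimately show ?thesis using fin unfolding M_def by (simp add: field_simps)
qed

section \<open>The intensity measure and the scale function\<close>

lemma admissible_scaleD:
  assumes "admissible_scale r"
  shows "\<And>t. 0 < t \<Longrightarrow> t < 1 \<Longrightarrow> 0 < r t" "\<And>t. 0 < t \<Longrightarrow> t < 1 \<Longrightarrow> r (- t) = r t"
    "\<And>t j. 0 < t \<Longrightarrow> t < 1 \<Longrightarrow> (deriv ^^ j) r differentiable (at t)"
    "(r \<longlongrightarrow> 1) (at_left 1)" "\<exists>D. (deriv r \<longlongrightarrow> D) (at_left 1)"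
    "((\<lambda>t. t * deriv (\<lambda>z. ln (r z)) t) \<longlongrightarrow> 1) (at_right 0)"
    "\<And>l. 0 < l \<Longrightarrow> intensity r l > 0"
  using assms unfolding admissible_scale_def by auto

section \<open>Log r, its derivatives, and the integrals of the intensity\<close>

locale scale =
  fixes r :: "real \<Rightarrow> real"
  assumes adm: "admissible_scale r"
begin

definition L :: "real \<Rightarrow> real" where "L t = ln (r t)"
definition L' :: "real \<Rightarrow> real" where "L' t = deriv r t / r t"
text \<open>Second derivative of log r by the quotient rule. Positivity of the intensity on (0, 1)
  says exactly that it is negative, so log r is strictly concave there.\<close>

definition L'' :: "real \<Rightarrow> real" where "L'' t = deriv (deriv r) t / r t - (deriv r t / r t)\<^sup>2"

lemma r_pos: "0 < t \<Longrightarrow> t < 1 \<Longrightarrow> 0 < r t" by (rule admissible_scaleD(1)[OF adm])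
lemma r_even: "0 < t \<Longrightarrow> t < 1 \<Longrightarrow> r (- t) = r t" by (rule admissible_scaleD(2)[OF adm])

lemma DERIV_iter:
  assumes "0 < t" "t < 1" shows "((deriv ^^ j) r has_field_derivative (deriv ^^ Suc j) r t) (at t)"
  using admissible_scaleD(3)[OF adm assms, of j]
  by (metis DERIV_deriv_iff_real_differentiable comp_apply funpow.simps(2))

lemma DERIV_r: "0 < t \<Longrightarrow> t < 1 \<Longrightarrow> (r has_field_derivative deriv r t) (at t)"
  using DERIV_iter[of t 0] by simp
lemma DERIV_r': "0 < t \<Longrightarrow> t < 1 \<Longrightarrow> (deriv r has_field_derivative deriv (deriv r) t) (at t)"
  using DERIV_iter[of t 1] by simp
lemma DERIV_r'': "0 < t \<Longrightarrow> t < 1 \<Longrightarrow> (deriv (deriv r) has_field_derivative deriv (deriv (deriv r)) t) (at t)"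
  using DERIV_iter[of t 2] by (simp add: numeral_2_eq_2)

lemma DERIV_L: "0 < t \<Longrightarrow> t < 1 \<Longrightarrow> (L has_field_derivative L' t) (at t)"
  unfolding L_def[abs_def] L'_def using r_pos DERIV_r
  by (auto intro!: derivative_eq_intros)

lemma DERIV_L': "0 < t \<Longrightarrow> t < 1 \<Longrightarrow> (L' has_field_derivative L'' t) (at t)"
  unfolding L''_def L'_def[abs_def] using r_pos[of t]
  by (auto intro!: derivative_eq_intros DERIV_r DERIV_r' simp: field_simps power2_eq_square)

lemma isCont_L'': "0 < t \<Longrightarrow> t < 1 \<Longrightarrow> isCont L'' t"
  unfolding L''_def[abs_def] using r_pos[of t] DERIV_isCont[OF DERIV_r] DERIV_isCont[OF DERIV_r'] DERIV_isCont[OF DERIV_r'']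
  by (intro continuous_intros) auto

lemma deriv_L: "0 < t \<Longrightarrow> t < 1 \<Longrightarrow> deriv L t = L' t"
  by (rule DERIV_imp_deriv[OF DERIV_L])

lemma deriv_deriv_L: "0 < t \<Longrightarrow> t < 1 \<Longrightarrow> deriv (deriv L) t = L'' t"
proof -
  assume t: "0 < t" "t < 1"
  have "eventually (\<lambda>x. x \<in> {0<..<1}) (nhds t)" using t by (intro eventually_nhds_in_open) auto
  then have "eventually (\<lambda>x. deriv L x = L' x) (nhds t)" by eventually_elim (auto simp: deriv_L)
  then have "deriv (deriv L) t = deriv L' t" by (rule deriv_cong_ev) simp
  also have "\<dots> = L'' t" using t by (intro DERIV_imp_deriv DERIV_L') auto
  finally show ?thesis .
qed

text \<open>Left limit of r' at 1. Since r tends to 1, it is also the left limit of (log r)' and the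
  one-sided derivative of log r at 1, hence the constant value of the intensity beyond 1.\<close>

definition D1 :: real where "D1 = (SOME D. (deriv r \<longlongrightarrow> D) (at_left 1))"

lemma tendsto_r: "(r \<longlongrightarrow> 1) (at_left 1)" by (rule admissible_scaleD(4)[OF adm])
lemma tendsto_L: "(L \<longlongrightarrow> 0) (at_left 1)"
  unfolding L_def[abs_def] using tendsto_ln[OF tendsto_r] by simp
lemma tendsto_L': "(L' \<longlongrightarrow> D1) (at_left 1)"
proof -
  have "(deriv r \<longlongrightarrow> D1) (at_left 1)" unfolding D1_def by (rule someI_ex[OF admissible_scaleD(5)[OF adm]])
  from tendsto_divide[OF this tendsto_r] show ?thesis unfolding L'_def[abs_def] by simp
qed

lemma L_r1: "L 1 = 0" using adm unfolding L_def admissible_scale_def by simp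

text \<open>The hypotheses give the limit of r' from the left, whereas the intensity at l \<ge> 1 is
  a one-sided derivative at the endpoint; l'Hopital's rule connects the two, with L 1 = 0.\<close>

lemma has_left_derivative_L: "(L has_vector_derivative D1) (at_left 1)"
proof -
  have ev: "eventually (\<lambda>x::real. x \<in> {0<..<1}) (at_left 1)"
    by (rule eventually_at_leftI[of 0]) auto
  have "((\<lambda>x. L x / (x - 1)) \<longlongrightarrow> D1) (at_left 1)"
  proof (rule lhopital_left[where f' = L' and g' = "\<lambda>_. 1"])
    show "((\<lambda>x. x - 1) \<longlongrightarrow> (0::real)) (at_left 1)" by (auto intro!: tendsto_eq_intros)
    show "\<forall>\<^sub>F x in at_left 1. (L has_real_derivative L' x) (at x)" using ev by eventually_elim (auto intro: DERIV_L)
    show "\<forall>\<^sub>F x in at_left 1. x - 1 \<noteq> (0::real)" using ev by eventually_elim auto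
    show "\<forall>\<^sub>F x in at_left 1. ((\<lambda>x. x - 1) has_real_derivative 1) (at x)"
      by (auto intro!: always_eventually derivative_eq_intros)
  qed (use tendsto_L tendsto_L' in auto)
  then have "(L has_field_derivative D1) (at_left 1)"
    unfolding has_field_derivative_iff using L_r1 by simp
  then show ?thesis by (simp add: has_real_derivative_iff_has_vector_derivative)
qed

lemma intensity_less: "0 < l \<Longrightarrow> l < 1 \<Longrightarrow> intensity r l = - l\<^sup>2 * L'' l"
  unfolding intensity_def using deriv_deriv_L[of l] by (simp add: L_def[abs_def])
lemma intensity_ge: "1 \<le> l \<Longrightarrow> intensity r l = D1"
  unfolding intensity_def using vector_derivative_within[OF _ has_left_derivative_L]
  by (simp add: L_def[abs_def] trivial_limit_at_left_real)

lemma intensity_pos: "0 < l \<Longrightarrow> intensity r l > 0" by (rule admissible_scaleD(7)[OF adm])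
lemma D1_pos: "D1 > 0" using intensity_pos[of 1] intensity_ge[of 1] by simp
lemma L''_neg: "0 < l \<Longrightarrow> l < 1 \<Longrightarrow> L'' l < 0"
  using intensity_pos[of l] by (simp add: intensity_less zero_less_mult_iff mult_less_0_iff not_less)

text \<open>The indicator discards l \<le> 0, where the value is whatever \<open>deriv\<close>
  returns. On (0, 1) the function is continuous, from 1 on it is constant.\<close>

lemma borel_measurable_intensity: "(\<lambda>l. intensity r l * indicator {0<..} l) \<in> borel_measurable borel"
proof -
  have "continuous_on {0<..<1} (\<lambda>l. - l\<^sup>2 * L'' l)"
    by (intro continuous_intros continuous_at_imp_continuous_on ballI isCont_L'') auto
  then have "(\<lambda>l. indicator {0<..<1} l *\<^sub>R (- l\<^sup>2 * L'' l)) \<in> borel_measurable borel"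
    by (intro borel_measurable_continuous_on_indicator) auto
  moreover have "(\<lambda>l. intensity r l * indicator {0<..} l) = 
      (\<lambda>l. indicator {0<..<1} l *\<^sub>R (- l\<^sup>2 * L'' l) + indicator {1..} l * D1)"
    by (auto simp: fun_eq_iff indicator_def intensity_less intensity_ge)
  ultimately show ?thesis by simp
qed

text \<open>Integration by parts: the antiderivative of \<open>- (l - w) L''(l)\<close> is \<open>L(l) - (l - w) L'(l)\<close>.\<close>

lemma nn_integral_intensity_Ioo:
  assumes a: "0 < a" "a < 1" "w \<le> a"
  shows "(\<integral>\<^sup>+l. ennreal ((l - w) * (intensity r l / l\<^sup>2)) * indicator {a<..<1} l \<partial>lborel)
    = ennreal ((a - w) * L' a - L a - (1 - w) * D1)"
    and "(a - w) * L' a - L a - (1 - w) * D1 \<ge> 0"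
proof -
  let ?F = "\<lambda>l. L l - (l - w) * L' l"
  let ?f = "\<lambda>l. (l - w) * (- L'' l)"
  have F: "(?F has_real_derivative ?f x) (at x)" if "0 < x" "x < 1" for x
    using that by (auto intro!: derivative_eq_intros DERIV_L DERIV_L')
  have c: "isCont ?f x" if "0 < x" "x < 1" for x
    using that by (intro continuous_intros isCont_L'') auto
  have nn: "0 \<le> ?f x" if "a < x" "x < 1" for x
    using that a L''_neg[of x] by (intro mult_nonneg_nonneg) auto
  have A: "((?F \<circ> real_of_ereal) \<longlongrightarrow> ?F a) (at_right (ereal a))"
  proof -
    have "(?F \<longlongrightarrow> ?F a) (at_right a)"
      using DERIV_isCont[OF F[of a]] a by (auto simp: isCont_def filterlim_at_split)
    then show ?thesis unfolding at_right_ereal filterlim_filtermap o_def by simp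
  qed
  \<comment> \<open>Boundary value at 1: L tends to 0 and L' to \<open>D1\<close>.\<close>
  have B: "((?F \<circ> real_of_ereal) \<longlongrightarrow> 0 - (1 - w) * D1) (at_left (ereal 1))"
  proof -
    have "(?F \<longlongrightarrow> 0 - (1 - w) * D1) (at_left 1)"
      by (intro tendsto_intros tendsto_L tendsto_L')
    then show ?thesis unfolding at_left_ereal filterlim_filtermap o_def by simp
  qed
  have si: "set_integrable lborel (einterval a 1) ?f"
    and I: "(LBINT x=a..1. ?f x) = (0 - (1 - w) * D1) - ?F a"
    using interval_integral_FTC_nonneg[of "ereal a" "ereal 1" ?F ?f, OF _ _ _ _ A B] a F c nn
    by (auto simp: one_ereal_def)
  have e: "einterval a 1 = {a<..<1}" by (auto simp: einterval_def)
  have I': "(LINT l|lborel. ?f l * indicator {a<..<1} l) = (a - w) * L' a - L a - (1 - w) * D1"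
    using I a by (simp add: interval_lebesgue_integral_def set_lebesgue_integral_def e one_ereal_def[symmetric] mult.commute)
  have int: "integrable lborel (\<lambda>l. ?f l * indicator {a<..<1} l)"
    using si by (simp add: set_integrable_def e mult.commute)
  have nn': "0 \<le> ?f l * indicator {a<..<1} l" for l
    using nn[of l] by (auto simp: indicator_def)
  have "(\<integral>\<^sup>+l. ennreal ((l - w) * (intensity r l / l\<^sup>2)) * indicator {a<..<1} l \<partial>lborel)
     = (\<integral>\<^sup>+l. ennreal (?f l * indicator {a<..<1} l) \<partial>lborel)"
    using a by (intro nn_integral_cong) (auto simp: indicator_def intensity_less)
  also have "\<dots> = ennreal ((a - w) * L' a - L a - (1 - w) * D1)"
    using nn_integral_eq_integral[OF int] nn' I' by simp
  finally show "(\<integral>\<^sup>+l. ennreal ((l - w) * (intensity r l / l\<^sup>2)) * indicator {a<..<1} l \<partial>lborel)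
    = ennreal ((a - w) * L' a - L a - (1 - w) * D1)" .
  show "(a - w) * L' a - L a - (1 - w) * D1 \<ge> 0"
    using Bochner_Integration.integral_nonneg[of lborel "\<lambda>l. ?f l * indicator {a<..<1} l"] nn' I' by simp
qed

lemma nn_integral_intensity_Ici:
  "(\<integral>\<^sup>+l. ennreal (intensity r l / l\<^sup>2) * indicator {1..} l \<partial>lborel) = ennreal D1"
proof -
  have "(\<integral>\<^sup>+l. ennreal (intensity r l / l\<^sup>2) * indicator {1..} l \<partial>lborel) = (\<integral>\<^sup>+l. ennreal (D1 / l\<^sup>2) * indicator {1..} l \<partial>lborel)"
    by (intro nn_integral_cong) (auto simp: indicator_def intensity_ge)
  also have "\<dots> = ennreal (0 - (- D1 / 1))"
  proof (rule nn_integral_FTC_atLeast)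
    show "((\<lambda>x. - D1 / x) has_real_derivative D1 / x\<^sup>2) (at x)" if "1 \<le> x" for x
      using that by (auto intro!: derivative_eq_intros simp: power2_eq_square)
    show "((\<lambda>x. - D1 / x) \<longlongrightarrow> 0) at_top"
      by (intro tendsto_divide_0[OF tendsto_const] filterlim_at_top_imp_at_infinity filterlim_ident)
  qed (use D1_pos in auto)
  finally show ?thesis by simp
qed

end

section \<open>Cones and the mass of their intersections\<close>

lemma log_cone_altdef: "\<epsilon> \<le> 1 \<Longrightarrow> log_cone \<epsilon> u = {z. \<epsilon> \<le> snd z \<and> \<bar>fst z - u\<bar> \<le> min (snd z) 1 / 2}"
  unfolding log_cone_def by auto

lemma borel_log_cone: "\<epsilon> \<le> 1 \<Longrightarrow> log_cone \<epsilon> u \<in> sets borel"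
  unfolding log_cone_altdef
  by (intro borel_closed closed_Collect_conj closed_Collect_le continuous_intros) auto

lemma log_cone_subset: "0 < \<epsilon> \<Longrightarrow> \<epsilon> \<le> 1 \<Longrightarrow> log_cone \<epsilon> u \<subseteq> {(t, l). 0 < l}"
  by (auto simp: log_cone_altdef)

lemma log_cone_antimono: "\<epsilon> \<le> \<epsilon>' \<Longrightarrow> \<epsilon>' \<le> 1 \<Longrightarrow> log_cone \<epsilon>' u \<subseteq> log_cone \<epsilon> u"
  by (auto simp: log_cone_altdef)

lemma upper_half_borel: "{(t :: real, l :: real). 0 < l} \<in> sets borel"
proof -
  have "{(t :: real, l :: real). 0 < l} = {z. 0 < snd z}" by auto
  also have "\<dots> \<in> sets borel" by (intro borel_open open_Collect_less continuous_intros)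
  finally show ?thesis .
qed

context scale
begin

lemma sets_intensity_measureI:
  "A \<in> sets borel \<Longrightarrow> A \<subseteq> {(t, l). 0 < l} \<Longrightarrow> A \<in> sets (intensity_measure r)"
  unfolding intensity_measure_def using upper_half_borel
  by (auto simp: sets_restrict_space_iff)

lemma intensity_density_measurable:
  "(\<lambda>(t :: real, l). ennreal (intensity r l / l\<^sup>2) * indicator {(t, l). 0 < l} (t, l)) \<in> borel_measurable borel"
proof -
  have "(\<lambda>z :: real \<times> real. ennreal ((intensity r (snd z) * indicator {0<..} (snd z)) / (snd z)\<^sup>2)) \<in> borel_measurable borel"
    by (intro measurable_compose[OF _ measurable_ennreal] borel_measurable_divide
       measurable_compose[OF _ borel_measurable_intensity] borel_measurable_continuous_onI continuous_intros)
  also have "(\<lambda>z :: real \<times> real. ennreal ((intensity r (snd z) * indicator {0<..} (snd z)) / (snd z)\<^sup>2)) =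
    (\<lambda>(t :: real, l). ennreal (intensity r l / l\<^sup>2) * indicator {(t, l). 0 < l} (t, l))"
    by (auto simp: fun_eq_iff indicator_def)
  finally show ?thesis .
qed

text \<open>Tonelli in horizontal slices: the density depends on the height only, so a slice
  contributes its length.\<close>

lemma emeasure_intensity_measure:
  assumes A: "A \<in> sets borel" "A \<subseteq> {(t, l). 0 < l}"
  shows "emeasure (intensity_measure r) A =
    (\<integral>\<^sup>+l. ennreal (intensity r l / l\<^sup>2) * emeasure lborel {t. (t, l) \<in> A} * indicator {0<..} l \<partial>lborel)"
proof -
  let ?H = "{(t :: real, l :: real). 0 < l}"
  let ?g = "\<lambda>(t :: real, l). ennreal (intensity r l / l\<^sup>2) :: ennreal"
  have g: "(\<lambda>z. ?g z * indicator ?H z) \<in> borel_measurable borel"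
  proof -
    have "(\<lambda>z. ?g z * indicator ?H z) = (\<lambda>(t, l). ennreal (intensity r l / l\<^sup>2) * indicator ?H (t, l))"
      by (auto simp: fun_eq_iff)
    then show ?thesis using intensity_density_measurable by simp
  qed
  then have gr: "?g \<in> borel_measurable (restrict_space lborel ?H)"
    using upper_half_borel by (subst borel_measurable_restrict_space_iff_ennreal) auto
  have gA: "(\<lambda>z. ?g z * indicator A z) = (\<lambda>z. (?g z * indicator ?H z) * indicator A z)"
    using A(2) by (auto simp: fun_eq_iff indicator_def)
  have gAm: "(\<lambda>z. ?g z * indicator A z) \<in> borel_measurable (lborel \<Otimes>\<^sub>M lborel)"
    unfolding gA lborel_prod using borel_measurable_times_ennreal[OF g borel_measurable_indicator[OF A(1)]] by simp
  have "emeasure (intensity_measure r) A = (\<integral>\<^sup>+z. ?g z * indicator A z \<partial>restrict_space lborel ?H)"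
    unfolding intensity_measure_def
    using A upper_half_borel by (intro emeasure_density[OF gr]) (auto simp: sets_restrict_space_iff)
  also have "\<dots> = (\<integral>\<^sup>+z. ?g z * indicator A z * indicator ?H z \<partial>lborel)"
    using upper_half_borel by (intro nn_integral_restrict_space) auto
  also have "\<dots> = (\<integral>\<^sup>+z. ?g z * indicator A z \<partial>(lborel \<Otimes>\<^sub>M lborel))"
    unfolding lborel_prod using A(2) by (intro nn_integral_cong) (auto simp: indicator_def)
  also have "\<dots> = (\<integral>\<^sup>+l. (\<integral>\<^sup>+t. ?g (t, l) * indicator A (t, l) \<partial>lborel) \<partial>lborel)"
    using lborel_pair.nn_integral_snd[OF gAm] by simp
  also have "\<dots> = (\<integral>\<^sup>+l. ennreal (intensity r l / l\<^sup>2) * emeasure lborel {t. (t, l) \<in> A} * indicator {0<..} l \<partial>lborel)"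
  proof (rule nn_integral_cong)
    fix l :: real
    have s: "{t. (t, l) \<in> A} \<in> sets borel"
    proof -
      have "(\<lambda>t. (t, l)) -` A \<inter> space borel \<in> sets borel"
        by (rule measurable_sets[OF _ A(1)]) (auto simp: borel_prod[symmetric])
      then show ?thesis by (simp add: vimage_def)
    qed
    have "(\<integral>\<^sup>+t. ?g (t, l) * indicator A (t, l) \<partial>lborel) = (\<integral>\<^sup>+t. ennreal (intensity r l / l\<^sup>2) * indicator {t. (t, l) \<in> A} t \<partial>lborel)"
      by (intro nn_integral_cong) (auto simp: indicator_def)
    also have "\<dots> = ennreal (intensity r l / l\<^sup>2) * emeasure lborel {t. (t, l) \<in> A}"
      using s by (subst nn_integral_cmult) auto
    also have "\<dots> = ennreal (intensity r l / l\<^sup>2) * emeasure lborel {t. (t, l) \<in> A} * indicator {0<..} l"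
    proof (cases "0 < l")
      case False
      then have "{t. (t, l) \<in> A} = {}" using A(2) by auto
      then show ?thesis by simp
    qed simp
    finally show "(\<integral>\<^sup>+t. ?g (t, l) * indicator A (t, l) \<partial>lborel) = \<dots>" .
  qed
  finally show ?thesis .
qed

text \<open>At height l \<ge> \<epsilon> the two slices are intervals of length min l 1 centred at u
  and v; they overlap in length min l 1 - |u - v|. The embedding into \<open>ennreal\<close> sends
  negative values, that is disjoint slices, to 0.\<close>

lemma emeasure_log_cone_inter:
  assumes \<epsilon>: "0 < \<epsilon>" "\<epsilon> \<le> 1"
  shows "emeasure (intensity_measure r) (log_cone \<epsilon> u \<inter> log_cone \<epsilon> v) =
    (\<integral>\<^sup>+l. ennreal ((min l 1 - \<bar>u - v\<bar>) * (intensity r l / l\<^sup>2)) * indicator {\<epsilon>..} l \<partial>lborel)"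
proof -
  have "emeasure (intensity_measure r) (log_cone \<epsilon> u \<inter> log_cone \<epsilon> v) =
    (\<integral>\<^sup>+l. ennreal (intensity r l / l\<^sup>2) * emeasure lborel {t. (t, l) \<in> log_cone \<epsilon> u \<inter> log_cone \<epsilon> v} * indicator {0<..} l \<partial>lborel)"
    using borel_log_cone[OF \<epsilon>(2)] log_cone_subset[OF \<epsilon>] by (intro emeasure_intensity_measure) auto
  also have "\<dots> = (\<integral>\<^sup>+l. ennreal ((min l 1 - \<bar>u - v\<bar>) * (intensity r l / l\<^sup>2)) * indicator {\<epsilon>..} l \<partial>lborel)"
  proof (rule nn_integral_cong)
    fix l :: real
    show "ennreal (intensity r l / l\<^sup>2) * emeasure lborel {t. (t, l) \<in> log_cone \<epsilon> u \<inter> log_cone \<epsilon> v} * indicator {0<..} l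
      = ennreal ((min l 1 - \<bar>u - v\<bar>) * (intensity r l / l\<^sup>2)) * indicator {\<epsilon>..} l"
    proof (cases "\<epsilon> \<le> l")
      case True
      let ?m = "min l 1"
      have pos: "0 \<le> intensity r l / l\<^sup>2" using True \<epsilon> intensity_pos[of l] by simp
      have eq: "{t. \<bar>t - u\<bar> \<le> m / 2 \<and> \<bar>t - v\<bar> \<le> m / 2} = {max u v - m / 2 .. min u v + m / 2}" for m
        by (rule set_eqI, unfold mem_Collect_eq atLeastAtMost_iff abs_le_iff max_def min_def) auto
      have "(t, l) \<in> log_cone \<epsilon> u \<inter> log_cone \<epsilon> v \<longleftrightarrow> \<bar>t - u\<bar> \<le> ?m / 2 \<and> \<bar>t - v\<bar> \<le> ?m / 2" for t
        unfolding log_cone_altdef[OF \<epsilon>(2)] using True by auto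
      then have "{t. (t, l) \<in> log_cone \<epsilon> u \<inter> log_cone \<epsilon> v} = {max u v - ?m / 2 .. min u v + ?m / 2}"
        unfolding eq[symmetric] by blast
      then have "emeasure lborel {t. (t, l) \<in> log_cone \<epsilon> u \<inter> log_cone \<epsilon> v} = ennreal (?m - \<bar>u - v\<bar>)"
        by (auto simp: emeasure_lborel_Icc_eq ennreal_neg max_def min_def not_le field_simps)
      then show ?thesis using True \<epsilon> pos by (simp add: ennreal_mult'' mult.commute del: times_divide_eq_right times_divide_eq_left)
    next
      case False
      then have "{t. (t, l) \<in> log_cone \<epsilon> u \<inter> log_cone \<epsilon> v} = {}" by (auto simp: log_cone_altdef[OF \<epsilon>(2)])
      then show ?thesis using False by (simp only: emeasure_empty) simp
    qed
  qed
  finally show ?thesis .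
qed

text \<open>The boundary term -(1 - w) \<open>D1\<close> from heights below 1 is cancelled by the
  contribution of the heights above 1.\<close>

lemma nn_integral_intensity_ge:
  assumes a: "0 < a" "a < 1" "w \<le> a"
  shows "(\<integral>\<^sup>+l. ennreal ((min l 1 - w) * (intensity r l / l\<^sup>2)) * indicator {a..} l \<partial>lborel)
    = ennreal ((a - w) * L' a - L a)"
proof -
  have w1: "0 \<le> 1 - w" using a by simp
  have meas: "(\<lambda>l. ennreal ((l - w) * (intensity r l / l\<^sup>2)) * indicator {a<..<1} l) \<in> borel_measurable lborel"
  proof -
    have "(\<lambda>l. ennreal ((l - w) * ((intensity r l * indicator {0<..} l) / l\<^sup>2)) * indicator {a<..<1} l) \<in> borel_measurable lborel"
      using borel_measurable_intensity by measurable
    also have "(\<lambda>l. ennreal ((l - w) * ((intensity r l * indicator {0<..} l) / l\<^sup>2)) * indicator {a<..<1} l) =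
      (\<lambda>l. ennreal ((l - w) * (intensity r l / l\<^sup>2)) * indicator {a<..<1} l)"
      using a by (auto simp: fun_eq_iff indicator_def)
    finally show ?thesis .
  qed
  have meas2: "(\<lambda>l. ennreal (intensity r l / l\<^sup>2) * indicator {1..} l) \<in> borel_measurable lborel"
  proof -
    have "(\<lambda>l. ennreal ((intensity r l * indicator {0<..} l) / l\<^sup>2) * indicator {1..} l) \<in> borel_measurable lborel"
      using borel_measurable_intensity by measurable
    also have "(\<lambda>l. ennreal ((intensity r l * indicator {0<..} l) / l\<^sup>2) * indicator {1..} l) =
      (\<lambda>l. ennreal (intensity r l / l\<^sup>2) * indicator {1..} l)"
      by (auto simp: fun_eq_iff indicator_def)
    finally show ?thesis .
  qed
  have "AE l in lborel. ennreal ((min l 1 - w) * (intensity r l / l\<^sup>2)) * indicator {a..} l =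
     ennreal ((l - w) * (intensity r l / l\<^sup>2)) * indicator {a<..<1} l +
     ennreal (1 - w) * (ennreal (intensity r l / l\<^sup>2) * indicator {1..} l)"
    using AE_lborel_singleton[of a]
  proof eventually_elim
    case (elim l)
    have "ennreal ((1 - w) * (intensity r l / l\<^sup>2)) = ennreal (1 - w) * ennreal (intensity r l / l\<^sup>2)"
      using w1 by (rule ennreal_mult')
    then show ?case using elim a by (auto simp: indicator_def simp del: times_divide_eq_right)
  qed
  then have "(\<integral>\<^sup>+l. ennreal ((min l 1 - w) * (intensity r l / l\<^sup>2)) * indicator {a..} l \<partial>lborel)
    = (\<integral>\<^sup>+l. ennreal ((l - w) * (intensity r l / l\<^sup>2)) * indicator {a<..<1} l +
       ennreal (1 - w) * (ennreal (intensity r l / l\<^sup>2) * indicator {1..} l) \<partial>lborel)"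
    by (rule nn_integral_cong_AE)
  also have "\<dots> = ennreal ((a - w) * L' a - L a - (1 - w) * D1) + ennreal (1 - w) * ennreal D1"
    using meas meas2 by (simp add: nn_integral_add nn_integral_cmult nn_integral_intensity_Ioo[OF a] nn_integral_intensity_Ici
      del: times_divide_eq_right)
  also have "\<dots> = ennreal ((a - w) * L' a - L a)"
    using nn_integral_intensity_Ioo(2)[OF a] w1 D1_pos
    by (simp add: ennreal_mult'[symmetric] ennreal_plus[symmetric] del: ennreal_plus)
  finally show ?thesis .
qed

text \<open>The cones are disjoint below height |u - v|, so the mass stops depending on \<epsilon>
  once \<epsilon> is at most this distance. Starting the integral at a = w = |u - v| also removes
  the term with L'.\<close>

lemma emeasure_log_cone_inter_eq:
  assumes \<epsilon>: "0 < \<epsilon>" "\<epsilon> \<le> \<bar>u - v\<bar>" "\<bar>u - v\<bar> < 1"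
  shows "emeasure (intensity_measure r) (log_cone \<epsilon> u \<inter> log_cone \<epsilon> v) = ennreal (- L \<bar>u - v\<bar>)"
proof -
  let ?w = "\<bar>u - v\<bar>"
  have "emeasure (intensity_measure r) (log_cone \<epsilon> u \<inter> log_cone \<epsilon> v) =
    (\<integral>\<^sup>+l. ennreal ((min l 1 - ?w) * (intensity r l / l\<^sup>2)) * indicator {\<epsilon>..} l \<partial>lborel)"
    using \<epsilon> by (intro emeasure_log_cone_inter) auto
  also have "\<dots> = (\<integral>\<^sup>+l. ennreal ((min l 1 - ?w) * (intensity r l / l\<^sup>2)) * indicator {?w..} l \<partial>lborel)"
  proof (rule nn_integral_cong)
    fix l :: real
    have "(min l 1 - ?w) * (intensity r l / l\<^sup>2) \<le> 0" if "\<epsilon> \<le> l" "l < ?w"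
      using that \<epsilon> intensity_pos[of l] by (intro mult_nonpos_nonneg) auto
    then show "ennreal ((min l 1 - ?w) * (intensity r l / l\<^sup>2)) * indicator {\<epsilon>..} l
      = ennreal ((min l 1 - ?w) * (intensity r l / l\<^sup>2)) * indicator {?w..} l"
      using \<epsilon> by (auto simp: indicator_def ennreal_neg)
  qed
  also have "\<dots> = ennreal (- L ?w)"
    using \<epsilon> nn_integral_intensity_ge[of ?w ?w] by simp
  finally show ?thesis .
qed

lemma emeasure_log_cone_finite:
  assumes \<epsilon>: "0 < \<epsilon>" "\<epsilon> \<le> 1"
  shows "emeasure (intensity_measure r) (log_cone \<epsilon> u) < \<infinity>"
proof -
  let ?e = "\<epsilon> / 2"
  have e: "0 < ?e" "?e < 1" "?e \<le> 1" "?e \<le> \<epsilon>" using \<epsilon> by auto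
  have s: "log_cone ?e u \<in> sets (intensity_measure r)"
    using borel_log_cone[OF e(3)] log_cone_subset[OF e(1,3)] by (rule sets_intensity_measureI)
  have "emeasure (intensity_measure r) (log_cone \<epsilon> u) \<le> emeasure (intensity_measure r) (log_cone ?e u \<inter> log_cone ?e u)"
    using log_cone_antimono[OF e(4) \<epsilon>(2)] s by (intro emeasure_mono) auto
  also have "\<dots> < \<infinity>"
    using nn_integral_intensity_ge[OF e(1,2), of 0] e by (subst emeasure_log_cone_inter) auto
  finally show ?thesis .
qed

lemma sets_log_cone: "0 < \<epsilon> \<Longrightarrow> \<epsilon> \<le> 1 \<Longrightarrow> log_cone \<epsilon> u \<in> sets (intensity_measure r)"
  by (intro sets_intensity_measureI borel_log_cone log_cone_subset)

section \<open>Monotonicity of log r and a lower bound for r\<close>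

lemma L_nonpos: "0 < t \<Longrightarrow> t < 1 \<Longrightarrow> L t \<le> 0"
proof -
  assume t: "0 < t" "t < 1"
  have "0 \<le> (1 - t) * D1" using t D1_pos by (intro mult_nonneg_nonneg) auto
  \<comment> \<open>With w = a = t the nonnegative integral reads L t \<le> -(1 - t)
    \<open>D1\<close>.\<close>
  then show ?thesis using nn_integral_intensity_Ioo(2)[of t t] t by simp
qed

text \<open>The integral of (l - w) (-L''(l)) over (t, 1) is nonnegative for every w \<le> t and
  affine in w with slope D1 - L' t. Letting w go to minus infinity forbids a positive slope.\<close>

lemma L'_ge: assumes t: "0 < t" "t < 1" shows "L' t \<ge> D1"
proof (rule ccontr)
  assume "\<not> ?thesis"
  then have l: "0 < D1 - L' t" by simp
  define c where "c = D1 + L t - t * L' t"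
  \<comment> \<open>The integral equals w (D1 - L' t) - c; this w makes it at most -1.\<close>
  define w where "w = min t ((c - 1) / (D1 - L' t))"
  have "w \<le> (c - 1) / (D1 - L' t)" by (simp add: w_def)
  then have "w * (D1 - L' t) \<le> c - 1" using l by (simp add: pos_le_divide_eq)
  moreover have "(t - w) * L' t - L t - (1 - w) * D1 \<ge> 0"
    using t by (intro nn_integral_intensity_Ioo(2)) (auto simp: w_def)
  ultimately show False by (simp add: c_def algebra_simps)
qed

lemma L_mono: assumes "0 < s" "s \<le> t" "t < 1" shows "L s \<le> L t"
proof (rule DERIV_nonneg_imp_nondecreasing[OF assms(2)])
  fix x assume "s \<le> x" "x \<le> t"
  then have x: "0 < x" "x < 1" using assms by auto
  show "\<exists>y. (L has_real_derivative y) (at x) \<and> 0 \<le> y"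
    using DERIV_L[OF x] L'_ge[OF x] D1_pos by (intro exI[of _ "L' x"]) auto
qed

text \<open>Near 0, t L'(t) < 1 + \<delta> makes L(t) - (1 + \<delta>) ln t nonincreasing; away from
  0 the monotonicity of L suffices. Through this bound products of powers of r are compared with
  products of powers of distances.\<close>

lemma r_lower_bound:
  assumes "\<delta> > 0"
  obtains C where "C > 0" "\<And>t. 0 < t \<Longrightarrow> t < 1 \<Longrightarrow> C * t powr (1 + \<delta>) \<le> r t"
proof -
  have "eventually (\<lambda>t. t * deriv L t < 1 + \<delta>) (at_right 0)"
    using admissible_scaleD(6)[OF adm] assms unfolding L_def[abs_def] by (intro order_tendstoD(2)) auto
  then obtain b where b: "b > 0" "\<And>t. 0 < t \<Longrightarrow> t < b \<Longrightarrow> t * deriv L t < 1 + \<delta>"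
    unfolding eventually_at_right_field by auto
  define t0 where "t0 = min (b / 2) (1 / 2)"
  have t0: "0 < t0" "t0 < 1" "t0 < b" using b(1) by (auto simp: t0_def)
  have *: "L t0 + (1 + \<delta>) * ln t \<le> L t" if t: "0 < t" "t < 1" for t
  proof (cases "t \<le> t0")
    case True
    have "L t0 - (1 + \<delta>) * ln t0 \<le> L t - (1 + \<delta>) * ln t"
    proof (rule DERIV_nonpos_imp_nonincreasing[OF True])
      fix x assume x: "t \<le> x" "x \<le> t0"
      then have x01: "0 < x" "x < 1" "x < b" using t t0 by auto
      then have "x * L' x < 1 + \<delta>" using b(2)[of x] deriv_L[of x] by simp
      then have "L' x \<le> (1 + \<delta>) / x" using x01 by (simp add: field_simps)
      then show "\<exists>y. ((\<lambda>t. L t - (1 + \<delta>) * ln t) has_real_derivative y) (at x) \<and> y \<le> 0"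
        using x01 by (intro exI[of _ "L' x - (1 + \<delta>) * (1 / x)"] conjI) (auto intro!: derivative_eq_intros DERIV_L)
    qed
    moreover have "(1 + \<delta>) * ln t0 \<le> 0" using t0 assms by (intro mult_nonneg_nonpos) auto
    ultimately show ?thesis by simp
  next
    case False
    then have "L t0 \<le> L t" using t0 t by (intro L_mono) auto
    moreover have "(1 + \<delta>) * ln t \<le> 0" using t assms by (intro mult_nonneg_nonpos) auto
    ultimately show ?thesis by simp
  qed
  show thesis
  proof (rule that[of "r t0"])
    show "0 < r t0" using r_pos t0 by auto
    fix t :: real assume t: "0 < t" "t < 1"
    have "r t0 * t powr (1 + \<delta>) = exp (L t0 + (1 + \<delta>) * ln t)"
      using r_pos[of t0] t0 t by (simp add: L_def exp_add powr_def)
    also have "\<dots> \<le> exp (L t)" using *[OF t] by simp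
    also have "\<dots> = r t" using r_pos[OF t] by (simp add: L_def)
    finally show "r t0 * t powr (1 + \<delta>) \<le> r t" .
  qed
qed

lemma continuous_on_r: "continuous_on {0<..<1} r"
  using DERIV_isCont[OF DERIV_r] by (intro continuous_at_imp_continuous_on) auto

end

section \<open>The infinitely divisible exponent\<close>

text \<open>One integrable majorant for all integrands that follow: quadratic at 0 by the Levy
  condition, e^(nu) at plus infinity by the moment hypothesis, constant at minus infinity, where
  \<nu> is finite.\<close>

definition levy_bound :: "nat \<Rightarrow> real \<Rightarrow> real" where
  "levy_bound n u = (if \<bar>u\<bar> \<le> 1 then u\<^sup>2 else if u > 1 then exp (real n * u) else 1)"

lemma borel_measurable_levy_bound [measurable]: "levy_bound n \<in> borel_measurable borel"
  unfolding levy_bound_def[abs_def] by measurable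

text \<open>The spectral function increases from its limit 0 at minus infinity, hence is nonnegative
  on the negative axis, and every interval ending at -1 has mass at most M(-1).\<close>

lemma levy_spectral_function_finite_left:
  assumes "levy_spectral_function M \<nu>"
  shows "emeasure \<nu> {..-1} < \<infinity>"
proof -
  have mono: "mono_on {..<0} M" and lim: "(M \<longlongrightarrow> 0) at_bot"
    and sets: "sets \<nu> = sets borel"
    and em: "\<And>a b. a \<le> b \<Longrightarrow> b < 0 \<Longrightarrow> emeasure \<nu> {a<..b} = ennreal (M b - M a)"
    using assms unfolding levy_spectral_function_def stieltjes_measure_def by auto
  have M0: "0 \<le> M x" if "x < 0" for x
  proof (rule tendsto_upperbound[OF lim])
    show "\<forall>\<^sub>F i in at_bot. M i \<le> M x"
      using eventually_le_at_bot[of x] by eventually_elim (rule mono_onD[OF mono], use that in auto)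
  qed simp
  have un: "(\<Union>i::nat. {- 1 - real i <.. -1}) = {..- 1 :: real}"
  proof (intro set_eqI iffI)
    fix x :: real assume x: "x \<in> {..-1}"
    obtain i :: nat where "- 1 - x < real i" using reals_Archimedean2 by blast
    then show "x \<in> (\<Union>i::nat. {- 1 - real i <.. -1})" using x by (intro UN_I[of i]) auto
  qed auto
  have inc: "incseq (\<lambda>i::nat. {- 1 - real i <.. -1})"
  proof (rule incseq_SucI)
    fix i :: nat
    show "{- 1 - real i <.. -1} \<subseteq> {- 1 - real (Suc i) <.. -1}" by auto
  qed
  have "range (\<lambda>i::nat. {- 1 - real i <.. -1}) \<subseteq> sets \<nu>" unfolding sets by (intro image_subsetI) simp
  from SUP_emeasure_incseq[OF this inc]
  have "emeasure \<nu> {..-1} = (SUP i::nat. emeasure \<nu> {- 1 - real i <.. -1})"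
    unfolding un by (rule sym)
  also have "\<dots> \<le> ennreal (M (-1))"
  proof (rule SUP_least)
    fix i :: nat
    have "emeasure \<nu> {- 1 - real i <.. -1} = ennreal (M (-1) - M (- 1 - real i))" by (rule em) auto
    also have "\<dots> \<le> ennreal (M (-1))" using M0[of "- 1 - real i"] by (intro ennreal_leI) auto
    finally show "emeasure \<nu> {- 1 - real i <.. -1} \<le> ennreal (M (-1))" .
  qed
  finally show ?thesis by (rule le_less_trans) simp
qed

lemma exp_minus_one_minus_bound: "\<bar>u\<bar> \<le> 1 \<Longrightarrow> \<bar>exp u - 1 - u\<bar> \<le> u\<^sup>2" for u :: real
proof (cases "0 \<le> u")
  case True
  assume "\<bar>u\<bar> \<le> 1"
  then have "exp u \<le> 1 + u + u\<^sup>2" using True by (intro exp_bound) auto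
  then show ?thesis using exp_ge_add_one_self[of u] zero_le_power2[of u] unfolding abs_le_iff by linarith
next
  case False
  define v where "v = - u"
  have v: "0 \<le> v" using False by (simp add: v_def)
  have q: "0 \<le> 1 - v + v\<^sup>2"
  proof -
    have "0 \<le> (v - 1 / 2)\<^sup>2" by simp
    then show ?thesis by (simp add: power2_eq_square algebra_simps)
  qed
  \<comment> \<open>The product equals 1 + v^3.\<close>
  have "1 \<le> (1 + v) * (1 - v + v\<^sup>2)"
    using v by (simp add: power2_eq_square algebra_simps)
  also have "\<dots> \<le> exp v * (1 - v + v\<^sup>2)"
    using q exp_ge_add_one_self[of v] by (intro mult_right_mono) auto
  finally have "exp u \<le> 1 - v + v\<^sup>2"
    by (simp add: v_def exp_minus field_simps)
  then have "exp u \<le> 1 + u + u\<^sup>2" by (simp add: v_def)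
  then show ?thesis using exp_ge_add_one_self[of u] zero_le_power2[of u] unfolding abs_le_iff by linarith
qed

lemma exp_minus_one_bound: "\<bar>u\<bar> \<le> 1 \<Longrightarrow> \<bar>exp u - 1\<bar> \<le> 2 * \<bar>u\<bar>" for u :: real
proof -
  assume u: "\<bar>u\<bar> \<le> 1"
  have "\<bar>exp u - 1\<bar> \<le> \<bar>exp u - 1 - u\<bar> + \<bar>u\<bar>" by simp
  also have "\<bar>exp u - 1 - u\<bar> \<le> \<bar>u\<bar> * \<bar>u\<bar>" using exp_minus_one_minus_bound[OF u] by (simp add: power2_eq_square)
  also have "\<bar>u\<bar> * \<bar>u\<bar> \<le> \<bar>u\<bar> * 1" using u by (intro mult_left_mono) auto
  finally show ?thesis by simp
qed

lemma norm_exp_iz: "norm (exp (\<i> * z * of_real u)) = exp (- Im z * u)" for u :: real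
  by (simp add: norm_exp_eq_Re)

text \<open>Absorbs the factor u that differentiation in z produces, at the price of \<delta> in the
  exponent.\<close>

lemma abs_le_exp_div: "0 < \<delta> \<Longrightarrow> \<bar>u\<bar> \<le> exp (\<delta> * \<bar>u\<bar>) / \<delta>" for u \<delta> :: real
proof -
  assume d: "0 < \<delta>"
  have "\<delta> * \<bar>u\<bar> \<le> exp (\<delta> * \<bar>u\<bar>)" using exp_ge_add_one_self[of "\<delta> * \<bar>u\<bar>"] by linarith
  then show ?thesis using d by (simp add: pos_le_divide_eq mult.commute)
qed

section \<open>The Levy integral on the strip -n \<le> Im z \<le> 0\<close>

locale levy =
  fixes \<nu> :: "real measure" and n :: nat
  assumes levy: "levy_measure \<nu>" and exp_int: "set_integrable \<nu> {1..} (\<lambda>u. exp (real n * u))"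
    and n_ge: "2 \<le> n"
begin

lemma sets_nu [measurable_cong]: "sets \<nu> = sets borel"
  using levy unfolding levy_measure_def levy_spectral_function_def stieltjes_measure_def by auto

lemma integrable_levy_bound: "integrable \<nu> (levy_bound n)"
  using levy unfolding levy_measure_def
proof (elim disjE exE conjE)
  fix M assume M: "levy_spectral_function M \<nu>"
  have 1: "set_integrable \<nu> ({-1..1} - {0}) (\<lambda>u. u\<^sup>2)" using M unfolding levy_spectral_function_def by auto
  have 2: "set_integrable \<nu> {1<..} (\<lambda>u. exp (real n * u))"
    using sets_nu by (intro set_integrable_subset[OF exp_int]) auto
  have "emeasure \<nu> {..<-1} \<le> emeasure \<nu> {..-1}" using sets_nu by (intro emeasure_mono) auto
  then have 3: "integrable \<nu> (indicator {..<-1} :: real \<Rightarrow> real)"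
    using levy_spectral_function_finite_left[OF M] sets_nu by (intro integrable_real_indicator) auto
  have "levy_bound n = (\<lambda>u. indicator ({-1..1} - {0}) u *\<^sub>R u\<^sup>2 + indicator {1<..} u *\<^sub>R exp (real n * u) + indicator {..<-1} u)"
    by (auto simp: fun_eq_iff levy_bound_def indicator_def)
  then show ?thesis using 1 2 3 unfolding set_integrable_def by simp
next
  fix c :: real assume "\<nu> = return borel (ln c)"
  then show ?thesis by (auto intro!: integrableI_bounded simp: nn_integral_return less_top[symmetric])
qed

lemma integrable_dominated:
  fixes f :: "real \<Rightarrow> 'a::{banach, second_countable_topology}"
  assumes "f \<in> borel_measurable borel" "\<And>u. norm (f u) \<le> C * levy_bound n u"
  shows "integrable \<nu> f"
proof (rule Bochner_Integration.integrable_bound)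
  show "integrable \<nu> (\<lambda>u. C * levy_bound n u)" using integrable_levy_bound by simp
  show "f \<in> borel_measurable \<nu>" using assms(1) measurable_cong_sets[OF sets_nu refl] by blast
  show "AE u in \<nu>. norm (f u) \<le> norm (C * levy_bound n u)"
    using assms(2) order_trans[OF norm_ge_zero assms(2)] by (intro AE_I2) (simp add: abs_of_nonneg)
qed

lemma integrable_power_expm1:
  assumes "2 \<le> k" "k \<le> n"
  shows "integrable \<nu> (\<lambda>u. (exp u - 1) ^ k)"
proof (rule integrable_dominated[where C = "2 ^ k"])
  fix u :: real
  consider "\<bar>u\<bar> \<le> 1" | "u > 1" | "u < -1" by linarith
  then show "norm ((exp u - 1) ^ k) \<le> 2 ^ k * levy_bound n u"
  proof cases
    case 1
    have "norm ((exp u - 1) ^ k) \<le> (2 * \<bar>u\<bar>) ^ k"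
      unfolding norm_power using exp_minus_one_bound[OF 1] by (intro power_mono) auto
    also have "\<dots> = 2 ^ k * \<bar>u\<bar> ^ k" by (simp add: power_mult_distrib)
    also have "\<bar>u\<bar> ^ k \<le> \<bar>u\<bar> ^ 2" using 1 assms by (intro power_decreasing) auto
    finally show ?thesis using 1 by (simp add: levy_bound_def)
  next
    case 2
    have "norm ((exp u - 1) ^ k) \<le> exp u ^ k" unfolding norm_power using 2 by (intro power_mono) auto
    also have "\<dots> \<le> exp u ^ n" using assms 2 by (intro power_increasing) auto
    also have "\<dots> = 1 * exp (real n * u)" by (simp add: exp_of_nat_mult)
    also have "\<dots> \<le> 2 ^ k * exp (real n * u)" by (intro mult_right_mono) auto
    finally show ?thesis using 2 by (simp add: levy_bound_def)
  next
    case 3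
    have "norm ((exp u - 1) ^ k) \<le> 1 ^ k" unfolding norm_power using 3 by (intro power_mono) auto
    also have "\<dots> \<le> 2 ^ k" by simp
    finally show ?thesis using 3 by (simp add: levy_bound_def)
  qed
qed measurable

definition F :: "complex \<Rightarrow> real \<Rightarrow> complex" where
  "F z u = exp (\<i> * z * of_real u) - 1 - \<i> * z * of_real (exp u - 1)"

text \<open>Near 0 the integrand is of second order in u. For large |u| the exponential has modulus
  exp(-Im z u), which \<open>levy_bound\<close> dominates on both sides of 0 exactly because -n
  \<le> Im z \<le> 0; the compensating term grows at most like e^u.\<close>

lemma norm_F_le:
  assumes z: "- real n \<le> Im z" "Im z \<le> 0" "norm z \<le> R"
  shows "norm (F z u) \<le> (exp R * R\<^sup>2 + R + 2) * levy_bound n u"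
proof -
  have R: "0 \<le> R" using z(3) norm_ge_zero order_trans by blast
  have c0: "0 \<le> exp R * R\<^sup>2" by simp
  consider "\<bar>u\<bar> \<le> 1" | "u > 1" | "u < -1" by linarith
  then show ?thesis
  proof cases
    case 1
    let ?w = "\<i> * z * of_real u"
    have nw: "norm ?w = norm z * \<bar>u\<bar>" by (simp add: norm_mult)
    \<comment> \<open>The compensator contains e^u - 1 in place of u; the difference is again
      quadratic and is split off from the Taylor remainder.\<close>
    have "F z u = (exp ?w - (\<Sum>i\<le>1. ?w ^ i / fact i)) - \<i> * z * of_real (exp u - 1 - u)"
      unfolding F_def by (simp add: algebra_simps)
    then have "norm (F z u) \<le> norm (exp ?w - (\<Sum>i\<le>1. ?w ^ i / fact i)) + norm (\<i> * z * of_real (exp u - 1 - u))"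
      by (metis norm_triangle_ineq4)
    also have "norm (exp ?w - (\<Sum>i\<le>1. ?w ^ i / fact i)) \<le> exp \<bar>Re ?w\<bar> * norm ?w ^ Suc 1 / fact 1"
      by (rule Taylor_exp)
    also have "exp \<bar>Re ?w\<bar> * norm ?w ^ Suc 1 / fact 1 \<le> exp R * (R\<^sup>2 * u\<^sup>2)"
    proof -
      have "\<bar>Re ?w\<bar> \<le> norm ?w" by (rule abs_Re_le_cmod)
      also have "\<dots> \<le> R * 1" unfolding nw using z(3) 1 R by (intro mult_mono) auto
      finally have "exp \<bar>Re ?w\<bar> \<le> exp R" by simp
      moreover have "norm ?w ^ 2 \<le> R\<^sup>2 * u\<^sup>2" unfolding nw using z(3)
        by (auto simp: power_mult_distrib intro!: mult_right_mono power_mono)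
      ultimately show ?thesis by (auto simp: power2_eq_square[symmetric] numeral_2_eq_2[symmetric] intro!: mult_mono)
    qed
    also have "norm (\<i> * z * of_real (exp u - 1 - u)) \<le> R * u\<^sup>2"
      using z(3) exp_minus_one_minus_bound[OF 1] R by (auto simp: norm_mult simp del: of_real_diff intro!: mult_mono)
    finally have "norm (F z u) \<le> (exp R * R\<^sup>2 + R) * u\<^sup>2" by (simp add: algebra_simps)
    also have "\<dots> \<le> (exp R * R\<^sup>2 + R + 2) * u\<^sup>2" by (intro mult_right_mono) auto
    finally show ?thesis using 1 by (simp add: levy_bound_def)
  next
    case 2
    have "- Im z * u \<le> real n * u" using z 2 by (intro mult_right_mono) auto
    then have 1: "norm (exp (\<i> * z * of_real u)) \<le> exp (real n * u)" unfolding norm_exp_iz by simp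
    have "1 * u \<le> real n * u" using n_ge 2 by (intro mult_right_mono) auto
    then have eu: "exp u \<le> exp (real n * u)" by simp
    have "norm (\<i> * z * of_real (exp u - 1)) = norm z * (exp u - 1)"
      using 2 by (simp add: norm_mult del: of_real_diff)
    also have "\<dots> \<le> R * exp (real n * u)"
    proof (rule mult_mono[OF z(3) _ R])
      show "exp u - 1 \<le> exp (real n * u)" using eu by linarith
    qed (use 2 in simp)
    finally have 3: "norm (\<i> * z * of_real (exp u - 1)) \<le> R * exp (real n * u)" .
    have 4: "1 \<le> exp (real n * u)" using 2 by simp
    have "norm (F z u) \<le> norm (exp (\<i> * z * of_real u)) + norm (1::complex) + norm (\<i> * z * of_real (exp u - 1))"
      unfolding F_def by (meson norm_triangle_ineq4 order_trans add_right_mono)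
    also have "\<dots> \<le> (R + 2) * exp (real n * u)" using 1 3 4 by (simp only: norm_one distrib_right)
    also have "\<dots> \<le> (exp R * R\<^sup>2 + R + 2) * exp (real n * u)" using c0 by (intro mult_right_mono) auto
    finally show ?thesis using 2 by (simp add: levy_bound_def)
  next
    case 3
    have "- Im z * u \<le> 0" using z 3 by (simp add: mult_nonpos_nonpos)
    then have 1: "norm (exp (\<i> * z * of_real u)) \<le> 1" unfolding norm_exp_iz by simp
    have "norm (\<i> * z * of_real (exp u - 1)) = norm z * \<bar>exp u - 1\<bar>"
      by (simp add: norm_mult del: of_real_diff)
    also have "\<dots> \<le> R * 1" using z(3) R 3 by (intro mult_mono) auto
    finally have 4: "norm (\<i> * z * of_real (exp u - 1)) \<le> R" by simp
    have "norm (F z u) \<le> norm (exp (\<i> * z * of_real u)) + norm (1::complex) + norm (\<i> * z * of_real (exp u - 1))"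
      unfolding F_def by (meson norm_triangle_ineq4 order_trans add_right_mono)
    also have "\<dots> \<le> exp R * R\<^sup>2 + R + 2" using 1 4 c0 unfolding norm_one by linarith
    finally show ?thesis using 3 by (simp add: levy_bound_def)
  qed
qed

lemma borel_measurable_F [measurable]: "F z \<in> borel_measurable borel"
  unfolding F_def by measurable

lemma integrable_F: "- real n \<le> Im z \<Longrightarrow> Im z \<le> 0 \<Longrightarrow> integrable \<nu> (F z)"
  by (rule integrable_dominated[OF borel_measurable_F norm_F_le[OF _ _ order_refl]])

end

context levy
begin

lemma DERIV_F: "((\<lambda>z. F z u) has_field_derivative (\<i> * of_real u * exp (\<i> * z * of_real u) - \<i> * of_real (exp u - 1))) (at z)"
  unfolding F_def by (auto intro!: derivative_eq_intros)

definition F' :: "complex \<Rightarrow> real \<Rightarrow> complex" where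
  "F' z u = \<i> * of_real u * exp (\<i> * z * of_real u) - \<i> * of_real (exp u - 1)"

lemma borel_measurable_F' [measurable]: "F' z \<in> borel_measurable borel"
  unfolding F'_def by measurable

text \<open>The z-derivative carries an extra factor u, which the majorant tolerates only at a
  distance \<delta> from both edges of the strip.\<close>

lemma norm_F'_le:
  assumes z: "- real n + \<delta> \<le> Im z" "Im z \<le> - \<delta>" "norm z \<le> R" and \<delta>: "0 < \<delta>"
  shows "norm (F' z u) \<le> (exp R * R + 2 + 1 / \<delta>) * levy_bound n u"
proof -
  have R: "0 \<le> R" using z(3) norm_ge_zero order_trans by blast
  have c0: "0 \<le> exp R * R" "0 < 1 / \<delta>" using R \<delta> by auto
  have nF: "norm (F' z u) \<le> \<bar>u\<bar> * exp (- Im z * u) + \<bar>exp u - 1\<bar>"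
  proof -
    have "norm (F' z u) \<le> norm (\<i> * of_real u * exp (\<i> * z * of_real u)) + norm (\<i> * of_real (exp u - 1) :: complex)"
      unfolding F'_def by (rule norm_triangle_ineq4)
    also have "\<dots> = \<bar>u\<bar> * exp (- Im z * u) + \<bar>exp u - 1\<bar>"
      by (simp only: norm_mult norm_exp_iz norm_of_real norm_ii) simp
    finally show ?thesis .
  qed
  consider "\<bar>u\<bar> \<le> 1" | "u > 1" | "u < -1" by linarith
  then show ?thesis
  proof cases
    case 1
    let ?w = "\<i> * z * of_real u"
    have nw: "norm ?w = norm z * \<bar>u\<bar>" by (simp add: norm_mult)
    have t: "norm (exp ?w - 1) \<le> exp R * (R * \<bar>u\<bar>)"
    proof -
      have "norm (exp ?w - (\<Sum>i\<le>0. ?w ^ i / fact i)) \<le> exp \<bar>Re ?w\<bar> * norm ?w ^ Suc 0 / fact 0"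
        by (rule Taylor_exp)
      also have "\<dots> = exp \<bar>Re ?w\<bar> * (norm z * \<bar>u\<bar>)" using nw by simp
      also have "\<dots> \<le> exp R * (R * \<bar>u\<bar>)"
      proof (intro mult_mono)
        have "\<bar>Re ?w\<bar> \<le> norm ?w" by (rule abs_Re_le_cmod)
        also have "\<dots> \<le> R * 1" unfolding nw using z(3) 1 R by (intro mult_mono) auto
        finally show "exp \<bar>Re ?w\<bar> \<le> exp R" by simp
      qed (use z(3) R in auto)
      finally show ?thesis by simp
    qed
    have "F' z u = \<i> * of_real u * (exp ?w - 1) - \<i> * of_real (exp u - 1 - u)"
      unfolding F'_def by (simp add: algebra_simps)
    then have "norm (F' z u) \<le> norm (\<i> * of_real u * (exp ?w - 1)) + norm (\<i> * of_real (exp u - 1 - u) :: complex)"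
      by (metis norm_triangle_ineq4)
    also have "\<dots> = \<bar>u\<bar> * norm (exp ?w - 1) + \<bar>exp u - 1 - u\<bar>"
      by (simp only: norm_mult norm_of_real norm_ii) simp
    also have "\<dots> \<le> \<bar>u\<bar> * (exp R * (R * \<bar>u\<bar>)) + u\<^sup>2"
      using t exp_minus_one_minus_bound[OF 1] by (intro add_mono mult_left_mono) auto
    also have "\<dots> = (exp R * R + 1) * u\<^sup>2" by (simp add: power2_eq_square algebra_simps)
    also have "\<dots> \<le> (exp R * R + 2 + 1 / \<delta>) * u\<^sup>2" using c0 by (intro mult_right_mono) auto
    finally show ?thesis using 1 by (simp add: levy_bound_def)
  next
    case 2
    let ?E = "exp (real n * u)"
    have "1 * u \<le> real n * u" using n_ge 2 by (intro mult_right_mono) auto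
    then have eu: "exp u \<le> ?E" by simp
    have "- Im z * u \<le> (real n - \<delta>) * u" using z 2 by (intro mult_right_mono) auto
    then have "\<bar>u\<bar> * exp (- Im z * u) \<le> exp (\<delta> * \<bar>u\<bar>) / \<delta> * exp ((real n - \<delta>) * u)"
      using \<delta> abs_le_exp_div[OF \<delta>, of u] by (intro mult_mono) auto
    also have "\<dots> = (1 / \<delta>) * ?E" using 2 by (simp add: exp_add[symmetric] algebra_simps)
    finally have a: "\<bar>u\<bar> * exp (- Im z * u) \<le> (1 / \<delta>) * ?E" .
    have b: "\<bar>exp u - 1\<bar> \<le> 1 * ?E"
    proof -
      have "1 \<le> exp u" using 2 by simp
      then show ?thesis using eu by linarith
    qed
    have "norm (F' z u) \<le> (1 / \<delta> + 1) * ?E" using nF a b unfolding distrib_right by linarith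
    also have "\<dots> \<le> (exp R * R + 2 + 1 / \<delta>) * ?E" using c0 by (intro mult_right_mono) auto
    finally show ?thesis using 2 by (simp add: levy_bound_def)
  next
    case 3
    have "- Im z * u \<le> - (\<delta> * \<bar>u\<bar>)"
    proof -
      have "\<delta> * (-u) \<le> - Im z * (- u)" using z 3 by (intro mult_right_mono) auto
      then show ?thesis using 3 by simp
    qed
    then have "\<bar>u\<bar> * exp (- Im z * u) \<le> exp (\<delta> * \<bar>u\<bar>) / \<delta> * exp (- (\<delta> * \<bar>u\<bar>))"
      using abs_le_exp_div[OF \<delta>, of u] \<delta> by (intro mult_mono) auto
    also have "\<dots> = 1 / \<delta>" by (simp add: exp_minus)
    finally have a: "\<bar>u\<bar> * exp (- Im z * u) \<le> 1 / \<delta>" .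
    have "\<bar>exp u - 1\<bar> \<le> 1" using 3 by simp
    then have "norm (F' z u) \<le> exp R * R + 2 + 1 / \<delta>" using nF a c0 by linarith
    then show ?thesis using 3 by (simp add: levy_bound_def)
  qed
qed

definition Psi :: "complex \<Rightarrow> complex" where "Psi z = (CLINT u|\<nu>. F z u)"

text \<open>Differentiation under the integral sign: inside a ball in the open strip the mean value
  inequality bounds the difference quotients by the majorant of \<open>F'\<close>.\<close>

lemma Psi_field_differentiable:
  assumes z: "- real n < Im z" "Im z < 0"
  shows "Psi field_differentiable (at z)"
proof -
  \<comment> \<open>Half the distance of z to the edges, so that every point of the ball of radius
    \<delta> still keeps the distance \<delta> from them.\<close>
  define \<delta> where "\<delta> = min (Im z + real n) (- Im z) / 2"
  have \<delta>: "0 < \<delta>" using z by (auto simp: \<delta>_def)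
  define R where "R = norm z + \<delta>"
  have ball: "- real n + \<delta> \<le> Im w \<and> Im w \<le> - \<delta> \<and> norm w \<le> R" if "w \<in> ball z \<delta>" for w
  proof -
    have d: "norm (w - z) < \<delta>" using that by (simp add: dist_norm norm_minus_commute)
    have "\<bar>Im (w - z)\<bar> \<le> norm (w - z)" by (rule abs_Im_le_cmod)
    moreover have "norm w \<le> norm z + norm (w - z)" using norm_triangle_ineq[of z "w - z"] by simp
    moreover have "\<delta> \<le> (Im z + real n) / 2" "\<delta> \<le> - Im z / 2" unfolding \<delta>_def by auto
    ultimately show ?thesis using d unfolding R_def by (auto simp: abs_le_iff)
  qed
  have int: "integrable \<nu> (F w)" if "w \<in> ball z \<delta>" for w
    using ball[OF that] \<delta> by (intro integrable_F) auto
  define B where "B = exp R * R + 2 + 1 / \<delta>"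
  have "((\<lambda>w. (Psi w - Psi z) / (w - z)) \<longlongrightarrow> (CLINT u|\<nu>. F' z u)) (at z)"
    unfolding tendsto_at_iff_sequentially comp_def
  proof (intro allI impI)
    fix X :: "nat \<Rightarrow> complex" assume X: "\<forall>i. X i \<in> UNIV - {z}" "X \<longlonglongrightarrow> z"
    obtain i0 where i0: "\<And>i. i \<ge> i0 \<Longrightarrow> X i \<in> ball z \<delta>"
      using X(2) \<delta> unfolding lim_sequentially by (metis dist_commute mem_ball)
    \<comment> \<open>A tail of the sequence, so that all its terms lie in the ball.\<close>
    define Y where "Y i = X (i + i0)" for i
    have Y: "Y i \<in> ball z \<delta>" "Y i \<noteq> z" for i using i0 X(1) by (auto simp: Y_def)
    have Ylim: "Y \<longlonglongrightarrow> z" unfolding Y_def using X(2) by (rule LIMSEQ_ignore_initial_segment)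
    have "(\<lambda>i. CLINT u|\<nu>. (F (Y i) u - F z u) / (Y i - z)) \<longlonglongrightarrow> (CLINT u|\<nu>. F' z u)"
    proof (rule integral_dominated_convergence[where w = "\<lambda>u. B * levy_bound n u"])
      show "F' z \<in> borel_measurable \<nu>" using sets_nu by measurable
      show "(\<lambda>u. (F (Y i) u - F z u) / (Y i - z)) \<in> borel_measurable \<nu>" for i using sets_nu by measurable
      show "integrable \<nu> (\<lambda>u. B * levy_bound n u)" using integrable_levy_bound by simp
      show "AE u in \<nu>. (\<lambda>i. (F (Y i) u - F z u) / (Y i - z)) \<longlonglongrightarrow> F' z u"
      proof (rule AE_I2)
        fix u
        have "((\<lambda>w. (F w u - F z u) / (w - z)) \<longlongrightarrow> F' z u) (at z)"
          using DERIV_F[of u z] unfolding has_field_derivative_iff F'_def by simp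
        moreover have "filterlim Y (at z) sequentially"
          using Ylim Y(2) by (intro filterlim_atI) auto
        ultimately show "(\<lambda>i. (F (Y i) u - F z u) / (Y i - z)) \<longlonglongrightarrow> F' z u"
          by (rule filterlim_compose)
      qed
      show "AE u in \<nu>. norm ((F (Y i) u - F z u) / (Y i - z)) \<le> B * levy_bound n u" for i
      proof (rule AE_I2)
        fix u
        have "norm (F (Y i) u - F z u) \<le> (B * levy_bound n u) * norm (Y i - z)"
        proof (rule field_differentiable_bound[of "ball z \<delta>"])
          show "convex (ball z \<delta>)" by simp
          show "((\<lambda>w. F w u) has_field_derivative F' w u) (at w within ball z \<delta>)" for w
            unfolding F'_def by (rule has_field_derivative_at_within[OF DERIV_F])
          show "norm (F' w u) \<le> B * levy_bound n u" if "w \<in> ball z \<delta>" for w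
            unfolding B_def using ball[OF that] \<delta> by (intro norm_F'_le) auto
        qed (use Y \<delta> in auto)
        then show "norm ((F (Y i) u - F z u) / (Y i - z)) \<le> B * levy_bound n u"
          using Y(2)[of i] by (simp add: norm_divide divide_le_eq)
      qed
    qed
    moreover have "(CLINT u|\<nu>. (F (Y i) u - F z u) / (Y i - z)) = (Psi (Y i) - Psi z) / (Y i - z)" for i
      using int[OF Y(1)[of i]] int[of z] \<delta> unfolding Psi_def by simp
    ultimately have "(\<lambda>i. (Psi (Y i) - Psi z) / (Y i - z)) \<longlonglongrightarrow> (CLINT u|\<nu>. F' z u)" by (simp only:)
    then show "(\<lambda>i. (Psi (X i) - Psi z) / (X i - z)) \<longlonglongrightarrow> (CLINT u|\<nu>. F' z u)"
      unfolding Y_def by (rule LIMSEQ_offset)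
  qed
  then have "(Psi has_field_derivative (CLINT u|\<nu>. F' z u)) (at z)"
    unfolding has_field_derivative_iff by simp
  then show ?thesis unfolding field_differentiable_def by blast
qed

text \<open>Without the derivative no margin is lost, so dominated convergence reaches the edges of
  the strip. Both are used: the real line, where the characteristic function lives, and the line
  through -i m, also for m = n.\<close>

lemma continuous_on_Psi: "continuous_on {z. - real n \<le> Im z \<and> Im z \<le> 0} Psi"
  unfolding continuous_on_sequentially comp_def
proof (intro allI ballI impI, elim conjE)
  fix X :: "nat \<Rightarrow> complex" and z assume z: "z \<in> {z. - real n \<le> Im z \<and> Im z \<le> 0}"
    and X: "\<forall>i. X i \<in> {z. - real n \<le> Im z \<and> Im z \<le> 0}" "X \<longlonglongrightarrow> z"
  obtain R where R: "\<And>i. norm (X i) \<le> R"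
    using convergent_imp_bounded[OF X(2)] unfolding bounded_iff by auto
  show "(\<lambda>i. Psi (X i)) \<longlonglongrightarrow> Psi z"
    unfolding Psi_def
  proof (rule integral_dominated_convergence[where w = "\<lambda>u. (exp R * R\<^sup>2 + R + 2) * levy_bound n u"])
    show "F z \<in> borel_measurable \<nu>" using sets_nu by measurable
    show "F (X i) \<in> borel_measurable \<nu>" for i using sets_nu by measurable
    show "integrable \<nu> (\<lambda>u. (exp R * R\<^sup>2 + R + 2) * levy_bound n u)" using integrable_levy_bound by simp
    show "AE u in \<nu>. (\<lambda>i. F (X i) u) \<longlonglongrightarrow> F z u"
      unfolding F_def by (intro AE_I2 tendsto_intros X(2))
    show "AE u in \<nu>. norm (F (X i) u) \<le> (exp R * R\<^sup>2 + R + 2) * levy_bound n u" for i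
      using X(1) R by (intro AE_I2 norm_F_le) auto
  qed
qed

text \<open>On a horizontal line the real part of the integrand contains exp(-Im z u) cos(Re z u),
  which is largest on the imaginary axis.\<close>

lemma Re_Psi_le:
  assumes "- real n \<le> Im z" "Im z \<le> 0"
  shows "Re (Psi z) \<le> (LINT u|\<nu>. exp (- Im z * u) - 1 - (- Im z) * (exp u - 1))"
proof -
  have i1: "integrable \<nu> (F z)" by (rule integrable_F[OF assms])
  have i2: "integrable \<nu> (\<lambda>u. exp (- Im z * u) - 1 - (- Im z) * (exp u - 1))"
  proof -
    have "integrable \<nu> (\<lambda>u. Re (F (- \<i> * of_real (- Im z)) u))" using assms by (intro integrable_Re integrable_F) auto
    also have "(\<lambda>u. Re (F (- \<i> * of_real (- Im z)) u)) = (\<lambda>u. exp (- Im z * u) - 1 - (- Im z) * (exp u - 1))"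
      unfolding F_def by (auto simp: fun_eq_iff Re_exp)
    finally show ?thesis .
  qed
  have "Re (Psi z) = (LINT u|\<nu>. Re (F z u))" unfolding Psi_def using i1 by simp
  also have "\<dots> \<le> (LINT u|\<nu>. exp (- Im z * u) - 1 - (- Im z) * (exp u - 1))"
  proof (rule integral_mono[OF integrable_Re[OF i1] i2])
    fix u
    have "Re (F z u) = exp (- Im z * u) * cos (Re z * u) - 1 - (- Im z) * (exp u - 1)"
      unfolding F_def by (simp add: Re_exp algebra_simps)
    also have "exp (- Im z * u) * cos (Re z * u) \<le> exp (- Im z * u) * 1" by (intro mult_left_mono) auto
    finally show "Re (F z u) \<le> exp (- Im z * u) - 1 - (- Im z) * (exp u - 1)" by simp
  qed
  finally show ?thesis .
qed

lemma id_exponent_altdef: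
  "id_exponent \<sigma>2 \<nu> z = - (\<i> * z * of_real \<sigma>2) / 2 - z\<^sup>2 * of_real \<sigma>2 / 2 + Psi z"
  unfolding id_exponent_def Psi_def F_def ..

lemma id_exponent_field_differentiable:
  "- real n < Im z \<Longrightarrow> Im z < 0 \<Longrightarrow> id_exponent \<sigma>2 \<nu> field_differentiable (at z)"
  unfolding id_exponent_altdef[abs_def]
  by (intro field_differentiable_add field_differentiable_diff Psi_field_differentiable derivative_intros
       field_differentiable_divide field_differentiable_minus field_differentiable_mult field_differentiable_power) auto

lemma continuous_on_id_exponent: "continuous_on {z. - real n \<le> Im z \<and> Im z \<le> 0} (id_exponent \<sigma>2 \<nu>)"
  unfolding id_exponent_altdef[abs_def] by (intro continuous_intros continuous_on_Psi) auto

text \<open>Although the strip is unbounded horizontally, an upper bound on the real part is enough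
  to keep the exponential of a nonnegative multiple of the exponent bounded. \<open>Psi\<close> is
  compared with its value at the same height on the imaginary axis; the Gaussian part contributes
  -(Re z)^2 with a nonnegative factor and otherwise depends on Im z only.\<close>

lemma Re_id_exponent_bound:
  assumes \<sigma>: "0 \<le> \<sigma>2"
  shows "\<exists>B. \<forall>z. - real n \<le> Im z \<longrightarrow> Im z \<le> 0 \<longrightarrow> Re (id_exponent \<sigma>2 \<nu> z) \<le> B"
proof -
  define C where "C = (exp (real n) * (real n)\<^sup>2 + real n + 2) * (LINT u|\<nu>. levy_bound n u)"
  have "Re (id_exponent \<sigma>2 \<nu> z) \<le> \<sigma>2 / 2 * (real n)\<^sup>2 + C" if z: "- real n \<le> Im z" "Im z \<le> 0" for z
  proof -
    let ?w = "- \<i> * of_real (- Im z)"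
    have w: "- real n \<le> Im ?w" "Im ?w \<le> 0" using z by auto
    have eq: "(\<lambda>u. exp (- Im z * u) - 1 - (- Im z) * (exp u - 1)) = (\<lambda>u. Re (F ?w u))"
      unfolding F_def by (auto simp: fun_eq_iff Re_exp)
    have "Re (Psi z) \<le> (LINT u|\<nu>. Re (F ?w u))" using Re_Psi_le[OF z] unfolding eq .
    also have "\<dots> \<le> (LINT u|\<nu>. (exp (real n) * (real n)\<^sup>2 + real n + 2) * levy_bound n u)"
    proof (rule integral_mono)
      show "integrable \<nu> (\<lambda>u. Re (F ?w u))" using w by (intro integrable_Re integrable_F)
      show "integrable \<nu> (\<lambda>u. (exp (real n) * (real n)\<^sup>2 + real n + 2) * levy_bound n u)" using integrable_levy_bound by simp
      fix u
      have "Re (F ?w u) \<le> norm (F ?w u)" by (rule complex_Re_le_cmod)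
      also have "\<dots> \<le> (exp (real n) * (real n)\<^sup>2 + real n + 2) * levy_bound n u"
        using w z by (intro norm_F_le) (auto simp: norm_mult)
      finally show "Re (F ?w u) \<le> (exp (real n) * (real n)\<^sup>2 + real n + 2) * levy_bound n u" .
    qed
    also have "\<dots> = C" by (simp add: C_def)
    finally have P: "Re (Psi z) \<le> C" .
    have sq: "(Im z)\<^sup>2 \<le> (real n)\<^sup>2" using z by (intro power2_le_iff_abs_le[THEN iffD2]) auto
    have "Re (- (\<i> * z * of_real \<sigma>2) / 2 - z\<^sup>2 * of_real \<sigma>2 / 2) = \<sigma>2 / 2 * (Im z - (Re z)\<^sup>2 + (Im z)\<^sup>2)"
      by (simp add: power2_eq_square field_simps)
    also have "\<dots> \<le> \<sigma>2 / 2 * (real n)\<^sup>2"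
      using \<sigma> z sq zero_le_power2[of "Re z"] by (intro mult_left_mono) linarith+
    finally show ?thesis using P unfolding id_exponent_altdef by simp
  qed
  then show ?thesis by blast
qed

end

section \<open>Exponential moments from the characteristic function\<close>

lemma integrable_gauss:
  assumes "h > 0" shows "integrable lborel (\<lambda>x::real. exp (- x\<^sup>2 / (2 * h\<^sup>2)))"
proof -
  have "integrable lborel (\<lambda>x. sqrt (2 * pi * h\<^sup>2) * normal_density 0 h x)"
    using assms by (intro integrable_mult_right integrable_normal_density)
  also have "(\<lambda>x. sqrt (2 * pi * h\<^sup>2) * normal_density 0 h x) = (\<lambda>x. exp (- x\<^sup>2 / (2 * h\<^sup>2)))"
    using assms by (auto simp: normal_density_def fun_eq_iff)
  finally show ?thesis .
qed

lemma LIMSEQ_set_integral_symmetric: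
  fixes f :: "real \<Rightarrow> complex"
  assumes "integrable lborel f"
  shows "(\<lambda>N. CLINT x:{- real N..real N}|lborel. f x) \<longlonglongrightarrow> (CLINT x|lborel. f x)"
  unfolding set_lebesgue_integral_def
proof (rule integral_dominated_convergence[where w = "\<lambda>x. norm (f x)"])
  show "AE x in lborel. (\<lambda>N. indicat_real {- real N..real N} x *\<^sub>R f x) \<longlonglongrightarrow> f x"
  proof (rule AE_I2)
    fix x :: real
    obtain N0 :: nat where N0: "\<bar>x\<bar> < real N0" using reals_Archimedean2 by blast
    have "\<forall>\<^sub>F N in sequentially. indicat_real {- real N..real N} x *\<^sub>R f x = f x"
      using eventually_ge_at_top[of N0]
    proof eventually_elim
      case (elim N)
      then have "real N0 \<le> real N" by simp
      then show ?case using N0 by (simp add: indicator_def abs_less_iff)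
    qed
    then show "(\<lambda>N. indicat_real {- real N..real N} x *\<^sub>R f x) \<longlonglongrightarrow> f x" by (rule tendsto_eventually)
  qed
qed (use assms in \<open>auto simp: indicator_def\<close>)

text \<open>This Gaussian is centred at -i\<theta>, hence real on the line Im z = -\<theta>;
  elsewhere in the strip it is enlarged by a factor independent of Re z.\<close>

lemma norm_exp_gauss_strip:
  assumes "h > 0" "- \<theta> \<le> Im z" "Im z \<le> 0"
  shows "norm (exp (- (z + \<i> * of_real \<theta>)\<^sup>2 / (2 * (of_real h)\<^sup>2))) \<le> exp (\<theta>\<^sup>2 / (2 * h\<^sup>2)) * exp (- (Re z)\<^sup>2 / (2 * h\<^sup>2))"
proof -
  have "Re (- (z + \<i> * of_real \<theta>)\<^sup>2 / (2 * (of_real h)\<^sup>2)) = ((Im z + \<theta>)\<^sup>2 - (Re z)\<^sup>2) / (2 * h\<^sup>2)"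
  proof -
    have "- (z + \<i> * of_real \<theta>)\<^sup>2 / (2 * (of_real h)\<^sup>2) = - (z + \<i> * of_real \<theta>)\<^sup>2 / of_real (2 * h\<^sup>2)" by simp
    then show ?thesis by (simp only: Re_divide_of_real) (simp add: power2_eq_square)
  qed
  moreover have "(Im z + \<theta>)\<^sup>2 \<le> \<theta>\<^sup>2" using assms by (intro power_mono) auto
  then have "((Im z + \<theta>)\<^sup>2 - (Re z)\<^sup>2) / (2 * h\<^sup>2) \<le> \<theta>\<^sup>2 / (2 * h\<^sup>2) + - (Re z)\<^sup>2 / (2 * h\<^sup>2)"
    unfolding add_divide_distrib[symmetric] using assms by (intro divide_right_mono) auto
  ultimately show ?thesis unfolding norm_exp_eq_Re exp_add[symmetric] by simp
qed

section \<open>Shifting the line of integration under a Gaussian factor\<close>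

lemma has_contour_integral_linepath_translate:
  "(f has_contour_integral I) (linepath (a + c) (b + c)) \<longleftrightarrow> ((\<lambda>z. f (z + c)) has_contour_integral I) (linepath a b)"
proof -
  have "linepath (a + c) (b + c) x = linepath a b x + c" for x
    by (simp add: linepath_def scaleR_conv_of_real algebra_simps)
  then show ?thesis unfolding has_contour_integral_linepath by simp
qed

text \<open>Cauchy's theorem on rectangles between the two edges of the strip. As f is bounded, the
  Gaussian makes the vertical sides vanish when the rectangles widen.\<close>

lemma gauss_contour_shift:
  fixes f :: "complex \<Rightarrow> complex"
  assumes \<theta>: "0 < \<theta>" and h: "0 < h"
    and cont: "continuous_on {z. - \<theta> \<le> Im z \<and> Im z \<le> 0} f"
    and hol: "\<And>z. - \<theta> < Im z \<Longrightarrow> Im z < 0 \<Longrightarrow> f field_differentiable (at z)"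
    and bd: "\<And>z. - \<theta> \<le> Im z \<Longrightarrow> Im z \<le> 0 \<Longrightarrow> norm (f z) \<le> B"
  shows "(CLINT q|lborel. f (of_real q) * exp (- (of_real q + \<i> * of_real \<theta>)\<^sup>2 / (2 * (of_real h)\<^sup>2)))
    = (CLINT q|lborel. f (of_real q - \<i> * of_real \<theta>) * of_real (exp (- q\<^sup>2 / (2 * h\<^sup>2))))"
    and "integrable lborel (\<lambda>q. f (of_real q) * exp (- (of_real q + \<i> * of_real \<theta>)\<^sup>2 / (2 * (of_real h)\<^sup>2)))"
    and "integrable lborel (\<lambda>q. f (of_real q - \<i> * of_real \<theta>) * of_real (exp (- q\<^sup>2 / (2 * h\<^sup>2))))"
proof -
  define S where "S = {z. - \<theta> \<le> Im z \<and> Im z \<le> 0}"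
  define g where "g z = f z * exp (- (z + \<i> * of_real \<theta>)\<^sup>2 / (2 * (of_real h)\<^sup>2))" for z
  define K where "K = B * exp (\<theta>\<^sup>2 / (2 * h\<^sup>2))"
  have B: "0 \<le> B" using order_trans[OF norm_ge_zero bd[of 0]] \<theta> by simp
  have gcont: "continuous_on S g" unfolding g_def[abs_def] S_def using h
    by (intro continuous_intros cont) auto
  have gbd: "norm (g z) \<le> K * exp (- (Re z)\<^sup>2 / (2 * h\<^sup>2))" if "z \<in> S" for z
  proof -
    have "norm (g z) \<le> B * (exp (\<theta>\<^sup>2 / (2 * h\<^sup>2)) * exp (- (Re z)\<^sup>2 / (2 * h\<^sup>2)))"
      unfolding g_def norm_mult using that B unfolding S_def
      by (intro mult_mono bd norm_exp_gauss_strip h) auto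
    then show ?thesis by (simp add: K_def)
  qed
  have K: "0 \<le> K" using B by (simp add: K_def)
  have ghol: "g field_differentiable (at z)" if "- \<theta> < Im z" "Im z < 0" for z
  proof -
    have "(\<lambda>z. exp (- (z + \<i> * of_real \<theta>)\<^sup>2 / (2 * (of_real h)\<^sup>2))) holomorphic_on UNIV"
      using h by (intro holomorphic_intros) auto
    then have "(\<lambda>z. exp (- (z + \<i> * of_real \<theta>)\<^sup>2 / (2 * (of_real h)\<^sup>2))) field_differentiable (at z)"
      by (rule holomorphic_on_imp_differentiable_at) auto
    then show ?thesis unfolding g_def using hol[OF that] by (intro field_differentiable_mult)
  qed
  have line_int: "integrable lborel (\<lambda>x. g (of_real x - \<i> * of_real y))"
    and line_meas: "continuous_on UNIV (\<lambda>x. g (of_real x - \<i> * of_real y))" if y: "0 \<le> y" "y \<le> \<theta>" for y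
  proof -
    show c: "continuous_on UNIV (\<lambda>x. g (of_real x - \<i> * of_real y))"
      by (rule continuous_on_compose2[OF gcont]) (use y in \<open>auto intro!: continuous_intros simp: S_def\<close>)
    show "integrable lborel (\<lambda>x. g (of_real x - \<i> * of_real y))"
    proof (rule Bochner_Integration.integrable_bound)
      show "integrable lborel (\<lambda>x::real. K * exp (- x\<^sup>2 / (2 * h\<^sup>2)))" using integrable_gauss[OF h] by simp
      show "(\<lambda>x. g (of_real x - \<i> * of_real y)) \<in> borel_measurable lborel"
        using borel_measurable_continuous_onI[OF c] by simp
      show "AE x in lborel. norm (g (of_real x - \<i> * of_real y)) \<le> norm (K * exp (- x\<^sup>2 / (2 * h\<^sup>2)))"
      proof (rule AE_I2)
        fix x :: real
        have "of_real x - \<i> * of_real y \<in> S" using y by (simp add: S_def)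
        from gbd[OF this] show "norm (g (of_real x - \<i> * of_real y)) \<le> norm (K * exp (- x\<^sup>2 / (2 * h\<^sup>2)))"
          using K by simp
      qed
    qed
  qed
  \<comment> \<open>The two horizontal integrals differ by the two vertical sides, each of length
    \<theta> and with integrand at most K exp(-N^2 / (2 h^2)).\<close>
  have close: "norm ((CLINT x:{- real N..real N}|lborel. g (of_real x - \<i> * of_real \<theta>)) - (CLINT x:{- real N..real N}|lborel. g (of_real x)))
     \<le> 2 * K * \<theta> * exp (- (real N)\<^sup>2 / (2 * h\<^sup>2))" if N: "N > 0" for N
  proof -
    define R where "R = real N"
    have R: "0 < R" using N by (simp add: R_def)
    let ?a = "Complex (-R) (-\<theta>)" and ?b = "Complex R (-\<theta>)" and ?c = "Complex R 0" and ?d = "Complex (-R) 0"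
    have cS: "convex S"
    proof -
      have "S = {z. - \<theta> \<le> Im z} \<inter> {z. Im z \<le> 0}" by (auto simp: S_def)
      then show ?thesis using convex_halfspace_Im_ge[of "-\<theta>"] convex_halfspace_Im_le[of 0] by (simp add: convex_Int)
    qed
    have inS: "closed_segment x y \<subseteq> S" if "x \<in> S" "y \<in> S" for x y
    proof -
      show ?thesis using that cS by (simp add: closed_segment_subset)
    qed
    have pts: "?a \<in> S" "?b \<in> S" "?c \<in> S" "?d \<in> S" using \<theta> by (auto simp: S_def)
    have intS: "- \<theta> < Im z \<and> Im z < 0" if "z \<in> interior S" for z
    proof -
      from that obtain e where e: "e > 0" "ball z e \<subseteq> S" by (meson mem_interior)
      have "z + \<i> * of_real (e / 2) \<in> ball z e" "z - \<i> * of_real (e / 2) \<in> ball z e"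
        using e by (auto simp: dist_norm norm_mult)
      then have "z + \<i> * of_real (e / 2) \<in> S" "z - \<i> * of_real (e / 2) \<in> S" using e by auto
      then show ?thesis using e by (auto simp: S_def)
    qed
    let ?p = "linepath ?a ?b +++ linepath ?b ?c +++ linepath ?c ?d +++ linepath ?d ?a"
    have hp: "(g has_contour_integral 0) ?p"
    \<comment> \<open>This version asks for continuity on the closed strip and differentiability in
      its interior only, so the rectangle may run along the edges.\<close>
    proof (rule Cauchy_theorem_convex[OF gcont cS finite.emptyI])
      show "g field_differentiable at z" if "z \<in> interior S - {}" for z using intS[of z] that ghol by auto
      show "path_image ?p \<subseteq> S" using inS pts by (auto simp: path_image_join)
    qed auto
    have ci: "g contour_integrable_on linepath x y" if "x \<in> S" "y \<in> S" for x y
      by (rule contour_integrable_continuous_linepath[OF continuous_on_subset[OF gcont inS[OF that]]])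
    have sum0: "contour_integral (linepath ?a ?b) g + contour_integral (linepath ?b ?c) g +
      contour_integral (linepath ?c ?d) g + contour_integral (linepath ?d ?a) g = 0"
      using contour_integral_unique[OF hp] pts ci by (simp add: contour_integrable_joinI algebra_simps)
    have hor: "contour_integral (linepath (Complex (-R) (-y)) (Complex R (-y))) g = (CLINT x:{-R..R}|lborel. g (of_real x - \<i> * of_real y))"
      if y: "0 \<le> y" "y \<le> \<theta>" for y
    proof -
      have "Complex (-R) (-y) \<in> S" "Complex R (-y) \<in> S" using y by (auto simp: S_def)
      moreover have cplx: "Complex (-R) (-y) = of_real (-R) + (- \<i> * of_real y)" "Complex R (-y) = of_real R + (- \<i> * of_real y)"
        by (simp_all add: complex_eq_iff)
      ultimately have "((\<lambda>z. g (z + (- \<i> * of_real y))) has_contour_integral contour_integral (linepath (Complex (-R) (-y)) (Complex R (-y))) g) (linepath (of_real (-R)) (of_real R))"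
        using has_contour_integral_integral[OF ci, of "Complex (-R) (-y)" "Complex R (-y)"]
        unfolding cplx by (simp only: has_contour_integral_linepath_translate)
      then have "((\<lambda>x. g (of_real x + (- \<i> * of_real y))) has_integral contour_integral (linepath (Complex (-R) (-y)) (Complex R (-y))) g) {-R..R}"
        using R by (subst (asm) has_contour_integral_linepath_Reals_iff) auto
      then have "((\<lambda>x. g (of_real x - \<i> * of_real y)) has_integral contour_integral (linepath (Complex (-R) (-y)) (Complex R (-y))) g) {-R..R}"
        by (simp add: mult.commute)
      moreover have "set_integrable lborel {-R..R} (\<lambda>x. g (of_real x - \<i> * of_real y))"
        using line_meas[OF y] by (intro borel_integrable_atLeastAtMost' continuous_on_subset[OF line_meas[OF y]]) auto
      ultimately show ?thesis
        using set_borel_integral_eq_integral(2) integral_unique by metis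
    qed
    have rev: "contour_integral (linepath ?c ?d) g = - contour_integral (linepath ?d ?c) g"
      by (metis contour_integral_reversepath reversepath_linepath valid_path_linepath)
    have ver: "norm (contour_integral (linepath x y) g) \<le> K * exp (- R\<^sup>2 / (2 * h\<^sup>2)) * \<theta>"
      if xy: "x \<in> S" "y \<in> S" "norm (y - x) = \<theta>" "\<And>z. z \<in> closed_segment x y \<Longrightarrow> (Re z)\<^sup>2 = R\<^sup>2" for x y
    proof -
      have "norm (contour_integral (linepath x y) g) \<le> K * exp (- R\<^sup>2 / (2 * h\<^sup>2)) * norm (y - x)"
      proof (rule has_contour_integral_bound_linepath[OF has_contour_integral_integral[OF ci[OF xy(1,2)]]])
        show "0 \<le> K * exp (- R\<^sup>2 / (2 * h\<^sup>2))" using K by simp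
        fix z assume z: "z \<in> closed_segment x y"
        then have "z \<in> S" using inS[OF xy(1,2)] by auto
        from gbd[OF this] show "norm (g z) \<le> K * exp (- R\<^sup>2 / (2 * h\<^sup>2))" using xy(4)[OF z] by simp
      qed
      then show ?thesis using xy(3) by simp
    qed
    have seg: "Re z = r" if "z \<in> closed_segment (Complex r s) (Complex r t)" for z r s t
    proof -
      obtain w where "z = (1 - w) *\<^sub>R Complex r s + w *\<^sub>R Complex r t" using \<open>z \<in> _\<close> by (auto simp: closed_segment_def)
      then have "Re z = (1 - w) * r + w * r" by simp
      then show ?thesis by (simp add: algebra_simps)
    qed
    have v1: "norm (contour_integral (linepath ?b ?c) g) \<le> K * exp (- R\<^sup>2 / (2 * h\<^sup>2)) * \<theta>"
      using pts \<theta> seg by (intro ver) (auto simp: cmod_def)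
    have v2: "norm (contour_integral (linepath ?d ?a) g) \<le> K * exp (- R\<^sup>2 / (2 * h\<^sup>2)) * \<theta>"
      using pts \<theta> seg[of _ "-R"] by (intro ver) (auto simp: cmod_def)
    have "(CLINT x:{-R..R}|lborel. g (of_real x - \<i> * of_real \<theta>)) - (CLINT x:{-R..R}|lborel. g (of_real x))
      = - (contour_integral (linepath ?b ?c) g + contour_integral (linepath ?d ?a) g)"
      using sum0 rev hor[of \<theta>] hor[of 0] \<theta> by (simp add: algebra_simps eq_neg_iff_add_eq_0)
    then have "norm ((CLINT x:{-R..R}|lborel. g (of_real x - \<i> * of_real \<theta>)) - (CLINT x:{-R..R}|lborel. g (of_real x)))
      \<le> norm (contour_integral (linepath ?b ?c) g) + norm (contour_integral (linepath ?d ?a) g)"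
      by (simp only: norm_minus_cancel norm_triangle_ineq)
    then show ?thesis using v1 v2 unfolding R_def by (simp add: algebra_simps)
  qed
  have i1: "integrable lborel (\<lambda>x. g (of_real x - \<i> * of_real \<theta>))" using line_int[of \<theta>] \<theta> by simp
  have i2: "integrable lborel (\<lambda>x. g (of_real x))" using line_int[of 0] \<theta> by simp
  have "(\<lambda>N. (CLINT x:{- real N..real N}|lborel. g (of_real x - \<i> * of_real \<theta>)) - (CLINT x:{- real N..real N}|lborel. g (of_real x))) \<longlonglongrightarrow>
     (CLINT x|lborel. g (of_real x - \<i> * of_real \<theta>)) - (CLINT x|lborel. g (of_real x))"
    by (intro tendsto_diff LIMSEQ_set_integral_symmetric i1 i2)
  moreover have "(\<lambda>N. (CLINT x:{- real N..real N}|lborel. g (of_real x - \<i> * of_real \<theta>)) - (CLINT x:{- real N..real N}|lborel. g (of_real x))) \<longlonglongrightarrow> 0"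
  proof (rule Lim_null_comparison)
    show "\<forall>\<^sub>F N in sequentially. norm ((CLINT x:{- real N..real N}|lborel. g (of_real x - \<i> * of_real \<theta>)) - (CLINT x:{- real N..real N}|lborel. g (of_real x)))
     \<le> 2 * K * \<theta> * exp (- (real N)\<^sup>2 / (2 * h\<^sup>2))"
      using eventually_gt_at_top[of 0] by eventually_elim (rule close)
    have "(\<lambda>N. exp (- (real N)\<^sup>2 / (2 * h\<^sup>2))) \<longlonglongrightarrow> 0"
    proof (rule filterlim_compose[OF exp_at_bot])
      have "filterlim (\<lambda>N. (real N)\<^sup>2 * (1 / (2 * h\<^sup>2))) at_top sequentially"
        using h by (intro filterlim_at_top_mult_tendsto_pos[OF tendsto_const] filterlim_pow_at_top filterlim_real_sequentially) auto
      then show "filterlim (\<lambda>N. - (real N)\<^sup>2 / (2 * h\<^sup>2)) at_bot sequentially"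
        by (simp add: filterlim_uminus_at_bot)
    qed
    from tendsto_mult_right_zero[OF this, of "2 * K * \<theta>"]
    show "(\<lambda>N. 2 * K * \<theta> * exp (- (real N)\<^sup>2 / (2 * h\<^sup>2))) \<longlonglongrightarrow> 0" by simp
  qed
  ultimately have eq: "(CLINT x|lborel. g (of_real x - \<i> * of_real \<theta>)) - (CLINT x|lborel. g (of_real x)) = 0"
    by (rule LIMSEQ_unique)
  have g1: "g (of_real x - \<i> * of_real \<theta>) = f (of_real x - \<i> * of_real \<theta>) * of_real (exp (- x\<^sup>2 / (2 * h\<^sup>2)))" for x
    unfolding g_def by (simp add: exp_of_real[symmetric])
  show "(CLINT q|lborel. f (of_real q) * exp (- (of_real q + \<i> * of_real \<theta>)\<^sup>2 / (2 * (of_real h)\<^sup>2)))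
    = (CLINT q|lborel. f (of_real q - \<i> * of_real \<theta>) * of_real (exp (- q\<^sup>2 / (2 * h\<^sup>2))))"
    using eq unfolding g1 unfolding g_def by simp
  show "integrable lborel (\<lambda>q. f (of_real q) * exp (- (of_real q + \<i> * of_real \<theta>)\<^sup>2 / (2 * (of_real h)\<^sup>2)))"
    using i2 unfolding g_def .
  show "integrable lborel (\<lambda>q. f (of_real q - \<i> * of_real \<theta>) * of_real (exp (- q\<^sup>2 / (2 * h\<^sup>2))))"
    using i1 unfolding g1 .
qed

text \<open>The substitution q = h y displays an argument h y that shrinks to 0 with h against a
  fixed probability density.\<close>

lemma gauss_integral_scale:
  fixes F :: "real \<Rightarrow> complex"
  assumes h: "0 < h"
  shows "(CLINT q|lborel. F q * of_real (exp (- q\<^sup>2 / (2 * h\<^sup>2)))) =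
    of_real (h * sqrt (2 * pi)) * (CLINT y|lborel. F (h * y) * of_real (std_normal_density y))"
proof -
  have "(CLINT q|lborel. F q * of_real (exp (- q\<^sup>2 / (2 * h\<^sup>2)))) =
    \<bar>h\<bar> *\<^sub>R (CLINT y|lborel. F (0 + h * y) * of_real (exp (- (0 + h * y)\<^sup>2 / (2 * h\<^sup>2))))"
    using h by (intro lborel_integral_real_affine) simp
  also have "(CLINT y|lborel. F (0 + h * y) * of_real (exp (- (0 + h * y)\<^sup>2 / (2 * h\<^sup>2)))) =
    (CLINT y|lborel. of_real (sqrt (2 * pi)) * (F (h * y) * of_real (std_normal_density y)))"
    using h by (intro Bochner_Integration.integral_cong) (auto simp: std_normal_density_def power_mult_distrib)
  also have "\<dots> = of_real (sqrt (2 * pi)) * (CLINT y|lborel. F (h * y) * of_real (std_normal_density y))"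
    by simp
  finally show ?thesis using h by (simp add: scaleR_conv_of_real)
qed

lemma std_normal_fourier:
  "(CLINT y|lborel. exp (\<i> * of_real (t * y)) * of_real (std_normal_density y)) = of_real (exp (- (t\<^sup>2) / 2))"
proof -
  have "char std_normal_distribution t = (CLINT y|lborel. std_normal_density y *\<^sub>R exp (\<i> * of_real (t * y)))"
    unfolding char_def by (subst integral_density) auto
  also have "\<dots> = (CLINT y|lborel. exp (\<i> * of_real (t * y)) * of_real (std_normal_density y))"
    by (simp add: scaleR_conv_of_real mult.commute)
  finally show ?thesis using char_std_normal_distribution by simp
qed

text \<open>Both sides of the contour shift are integrated against the law of \<open>X\<close>; the Gaussian then shrinks
  to a point mass.\<close>

lemma (in prob_space) exponential_moment_of_char:
  fixes X :: "'a \<Rightarrow> real" and f :: "complex \<Rightarrow> complex"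
  assumes X[measurable]: "X \<in> borel_measurable M" and \<theta>: "0 < \<theta>"
    and cont: "continuous_on {z. - \<theta> \<le> Im z \<and> Im z \<le> 0} f"
    and hol: "\<And>z. - \<theta> < Im z \<Longrightarrow> Im z < 0 \<Longrightarrow> f field_differentiable (at z)"
    and bd: "\<And>z. - \<theta> \<le> Im z \<Longrightarrow> Im z \<le> 0 \<Longrightarrow> norm (f z) \<le> B"
    and char: "\<And>q::real. (CLINT x|M. exp (\<i> * of_real q * of_real (X x))) = f (of_real q)"
    and c: "f (- \<i> * of_real \<theta>) = of_real c"
  shows "(\<integral>\<^sup>+x. ennreal (exp (\<theta> * X x)) \<partial>M) = ennreal c"
proof -
  \<comment> \<open>The exponential damped by a Gaussian in X: bounded for each h > 0, hence
    integrable without any assumption on moments, and increasing to exp(\<theta> X) as h decreases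
    to 0.\<close>
  define G where "G h x = exp (\<theta> * X x - (h * X x)\<^sup>2 / 2)" for h x
  have Gm[measurable]: "G h \<in> borel_measurable M" for h unfolding G_def by measurable
  have key: "integrable M (G h)" 
    "of_real (LINT x|M. G h x) = (CLINT y|lborel. f (of_real (h * y) - \<i> * of_real \<theta>) * of_real (std_normal_density y))"
    if h: "0 < h" for h
  proof -
    interpret P: pair_sigma_finite M lborel ..
    define g where "g q = exp (- (of_real q + \<i> * of_real \<theta>)\<^sup>2 / (2 * (of_real h)\<^sup>2))" for q :: real
    have gm[measurable]: "g \<in> borel_measurable borel" unfolding g_def by (intro borel_measurable_continuous_onI continuous_intros) (use h in auto)
    \<comment> \<open>The integrability statement of the contour shift for the constant function
      1.\<close>
    have gi: "integrable lborel g"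
      using gauss_contour_shift(2)[OF \<theta> h, of "\<lambda>_. 1" 1] unfolding g_def by simp
    have gX: "norm (exp (\<i> * of_real q * of_real (X x)) * g q) = norm (g q)" for q x
      by (simp add: norm_mult norm_exp_eq_Re)
    have int: "integrable (M \<Otimes>\<^sub>M lborel) (\<lambda>(x, q). exp (\<i> * of_real q * of_real (X x)) * g q)"
    proof (rule P.Fubini_integrable)
      show "(\<lambda>(x, q). exp (\<i> * of_real q * of_real (X x)) * g q) \<in> borel_measurable (M \<Otimes>\<^sub>M lborel)" by measurable
      show "integrable M (\<lambda>x. LINT q|lborel. norm (case (x, q) of (x, q) \<Rightarrow> exp (\<i> * of_real q * of_real (X x)) * g q))"
        by (simp add: gX)
      show "AE x in M. integrable lborel (\<lambda>q. case (x, q) of (x, q) \<Rightarrow> exp (\<i> * of_real q * of_real (X x)) * g q)"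
      proof (rule AE_I2)
        fix x
        have "integrable lborel (\<lambda>q. exp (\<i> * of_real q * of_real (X x)) * g q)"
          by (rule Bochner_Integration.integrable_bound[OF gi]) (auto simp: gX)
        then show "integrable lborel (\<lambda>q. case (x, q) of (x, q) \<Rightarrow> exp (\<i> * of_real q * of_real (X x)) * g q)" by simp
      qed
    qed
    \<comment> \<open>A contour shift for each fixed x, with f(z) = exp(i z X(x)); the remaining
      integral is the Fourier transform of the normal density at h X(x).\<close>
    have inner: "(CLINT q|lborel. exp (\<i> * of_real q * of_real (X x)) * g q) = of_real (h * sqrt (2 * pi)) * of_real (G h x)" for x
    proof -
      have "(CLINT q|lborel. exp (\<i> * of_real q * of_real (X x)) * g q) =
        (CLINT q|lborel. exp (\<i> * (of_real q - \<i> * of_real \<theta>) * of_real (X x)) * of_real (exp (- q\<^sup>2 / (2 * h\<^sup>2))))"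
        unfolding g_def
      proof (rule gauss_contour_shift(1)[OF \<theta> h, where f = "\<lambda>z. exp (\<i> * z * of_real (X x))" and B = "exp (\<theta> * \<bar>X x\<bar>)"])
        show "norm (exp (\<i> * z * of_real (X x))) \<le> exp (\<theta> * \<bar>X x\<bar>)" if "- \<theta> \<le> Im z" "Im z \<le> 0" for z
        proof -
          have "- Im z * X x \<le> \<bar>- Im z * X x\<bar>" by simp
          also have "\<dots> \<le> \<theta> * \<bar>X x\<bar>" unfolding abs_mult using that by (intro mult_right_mono) auto
          finally show ?thesis by (simp add: norm_exp_eq_Re)
        qed
        show "(\<lambda>z. exp (\<i> * z * of_real (X x))) field_differentiable at z" for z
          by (rule holomorphic_on_imp_differentiable_at[of _ UNIV]) (auto intro!: holomorphic_intros)
      qed (auto intro!: continuous_intros)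
      also have "\<dots> = of_real (h * sqrt (2 * pi)) * (CLINT y|lborel. exp (\<i> * (of_real (h * y) - \<i> * of_real \<theta>) * of_real (X x)) * of_real (std_normal_density y))"
        by (rule gauss_integral_scale[OF h])
      also have "(CLINT y|lborel. exp (\<i> * (of_real (h * y) - \<i> * of_real \<theta>) * of_real (X x)) * of_real (std_normal_density y)) =
        (CLINT y|lborel. of_real (exp (\<theta> * X x)) * (exp (\<i> * of_real (h * X x * y)) * of_real (std_normal_density y)))"
      proof (rule Bochner_Integration.integral_cong[OF refl])
        fix y :: real
        have "\<i> * (of_real (h * y) - \<i> * of_real \<theta>) * of_real (X x) = of_real (\<theta> * X x) + \<i> * of_real (h * X x * y)"
          by (simp add: algebra_simps)
        then show "exp (\<i> * (of_real (h * y) - \<i> * of_real \<theta>) * of_real (X x)) * of_real (std_normal_density y) =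
          of_real (exp (\<theta> * X x)) * (exp (\<i> * of_real (h * X x * y)) * of_real (std_normal_density y))"
          by (simp only: exp_add exp_of_real mult.assoc)
      qed
      also have "\<dots> = of_real (exp (\<theta> * X x)) * of_real (exp (- ((h * X x)\<^sup>2) / 2))"
        by (simp only: integral_mult_right_zero std_normal_fourier)
      also have "\<dots> = of_real (G h x)"
        unfolding of_real_mult[symmetric] exp_add[symmetric] G_def by simp
      finally show ?thesis .
    qed
    let ?c = "h * sqrt (2 * pi)"
    have c0: "?c \<noteq> 0" using h by simp
    have i1: "integrable M (\<lambda>x. of_real ?c * of_real (G h x) :: complex)"
      using P.integrable_fst'[OF int] by (simp add: inner)
    have "integrable M (\<lambda>x. Re (of_real ?c * of_real (G h x) :: complex))" by (rule integrable_Re[OF i1])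
    then show G: "integrable M (G h)" using c0 by simp
    have "of_real ?c * of_real (LINT x|M. G h x) = (CLINT x|M. of_real ?c * of_real (G h x))"
      by (simp only: integral_mult_right_zero integral_complex_of_real)
    also have "\<dots> = (CLINT x|M. CLINT q|lborel. exp (\<i> * of_real q * of_real (X x)) * g q)" by (simp only: inner)
    also have "\<dots> = (CLINT q|lborel. CLINT x|M. exp (\<i> * of_real q * of_real (X x)) * g q)"
      using P.Fubini_integral[of "\<lambda>x q. exp (\<i> * of_real q * of_real (X x)) * g q"] int by simp
    also have "\<dots> = (CLINT q|lborel. f (of_real q) * g q)" by (simp only: integral_mult_left_zero char)
    \<comment> \<open>The same shift, now for the analytic continuation f of the characteristic
      function.\<close>
    also have "\<dots> = (CLINT q|lborel. f (of_real q - \<i> * of_real \<theta>) * of_real (exp (- q\<^sup>2 / (2 * h\<^sup>2))))"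
      unfolding g_def by (rule gauss_contour_shift(1)[OF \<theta> h cont hol bd])
    also have "\<dots> = of_real ?c * (CLINT y|lborel. f (of_real (h * y) - \<i> * of_real \<theta>) * of_real (std_normal_density y))"
      by (rule gauss_integral_scale[OF h])
    finally show "of_real (LINT x|M. G h x) = (CLINT y|lborel. f (of_real (h * y) - \<i> * of_real \<theta>) * of_real (std_normal_density y))"
      using c0 by simp
  qed
  define hs where "hs i = 1 / real (Suc i)" for i
  have hs: "0 < hs i" for i by (simp add: hs_def)
  have hs0: "hs \<longlonglongrightarrow> 0" unfolding hs_def using LIMSEQ_inverse_real_of_nat by (simp add: inverse_eq_divide)
  have "(\<lambda>i. CLINT y|lborel. f (of_real (hs i * y) - \<i> * of_real \<theta>) * of_real (std_normal_density y))
    \<longlonglongrightarrow> (CLINT y|lborel. of_real c * of_real (std_normal_density y))"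
  proof (rule integral_dominated_convergence[where w = "\<lambda>y. B * std_normal_density y"])
    have cf: "continuous_on UNIV (\<lambda>y. f (of_real (h * y) - \<i> * of_real \<theta>))" for h
      by (rule continuous_on_compose2[OF cont]) (use \<theta> in \<open>auto intro!: continuous_intros\<close>)
    show "(\<lambda>y. f (of_real (hs i * y) - \<i> * of_real \<theta>) * of_real (std_normal_density y)) \<in> borel_measurable lborel" for i
      using borel_measurable_continuous_onI[OF cf] by measurable
    show "integrable lborel (\<lambda>y. B * std_normal_density y)" by simp
    show "AE y in lborel. norm (f (of_real (hs i * y) - \<i> * of_real \<theta>) * of_real (std_normal_density y)) \<le> B * std_normal_density y" for i
      using \<theta> by (intro AE_I2) (auto simp: norm_mult intro!: mult_right_mono bd)
    show "AE y in lborel. (\<lambda>i. f (of_real (hs i * y) - \<i> * of_real \<theta>) * of_real (std_normal_density y)) \<longlonglongrightarrow> of_real c * of_real (std_normal_density y)"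
    proof (intro AE_I2 tendsto_mult tendsto_const)
      fix y :: real
      have "(\<lambda>i. of_real (hs i * y) - \<i> * of_real \<theta>) \<longlonglongrightarrow> of_real (0 * y) - \<i> * of_real \<theta>"
        by (intro tendsto_intros hs0)
      then have l: "(\<lambda>i. of_real (hs i * y) - \<i> * of_real \<theta>) \<longlonglongrightarrow> - \<i> * of_real \<theta>" by simp
      have "(\<lambda>i. f (of_real (hs i * y) - \<i> * of_real \<theta>)) \<longlonglongrightarrow> f (- \<i> * of_real \<theta>)"
        by (rule continuous_on_tendsto_compose[OF cont l]) (use \<theta> in auto)
      then show "(\<lambda>i. f (of_real (hs i * y) - \<i> * of_real \<theta>)) \<longlonglongrightarrow> of_real c" unfolding c .
    qed
  qed measurable
  also have "(CLINT y|lborel. of_real c * of_real (std_normal_density y)) = (of_real c :: complex)"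
    by (simp only: integral_mult_right_zero integral_complex_of_real) simp
  finally have "(\<lambda>i. of_real (LINT x|M. G (hs i) x) :: complex) \<longlonglongrightarrow> of_real c"
    using key(2)[OF hs] by simp
  then have lim: "(\<lambda>i. LINT x|M. G (hs i) x) \<longlonglongrightarrow> c" by (simp only: tendsto_of_real_iff)
  \<comment> \<open>Monotone convergence needs no bound in advance: it yields the finiteness of the
    moment together with its value.\<close>
  have "(\<lambda>i. \<integral>\<^sup>+x. ennreal (G (hs i) x) \<partial>M) \<longlonglongrightarrow> (\<integral>\<^sup>+x. ennreal (exp (\<theta> * X x)) \<partial>M)"
  proof (rule nn_integral_LIMSEQ)
    show "incseq (\<lambda>i x. ennreal (G (hs i) x))"
    proof (intro incseq_SucI le_funI ennreal_leI)
      fix i x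
      have "hs (Suc i) \<le> hs i" by (simp add: hs_def frac_le)
      then have "(hs (Suc i) * \<bar>X x\<bar>)\<^sup>2 \<le> (hs i * \<bar>X x\<bar>)\<^sup>2"
        using hs[of "Suc i"] by (intro power_mono mult_right_mono) auto
      then show "G (hs i) x \<le> G (hs (Suc i)) x" unfolding G_def by (simp add: power_mult_distrib)
    qed
    show "(\<lambda>i. ennreal (G (hs i) x)) \<longlonglongrightarrow> ennreal (exp (\<theta> * X x))" for x
    proof (rule tendsto_ennrealI)
      have "(\<lambda>i. exp (\<theta> * X x - (hs i * X x)\<^sup>2 / 2)) \<longlonglongrightarrow> exp (\<theta> * X x - (0 * X x)\<^sup>2 / 2)"
        by (intro tendsto_intros hs0) auto
      then show "(\<lambda>i. G (hs i) x) \<longlonglongrightarrow> exp (\<theta> * X x)" unfolding G_def by simp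
    qed
  qed measurable
  moreover have "(\<integral>\<^sup>+x. ennreal (G (hs i) x) \<partial>M) = ennreal (LINT x|M. G (hs i) x)" for i
    by (rule nn_integral_eq_integral[OF key(1)[OF hs]]) (simp add: G_def)
  ultimately have "(\<lambda>i. ennreal (LINT x|M. G (hs i) x)) \<longlonglongrightarrow> (\<integral>\<^sup>+x. ennreal (exp (\<theta> * X x)) \<partial>M)" by simp
  then show ?thesis using LIMSEQ_unique tendsto_ennrealI[OF lim] by blast
qed

section \<open>Exponential moments of a random measure on overlapping sets\<close>

text \<open>Sum of d(q - p) over all pairs p < q among c consecutive indices, arranged by the larger
  index: a point with k predecessors sees the gaps 1, ..., k.\<close>

definition pair_exponent :: "(nat \<Rightarrow> real) \<Rightarrow> nat \<Rightarrow> real" where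
  "pair_exponent d c = (\<Sum>k<c. \<Sum>m\<in>{1..k}. d m)"

text \<open>Index difference of two points after sorting. It is defined through the values because
  the points that get integrated out arrive unsorted.\<close>

definition rank_gap :: "'i set \<Rightarrow> ('i \<Rightarrow> real) \<Rightarrow> 'i \<Rightarrow> 'i \<Rightarrow> nat" where
  "rank_gap I t i j = card {l\<in>I. t i < t l \<and> t l \<le> t j}"

text \<open>Insert the points in increasing order of value. A new maximum leaves the earlier gaps
  unchanged and sees the earlier points at the gaps 1, ..., card S, each exactly once.\<close>

lemma pair_exponent_eq_sum:
  assumes "finite J" "inj_on t J"
  shows "(\<Sum>i\<in>J. \<Sum>j\<in>J. if t i < t j then d (rank_gap J t i j) else 0) = pair_exponent d (card J)"
  using assms
proof (induction rule: finite_ranking_induct[where f = t])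
  case empty
  then show ?case by (simp add: pair_exponent_def)
next
  case (insert x S)
  show ?case
  proof (cases "x \<in> S")
    case True
    then have eq: "insert x S = S" by (rule insert_absorb)
    show ?thesis using insert(3,4) unfolding eq by simp
  next
    case False
    have lt: "t y < t x" if "y \<in> S" for y
    proof -
      have "t y \<noteq> t x" using insert(4) that False by (auto simp: inj_on_def)
      then show ?thesis using insert(2)[OF that] by simp
    qed
    have inS: "inj_on t S" using insert(4) by (auto simp: inj_on_def)
    have 1: "rank_gap (insert x S) t i j = rank_gap S t i j" if "j \<in> S" for i j
    proof -
      have "{l \<in> insert x S. t i < t l \<and> t l \<le> t j} = {l \<in> S. t i < t l \<and> t l \<le> t j}"
        using lt[OF that] by auto
      then show ?thesis by (simp add: rank_gap_def)
    qed
    let ?r = "\<lambda>i. rank_gap (insert x S) t i x"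
    have r: "?r i = card (insert x {l\<in>S. t i < t l})" if "i \<in> S" for i
    proof -
      have "{l \<in> insert x S. t i < t l \<and> t l \<le> t x} = insert x {l\<in>S. t i < t l}"
        using lt that by (auto intro: less_imp_le)
      then show ?thesis by (simp add: rank_gap_def)
    qed
    have r': "?r i = Suc (card {l\<in>S. t i < t l})" if "i \<in> S" for i
      using r[OF that] insert(1) False by simp
    have inj: "inj_on ?r S"
    proof (rule inj_onI)
      fix i j assume ij: "i \<in> S" "j \<in> S" "?r i = ?r j"
      have strict: "card {l\<in>S. t b < t l} < card {l\<in>S. t a < t l}" if "a \<in> S" "b \<in> S" "t a < t b" for a b
        using insert(1) that by (intro psubset_card_mono) auto
      have "t i = t j"
        using strict[of i j] strict[of j i] ij r' by (metis linorder_neqE_linordered_idom nat.inject nat_neq_iff)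
      then show "i = j" using inS ij by (auto dest: inj_onD)
    qed
    have sub: "?r ` S \<subseteq> {1..card S}"
    proof (rule image_subsetI)
      fix i assume i: "i \<in> S"
      have "card {l\<in>S. t i < t l} < card S"
        using insert(1) i by (intro psubset_card_mono) auto
      then show "?r i \<in> {1..card S}" using r'[OF i] by simp
    qed
    have "?r ` S = {1..card S}"
      by (rule card_subset_eq[OF _ sub]) (auto simp: card_image[OF inj])
    then have bij: "bij_betw ?r S {1..card S}" using inj by (simp add: bij_betw_def)
    have "(\<Sum>i\<in>insert x S. \<Sum>j\<in>insert x S. if t i < t j then d (rank_gap (insert x S) t i j) else 0)
      = (\<Sum>j\<in>insert x S. if t x < t j then d (rank_gap (insert x S) t x j) else 0)
       + (\<Sum>i\<in>S. \<Sum>j\<in>insert x S. if t i < t j then d (rank_gap (insert x S) t i j) else 0)"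
      using insert(1) False by simp
    also have "(\<Sum>j\<in>insert x S. if t x < t j then d (rank_gap (insert x S) t x j) else 0) = 0"
      using lt by (intro sum.neutral) force
    also have "(\<Sum>i\<in>S. \<Sum>j\<in>insert x S. if t i < t j then d (rank_gap (insert x S) t i j) else 0)
      = (\<Sum>i\<in>S. d (?r i) + (\<Sum>j\<in>S. if t i < t j then d (rank_gap S t i j) else 0))"
      using insert(1) False lt by (intro sum.cong refl) (auto simp: 1 intro!: sum.cong)
    also have "\<dots> = (\<Sum>i\<in>S. d (?r i)) + pair_exponent d (card S)"
      using insert(3) inS by (simp add: sum.distrib)
    also have "(\<Sum>i\<in>S. d (?r i)) = (\<Sum>m\<in>{1..card S}. d m)"
      by (rule sum.reindex_bij_betw[OF bij])
    finally show ?thesis using insert(1) False by (simp add: pair_exponent_def)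
  qed
qed

section \<open>Finite additivity and independence over disjoint sets\<close>

locale random_measure =
  fixes \<Omega> :: "'a measure" and \<rho> :: "'b measure" and \<psi> :: "complex \<Rightarrow> complex" and P :: "'b set \<Rightarrow> 'a \<Rightarrow> real"
  assumes irm: "id_random_measure \<Omega> \<rho> \<psi> P"

sublocale random_measure \<subseteq> prob_space \<Omega>
  using irm unfolding id_random_measure_def by simp

context random_measure
begin

lemma P_measurable: "A \<in> sets \<rho> \<Longrightarrow> emeasure \<rho> A < \<infinity> \<Longrightarrow> P A \<in> borel_measurable \<Omega>"
  using irm unfolding id_random_measure_def by blast

lemma P_char: "A \<in> sets \<rho> \<Longrightarrow> emeasure \<rho> A < \<infinity> \<Longrightarrow>
  (CLINT x|\<Omega>. exp (\<i> * of_real q * of_real (P A x))) = exp (\<psi> (of_real q) * of_real (measure \<rho> A))"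
  using irm unfolding id_random_measure_def by blast

lemma P_indep: "disjoint_family A \<Longrightarrow> (\<And>i::nat. A i \<in> sets \<rho>) \<Longrightarrow> (\<And>i. emeasure \<rho> (A i) < \<infinity>) \<Longrightarrow>
   indep_vars (\<lambda>_. borel) (\<lambda>i. P (A i)) UNIV"
  using irm unfolding id_random_measure_def by blast

lemma P_sums: "disjoint_family A \<Longrightarrow> (\<And>i::nat. A i \<in> sets \<rho>) \<Longrightarrow> (\<And>i. emeasure \<rho> (A i) < \<infinity>) \<Longrightarrow>
   emeasure \<rho> (\<Union>i. A i) < \<infinity> \<Longrightarrow> AE x in \<Omega>. (\<lambda>i. P (A i) x) sums P (\<Union>i. A i) x"
  using irm unfolding id_random_measure_def by blast

text \<open>Additivity for the sequence of empty sets makes a constant series converge almost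
  surely, so its term vanishes.\<close>

lemma P_empty: "AE x in \<Omega>. P {} x = 0"
proof -
  have "AE x in \<Omega>. (\<lambda>i::nat. P {} x) sums P (\<Union>i::nat. {}) x"
    by (rule P_sums) (auto simp: disjoint_family_on_def)
  then show ?thesis by eventually_elim (auto simp: sums_iff summable_const_iff)
qed

text \<open>The hypotheses concern sequences of sets; a finite family is enumerated and padded with
  empty sets, on which \<open>P\<close> vanishes almost surely.\<close>

lemma
  assumes K: "finite K" and dis: "disjoint_family_on B K"
    and B: "\<And>k. k \<in> K \<Longrightarrow> B k \<in> sets \<rho>" "\<And>k. k \<in> K \<Longrightarrow> emeasure \<rho> (B k) < \<infinity>"
  shows P_UN: "AE x in \<Omega>. P (\<Union>k\<in>K. B k) x = (\<Sum>k\<in>K. P (B k) x)"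
    and nn_integral_exp_sum: "(\<integral>\<^sup>+x. ennreal (exp (\<Sum>k\<in>K. c k * P (B k) x)) \<partial>\<Omega>) =
      (\<Prod>k\<in>K. \<integral>\<^sup>+x. ennreal (exp (c k * P (B k) x)) \<partial>\<Omega>)"
proof -
  let ?N = "card K"
  obtain e where e: "bij_betw e {..<?N} K" using ex_bij_betw_nat_finite[OF K] by (auto simp: atLeast0LessThan)
  define A where "A i = (if i < ?N then B (e i) else {})" for i
  have eK: "e i \<in> K" if "i < ?N" for i using e that by (auto simp: bij_betw_def)
  have A1: "A i \<in> sets \<rho>" "emeasure \<rho> (A i) < \<infinity>" for i using B eK by (auto simp: A_def)
  have dA: "disjoint_family A"
    unfolding disjoint_family_on_def
  proof (intro ballI impI)
    fix i j :: nat assume ij: "i \<noteq> j"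
    then have "e i \<noteq> e j" if "i < ?N" "j < ?N" using e that by (auto simp: bij_betw_def inj_on_def)
    then show "A i \<inter> A j = {}" using dis eK unfolding A_def disjoint_family_on_def by auto
  qed
  have UA: "(\<Union>i. A i) = (\<Union>k\<in>K. B k)"
  proof -
    have "(\<Union>i. A i) = (\<Union>i\<in>{..<?N}. B (e i))" by (auto simp: A_def split: if_splits)
    also have "\<dots> = (\<Union>k\<in>e ` {..<?N}. B k)" by simp
    also have "e ` {..<?N} = K" using e by (simp add: bij_betw_def)
    finally show ?thesis .
  qed
  have "emeasure \<rho> (\<Union>k\<in>K. B k) \<le> (\<Sum>k\<in>K. emeasure \<rho> (B k))"
    using B K by (intro emeasure_subadditive_finite) auto
  also have "\<dots> < \<infinity>" using B K by (simp add: less_top[symmetric])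
  finally have fin: "emeasure \<rho> (\<Union>i. A i) < \<infinity>" unfolding UA .
  show "AE x in \<Omega>. P (\<Union>k\<in>K. B k) x = (\<Sum>k\<in>K. P (B k) x)"
    using P_sums[OF dA A1 fin] P_empty
  proof eventually_elim
    case (elim x)
    have "(\<lambda>i. P (A i) x) sums (\<Sum>i<?N. P (A i) x)"
      by (rule sums_finite) (auto simp: A_def elim)
    with elim(1) have "P (\<Union>k\<in>K. B k) x = (\<Sum>i<?N. P (A i) x)" unfolding UA using sums_unique2 by blast
    also have "\<dots> = (\<Sum>i<?N. P (B (e i)) x)" by (intro sum.cong) (auto simp: A_def)
    also have "\<dots> = (\<Sum>k\<in>K. P (B k) x)" by (rule sum.reindex_bij_betw[OF e])
    finally show ?case .
  qed
  have ind: "indep_vars (\<lambda>_. borel) (\<lambda>i. P (A i)) {..<?N}"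
    by (rule indep_vars_subset[OF P_indep[OF dA A1]]) auto
  have ind2: "indep_vars (\<lambda>_. borel) (\<lambda>i x. ennreal (exp (c (e i) * P (A i) x))) {..<?N}"
    by (rule indep_vars_compose2[OF ind, of "\<lambda>i y. ennreal (exp (c (e i) * y))"]) measurable
  have "(\<integral>\<^sup>+x. ennreal (exp (\<Sum>k\<in>K. c k * P (B k) x)) \<partial>\<Omega>) = (\<integral>\<^sup>+x. (\<Prod>i<?N. ennreal (exp (c (e i) * P (A i) x))) \<partial>\<Omega>)"
  proof (rule nn_integral_cong)
    fix x
    have "(\<Sum>k\<in>K. c k * P (B k) x) = (\<Sum>i<?N. c (e i) * P (B (e i)) x)" by (rule sum.reindex_bij_betw[OF e, symmetric])
    also have "\<dots> = (\<Sum>i<?N. c (e i) * P (A i) x)" by (intro sum.cong) (auto simp: A_def)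
    finally show "ennreal (exp (\<Sum>k\<in>K. c k * P (B k) x)) = (\<Prod>i<?N. ennreal (exp (c (e i) * P (A i) x)))"
      by (simp add: exp_sum prod_ennreal)
  qed
  also have "\<dots> = (\<Prod>i<?N. \<integral>\<^sup>+x. ennreal (exp (c (e i) * P (A i) x)) \<partial>\<Omega>)"
    by (rule indep_vars_nn_integral[OF _ ind2]) auto
  also have "\<dots> = (\<Prod>i<?N. \<integral>\<^sup>+x. ennreal (exp (c (e i) * P (B (e i)) x)) \<partial>\<Omega>)"
    by (intro prod.cong) (auto simp: A_def)
  also have "\<dots> = (\<Prod>k\<in>K. \<integral>\<^sup>+x. ennreal (exp (c k * P (B k) x)) \<partial>\<Omega>)"
    by (rule prod.reindex_bij_betw[OF e])
  finally show "(\<integral>\<^sup>+x. ennreal (exp (\<Sum>k\<in>K. c k * P (B k) x)) \<partial>\<Omega>) = \<dots>" .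
qed

end

section \<open>Cutting overlapping sets into disjoint cells\<close>

definition venn_cell :: "('i \<Rightarrow> 'b set) \<Rightarrow> 'i set \<Rightarrow> 'i set \<Rightarrow> 'b set" where
  "venn_cell A I J = (\<Inter>i\<in>J. A i) - (\<Union>i\<in>I - J. A i)"

text \<open>The empty index set is excluded: its cell would be the complement of all the sets, for
  which neither measurability nor finite mass is available.\<close>

definition cells :: "'i set \<Rightarrow> 'i set set" where "cells I = Pow I - {{}}"

lemma finite_cells: "finite I \<Longrightarrow> finite (cells I)" by (simp add: cells_def)

lemma disjoint_venn_cells: "disjoint_family_on (venn_cell A I) (cells I)"
  unfolding disjoint_family_on_def
proof (intro ballI impI)
  fix J K assume JK: "J \<in> cells I" "K \<in> cells I" "J \<noteq> K"
  then have "J \<subseteq> I" "K \<subseteq> I" by (auto simp: cells_def)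
  moreover obtain i where "i \<in> J \<and> i \<notin> K \<or> i \<in> K \<and> i \<notin> J" using JK(3) by blast
  ultimately show "venn_cell A I J \<inter> venn_cell A I K = {}" unfolding venn_cell_def by blast
qed

lemma venn_cell_union_Int:
  assumes "i \<in> I" "j \<in> I" shows "A i \<inter> A j = (\<Union>J\<in>{J\<in>cells I. i \<in> J \<and> j \<in> J}. venn_cell A I J)"
proof (rule equalityI; rule subsetI)
  fix z assume z: "z \<in> A i \<inter> A j"
  let ?J = "{k\<in>I. z \<in> A k}"
  have "i \<in> ?J" "j \<in> ?J" using assms z by simp_all
  moreover from this have "?J \<in> cells I" unfolding cells_def by blast
  moreover have "z \<in> venn_cell A I ?J" unfolding venn_cell_def by simp
  ultimately show "z \<in> (\<Union>J\<in>{J\<in>cells I. i \<in> J \<and> j \<in> J}. venn_cell A I J)" by blast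
next
  fix z assume "z \<in> (\<Union>J\<in>{J\<in>cells I. i \<in> J \<and> j \<in> J}. venn_cell A I J)"
  then show "z \<in> A i \<inter> A j" unfolding venn_cell_def by blast
qed

lemma venn_cell_union:
  assumes "i \<in> I" shows "A i = (\<Union>J\<in>{J\<in>cells I. i \<in> J}. venn_cell A I J)"
  using venn_cell_union_Int[OF assms assms, of A] by simp

context random_measure
begin

text \<open>A cell belonging to \<open>J\<close> is counted card J times in the sum of the P(A i),
  and independence factors the expectation over the cells. The hypothesis on \<open>w\<close>
  distributes the exponent of a cell over the pairs in \<open>J\<close>; collecting the cells that
  contain both i and j restores the mass of A i \<inter> A j. The distribution is demanded for
  nonempty cells only, which is where the geometry of the sets will enter.\<close>

lemma nn_integral_exp_overlapping:
  fixes A :: "'i \<Rightarrow> 'b set" and w :: "'i \<Rightarrow> 'i \<Rightarrow> real"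
  assumes I: "finite I" and A: "\<And>i. i \<in> I \<Longrightarrow> A i \<in> sets \<rho>" "\<And>i. i \<in> I \<Longrightarrow> emeasure \<rho> (A i) < \<infinity>"
    and mom: "\<And>B m. B \<in> sets \<rho> \<Longrightarrow> emeasure \<rho> B < \<infinity> \<Longrightarrow> 1 \<le> m \<Longrightarrow> m \<le> card I \<Longrightarrow>
      (\<integral>\<^sup>+x. ennreal (exp (real m * P B x)) \<partial>\<Omega>) = ennreal (exp (\<Phi> m * measure \<rho> B))"
    and w: "\<And>J. J \<in> cells I \<Longrightarrow> venn_cell A I J \<noteq> {} \<Longrightarrow> \<Phi> (card J) = (\<Sum>i\<in>J. \<Sum>j\<in>J. w i j)"
  shows "(\<integral>\<^sup>+x. ennreal (exp (\<Sum>i\<in>I. P (A i) x)) \<partial>\<Omega>) =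
    ennreal (exp (\<Sum>i\<in>I. \<Sum>j\<in>I. w i j * measure \<rho> (A i \<inter> A j)))"
proof -
  let ?C = "venn_cell A I"
  have fc: "finite (cells I)" using I by (rule finite_cells)
  have subI: "J \<subseteq> I" "J \<noteq> {}" "finite J" if "J \<in> cells I" for J
    using that I finite_subset by (auto simp: cells_def)
  have C1: "?C J \<in> sets \<rho>" if "J \<in> cells I" for J
    unfolding venn_cell_def using subI[OF that] A(1) I
    by (intro sets.Diff sets.finite_INT sets.finite_UN) auto
  have C2: "emeasure \<rho> (?C J) < \<infinity>" if J: "J \<in> cells I" for J
  proof -
    obtain i where i: "i \<in> J" "i \<in> I" using subI[OF J] by auto
    then have "emeasure \<rho> (?C J) \<le> emeasure \<rho> (A i)"
      using A(1) by (intro emeasure_mono) (auto simp: venn_cell_def)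
    then show ?thesis using A(2)[OF i(2)] by (rule le_less_trans)
  qed
  have AE1: "AE x in \<Omega>. \<forall>i\<in>I. P (A i) x = (\<Sum>J\<in>{J\<in>cells I. i \<in> J}. P (?C J) x)"
  proof (rule AE_finite_allI[OF I])
    fix i assume i: "i \<in> I"
    have "AE x in \<Omega>. P (\<Union>J\<in>{J\<in>cells I. i \<in> J}. ?C J) x = (\<Sum>J\<in>{J\<in>cells I. i \<in> J}. P (?C J) x)"
      using fc C1 C2 by (intro P_UN disjoint_family_on_mono[OF _ disjoint_venn_cells]) auto
    then show "AE x in \<Omega>. P (A i) x = (\<Sum>J\<in>{J\<in>cells I. i \<in> J}. P (?C J) x)"
      using venn_cell_union[OF i, of A] by simp
  qed
  have "(\<integral>\<^sup>+x. ennreal (exp (\<Sum>i\<in>I. P (A i) x)) \<partial>\<Omega>) = (\<integral>\<^sup>+x. ennreal (exp (\<Sum>J\<in>cells I. real (card J) * P (?C J) x)) \<partial>\<Omega>)"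
  proof (rule nn_integral_cong_AE)
    show "AE x in \<Omega>. ennreal (exp (\<Sum>i\<in>I. P (A i) x)) = ennreal (exp (\<Sum>J\<in>cells I. real (card J) * P (?C J) x))"
      using AE1
    proof eventually_elim
      case (elim x)
      have "(\<Sum>i\<in>I. P (A i) x) = (\<Sum>i\<in>I. \<Sum>J\<in>{J\<in>cells I. i \<in> J}. P (?C J) x)" using elim by simp
      also have "\<dots> = (\<Sum>i\<in>I. \<Sum>J\<in>cells I. if i \<in> J then P (?C J) x else 0)"
        by (intro sum.cong refl sum.inter_filter fc)
      also have "\<dots> = (\<Sum>J\<in>cells I. \<Sum>i\<in>I. if i \<in> J then P (?C J) x else 0)" by (rule sum.swap)
      also have "\<dots> = (\<Sum>J\<in>cells I. real (card J) * P (?C J) x)"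
      proof (intro sum.cong refl)
        fix J assume J: "J \<in> cells I"
        have "(\<Sum>i\<in>I. if i \<in> J then P (?C J) x else 0) = (\<Sum>i\<in>{i\<in>I. i \<in> J}. P (?C J) x)"
          by (rule sum.inter_filter[OF I, symmetric])
        also have "{i\<in>I. i \<in> J} = J" using subI[OF J] by auto
        finally show "(\<Sum>i\<in>I. if i \<in> J then P (?C J) x else 0) = real (card J) * P (?C J) x" by simp
      qed
      finally show ?case by simp
    qed
  qed
  also have "\<dots> = (\<Prod>J\<in>cells I. \<integral>\<^sup>+x. ennreal (exp (real (card J) * P (?C J) x)) \<partial>\<Omega>)"
    by (rule nn_integral_exp_sum[OF fc disjoint_venn_cells C1 C2])
  also have "\<dots> = (\<Prod>J\<in>cells I. ennreal (exp (\<Phi> (card J) * measure \<rho> (?C J))))"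
  proof (intro prod.cong refl mom C1 C2)
    fix J assume J: "J \<in> cells I"
    show "1 \<le> card J" using subI[OF J] by (simp add: Suc_le_eq card_gt_0_iff)
    show "card J \<le> card I" using subI[OF J] I by (intro card_mono)
  qed
  also have "\<dots> = ennreal (exp (\<Sum>J\<in>cells I. \<Phi> (card J) * measure \<rho> (?C J)))"
    by (simp add: prod_ennreal exp_sum[OF fc])
  also have "(\<Sum>J\<in>cells I. \<Phi> (card J) * measure \<rho> (?C J)) = (\<Sum>J\<in>cells I. (\<Sum>i\<in>J. \<Sum>j\<in>J. w i j) * measure \<rho> (?C J))"
  proof (intro sum.cong refl)
    fix J assume J: "J \<in> cells I"
    show "\<Phi> (card J) * measure \<rho> (?C J) = (\<Sum>i\<in>J. \<Sum>j\<in>J. w i j) * measure \<rho> (?C J)"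
      using w[OF J] by (cases "?C J = {}") auto
  qed
  also have "\<dots> = (\<Sum>J\<in>cells I. \<Sum>i\<in>I. \<Sum>j\<in>I. if i \<in> J \<and> j \<in> J then w i j * measure \<rho> (?C J) else 0)"
  proof (intro sum.cong refl)
    fix J assume J: "J \<in> cells I"
    have JI: "{i\<in>I. i \<in> J} = J" using subI[OF J] by auto
    have s: "(\<Sum>i\<in>J. f i) = (\<Sum>i\<in>I. if i \<in> J then f i else 0)" for f :: "'i \<Rightarrow> real"
      using sum.inter_filter[OF I, of f "\<lambda>i. i \<in> J"] JI by simp
    show "(\<Sum>i\<in>J. \<Sum>j\<in>J. w i j) * measure \<rho> (?C J) = (\<Sum>i\<in>I. \<Sum>j\<in>I. if i \<in> J \<and> j \<in> J then w i j * measure \<rho> (?C J) else 0)"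
      unfolding s sum_distrib_right by (intro sum.cong refl) (auto simp: sum_distrib_right intro!: sum.cong)
  qed
  also have "\<dots> = (\<Sum>i\<in>I. \<Sum>J\<in>cells I. \<Sum>j\<in>I. if i \<in> J \<and> j \<in> J then w i j * measure \<rho> (?C J) else 0)" by (rule sum.swap)
  also have "\<dots> = (\<Sum>i\<in>I. \<Sum>j\<in>I. \<Sum>J\<in>cells I. if i \<in> J \<and> j \<in> J then w i j * measure \<rho> (?C J) else 0)"
    by (intro sum.cong refl sum.swap)
  also have "\<dots> = (\<Sum>i\<in>I. \<Sum>j\<in>I. w i j * measure \<rho> (A i \<inter> A j))"
  proof (intro sum.cong refl)
    fix i j assume ij: "i \<in> I" "j \<in> I"
    have "measure \<rho> (A i \<inter> A j) = (\<Sum>J\<in>{J\<in>cells I. i \<in> J \<and> j \<in> J}. measure \<rho> (?C J))"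
      unfolding venn_cell_union_Int[OF ij]
    proof (rule measure_finite_Union)
      show "finite {J \<in> cells I. i \<in> J \<and> j \<in> J}" using fc by simp
      show "disjoint_family_on ?C {J \<in> cells I. i \<in> J \<and> j \<in> J}"
        by (rule disjoint_family_on_mono[OF _ disjoint_venn_cells]) auto
      show "?C ` {J \<in> cells I. i \<in> J \<and> j \<in> J} \<subseteq> sets \<rho>" using C1 by auto
      show "emeasure \<rho> (?C J) \<noteq> \<infinity>" if "J \<in> {J \<in> cells I. i \<in> J \<and> j \<in> J}" for J
        using C2[of J] that by auto
    qed
    then show "(\<Sum>J\<in>cells I. if i \<in> J \<and> j \<in> J then w i j * measure \<rho> (?C J) else 0) = w i j * measure \<rho> (A i \<inter> A j)"
      by (simp add: sum.inter_filter[OF fc, symmetric] sum_distrib_left)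
  qed
  finally show ?thesis .
qed

end

section \<open>Integrals of products of powers over a simplex\<close>

text \<open>A pair (p, q) stands for the block of gaps x p, ..., x q, whose sum is the distance
  between the points p and q + 1; this explains the index q - p + 1 below.\<close>

definition gap_pairs :: "nat \<Rightarrow> nat \<Rightarrow> (nat \<times> nat) set" where
  "gap_pairs a c = {(p, q). a \<le> p \<and> p \<le> q \<and> q < c}"

text \<open>Total exponent of the kernel: scaling all gaps by y > 0 multiplies
  \<open>gap_kernel\<close> by y to the power minus this number.\<close>

definition gap_weight :: "(nat \<Rightarrow> real) \<Rightarrow> nat \<Rightarrow> nat \<Rightarrow> real" where
  "gap_weight b a c = (\<Sum>(p, q)\<in>gap_pairs a c. b (q - p + 1))"

definition gap_kernel :: "(nat \<Rightarrow> real) \<Rightarrow> nat \<Rightarrow> nat \<Rightarrow> (nat \<Rightarrow> real) \<Rightarrow> real" where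
  "gap_kernel b a c x = (\<Prod>(p, q)\<in>gap_pairs a c. (\<Sum>l\<in>{p..q}. x l) powr (- b (q - p + 1)))"

lemma finite_gap_pairs [simp, intro]: "finite (gap_pairs a c)"
  by (rule finite_subset[of _ "{..c} \<times> {..c}"]) (auto simp: gap_pairs_def)

lemma gap_kernel_nonneg: "0 \<le> gap_kernel b a c x"
  unfolding gap_kernel_def by (intro prod_nonneg) auto

text \<open>A block lies to the left of gap i, to the right of it, or contains it; the blocks of the
  last kind form a rectangle.\<close>

lemma gap_pairs_split:
  assumes "a \<le> i" "i < c"
  shows "gap_pairs a c = gap_pairs a i \<union> gap_pairs (Suc i) c \<union> {a..i} \<times> {i..<c}"
    and "gap_pairs a i \<inter> gap_pairs (Suc i) c = {}"
    and "(gap_pairs a i \<union> gap_pairs (Suc i) c) \<inter> {a..i} \<times> {i..<c} = {}"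
  using assms by (auto simp: gap_pairs_def)

lemma gap_weight_split:
  assumes "a \<le> i" "i < c"
  shows "gap_weight b a c = gap_weight b a i + gap_weight b (Suc i) c + (\<Sum>(p, q)\<in>{a..i} \<times> {i..<c}. b (q - p + 1))"
  unfolding gap_weight_def gap_pairs_split(1)[OF assms]
  using gap_pairs_split(2,3)[OF assms] by (simp add: sum.union_disjoint)

text \<open>A block containing gap i has sum at least \<open>x i\<close>, and the exponents are
  nonpositive, so each such factor is at most a power of \<open>x i\<close>.\<close>

lemma gap_kernel_split_le:
  assumes i: "a \<le> i" "i < c" and b: "\<And>j. 0 \<le> b j" and x: "\<And>l. l \<in> {a..<c} \<Longrightarrow> 0 < x l"
  shows "gap_kernel b a c x \<le> gap_kernel b a i x * gap_kernel b (Suc i) c x *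
    x i powr (- (gap_weight b a c - gap_weight b a i - gap_weight b (Suc i) c))"
proof -
  let ?M = "{a..i} \<times> {i..<c}"
  let ?f = "\<lambda>(p, q). (\<Sum>l\<in>{p..q}. x l) powr (- b (q - p + 1))"
  have xi: "0 < x i" using x i by auto
  have "gap_kernel b a c x = gap_kernel b a i x * gap_kernel b (Suc i) c x * (\<Prod>z\<in>?M. ?f z)"
    unfolding gap_kernel_def gap_pairs_split(1)[OF i]
    using gap_pairs_split(2,3)[OF i] by (simp add: prod.union_disjoint)
  also have "(\<Prod>z\<in>?M. ?f z) \<le> (\<Prod>(p, q)\<in>?M. x i powr (- b (q - p + 1)))"
  proof (rule prod_mono, safe)
    fix p q assume pq: "p \<in> {a..i}" "q \<in> {i..<c}"
    have "x i \<le> (\<Sum>l\<in>{p..q}. x l)"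
      using pq x by (intro member_le_sum) (auto intro: less_imp_le)
    then show "(\<Sum>l\<in>{p..q}. x l) powr (- b (q - p + 1)) \<le> x i powr (- b (q - p + 1))"
      using xi b by (intro powr_mono2') auto
  qed auto
  also have "(\<Prod>(p, q)\<in>?M. x i powr (- b (q - p + 1))) = x i powr (\<Sum>(p, q)\<in>?M. - b (q - p + 1))"
    using xi by (subst powr_sum) (auto simp: case_prod_beta)
  also have "(\<Sum>(p, q)\<in>?M. - b (q - p + 1)) = - (gap_weight b a c - gap_weight b a i - gap_weight b (Suc i) c)"
    unfolding gap_weight_split[OF i] by (simp add: sum_negf case_prod_beta)
  finally show ?thesis by (simp add: mult_left_mono gap_kernel_nonneg)
qed

lemma borel_measurable_gap_kernel:
  assumes "{a..<c} \<subseteq> I"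
  shows "gap_kernel b a c \<in> borel_measurable (PiM I (\<lambda>_. lborel))"
proof -
  have "(\<lambda>x. (\<Sum>l\<in>{p..q}. x l) powr (- b (q - p + 1))) \<in> borel_measurable (PiM I (\<lambda>_. lborel))"
    if "(p, q) \<in> gap_pairs a c" for p q
    using that assms by (intro powr_real_measurable borel_measurable_sum measurable_PiM_component_real borel_measurable_const)
      (auto simp: gap_pairs_def)
  then show ?thesis unfolding gap_kernel_def[abs_def]
    by (intro borel_measurable_prod) auto
qed

definition gap_box :: "nat \<Rightarrow> nat \<Rightarrow> real \<Rightarrow> (nat \<Rightarrow> real) set" where
  "gap_box a c y = {x. \<forall>l\<in>{a..<c}. 0 < x l \<and> x l \<le> y}"

lemma indicator_gap_box_measurable:
  assumes "{a..<c} \<subseteq> I"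
  shows "(indicator (gap_box a c y) :: _ \<Rightarrow> ennreal) \<in> borel_measurable (PiM I (\<lambda>_. lborel))"
proof -
  have "(\<lambda>x. (\<Prod>l\<in>{a..<c}. indicator {0<..y} (x l)) :: ennreal) \<in> borel_measurable (PiM I (\<lambda>_. lborel))"
    using assms by (intro borel_measurable_prod_ennreal measurable_compose[OF measurable_PiM_component_real] borel_measurable_indicator) auto
  also have "(\<lambda>x. (\<Prod>l\<in>{a..<c}. indicator {0<..y} (x l)) :: ennreal) = indicator (gap_box a c y)"
    by (auto simp: fun_eq_iff indicator_def gap_box_def prod_eq_1_iff)
  finally show ?thesis .
qed

definition gap_integrand :: "(nat \<Rightarrow> real) \<Rightarrow> nat \<Rightarrow> nat \<Rightarrow> real \<Rightarrow> (nat \<Rightarrow> real) \<Rightarrow> ennreal" where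
  "gap_integrand b a c y x = ennreal (gap_kernel b a c x) * indicator (gap_box a c y) x"

lemma gap_integrand_cong:
  assumes "\<And>l. l \<in> {a..<c} \<Longrightarrow> x l = x' l"
  shows "gap_integrand b a c y x = gap_integrand b a c y x'"
proof -
  have "gap_kernel b a c x = gap_kernel b a c x'"
    unfolding gap_kernel_def using assms
    by (intro prod.cong refl) (auto simp: gap_pairs_def intro!: arg_cong2[where f = "(powr)"] sum.cong)
  moreover have "x \<in> gap_box a c y \<longleftrightarrow> x' \<in> gap_box a c y" unfolding gap_box_def using assms by auto
  ultimately show ?thesis unfolding gap_integrand_def by (auto simp: indicator_def)
qed

lemma borel_measurable_gap_integrand:
  assumes "{a..<c} \<subseteq> I"
  shows "gap_integrand b a c y \<in> borel_measurable (PiM I (\<lambda>_. lborel))"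
  unfolding gap_integrand_def[abs_def]
  by (intro borel_measurable_times_ennreal indicator_gap_box_measurable assms
      measurable_compose[OF borel_measurable_gap_kernel measurable_ennreal])

lemma nn_integral_powr_Ioc:
  assumes s: "s > -1" and y: "0 < y"
  shows "(\<integral>\<^sup>+z. ennreal (z powr s) * indicator {0<..y} z \<partial>lborel) = ennreal (y powr (s + 1) / (s + 1))"
proof -
  have "(\<integral>\<^sup>+z. ennreal (z powr s) * indicator {0<..y} z \<partial>lborel) = (\<integral>\<^sup>+z. ennreal (indicator {0..y} z * z powr s) \<partial>lborel)"
    by (intro nn_integral_cong) (auto simp: indicator_def)
  also have "\<dots> = ennreal (y powr (s + 1) / (s + 1))"
    using has_integral_powr_from_0[OF s, of y] y
    by (intro nn_integral_has_integral_lebesgue) auto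
  finally show ?thesis .
qed

text \<open>Induction on the number of gaps: condition on the largest gap \<open>x i\<close>. The kernel then factors, up to
  a power of \<open>x i\<close>, into the kernels of the gaps to the left and to the right of \<open>i\<close>, which are bounded
  by \<open>x i\<close>.\<close>

lemma nn_integral_gap_integrand_le:
  assumes b: "\<And>j. 0 \<le> b j" and w: "\<And>a' c'. a' < c' \<Longrightarrow> c' - a' \<le> N \<Longrightarrow> gap_weight b a' c' < real (c' - a')"
    and "a \<le> c" "c - a \<le> N"
  shows "\<exists>C\<ge>0. \<forall>y>0. (\<integral>\<^sup>+x. gap_integrand b a c y x \<partial>PiM {a..<c} (\<lambda>_. lborel))
    \<le> ennreal (C * y powr (real (c - a) - gap_weight b a c))"
  using assms(3,4)
proof (induction "c - a" arbitrary: a c rule: less_induct)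
  case less
  show ?case
  proof (cases "a = c")
    case True
    have "gap_pairs a c = {}" using True by (auto simp: gap_pairs_def)
    then have "(\<integral>\<^sup>+x. gap_integrand b a c y x \<partial>PiM {a..<c} (\<lambda>_. lborel)) = 1" if "y > 0" for y
      using True by (simp add: lborel_PiM.nn_integral_empty gap_integrand_def gap_kernel_def gap_box_def PiM_empty)
    moreover have "gap_weight b a c = 0" using \<open>gap_pairs a c = {}\<close> by (simp add: gap_weight_def)
    ultimately show ?thesis using True by (intro exI[of _ 1]) auto
  next
    case False
    then have ac: "a < c" using less by simp
    \<comment> \<open>Number of variables minus total exponent, the power of y expected from
      scaling; subcriticality makes it positive.\<close>
    define E where "E = real (c - a) - gap_weight b a c"
    have E: "E > 0" using w[OF ac less(3)] by (simp add: E_def)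
    have "\<forall>i\<in>{a..<c}. \<exists>C\<ge>0. \<forall>y>0. (\<integral>\<^sup>+x. gap_integrand b a i y x \<partial>PiM {a..<i} (\<lambda>_. lborel))
        \<le> ennreal (C * y powr (real (i - a) - gap_weight b a i))"
      using less by (intro ballI less(1)) auto
    then obtain C1 where C1: "\<And>i. i \<in> {a..<c} \<Longrightarrow> C1 i \<ge> 0"
      "\<And>i y. i \<in> {a..<c} \<Longrightarrow> y > 0 \<Longrightarrow> (\<integral>\<^sup>+x. gap_integrand b a i y x \<partial>PiM {a..<i} (\<lambda>_. lborel))
        \<le> ennreal (C1 i * y powr (real (i - a) - gap_weight b a i))"
      unfolding bchoice_iff by blast
    have "\<forall>i\<in>{a..<c}. \<exists>C\<ge>0. \<forall>y>0. (\<integral>\<^sup>+x. gap_integrand b (Suc i) c y x \<partial>PiM {Suc i..<c} (\<lambda>_. lborel))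
        \<le> ennreal (C * y powr (real (c - Suc i) - gap_weight b (Suc i) c))"
      using less by (intro ballI less(1)) auto
    then obtain C2 where C2: "\<And>i. i \<in> {a..<c} \<Longrightarrow> C2 i \<ge> 0"
      "\<And>i y. i \<in> {a..<c} \<Longrightarrow> y > 0 \<Longrightarrow> (\<integral>\<^sup>+x. gap_integrand b (Suc i) c y x \<partial>PiM {Suc i..<c} (\<lambda>_. lborel))
        \<le> ennreal (C2 i * y powr (real (c - Suc i) - gap_weight b (Suc i) c))"
      unfolding bchoice_iff by blast
    \<comment> \<open>Total exponent of the blocks that contain gap i.\<close>
    define e where "e i = gap_weight b a c - gap_weight b a i - gap_weight b (Suc i) c" for i
    \<comment> \<open>Majorant for the region where \<open>x i\<close> is the largest gap: both side
      kernels are confined to boxes of side \<open>x i\<close>.\<close>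
    define Q where "Q i y x = ennreal (x i powr (- e i)) * indicator {0<..y} (x i) *
        (gap_integrand b a i (x i) x * gap_integrand b (Suc i) c (x i) x)" for i and y :: real and x :: "nat \<Rightarrow> real"
    have Qm: "Q i y \<in> borel_measurable (PiM {a..<c} (\<lambda>_. lborel))" if i: "i \<in> {a..<c}" for i y
    proof -
      have 1: "(\<lambda>x. indicator (gap_box a' c' (x i)) x :: ennreal) \<in> borel_measurable (PiM {a..<c} (\<lambda>_. lborel))"
        if "{a'..<c'} \<subseteq> {a..<c}" for a' c'
      proof -
        have "(\<lambda>x :: nat \<Rightarrow> real. (\<Prod>l\<in>{a'..<c'}. if 0 < x l \<and> x l \<le> x i then 1 else 0) :: ennreal) \<in> borel_measurable (PiM {a..<c} (\<lambda>_. lborel))"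
        proof (rule borel_measurable_prod_ennreal)
          fix l assume "l \<in> {a'..<c'}"
          then have "(\<lambda>x. x l) \<in> borel_measurable (PiM {a..<c} (\<lambda>_. lborel :: real measure))"
            "(\<lambda>x. x i) \<in> borel_measurable (PiM {a..<c} (\<lambda>_. lborel :: real measure))"
            using that i by (auto intro!: measurable_PiM_component_real)
          then have S: "{x \<in> space (PiM {a..<c} (\<lambda>_. lborel :: real measure)). 0 < x l \<and> x l \<le> x i} \<in> sets (PiM {a..<c} (\<lambda>_. lborel))"
            by (intro sets.sets_Collect_conj borel_measurable_less borel_measurable_le borel_measurable_const)
          show "(\<lambda>x :: nat \<Rightarrow> real. if 0 < x l \<and> x l \<le> x i then 1 else 0 :: ennreal) \<in> borel_measurable (PiM {a..<c} (\<lambda>_. lborel))"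
            by (rule measurable_If[OF borel_measurable_const borel_measurable_const S])
        qed
        also have "(\<lambda>x :: nat \<Rightarrow> real. (\<Prod>l\<in>{a'..<c'}. if 0 < x l \<and> x l \<le> x i then 1 else 0) :: ennreal) = (\<lambda>x. indicator (gap_box a' c' (x i)) x)"
          by (auto simp: fun_eq_iff indicator_def gap_box_def prod_eq_1_iff)
        finally show ?thesis .
      qed
      show ?thesis
        unfolding Q_def[abs_def] gap_integrand_def using i
        by (intro borel_measurable_times_ennreal 1 measurable_compose[OF borel_measurable_gap_kernel measurable_ennreal]
           measurable_compose[OF measurable_PiM_component_real borel_measurable_indicator]
           measurable_compose[OF _ measurable_ennreal] powr_real_measurable measurable_PiM_component_real) auto
    qed
    have Qint: "(\<integral>\<^sup>+x. Q i y x \<partial>PiM {a..<c} (\<lambda>_. lborel)) \<le> ennreal (C1 i * C2 i / E * y powr E)"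
      if i: "i \<in> {a..<c}" and y: "0 < y" for i y
    proof -
      let ?A = "{a..<i}" and ?B = "{Suc i..<c}"
      have un: "insert i (?A \<union> ?B) = {a..<c}" using i by auto
      have "(\<integral>\<^sup>+x. Q i y x \<partial>PiM {a..<c} (\<lambda>_. lborel)) = 
         (\<integral>\<^sup>+z. (\<integral>\<^sup>+x. Q i y (x(i := z)) \<partial>PiM (?A \<union> ?B) (\<lambda>_. lborel)) \<partial>lborel)"
        using lborel_PiM.product_nn_integral_insert_rev[of "?A \<union> ?B" i "Q i y"] Qm[OF i] unfolding un by simp
      also have "\<dots> \<le> (\<integral>\<^sup>+z. ennreal (C1 i * C2 i) * (ennreal (z powr (E - 1)) * indicator {0<..y} z) \<partial>lborel)"
      proof (rule nn_integral_mono)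
        fix z :: real
        show "(\<integral>\<^sup>+x. Q i y (x(i := z)) \<partial>PiM (?A \<union> ?B) (\<lambda>_. lborel)) \<le> ennreal (C1 i * C2 i) * (ennreal (z powr (E - 1)) * indicator {0<..y} z)"
        proof (cases "z \<in> {0<..y}")
          case True
          then have z: "0 < z" by simp
          have Qz: "Q i y (x(i := z)) = ennreal (z powr (- e i)) * (gap_integrand b a i z x * gap_integrand b (Suc i) c z x)" for x
          proof -
            have "gap_integrand b a i z (x(i := z)) = gap_integrand b a i z x" by (rule gap_integrand_cong) auto
            moreover have "gap_integrand b (Suc i) c z (x(i := z)) = gap_integrand b (Suc i) c z x" by (rule gap_integrand_cong) auto
            ultimately show ?thesis unfolding Q_def using True by simp
          qed
          have m1: "gap_integrand b a i z \<in> borel_measurable (PiM I (\<lambda>_. lborel))" if "?A \<subseteq> I" for I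
            by (rule borel_measurable_gap_integrand[OF that])
          have m2: "gap_integrand b (Suc i) c z \<in> borel_measurable (PiM I (\<lambda>_. lborel))" if "?B \<subseteq> I" for I
            by (rule borel_measurable_gap_integrand[OF that])
          have "(\<integral>\<^sup>+x. Q i y (x(i := z)) \<partial>PiM (?A \<union> ?B) (\<lambda>_. lborel)) =
            ennreal (z powr (- e i)) * (\<integral>\<^sup>+x. gap_integrand b a i z x * gap_integrand b (Suc i) c z x \<partial>PiM (?A \<union> ?B) (\<lambda>_. lborel))"
            unfolding Qz by (intro nn_integral_cmult borel_measurable_times_ennreal m1 m2) auto
          also have "(\<integral>\<^sup>+x. gap_integrand b a i z x * gap_integrand b (Suc i) c z x \<partial>PiM (?A \<union> ?B) (\<lambda>_. lborel)) =
            (\<integral>\<^sup>+x. (\<integral>\<^sup>+x'. gap_integrand b a i z (merge ?A ?B (x, x')) * gap_integrand b (Suc i) c z (merge ?A ?B (x, x')) \<partial>PiM ?B (\<lambda>_. lborel)) \<partial>PiM ?A (\<lambda>_. lborel))"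
            by (rule lborel_PiM.product_nn_integral_fold) (auto intro!: borel_measurable_times_ennreal m1 m2)
          also have "\<dots> = (\<integral>\<^sup>+x. (\<integral>\<^sup>+x'. gap_integrand b a i z x * gap_integrand b (Suc i) c z x' \<partial>PiM ?B (\<lambda>_. lborel)) \<partial>PiM ?A (\<lambda>_. lborel))"
            by (intro nn_integral_cong arg_cong2[where f = "(*)"] gap_integrand_cong) (auto simp: merge_def)
          also have "\<dots> = (\<integral>\<^sup>+x. gap_integrand b a i z x \<partial>PiM ?A (\<lambda>_. lborel)) * (\<integral>\<^sup>+x'. gap_integrand b (Suc i) c z x' \<partial>PiM ?B (\<lambda>_. lborel))"
            by (simp add: nn_integral_cmult nn_integral_multc m1 m2)
          also have "\<dots> \<le> ennreal (C1 i * z powr (real (i - a) - gap_weight b a i)) * ennreal (C2 i * z powr (real (c - Suc i) - gap_weight b (Suc i) c))"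
            by (intro mult_mono C1(2)[OF i z] C2(2)[OF i z]) auto
          also have "\<dots> = ennreal (C1 i * C2 i * z powr ((real (i - a) - gap_weight b a i) + (real (c - Suc i) - gap_weight b (Suc i) c)))"
            using C1(1)[OF i] C2(1)[OF i] by (simp add: ennreal_mult'[symmetric] powr_add ac_simps)
          finally have "(\<integral>\<^sup>+x. Q i y (x(i := z)) \<partial>PiM (?A \<union> ?B) (\<lambda>_. lborel)) \<le>
             ennreal (z powr (- e i)) * ennreal (C1 i * C2 i * z powr ((real (i - a) - gap_weight b a i) + (real (c - Suc i) - gap_weight b (Suc i) c)))"
            by (simp add: mult_left_mono del: fun_upd_apply)
          also have "\<dots> = ennreal (C1 i * C2 i) * ennreal (z powr (- e i) * z powr ((real (i - a) - gap_weight b a i) + (real (c - Suc i) - gap_weight b (Suc i) c)))"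
            using C1(1)[OF i] C2(1)[OF i] by (simp add: ennreal_mult'[symmetric] ac_simps)
          also have "\<dots> = ennreal (C1 i * C2 i) * ennreal (z powr (- e i + ((real (i - a) - gap_weight b a i) + (real (c - Suc i) - gap_weight b (Suc i) c))))"
            unfolding powr_add[of z "- e i"] ..
          \<comment> \<open>The exponents of the two sides and of the blocks through i add up to E -
            1, integrable at 0 precisely because E > 0.\<close>
          also have "- e i + ((real (i - a) - gap_weight b a i) + (real (c - Suc i) - gap_weight b (Suc i) c)) = E - 1"
            using i by (simp add: e_def E_def of_nat_diff)
          finally show ?thesis using True by (simp del: fun_upd_apply)
        next
          case False
          then have "Q i y (x(i := z)) = 0" for x unfolding Q_def by simp
          then show ?thesis by simp
        qed
      qed
      also have "\<dots> = ennreal (C1 i * C2 i) * ennreal (y powr (E - 1 + 1) / (E - 1 + 1))"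
        using E by (subst nn_integral_cmult) (auto simp: nn_integral_powr_Ioc y)
      also have "\<dots> = ennreal (C1 i * C2 i / E * y powr E)"
        using C1(1)[OF i] C2(1)[OF i] by (simp add: ennreal_mult'[symmetric])
      finally show ?thesis .
    qed
    \<comment> \<open>Some gap is the largest; summing the majorants over all i avoids choosing it
      measurably.\<close>
    have pw: "gap_integrand b a c y x \<le> (\<Sum>i\<in>{a..<c}. Q i y x)" for y x
    proof (cases "x \<in> gap_box a c y")
      case True
      then have x: "\<And>l. l \<in> {a..<c} \<Longrightarrow> 0 < x l \<and> x l \<le> y" by (auto simp: gap_box_def)
      have "{a..<c} \<noteq> {}" using ac by auto
      then obtain i where i: "i \<in> {a..<c}" "\<And>l. l \<in> {a..<c} \<Longrightarrow> x l \<le> x i"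
      proof -
        have "Max (x ` {a..<c}) \<in> x ` {a..<c}" using ac by (intro Max_in) auto
        then obtain i where "i \<in> {a..<c}" "x i = Max (x ` {a..<c})" by auto
        moreover have "x l \<le> Max (x ` {a..<c})" if "l \<in> {a..<c}" for l using that by (intro Max_ge) auto
        ultimately show thesis using that by metis
      qed
      have "gap_integrand b a c y x = ennreal (gap_kernel b a c x)" using True by (simp add: gap_integrand_def)
      also have "\<dots> \<le> ennreal (gap_kernel b a i x * gap_kernel b (Suc i) c x * x i powr (- e i))"
        unfolding e_def using i(1) x b by (intro ennreal_leI gap_kernel_split_le) auto
      also have "\<dots> = Q i y x"
      proof -
        have "x \<in> gap_box a i (x i)" "x \<in> gap_box (Suc i) c (x i)" "x i \<in> {0<..y}"
          using x i unfolding gap_box_def by auto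
        then show ?thesis unfolding Q_def gap_integrand_def
          by (simp add: ennreal_mult' gap_kernel_nonneg ac_simps)
      qed
      also have "\<dots> \<le> (\<Sum>i\<in>{a..<c}. Q i y x)" using i(1) by (intro member_le_sum) auto
      finally show ?thesis .
    qed (simp add: gap_integrand_def)
    show ?thesis
    proof (intro exI[of _ "\<Sum>i\<in>{a..<c}. C1 i * C2 i / E"] conjI allI impI)
      show "0 \<le> (\<Sum>i\<in>{a..<c}. C1 i * C2 i / E)" using C1 C2 E by (intro sum_nonneg) auto
      fix y :: real assume y: "0 < y"
      have "(\<integral>\<^sup>+x. gap_integrand b a c y x \<partial>PiM {a..<c} (\<lambda>_. lborel)) \<le> (\<integral>\<^sup>+x. (\<Sum>i\<in>{a..<c}. Q i y x) \<partial>PiM {a..<c} (\<lambda>_. lborel))"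
        by (intro nn_integral_mono pw)
      also have "\<dots> = (\<Sum>i\<in>{a..<c}. \<integral>\<^sup>+x. Q i y x \<partial>PiM {a..<c} (\<lambda>_. lborel))"
        by (intro nn_integral_sum Qm)
      also have "\<dots> \<le> (\<Sum>i\<in>{a..<c}. ennreal (C1 i * C2 i / E * y powr E))"
        by (intro sum_mono Qint y)
      also have "\<dots> = ennreal ((\<Sum>i\<in>{a..<c}. C1 i * C2 i / E) * y powr E)"
        using C1 C2 E by (subst sum_ennreal) (auto simp: sum_distrib_right)
      finally show "(\<integral>\<^sup>+x. gap_integrand b a c y x \<partial>PiM {a..<c} (\<lambda>_. lborel)) \<le>
        ennreal ((\<Sum>i\<in>{a..<c}. C1 i * C2 i / E) * y powr (real (c - a) - gap_weight b a c))"
        unfolding E_def .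
    qed
  qed
qed

section \<open>From points to gaps\<close>

lemma nn_integral_lborel_shift:
  fixes f :: "real \<Rightarrow> ennreal"
  assumes "f \<in> borel_measurable borel"
  shows "(\<integral>\<^sup>+y. f y \<partial>lborel) = (\<integral>\<^sup>+y. f (c + y) \<partial>lborel)"
  using nn_integral_real_affine[OF assms, of 1 c] by simp

text \<open>The map to the first point and the successive gaps is triangular with unit diagonal.
  Each induction step translates the last coordinate by its predecessor.\<close>

lemma nn_integral_PiM_gaps:
  fixes f :: "(nat \<Rightarrow> real) \<Rightarrow> ennreal"
  assumes "f \<in> borel_measurable (lborel_vec (Suc m))"
  shows "(\<integral>\<^sup>+t. f t \<partial>lborel_vec (Suc m)) =
    (\<integral>\<^sup>+u. (\<integral>\<^sup>+x. f (\<lambda>i\<in>{1..Suc m}. u + (\<Sum>l\<in>{1..<i}. x l)) \<partial>PiM {1..<Suc m} (\<lambda>_. lborel)) \<partial>lborel)"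
  using assms
proof (induction m arbitrary: f)
  case 0
  have e: "(\<lambda>i\<in>{1..Suc 0}. u + (\<Sum>l\<in>{1..<i}. x l)) = (\<lambda>_. undefined)(1 := u)" for u :: real and x
    by (auto simp: fun_eq_iff)
  have "(\<integral>\<^sup>+t. f t \<partial>lborel_vec (Suc 0)) = (\<integral>\<^sup>+u. (\<integral>\<^sup>+x. f (x(1 := u)) \<partial>PiM {} (\<lambda>_. lborel)) \<partial>lborel)"
    using lborel_PiM.product_nn_integral_insert_rev[of "{}" 1 f] 0 by simp
  then show ?case unfolding e by (simp add: PiM_empty nn_integral_count_space_finite del: fun_upd_apply)
next
  case (Suc m)
  note f[measurable] = Suc.prems
  let ?I = "{1..Suc m}"
  have ins: "{1..Suc (Suc m)} = insert (Suc (Suc m)) ?I" by auto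
  have ins': "{1..<Suc (Suc m)} = insert (Suc m) {1..<Suc m}" by auto
  have comp: "(\<lambda>t. t (Suc m)) \<in> borel_measurable (PiM ?I (\<lambda>_. lborel :: real measure))"
    by (rule measurable_PiM_component_real) auto
  have upd: "(\<lambda>(t, y). t(Suc (Suc m) := y)) \<in> measurable (PiM ?I (\<lambda>_. lborel :: real measure) \<Otimes>\<^sub>M lborel) (lborel_vec (Suc (Suc m)))"
    unfolding ins by (rule measurable_add_dim)
  have upd': "(\<lambda>z. (fst z)(Suc (Suc m) := fst z (Suc m) + snd z)) \<in> measurable (PiM ?I (\<lambda>_. lborel :: real measure) \<Otimes>\<^sub>M lborel) (lborel_vec (Suc (Suc m)))"
  proof -
    have "(\<lambda>z. (fst z, fst z (Suc m) + snd z)) \<in> measurable (PiM ?I (\<lambda>_. lborel :: real measure) \<Otimes>\<^sub>M lborel) (PiM ?I (\<lambda>_. lborel :: real measure) \<Otimes>\<^sub>M lborel)"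
      using measurable_compose[OF measurable_fst comp] by (intro measurable_Pair) auto
    from measurable_compose[OF this upd] show ?thesis by simp
  qed
  define g where "g t = (\<integral>\<^sup>+y. f (t(Suc (Suc m) := t (Suc m) + y)) \<partial>lborel)" for t
  have g: "g \<in> borel_measurable (lborel_vec (Suc m))"
    unfolding g_def[abs_def]
    using measurable_compose[OF upd' f] by (intro sigma_finite_measure.borel_measurable_nn_integral) (auto simp: case_prod_beta sigma_finite_lborel simp del: fun_upd_apply)
  have "(\<integral>\<^sup>+t. f t \<partial>lborel_vec (Suc (Suc m))) = (\<integral>\<^sup>+t. (\<integral>\<^sup>+y. f (t(Suc (Suc m) := y)) \<partial>lborel) \<partial>lborel_vec (Suc m))"
    using lborel_PiM.product_nn_integral_insert[of ?I "Suc (Suc m)" f] f unfolding ins by simp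
  also have "\<dots> = (\<integral>\<^sup>+t. g t \<partial>lborel_vec (Suc m))"
  proof (rule nn_integral_cong)
    fix t :: "nat \<Rightarrow> real" assume t: "t \<in> space (lborel_vec (Suc m))"
    have "(\<lambda>y. f (t(Suc (Suc m) := y))) \<in> borel_measurable borel"
      using measurable_compose[OF measurable_compose[OF measurable_Pair1'[OF t] upd] f] by (simp del: fun_upd_apply)
    from nn_integral_lborel_shift[OF this, of "t (Suc m)"]
    show "(\<integral>\<^sup>+y. f (t(Suc (Suc m) := y)) \<partial>lborel) = g t" unfolding g_def .
  qed
  also have "\<dots> = (\<integral>\<^sup>+u. (\<integral>\<^sup>+x. g (\<lambda>i\<in>{1..Suc m}. u + (\<Sum>l\<in>{1..<i}. x l)) \<partial>PiM {1..<Suc m} (\<lambda>_. lborel)) \<partial>lborel)"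
    by (rule Suc.IH[OF g])
  also have "\<dots> = (\<integral>\<^sup>+u. (\<integral>\<^sup>+x. f (\<lambda>i\<in>{1..Suc (Suc m)}. u + (\<Sum>l\<in>{1..<i}. x l)) \<partial>PiM {1..<Suc (Suc m)} (\<lambda>_. lborel)) \<partial>lborel)"
  proof (rule nn_integral_cong)
    fix u :: real
    let ?T = "\<lambda>x. (\<lambda>i\<in>{1..Suc (Suc m)}. u + (\<Sum>l\<in>{1..<i}. x l)) :: nat \<Rightarrow> real"
    have "?T \<in> measurable (PiM {1..<Suc (Suc m)} (\<lambda>_. lborel)) (lborel_vec (Suc (Suc m)))"
      by (intro measurable_restrict) (auto intro!: borel_measurable_add borel_measurable_sum measurable_PiM_component_real)
    then have "(\<lambda>x. f (?T x)) \<in> borel_measurable (PiM {1..<Suc (Suc m)} (\<lambda>_. lborel))"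
      by (rule measurable_compose[OF _ f])
    then have "(\<integral>\<^sup>+x. f (?T x) \<partial>PiM {1..<Suc (Suc m)} (\<lambda>_. lborel)) =
      (\<integral>\<^sup>+x. (\<integral>\<^sup>+y. f (?T (x(Suc m := y))) \<partial>lborel) \<partial>PiM {1..<Suc m} (\<lambda>_. lborel))"
      unfolding ins' by (intro lborel_PiM.product_nn_integral_insert) auto
    also have "\<dots> = (\<integral>\<^sup>+x. g (\<lambda>i\<in>{1..Suc m}. u + (\<Sum>l\<in>{1..<i}. x l)) \<partial>PiM {1..<Suc m} (\<lambda>_. lborel))"
      unfolding g_def
    proof (intro nn_integral_cong arg_cong[where f = f] ext)
      fix x :: "nat \<Rightarrow> real" and y i
      have "(\<Sum>l\<in>{1..<i}. (x(Suc m := y)) l) = (\<Sum>l\<in>{1..<i}. x l)" if "i \<le> Suc m"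
        using that by (intro sum.cong) auto
      moreover have "(\<Sum>l\<in>{1..<Suc m}. (x(Suc m := y)) l) = (\<Sum>l\<in>{1..<Suc m}. x l)"
        by (intro sum.cong) auto
      ultimately show "?T (x(Suc m := y)) i = ((\<lambda>i\<in>{1..Suc m}. u + (\<Sum>l\<in>{1..<i}. x l))
        (Suc (Suc m) := (\<lambda>i\<in>{1..Suc m}. u + (\<Sum>l\<in>{1..<i}. x l)) (Suc m) + y)) i"
        by (auto simp: le_Suc_eq)
    qed
    finally show "(\<integral>\<^sup>+x. g (\<lambda>i\<in>{1..Suc m}. u + (\<Sum>l\<in>{1..<i}. x l)) \<partial>PiM {1..<Suc m} (\<lambda>_. lborel)) =
      (\<integral>\<^sup>+x. f (?T x) \<partial>PiM {1..<Suc (Suc m)} (\<lambda>_. lborel))" ..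
  qed
  finally show ?case .
qed

text \<open>In gap coordinates the product over pairs is \<open>gap_kernel\<close>, the gaps lie in
  (0, 1] and the first point in (0, 1). The condition on the exponents concerns every run of
  consecutive gaps, that is every cluster of neighbouring points that may collapse.\<close>

lemma nn_integral_simplex_prod_powr_finite:
  assumes b: "\<And>j. 0 \<le> b j" and n: "1 \<le> n"
    and w: "\<And>a c. a < c \<Longrightarrow> c - a < n \<Longrightarrow> gap_weight b a c < real (c - a)"
    and meas: "ordered_simplex n \<in> sets (lborel_vec n)"
  shows "(\<integral>\<^sup>+t. ennreal (\<Prod>p\<in>{1..n}. \<Prod>k\<in>{1..<p}. (t p - t k) powr (- b (p - k))) * indicator (ordered_simplex n) t \<partial>lborel_vec n) < \<infinity>"
proof -
  obtain m where m: "n = Suc m" using n by (cases n) auto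
  define f where "f t = ennreal (\<Prod>p\<in>{1..n}. \<Prod>k\<in>{1..<p}. (t p - t k) powr (- b (p - k))) * indicator (ordered_simplex n) t" for t
  have f: "f \<in> borel_measurable (lborel_vec (Suc m))"
    unfolding f_def[abs_def] m[symmetric]
    by (intro borel_measurable_times_ennreal measurable_compose[OF _ measurable_ennreal] borel_measurable_prod
        powr_real_measurable borel_measurable_diff measurable_PiM_component_real borel_measurable_const
        borel_measurable_indicator meas) auto
  \<comment> \<open>The n = m + 1 points leave m gaps, indexed by {1..<Suc m}.\<close>
  obtain C where C: "0 \<le> C" "\<And>y. y > 0 \<Longrightarrow> (\<integral>\<^sup>+x. gap_integrand b 1 (Suc m) y x \<partial>PiM {1..<Suc m} (\<lambda>_. lborel))
    \<le> ennreal (C * y powr (real (Suc m - 1) - gap_weight b 1 (Suc m)))"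
    using nn_integral_gap_integrand_le[of b m 1 "Suc m", OF b] w m by auto
  let ?T = "\<lambda>u x. (\<lambda>i\<in>{1..Suc m}. u + (\<Sum>l\<in>{1..<i}. x l)) :: nat \<Rightarrow> real"
  have fT: "f (?T u x) \<le> gap_integrand b 1 (Suc m) 1 x * indicator {0<..<1::real} u" for u x
  proof (cases "?T u x \<in> ordered_simplex n")
    case True
    have rng: "0 < ?T u x i \<and> ?T u x i < 1" if "i \<in> {1..n}" for i
      using True that unfolding ordered_simplex_def PiE_iff by auto
    have smono: "?T u x i < ?T u x j" if "i \<in> {1..n}" "j \<in> {1..n}" "i < j" for i j
      using True that unfolding ordered_simplex_def strict_mono_on_def by auto
    have u: "u \<in> {0<..<1}" using rng[of 1] m by simp
    have diff: "?T u x p - ?T u x k = (\<Sum>l\<in>{k..<p}. x l)" if "1 \<le> k" "k \<le> p" "p \<le> n" for p k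
      using that m sum.atLeastLessThan_concat[of 1 k p x] by simp
    have gap: "x l \<in> {0<..1}" if "l \<in> {1..<Suc m}" for l
    proof -
      have "x l = ?T u x (Suc l) - ?T u x l" using that m diff[of l "Suc l"] by simp
      moreover have "?T u x l < ?T u x (Suc l)" "?T u x (Suc l) < 1" "0 < ?T u x l"
        using smono[of l "Suc l"] rng[of l] rng[of "Suc l"] that m by simp_all
      ultimately show ?thesis by (simp only: greaterThanAtMost_iff) linarith
    qed
    have "(\<Prod>p\<in>{1..n}. \<Prod>k\<in>{1..<p}. (?T u x p - ?T u x k) powr (- b (p - k))) =
      (\<Prod>p\<in>{1..n}. \<Prod>k\<in>{1..<p}. (\<Sum>l\<in>{k..<p}. x l) powr (- b (p - k)))"
      by (intro prod.cong refl, subst diff) auto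
    also have "\<dots> = (\<Prod>(p, k)\<in>Sigma {1..n} (\<lambda>p. {1..<p}). (\<Sum>l\<in>{k..<p}. x l) powr (- b (p - k)))"
      by (subst prod.Sigma) auto
    \<comment> \<open>The pair k < p of points corresponds to the block of gaps k, ..., p -
      1.\<close>
    also have "\<dots> = gap_kernel b 1 (Suc m) x"
      unfolding gap_kernel_def
    proof (rule prod.reindex_bij_witness[of _ "\<lambda>(p, q). (Suc q, p)" "\<lambda>(p, k). (k, p - 1)"])
      fix z assume "z \<in> Sigma {1..n} (\<lambda>p. {1..<p})"
      then obtain p k where z: "z = (p, k)" "1 \<le> k" "k < p" "p \<le> n" by auto
      then have "{k..p - 1} = {k..<p}" by auto
      then show "(case case z of (p, k) \<Rightarrow> (k, p - 1) of (p, q) \<Rightarrow> (\<Sum>l\<in>{p..q}. x l) powr (- b (q - p + 1))) =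
        (case z of (p, k) \<Rightarrow> (\<Sum>l\<in>{k..<p}. x l) powr (- b (p - k)))" using z by (simp add: Suc_diff_Suc)
    qed (use m in \<open>auto simp: gap_pairs_def\<close>)
    finally have "f (?T u x) = ennreal (gap_kernel b 1 (Suc m) x)" unfolding f_def using True by simp
    also have "\<dots> = gap_integrand b 1 (Suc m) 1 x * indicator {0<..<1::real} u"
      using u gap unfolding gap_integrand_def gap_box_def by auto
    finally show ?thesis by simp
  next
    case False
    then have "f (?T u x) = 0" unfolding f_def by simp
    then show ?thesis by simp
  qed
  have "(\<integral>\<^sup>+t. f t \<partial>lborel_vec (Suc m)) = (\<integral>\<^sup>+u. (\<integral>\<^sup>+x. f (?T u x) \<partial>PiM {1..<Suc m} (\<lambda>_. lborel)) \<partial>lborel)"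
    by (rule nn_integral_PiM_gaps[OF f])
  also have "\<dots> \<le> (\<integral>\<^sup>+u. (\<integral>\<^sup>+x. gap_integrand b 1 (Suc m) 1 x * indicator {0<..<1::real} u \<partial>PiM {1..<Suc m} (\<lambda>_. lborel)) \<partial>lborel)"
    by (intro nn_integral_mono fT)
  also have "\<dots> = (\<integral>\<^sup>+u. (\<integral>\<^sup>+x. gap_integrand b 1 (Suc m) 1 x \<partial>PiM {1..<Suc m} (\<lambda>_. lborel)) * indicator {0<..<1::real} u \<partial>lborel)"
    by (intro nn_integral_cong nn_integral_multc borel_measurable_gap_integrand) auto
  also have "\<dots> = (\<integral>\<^sup>+x. gap_integrand b 1 (Suc m) 1 x \<partial>PiM {1..<Suc m} (\<lambda>_. lborel))"
    by (subst nn_integral_cmult_indicator) auto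
  also have "\<dots> \<le> ennreal (C * 1 powr (real (Suc m - 1) - gap_weight b 1 (Suc m)))" by (rule C(2)) simp
  also have "\<dots> < \<infinity>" by simp
  finally show ?thesis unfolding m f_def .
qed

section \<open>Subcriticality\<close>

lemma d_coeff_nonneg: "0 \<le> \<sigma>2 \<Longrightarrow> 0 \<le> d_coeff \<sigma>2 \<nu> m"
  unfolding d_coeff_def by (intro add_nonneg_nonneg integral_nonneg_AE AE_I2) auto

text \<open>The number phi(-im), which is real; the real part only adjusts the type.\<close>

definition Phi :: "real \<Rightarrow> real measure \<Rightarrow> nat \<Rightarrow> real" where
  "Phi \<sigma>2 \<nu> m = Re (id_exponent \<sigma>2 \<nu> (- \<i> * of_nat m))"

lemma id_exponent_eq_Phi: "id_exponent \<sigma>2 \<nu> (- \<i> * of_nat m) = of_real (Phi \<sigma>2 \<nu> m)"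
  unfolding Phi_def using id_exponent_imaginary[of \<sigma>2 \<nu> "real m"] by simp

lemma Phi_eq: "Phi \<sigma>2 \<nu> m = \<sigma>2 / 2 * ((real m)\<^sup>2 - real m) + (LINT u|\<nu>. exp (real m * u) - 1 - real m * (exp u - 1))"
  unfolding Phi_def using id_exponent_imaginary[of \<sigma>2 \<nu> "real m"] by simp

context levy
begin

lemma integrable_exponent:
  assumes "m \<le> n" shows "integrable \<nu> (\<lambda>u. exp (real m * u) - 1 - real m * (exp u - 1))"
proof -
  have "integrable \<nu> (\<lambda>u. Re (F (- \<i> * of_real (real m)) u))" using assms by (intro integrable_Re integrable_F) auto
  also have "(\<lambda>u. Re (F (- \<i> * of_real (real m)) u)) = (\<lambda>u. exp (real m * u) - 1 - real m * (exp u - 1))"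
    unfolding F_def by (auto simp: fun_eq_iff Re_exp)
  finally show ?thesis .
qed

text \<open>Under the integral, e^((m+2)u) - 2 e^((m+1)u) + e^(mu) = e^(mu) (e^u - 1)^2, while the
  compensators, affine in m, cancel. The quadratic Gaussian part contributes \<sigma>^2.\<close>

lemma d_coeff_second_difference:
  assumes "Suc (Suc m) \<le> n"
  shows "d_coeff \<sigma>2 \<nu> (Suc m) = Phi \<sigma>2 \<nu> (Suc (Suc m)) - 2 * Phi \<sigma>2 \<nu> (Suc m) + Phi \<sigma>2 \<nu> m"
proof -
  let ?g = "\<lambda>m u. exp (real m * u) - 1 - real m * (exp u - 1)"
  have i: "integrable \<nu> (?g (Suc (Suc m)))" "integrable \<nu> (?g (Suc m))" "integrable \<nu> (?g m)"
    by (rule integrable_exponent, use assms in simp)+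
  have "(LINT u|\<nu>. ?g (Suc (Suc m)) u) - 2 * (LINT u|\<nu>. ?g (Suc m) u) + (LINT u|\<nu>. ?g m u) =
    (LINT u|\<nu>. ?g (Suc (Suc m)) u - 2 * ?g (Suc m) u + ?g m u)"
  proof -
    have gen: "(LINT u|\<nu>. f u) - 2 * (LINT u|\<nu>. g u) + (LINT u|\<nu>. h u) = (LINT u|\<nu>. f u - 2 * g u + h u)"
      if "integrable \<nu> f" "integrable \<nu> g" "integrable \<nu> h" for f g h :: "real \<Rightarrow> real"
      using that by simp
    show ?thesis by (rule gen[OF i])
  qed
  also have "\<dots> = (LINT u|\<nu>. exp ((real (Suc m) - 1) * u) * (exp u - 1)\<^sup>2)"
  proof (rule Bochner_Integration.integral_cong[OF refl])
    fix u :: real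
    have 1: "exp (real (Suc (Suc m)) * u) = exp (real m * u) * (exp u)\<^sup>2"
      by (simp add: exp_add[symmetric] power2_eq_square algebra_simps)
    have 2: "exp (real (Suc m) * u) = exp (real m * u) * exp u"
      by (simp add: exp_add[symmetric] algebra_simps)
    show "?g (Suc (Suc m)) u - 2 * ?g (Suc m) u + ?g m u = exp ((real (Suc m) - 1) * u) * (exp u - 1)\<^sup>2"
      unfolding 1 2 by (simp add: power2_eq_square algebra_simps)
  qed
  finally have 3: "(LINT u|\<nu>. exp ((real (Suc m) - 1) * u) * (exp u - 1)\<^sup>2) =
    (LINT u|\<nu>. ?g (Suc (Suc m)) u) - 2 * (LINT u|\<nu>. ?g (Suc m) u) + (LINT u|\<nu>. ?g m u)" by simp
  show ?thesis unfolding d_coeff_def 3 Phi_eq by (simp add: power2_eq_square field_simps)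
qed

lemma Phi_0: "Phi \<sigma>2 \<nu> 0 = 0" and Phi_1: "Phi \<sigma>2 \<nu> (Suc 0) = 0"
  unfolding Phi_eq by simp_all

text \<open>The second differences telescope from Phi(1) - Phi(0) = 0, so there is no boundary
  term.\<close>

lemma Phi_Suc_diff: "Suc c \<le> n \<Longrightarrow> Phi \<sigma>2 \<nu> (Suc c) - Phi \<sigma>2 \<nu> c = (\<Sum>m\<in>{1..c}. d_coeff \<sigma>2 \<nu> m)"
proof (induction c)
  case (Suc c)
  then show ?case using d_coeff_second_difference[of c \<sigma>2] by simp
qed (simp add: Phi_0 Phi_1)

lemma Phi_eq_pair_exponent: "c \<le> n \<Longrightarrow> Phi \<sigma>2 \<nu> c = pair_exponent (d_coeff \<sigma>2 \<nu>) c"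
proof (induction c)
  case (Suc c)
  then show ?case using Phi_Suc_diff[of c \<sigma>2] by (simp add: pair_exponent_def)
qed (simp add: Phi_0 pair_exponent_def)

text \<open>The continuation of the characteristic function is exp(\<mu> phi(z) w). On the strip of
  height m \<le> n it is continuous, holomorphic inside, and bounded, since Re phi is bounded above
  there.\<close>

lemma exponential_moment:
  fixes X :: "'a \<Rightarrow> real"
  assumes "prob_space \<Omega>" and X: "X \<in> borel_measurable \<Omega>" and \<sigma>: "0 \<le> \<sigma>2" and \<mu>: "0 \<le> \<mu>" and w: "0 \<le> w"
    and char: "\<And>q::real. (CLINT x|\<Omega>. exp (\<i> * of_real q * of_real (X x))) = exp (of_real \<mu> * id_exponent \<sigma>2 \<nu> (of_real q) * of_real w)"
    and m: "1 \<le> m" "m \<le> n"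
  shows "(\<integral>\<^sup>+x. ennreal (exp (real m * X x)) \<partial>\<Omega>) = ennreal (exp (\<mu> * Phi \<sigma>2 \<nu> m * w))"
proof -
  interpret prob_space \<Omega> by fact
  obtain B where B: "\<And>z. - real n \<le> Im z \<Longrightarrow> Im z \<le> 0 \<Longrightarrow> Re (id_exponent \<sigma>2 \<nu> z) \<le> B"
    using Re_id_exponent_bound[OF \<sigma>] by blast
  let ?f = "\<lambda>z. exp (of_real \<mu> * id_exponent \<sigma>2 \<nu> z * of_real w)"
  show ?thesis
  proof (rule exponential_moment_of_char[OF X, where f = ?f and B = "exp (\<mu> * B * w)"])
    show "0 < real m" using m by simp
    show "continuous_on {z. - real m \<le> Im z \<and> Im z \<le> 0} ?f"
      using m by (intro continuous_intros continuous_on_subset[OF continuous_on_id_exponent]) auto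
    show "?f field_differentiable at z" if z: "- real m < Im z" "Im z < 0" for z
    proof -
      have "id_exponent \<sigma>2 \<nu> field_differentiable at z" using z m by (intro id_exponent_field_differentiable) auto
      then obtain D where D: "(id_exponent \<sigma>2 \<nu> has_field_derivative D) (at z)" unfolding field_differentiable_def by blast
      have "(?f has_field_derivative ?f z * (of_real \<mu> * D * of_real w)) (at z)"
        using D by (auto intro!: derivative_eq_intros)
      then show ?thesis unfolding field_differentiable_def by blast
    qed
    show "norm (?f z) \<le> exp (\<mu> * B * w)" if "- real m \<le> Im z" "Im z \<le> 0" for z
    proof -
      have "Re (id_exponent \<sigma>2 \<nu> z) \<le> B" using that m by (intro B) auto
      then have "\<mu> * Re (id_exponent \<sigma>2 \<nu> z) * w \<le> \<mu> * B * w" using \<mu> w by (intro mult_right_mono mult_left_mono)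
      then show ?thesis by (simp add: norm_exp_eq_Re)
    qed
    show "?f (- \<i> * of_real (real m)) = of_real (exp (\<mu> * Phi \<sigma>2 \<nu> m * w))"
      using id_exponent_eq_Phi[of \<sigma>2 \<nu> m] by (simp add: exp_of_real[symmetric])
  qed (rule char)
qed

end

text \<open>A run of c - a gaps joins c - a + 1 points, and blocks of gaps are pairs of points; the
  induction adds the last point.\<close>

lemma gap_weight_eq_pair_exponent:
  "a \<le> c \<Longrightarrow> gap_weight b a c = pair_exponent b (Suc (c - a))"
proof (induction c rule: dec_induct)
  case base
  have "gap_pairs a a = {}" by (auto simp: gap_pairs_def)
  then show ?case by (simp add: gap_weight_def pair_exponent_def)
next
  case (step c)
  have un: "gap_pairs a (Suc c) = gap_pairs a c \<union> (\<lambda>p. (p, c)) ` {a..c}" using step by (auto simp: gap_pairs_def less_Suc_eq)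
  have "gap_weight b a (Suc c) = gap_weight b a c + (\<Sum>p\<in>{a..c}. b (c - p + 1))"
    unfolding gap_weight_def un by (subst sum.union_disjoint[OF finite_gap_pairs]) (auto simp: gap_pairs_def sum.reindex inj_on_def)
  also have "(\<Sum>p\<in>{a..c}. b (c - p + 1)) = (\<Sum>m\<in>{1..Suc (c - a)}. b m)"
    using step by (intro sum.reindex_bij_witness[of _ "\<lambda>m. c + 1 - m" "\<lambda>p. c - p + 1"]) auto
  finally show ?case using step by (simp add: pair_exponent_def Suc_diff_le)
qed

text \<open>The partial sums form a convex sequence with first increment a 0 = 0. If the sum up to m
  reached m - 1, its m - 1 other increments would average at least 1, so the last of them and all
  later ones would be at least 1, and the sum up to n would reach n - 1.\<close>

lemma convex_growth_bound:
  fixes a :: "nat \<Rightarrow> real"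
  assumes mono: "\<And>i j. i \<le> j \<Longrightarrow> a i \<le> a j" and a0: "a 0 = 0" and tot: "(\<Sum>k<n. a k) < real n - 1"
    and m: "2 \<le> m" "m \<le> n"
  shows "(\<Sum>k<m. a k) < real m - 1"
proof (rule ccontr)
  assume "\<not> ?thesis"
  then have ge: "real m - 1 \<le> (\<Sum>k<m. a k)" by simp
  obtain m' where m': "m = Suc m'" "1 \<le> m'" using m by (cases m) auto
  have "(\<Sum>k<m. a k) = (\<Sum>k<m'. a (Suc k))" unfolding m'(1) sum.lessThan_Suc_shift using a0 by simp
  also have "\<dots> \<le> (\<Sum>k<m'. a m')" by (intro sum_mono mono) auto
  also have "\<dots> = real m' * a m'" by simp
  finally have "(\<Sum>k<m. a k) \<le> real m' * a m'" .
  moreover have "real m - 1 = real m'" using m' by simp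
  ultimately have "real m' * 1 \<le> real m' * a m'" using ge by linarith
  then have am: "1 \<le> a m'" using m'(2) by (subst (asm) mult_le_cancel_left_pos) auto
  have "real n - 1 = (real m - 1) + (\<Sum>k\<in>{m..<n}. 1)" using m by (simp add: of_nat_diff)
  also have "\<dots> \<le> (\<Sum>k<m. a k) + (\<Sum>k\<in>{m..<n}. a k)"
  proof (intro add_mono ge sum_mono)
    fix k assume "k \<in> {m..<n}"
    then have "a m' \<le> a k" using m' by (intro mono) auto
    then show "1 \<le> a k" using am by simp
  qed
  also have "\<dots> = (\<Sum>k<n. a k)"
    using sum.atLeastLessThan_concat[of 0 m n a] m by (simp add: lessThan_atLeast0)
  finally show False using tot by simp
qed

text \<open>Finitely many strict inequalities survive a small perturbation. The inner \<delta> is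
  reserved for the factor -log r, the outer 1 + \<delta> for the exponent in the lower bound of
  r.\<close>

lemma pair_exponent_subcritical:
  assumes d: "\<And>j. 0 \<le> d j" and \<mu>: "0 \<le> \<mu>" and crit: "\<mu> * pair_exponent d n < real n - 1"
  obtains \<delta> where "0 < \<delta>"
    "\<And>m. 2 \<le> m \<Longrightarrow> m \<le> n \<Longrightarrow> pair_exponent (\<lambda>j. (1 + \<delta>) * (\<mu> * d j + \<delta>)) m < real m - 1"
proof -
  have sub: "\<mu> * pair_exponent d m < real m - 1" if m: "2 \<le> m" "m \<le> n" for m
  proof -
    have "(\<Sum>k<m. \<mu> * (\<Sum>j\<in>{1..k}. d j)) < real m - 1"
    proof (rule convex_growth_bound[OF _ _ _ m])
      show "(\<Sum>k<n. \<mu> * (\<Sum>j\<in>{1..k}. d j)) < real n - 1" using crit by (simp add: pair_exponent_def sum_distrib_left)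
      show "\<mu> * (\<Sum>k\<in>{1..i}. d k) \<le> \<mu> * (\<Sum>k\<in>{1..j}. d k)" if "i \<le> j" for i j
        using that \<mu> d by (intro mult_left_mono sum_mono2) auto
    qed simp
    then show ?thesis by (simp add: pair_exponent_def sum_distrib_left)
  qed
  have lin: "pair_exponent (\<lambda>j. (1 + \<delta>) * (\<mu> * d j + \<delta>)) m = (1 + \<delta>) * (\<mu> * pair_exponent d m + \<delta> * pair_exponent (\<lambda>_. 1) m)" for \<delta> m
    unfolding pair_exponent_def by (simp add: sum_distrib_left sum.distrib algebra_simps)
  have "\<forall>\<^sub>F \<delta> in at_right 0. \<forall>m\<in>{2..n}. (1 + \<delta>) * (\<mu> * pair_exponent d m + \<delta> * pair_exponent (\<lambda>_. 1) m) < real m - 1"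
  proof (rule eventually_ball_finite)
    show "\<forall>m\<in>{2..n}. \<forall>\<^sub>F \<delta> in at_right 0. (1 + \<delta>) * (\<mu> * pair_exponent d m + \<delta> * pair_exponent (\<lambda>_. 1) m) < real m - 1"
    proof
      fix m assume m: "m \<in> {2..n}"
      have "((\<lambda>\<delta>. (1 + \<delta>) * (\<mu> * pair_exponent d m + \<delta> * pair_exponent (\<lambda>_. 1) m)) \<longlongrightarrow>
        (1 + 0) * (\<mu> * pair_exponent d m + 0 * pair_exponent (\<lambda>_. 1) m)) (at_right 0)"
        by (intro tendsto_intros)
      moreover have "(1 + 0) * (\<mu> * pair_exponent d m + 0 * pair_exponent (\<lambda>_. 1) m) < real m - 1" using sub[of m] m by simp
      ultimately show "\<forall>\<^sub>F \<delta> in at_right 0. (1 + \<delta>) * (\<mu> * pair_exponent d m + \<delta> * pair_exponent (\<lambda>_. 1) m) < real m - 1"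
        by (rule order_tendstoD(2))
    qed
  qed simp
  then obtain b where b: "b > 0" "\<And>\<delta>. 0 < \<delta> \<Longrightarrow> \<delta> < b \<Longrightarrow> \<forall>m\<in>{2..n}. (1 + \<delta>) * (\<mu> * pair_exponent d m + \<delta> * pair_exponent (\<lambda>_. 1) m) < real m - 1"
    unfolding eventually_at_right_field by auto
  show thesis
    by (rule that[of "b / 2"]) (use b(1) b(2)[of "b / 2"] in \<open>auto simp: lin\<close>)
qed

section \<open>Moments of the field\<close>

lemma rank_gap_strict_mono:
  fixes t :: "nat \<Rightarrow> real"
  assumes t: "strict_mono_on {1..m} t" and ij: "i \<in> {1..m}" "j \<in> {1..m}"
  shows "rank_gap {1..m} t i j = j - i"
proof -
  have "{l\<in>{1..m}. t i < t l \<and> t l \<le> t j} = {i<..j}"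
    using ij by (auto simp: strict_mono_on_less[OF t] strict_mono_on_less_eq[OF t])
  then show ?thesis by (simp add: rank_gap_def)
qed

lemma member_le_prod:
  fixes f :: "'i \<Rightarrow> real"
  assumes "finite A" "x \<in> A" "\<And>y. y \<in> A \<Longrightarrow> 1 \<le> f y"
  shows "f x \<le> prod f A"
proof -
  have "f x * 1 \<le> f x * prod f (A - {x})"
    using assms order_trans[OF zero_le_one assms(3)[OF assms(2)]] by (intro mult_left_mono prod_ge_1) auto
  then show ?thesis using prod.remove[OF assms(1,2), of f] by simp
qed

locale cascade = levy \<nu> n + scale r +
  random_measure \<Omega> "intensity_measure r" "\<lambda>q. of_real \<mu> * id_exponent \<sigma>2 \<nu> q" P
  for \<nu> :: "real measure" and n :: nat and r :: "real \<Rightarrow> real" and \<Omega> :: "'a measure"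
    and \<mu> :: real and \<sigma>2 :: real and P :: "(real \<times> real) set \<Rightarrow> 'a \<Rightarrow> real" +
  assumes \<sigma>2: "0 \<le> \<sigma>2" and \<mu>: "0 < \<mu>" and field: "measurable_field \<Omega> P"
    and crit: "real n - \<mu> * Re (id_exponent \<sigma>2 \<nu> (- \<i> * of_nat n)) > 1"
begin

abbreviation d :: "nat \<Rightarrow> real" where "d \<equiv> d_coeff \<sigma>2 \<nu>"
abbreviation \<rho> :: "(real \<times> real) measure" where "\<rho> \<equiv> intensity_measure r"

text \<open>Only pairs with t i < t j carry weight, so a double sum over \<open>I\<close> counts
  each pair once. Through the rank gap the weight depends on the whole configuration.\<close>

definition pair_weight :: "'i set \<Rightarrow> ('i \<Rightarrow> real) \<Rightarrow> 'i \<Rightarrow> 'i \<Rightarrow> real" where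
  "pair_weight I t i j = (if t i < t j then \<mu> * d (rank_gap I t i j) else 0)"

lemma d_nonneg: "0 \<le> d m" by (rule d_coeff_nonneg[OF \<sigma>2])

lemma pair_weight_nonneg: "0 \<le> pair_weight I t i j"
  using \<mu> d_nonneg by (simp add: pair_weight_def)

definition log_moment :: "real \<Rightarrow> 'i set \<Rightarrow> ('i \<Rightarrow> real) \<Rightarrow> real" where
  "log_moment \<epsilon> I t = (\<Sum>i\<in>I. \<Sum>j\<in>I. pair_weight I t i j * measure \<rho> (log_cone \<epsilon> (t i) \<inter> log_cone \<epsilon> (t j)))"

text \<open>The index set \<open>J\<close> of a nonempty cell is an interval in the order of the
  points, so rank gaps computed in \<open>J\<close> and in \<open>I\<close> coincide. Hence one and
  the same \<open>pair_weight\<close> sums to the exponent of every nonempty cell.\<close>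

lemma nn_integral_exp_field:
  assumes I: "finite I" "card I \<le> n" and t: "inj_on t I" and \<epsilon>: "0 < \<epsilon>" "\<epsilon> \<le> 1"
  shows "(\<integral>\<^sup>+x. ennreal (exp (\<Sum>i\<in>I. omega_field P \<epsilon> (t i) x)) \<partial>\<Omega>) = ennreal (exp (log_moment \<epsilon> I t))"
  unfolding omega_field_def log_moment_def
proof (rule nn_integral_exp_overlapping[where \<Phi> = "\<lambda>m. \<mu> * Phi \<sigma>2 \<nu> m"])
  show "finite I" by fact
  show "log_cone \<epsilon> (t i) \<in> sets \<rho>" for i by (rule sets_log_cone[OF \<epsilon>])
  show "emeasure \<rho> (log_cone \<epsilon> (t i)) < \<infinity>" for i by (rule emeasure_log_cone_finite[OF \<epsilon>])
  fix B m assume B: "B \<in> sets \<rho>" "emeasure \<rho> B < \<infinity>" and m: "1 \<le> m" "m \<le> card I"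
  show "(\<integral>\<^sup>+x. ennreal (exp (real m * P B x)) \<partial>\<Omega>) = ennreal (exp (\<mu> * Phi \<sigma>2 \<nu> m * measure \<rho> B))"
    using m I by (intro exponential_moment prob_space_axioms P_measurable B \<sigma>2 less_imp_le[OF \<mu>] P_char) auto
next
  fix J assume J: "J \<in> cells I" "venn_cell (\<lambda>i. log_cone \<epsilon> (t i)) I J \<noteq> {}"
  have JI: "J \<subseteq> I" using J by (auto simp: cells_def)
  then have fJ: "finite J" "card J \<le> n" using I finite_subset card_mono[of I J] by auto
  obtain z where z: "\<And>i. i \<in> J \<Longrightarrow> z \<in> log_cone \<epsilon> (t i)" "\<And>i. i \<in> I - J \<Longrightarrow> z \<notin> log_cone \<epsilon> (t i)"
    using J(2) unfolding venn_cell_def by blast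
  \<comment> \<open>At a given height the cones over all points have the same width; a location
    within half that width of both t i and t j is so for each point between them.\<close>
  have conv: "l \<in> J" if "i \<in> J" "j \<in> J" "l \<in> I" "t i < t l" "t l \<le> t j" for i j l
  proof (rule ccontr)
    assume "l \<notin> J"
    then have "z \<notin> log_cone \<epsilon> (t l)" using z(2) that by auto
    moreover have "z \<in> log_cone \<epsilon> (t l)"
    proof -
      have "\<epsilon> \<le> snd z" "\<bar>fst z - t i\<bar> \<le> min (snd z) 1 / 2" "\<bar>fst z - t j\<bar> \<le> min (snd z) 1 / 2"
        using z(1)[OF that(1)] z(1)[OF that(2)] unfolding log_cone_altdef[OF \<epsilon>(2)] by blast+
      moreover from this have "\<bar>fst z - t l\<bar> \<le> min (snd z) 1 / 2" using that(4,5) by linarith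
      ultimately show ?thesis unfolding log_cone_altdef[OF \<epsilon>(2)] by blast
    qed
    ultimately show False by simp
  qed
  have rg: "rank_gap I t i j = rank_gap J t i j" if "i \<in> J" "j \<in> J" for i j
  proof -
    have "{l \<in> I. t i < t l \<and> t l \<le> t j} = {l \<in> J. t i < t l \<and> t l \<le> t j}" using conv[OF that] JI by auto
    then show ?thesis by (simp add: rank_gap_def)
  qed
  have "\<mu> * Phi \<sigma>2 \<nu> (card J) = \<mu> * (\<Sum>i\<in>J. \<Sum>j\<in>J. if t i < t j then d (rank_gap J t i j) else 0)"
    using Phi_eq_pair_exponent[OF fJ(2)] pair_exponent_eq_sum[OF fJ(1) inj_on_subset[OF t JI]] by simp
  also have "\<dots> = (\<Sum>i\<in>J. \<Sum>j\<in>J. pair_weight I t i j)"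
    unfolding sum_distrib_left pair_weight_def by (intro sum.cong refl) (simp add: rg)
  finally show "\<mu> * Phi \<sigma>2 \<nu> (card J) = (\<Sum>i\<in>J. \<Sum>j\<in>J. pair_weight I t i j)" .
qed

lemma log_moment_antimono:
  assumes "0 < \<epsilon>" "\<epsilon> \<le> \<epsilon>'" "\<epsilon>' \<le> 1"
  shows "log_moment \<epsilon>' I t \<le> log_moment \<epsilon> I t"
  unfolding log_moment_def
proof (intro sum_mono mult_left_mono pair_weight_nonneg)
  fix i j
  have e: "0 < \<epsilon>" "\<epsilon> \<le> 1" using assms by auto
  show "measure \<rho> (log_cone \<epsilon>' (t i) \<inter> log_cone \<epsilon>' (t j)) \<le> measure \<rho> (log_cone \<epsilon> (t i) \<inter> log_cone \<epsilon> (t j))"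
  proof (rule measure_mono_fmeasurable)
    show "log_cone \<epsilon>' (t i) \<inter> log_cone \<epsilon>' (t j) \<subseteq> log_cone \<epsilon> (t i) \<inter> log_cone \<epsilon> (t j)"
      using log_cone_antimono[OF assms(2,3)] by blast
    show "log_cone \<epsilon>' (t i) \<inter> log_cone \<epsilon>' (t j) \<in> sets \<rho>" using sets_log_cone[of \<epsilon>'] assms by auto
    show "log_cone \<epsilon> (t i) \<inter> log_cone \<epsilon> (t j) \<in> fmeasurable \<rho>"
      using sets_log_cone[OF e] emeasure_log_cone_finite[OF e]
      by (intro fmeasurable_Int_fmeasurable fmeasurableI) auto
  qed
qed

text \<open>Log r cut off to (0, 1), hence Borel on the whole line and of one sign.\<close>

definition L0 :: "real \<Rightarrow> real" where "L0 x = (if 0 < x \<and> x < 1 then L x else 0)"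

lemma borel_measurable_L0 [measurable]: "L0 \<in> borel_measurable borel"
proof -
  have "continuous_on {0<..<1} L"
    unfolding L_def[abs_def] using r_pos by (intro continuous_on_ln continuous_on_r) force
  then have "(\<lambda>x. indicator {0<..<1} x *\<^sub>R L x) \<in> borel_measurable borel"
    by (intro borel_measurable_continuous_on_indicator) auto
  also have "(\<lambda>x. indicator {0<..<1} x *\<^sub>R L x) = L0" by (auto simp: L0_def fun_eq_iff indicator_def)
  finally show ?thesis .
qed

definition log_limit :: "'i set \<Rightarrow> ('i \<Rightarrow> real) \<Rightarrow> real" where
  "log_limit I t = (\<Sum>i\<in>I. \<Sum>j\<in>I. pair_weight I t i j * (- L0 (t j - t i)))"

text \<open>The limit is attained: once \<epsilon> is below all distances between distinct points,
  the intersections of cones no longer change.\<close>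

lemma log_moment_eq_limit:
  assumes \<epsilon>: "0 < \<epsilon>" and t: "\<And>i. i \<in> I \<Longrightarrow> 0 < t i \<and> t i < 1"
    and gap: "\<And>i j. i \<in> I \<Longrightarrow> j \<in> I \<Longrightarrow> t i < t j \<Longrightarrow> \<epsilon> \<le> t j - t i"
  shows "log_moment \<epsilon> I t = log_limit I t"
  unfolding log_moment_def log_limit_def
proof (intro sum.cong refl)
  fix i j assume ij: "i \<in> I" "j \<in> I"
  show "pair_weight I t i j * measure \<rho> (log_cone \<epsilon> (t i) \<inter> log_cone \<epsilon> (t j)) = pair_weight I t i j * (- L0 (t j - t i))"
  proof (cases "t i < t j")
    case True
    have x: "0 < t j - t i" "t j - t i < 1" using True t[OF ij(1)] t[OF ij(2)] by auto
    have "emeasure \<rho> (log_cone \<epsilon> (t i) \<inter> log_cone \<epsilon> (t j)) = ennreal (- L \<bar>t i - t j\<bar>)"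
      using \<epsilon> gap[OF ij True] x by (intro emeasure_log_cone_inter_eq) auto
    moreover have "\<bar>t i - t j\<bar> = t j - t i" using True by simp
    ultimately have "measure \<rho> (log_cone \<epsilon> (t i) \<inter> log_cone \<epsilon> (t j)) = - L (t j - t i)"
      using L_nonpos[OF x] by (simp add: measure_def)
    then show ?thesis using x by (simp add: L0_def)
  qed (simp add: pair_weight_def)
qed

lemma eventually_log_moment_eq_limit:
  assumes I: "finite I" and t: "\<And>i. i \<in> I \<Longrightarrow> 0 < t i \<and> t i < 1"
  shows "\<exists>\<epsilon>0>0. \<forall>\<epsilon>. 0 < \<epsilon> \<longrightarrow> \<epsilon> \<le> \<epsilon>0 \<longrightarrow> log_moment \<epsilon> I t = log_limit I t"
proof -
  \<comment> \<open>Inserting 1 keeps the minimum meaningful when no two points differ.\<close>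
  let ?D = "insert 1 ((\<lambda>(i, j). t j - t i) ` {(i, j) \<in> I \<times> I. t i < t j})"
  have fin: "finite ?D" using I by (auto intro: finite_subset[of _ "I \<times> I"])
  have pos: "0 < Min ?D" using fin by (subst Min_gr_iff) auto
  have "log_moment \<epsilon> I t = log_limit I t" if "0 < \<epsilon>" "\<epsilon> \<le> Min ?D" for \<epsilon>
  proof (rule log_moment_eq_limit[OF that(1) t])
    fix i j assume "i \<in> I" "j \<in> I" "t i < t j"
    then have "t j - t i \<in> ?D" by force
    then have "Min ?D \<le> t j - t i" using fin by (intro Min_le)
    then show "\<epsilon> \<le> t j - t i" using that by simp
  qed
  then show ?thesis using pos by blast
qed

lemma log_moment_le_limit:
  assumes I: "finite I" and t: "\<And>i. i \<in> I \<Longrightarrow> 0 < t i \<and> t i < 1" and \<epsilon>: "0 < \<epsilon>" "\<epsilon> \<le> 1"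
  shows "log_moment \<epsilon> I t \<le> log_limit I t"
proof -
  obtain \<epsilon>0 where \<epsilon>0: "0 < \<epsilon>0" "\<And>\<epsilon>. 0 < \<epsilon> \<Longrightarrow> \<epsilon> \<le> \<epsilon>0 \<Longrightarrow> log_moment \<epsilon> I t = log_limit I t"
    using eventually_log_moment_eq_limit[of I t] I t by blast
  have "log_moment \<epsilon> I t \<le> log_moment (min \<epsilon> \<epsilon>0) I t" using \<epsilon> \<epsilon>0(1) by (intro log_moment_antimono) auto
  also have "\<dots> = log_limit I t" using \<epsilon> \<epsilon>0(1) by (intro \<epsilon>0(2)) auto
  finally show ?thesis .
qed

text \<open>All cones at a given \<epsilon> have the same mass, so the bound is uniform in the
  points. It makes the expectations finite for each fixed \<epsilon>, independently of the behaviour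
  of the limit.\<close>

lemma log_moment_bounded:
  assumes I: "finite I" and \<epsilon>: "0 < \<epsilon>" "\<epsilon> \<le> 1"
  shows "log_moment \<epsilon> I t \<le> real (card I) * real (card I) * (\<mu> * (\<Sum>m\<le>card I. d m) * measure \<rho> (log_cone \<epsilon> 0))"
proof -
  have cone: "measure \<rho> (log_cone \<epsilon> u) = measure \<rho> (log_cone \<epsilon> 0)" for u
    using emeasure_log_cone_inter[OF \<epsilon>, of u u] emeasure_log_cone_inter[OF \<epsilon>, of 0 0] by (simp add: measure_def)
  have fm: "log_cone \<epsilon> u \<in> fmeasurable \<rho>" for u
    using sets_log_cone[OF \<epsilon>] emeasure_log_cone_finite[OF \<epsilon>] by (intro fmeasurableI) auto
  have "log_moment \<epsilon> I t \<le> (\<Sum>i\<in>I. \<Sum>j\<in>I. \<mu> * (\<Sum>m\<le>card I. d m) * measure \<rho> (log_cone \<epsilon> 0))"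
    unfolding log_moment_def
  proof (intro sum_mono mult_mono)
    fix i j assume "i \<in> I" "j \<in> I"
    have "rank_gap I t i j \<le> card I" unfolding rank_gap_def using I by (intro card_mono) auto
    then have "d (rank_gap I t i j) \<le> (\<Sum>m\<le>card I. d m)" by (intro member_le_sum d_nonneg) auto
    then show "pair_weight I t i j \<le> \<mu> * (\<Sum>m\<le>card I. d m)"
      using \<mu> d_nonneg by (auto simp: pair_weight_def intro!: mult_left_mono mult_nonneg_nonneg sum_nonneg)
    have "measure \<rho> (log_cone \<epsilon> (t i) \<inter> log_cone \<epsilon> (t j)) \<le> measure \<rho> (log_cone \<epsilon> (t i))"
      using fm sets_log_cone[OF \<epsilon>] by (intro measure_mono_fmeasurable) auto
    then show "measure \<rho> (log_cone \<epsilon> (t i) \<inter> log_cone \<epsilon> (t j)) \<le> measure \<rho> (log_cone \<epsilon> 0)" using cone[of "t i"] by linarith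
  qed (use \<mu> d_nonneg in \<open>auto intro!: mult_nonneg_nonneg sum_nonneg\<close>)
  then show ?thesis by (simp add: mult.assoc)
qed

text \<open>Rank gaps are relabelled along with the points. This is the symmetry that the simplex
  identity demands of its weight.\<close>

lemma log_limit_permute:
  assumes p: "p permutes I"
  shows "log_limit I (\<lambda>i\<in>I. t (p i)) = log_limit I t"
proof -
  have pI: "p i \<in> I \<longleftrightarrow> i \<in> I" for i by (rule permutes_in_image[OF p])
  have rg: "rank_gap I (\<lambda>i\<in>I. t (p i)) i j = rank_gap I t (p i) (p j)" if "i \<in> I" "j \<in> I" for i j
  proof -
    have "{l\<in>I. t (p i) < t l \<and> t l \<le> t (p j)} = p ` {l\<in>I. t (p i) < t (p l) \<and> t (p l) \<le> t (p j)}"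
    proof (rule equalityI; rule subsetI)
      fix l assume l: "l \<in> {l\<in>I. t (p i) < t l \<and> t l \<le> t (p j)}"
      then obtain l' where "l' \<in> I" "l = p l'" using permutes_image[OF p] by blast
      then show "l \<in> p ` {l\<in>I. t (p i) < t (p l) \<and> t (p l) \<le> t (p j)}" using l by blast
    qed (use pI in auto)
    then have "rank_gap I t (p i) (p j) = card (p ` {l\<in>I. t (p i) < t (p l) \<and> t (p l) \<le> t (p j)})"
      by (simp add: rank_gap_def)
    also have "\<dots> = card {l\<in>I. t (p i) < t (p l) \<and> t (p l) \<le> t (p j)}"
      by (rule card_image) (use permutes_inj_on[OF p] in auto)
    also have "{l\<in>I. t (p i) < t (p l) \<and> t (p l) \<le> t (p j)} =
      {l\<in>I. (\<lambda>i\<in>I. t (p i)) i < (\<lambda>i\<in>I. t (p i)) l \<and> (\<lambda>i\<in>I. t (p i)) l \<le> (\<lambda>i\<in>I. t (p i)) j}"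
      using that by auto
    finally show ?thesis by (simp add: rank_gap_def)
  qed
  define h where "h i j = pair_weight I t i j * (- L0 (t j - t i))" for i j
  have "log_limit I (\<lambda>i\<in>I. t (p i)) = (\<Sum>i\<in>I. \<Sum>j\<in>I. h (p i) (p j))"
    unfolding log_limit_def h_def using rg by (intro sum.cong refl) (simp add: pair_weight_def)
  also have "\<dots> = (\<Sum>i\<in>I. \<Sum>j\<in>I. h (p i) j)"
  proof (rule sum.cong[OF refl])
    fix i
    show "(\<Sum>j\<in>I. h (p i) (p j)) = (\<Sum>j\<in>I. h (p i) j)"
      using sum.permute[OF p, of "h (p i)"] by (simp add: comp_def)
  qed
  also have "\<dots> = (\<Sum>i\<in>I. \<Sum>j\<in>I. h i j)"
    using sum.permute[OF p, of "\<lambda>i. \<Sum>j\<in>I. h i j"] by (simp add: comp_def)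
  finally show ?thesis unfolding log_limit_def h_def .
qed

text \<open>On the simplex rank gaps are index differences, and all differences of points lie in (0,
  1), where \<open>L0\<close> is log r.\<close>

lemma exp_log_limit_simplex:
  assumes t: "t \<in> ordered_simplex m"
  shows "exp (log_limit {1..m} t) = (\<Prod>p\<in>{1..m}. \<Prod>k\<in>{1..<p}. r (t p - t k) powr (- \<mu> * d (p - k)))"
proof -
  have sm: "strict_mono_on {1..m} t" and t01: "\<And>i. i \<in> {1..m} \<Longrightarrow> 0 < t i \<and> t i < 1"
    using t unfolding ordered_simplex_def PiE_iff by auto
  have "log_limit {1..m} t = (\<Sum>j\<in>{1..m}. \<Sum>i\<in>{1..m}. pair_weight {1..m} t i j * (- L0 (t j - t i)))"
    unfolding log_limit_def by (rule sum.swap)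
  also have "\<dots> = (\<Sum>j\<in>{1..m}. \<Sum>i\<in>{1..<j}. - \<mu> * d (j - i) * ln (r (t j - t i)))"
  proof (rule sum.cong[OF refl])
    fix j assume j: "j \<in> {1..m}"
    show "(\<Sum>i\<in>{1..m}. pair_weight {1..m} t i j * (- L0 (t j - t i))) = (\<Sum>i\<in>{1..<j}. - \<mu> * d (j - i) * ln (r (t j - t i)))"
    proof (rule sum.mono_neutral_cong_right)
    show "{1..<j} \<subseteq> {1..m}" using j by auto
    show "\<forall>i\<in>{1..m} - {1..<j}. pair_weight {1..m} t i j * (- L0 (t j - t i)) = 0"
    proof
      fix i assume i: "i \<in> {1..m} - {1..<j}"
      then have "t j \<le> t i" using j by (intro strict_mono_on_leD[OF sm]) auto
      then show "pair_weight {1..m} t i j * (- L0 (t j - t i)) = 0" by (simp add: pair_weight_def)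
    qed
    fix i assume i: "i \<in> {1..<j}"
    then have i': "i \<in> {1..m}" using j by auto
    have lt: "t i < t j" using i i' j by (intro strict_mono_onD[OF sm]) auto
    have "t j - t i < 1" using t01[OF i'] t01[OF j] by linarith
    then show "pair_weight {1..m} t i j * (- L0 (t j - t i)) = - \<mu> * d (j - i) * ln (r (t j - t i))"
      using lt unfolding pair_weight_def rank_gap_strict_mono[OF sm i' j] by (simp add: L0_def L_def)
    qed simp
  qed
  finally have "exp (log_limit {1..m} t) = (\<Prod>p\<in>{1..m}. \<Prod>k\<in>{1..<p}. exp (- \<mu> * d (p - k) * ln (r (t p - t k))))"
    by (simp add: exp_sum)
  also have "\<dots> = (\<Prod>p\<in>{1..m}. \<Prod>k\<in>{1..<p}. r (t p - t k) powr (- \<mu> * d (p - k)))"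
  proof (intro prod.cong refl)
    fix p k assume p: "p \<in> {1..m}" and k: "k \<in> {1..<p}"
    have k': "k \<in> {1..m}" using p k by auto
    have "t k < t p" using k k' p by (intro strict_mono_onD[OF sm]) auto
    moreover have "t p - t k < 1" using t01[OF k'] t01[OF p] by linarith
    ultimately have "r (t p - t k) > 0" by (intro r_pos) auto
    then show "exp (- \<mu> * d (p - k) * ln (r (t p - t k))) = r (t p - t k) powr (- \<mu> * d (p - k))"
      by (simp add: powr_def)
  qed
  finally show ?thesis .
qed

lemma borel_measurable_log_limit:
  assumes I: "finite I"
  shows "log_limit I \<in> borel_measurable (PiM I (\<lambda>_::nat. lborel))"
proof -
  let ?M = "PiM I (\<lambda>_::nat. lborel :: real measure)"
  have c: "(\<lambda>t. t i) \<in> borel_measurable ?M" if "i \<in> I" for i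
    using that by (rule measurable_PiM_component_real)
  have lt: "{t \<in> space ?M. t i < t j} \<in> sets ?M" "{t \<in> space ?M. t i \<le> t j} \<in> sets ?M" if "i \<in> I" "j \<in> I" for i j
    using c[OF that(1)] c[OF that(2)] by (rule borel_measurable_less borel_measurable_le)+
  have cnt: "(\<lambda>t. real (rank_gap I t i j)) \<in> borel_measurable ?M" if "i \<in> I" "j \<in> I" for i j
  proof -
    have "(\<lambda>t :: nat \<Rightarrow> real. \<Sum>l\<in>I. if t i < t l \<and> t l \<le> t j then 1 else 0 :: real) \<in> borel_measurable ?M"
    proof (rule borel_measurable_sum)
      fix l assume l: "l \<in> I"
      have "{t \<in> space ?M. t i < t l \<and> t l \<le> t j} \<in> sets ?M"
        using lt(1)[OF that(1) l] lt(2)[OF l that(2)] by (intro sets.sets_Collect_conj)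
      then show "(\<lambda>t :: nat \<Rightarrow> real. if t i < t l \<and> t l \<le> t j then 1 else 0 :: real) \<in> borel_measurable ?M"
        by (rule measurable_If[OF borel_measurable_const borel_measurable_const])
    qed
    also have "(\<lambda>t :: nat \<Rightarrow> real. \<Sum>l\<in>I. if t i < t l \<and> t l \<le> t j then 1 else 0 :: real) = (\<lambda>t. real (rank_gap I t i j))"
      using I by (auto simp: fun_eq_iff rank_gap_def sum.inter_filter[symmetric])
    finally show ?thesis .
  qed
  \<comment> \<open>The integer-valued rank gap is measurable as a real function; the floor turns d
    into a Borel function to compose with it.\<close>
  have dm: "(\<lambda>x. d (nat \<lfloor>x\<rfloor>)) \<in> borel_measurable (borel :: real measure)"
    by (rule measurable_compose[OF measurable_real_floor]) simp
  have "(\<lambda>t. pair_weight I t i j * (- L0 (t j - t i))) \<in> borel_measurable ?M" if "i \<in> I" "j \<in> I" for i j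
  proof (rule borel_measurable_times)
    have "(\<lambda>t. \<mu> * d (nat \<lfloor>real (rank_gap I t i j)\<rfloor>)) \<in> borel_measurable ?M"
      using measurable_compose[OF cnt[OF that] dm] by (intro borel_measurable_times borel_measurable_const)
    then have "(\<lambda>t :: nat \<Rightarrow> real. \<mu> * d (rank_gap I t i j)) \<in> borel_measurable ?M"
      by (simp only: floor_of_nat nat_int)
    then show "(\<lambda>t. pair_weight I t i j) \<in> borel_measurable ?M"
      unfolding pair_weight_def by (rule measurable_If[OF _ borel_measurable_const lt(1)[OF that]])
    show "(\<lambda>t. - L0 (t j - t i)) \<in> borel_measurable ?M"
      using c[OF that(1)] c[OF that(2)]
      by (intro borel_measurable_uminus measurable_compose[OF _ borel_measurable_L0] borel_measurable_diff)
  qed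
  then show ?thesis unfolding log_limit_def[abs_def] by (intro borel_measurable_sum) auto
qed

end

section \<open>Expectations at a fixed cutoff \<epsilon>\<close>

context cascade
begin

text \<open>Joint measurability is assumed for s in [0, 1] only; clamping the argument extends it to
  the line without changing the field on [0, 1].\<close>

definition clamped_field :: "real \<Rightarrow> real \<Rightarrow> 'a \<Rightarrow> real" where
  "clamped_field \<epsilon> s x = omega_field P \<epsilon> (max 0 (min 1 s)) x"

lemma clamped_field_eq: "0 \<le> s \<Longrightarrow> s \<le> 1 \<Longrightarrow> clamped_field \<epsilon> s x = omega_field P \<epsilon> s x"
  by (simp add: clamped_field_def)

lemma borel_measurable_clamped_field:
  assumes "0 < \<epsilon>" "\<epsilon> \<le> 1"
  shows "(\<lambda>z. clamped_field \<epsilon> (fst z) (snd z)) \<in> borel_measurable (lborel \<Otimes>\<^sub>M \<Omega>)"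
proof -
  have f: "(\<lambda>(s, x). omega_field P \<epsilon> s x) \<in> borel_measurable (restrict_space borel {0..1} \<Otimes>\<^sub>M \<Omega>)"
    using field assms unfolding measurable_field_def by blast
  have "(\<lambda>s :: real. max 0 (min 1 s)) \<in> measurable lborel (restrict_space borel {0..1})"
    by (rule measurable_restrict_space2) auto
  then have "(\<lambda>z :: real \<times> 'a. (max 0 (min 1 (fst z)), snd z)) \<in> measurable (lborel \<Otimes>\<^sub>M \<Omega>) (restrict_space borel {0..1} \<Otimes>\<^sub>M \<Omega>)"
    by (intro measurable_Pair measurable_compose[OF measurable_fst] measurable_snd)
  from measurable_compose[OF this f] show ?thesis by (simp only: clamped_field_def prod.case)
qed

lemma borel_measurable_clamped_field_section:
  assumes "0 < \<epsilon>" "\<epsilon> \<le> 1"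
  shows "x \<in> space \<Omega> \<Longrightarrow> (\<lambda>s. clamped_field \<epsilon> s x) \<in> borel_measurable lborel" "clamped_field \<epsilon> s \<in> borel_measurable \<Omega>"
proof -
  show "(\<lambda>s. clamped_field \<epsilon> s x) \<in> borel_measurable lborel" if "x \<in> space \<Omega>"
    using measurable_compose[OF measurable_Pair2'[OF that] borel_measurable_clamped_field[OF assms]] by (simp only: fst_conv snd_conv)
  have "s \<in> space lborel" by simp
  from measurable_compose[OF measurable_Pair1'[OF this] borel_measurable_clamped_field[OF assms]]
  show "clamped_field \<epsilon> s \<in> borel_measurable \<Omega>" by (simp only: fst_conv snd_conv)
qed

definition field_exp :: "real \<Rightarrow> real \<Rightarrow> 'a \<Rightarrow> ennreal" where
  "field_exp \<epsilon> s x = ennreal (exp (clamped_field \<epsilon> s x)) * indicator {0<..<1} s"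

lemma borel_measurable_field_exp:
  assumes "0 < \<epsilon>" "\<epsilon> \<le> 1"
  shows "(\<lambda>z. field_exp \<epsilon> (fst z) (snd z)) \<in> borel_measurable (lborel \<Otimes>\<^sub>M \<Omega>)"
  unfolding field_exp_def
  by (intro borel_measurable_times_ennreal measurable_compose[OF _ measurable_ennreal] measurable_compose[OF borel_measurable_clamped_field[OF assms]]
      measurable_compose[OF measurable_fst borel_measurable_indicator]) auto

text \<open>A single point forms no pairs, so the exponent is 0: the normalisation phi(-i) =
  0.\<close>

lemma nn_integral_exp_clamped_field:
  assumes \<epsilon>: "0 < \<epsilon>" "\<epsilon> \<le> 1"
  shows "(\<integral>\<^sup>+x. ennreal (exp (clamped_field \<epsilon> s x)) \<partial>\<Omega>) = 1"
  using nn_integral_exp_field[of "{0::nat}" "\<lambda>_. max 0 (min 1 s)", OF _ _ _ \<epsilon>] n_ge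
  by (simp add: clamped_field_def log_moment_def pair_weight_def)

definition path_mass :: "real \<Rightarrow> 'a \<Rightarrow> ennreal" where
  "path_mass \<epsilon> x = (\<integral>\<^sup>+s. field_exp \<epsilon> s x \<partial>lborel)"

text \<open>\<open>total_mass\<close> is a Bochner integral, which is 0 by default when it diverges.
  By Tonelli the nonnegative path integral has expectation 1, hence is finite almost surely, and
  there the two agree.\<close>

lemma AE_total_mass:
  assumes \<epsilon>: "0 < \<epsilon>" "\<epsilon> \<le> 1"
  shows "AE x in \<Omega>. ennreal (total_mass P \<epsilon> x) = path_mass \<epsilon> x"
proof -
  interpret Q: pair_sigma_finite lborel \<Omega> ..
  note w = borel_measurable_field_exp[OF \<epsilon>]
  have w': "(\<lambda>(s, x). field_exp \<epsilon> s x) \<in> borel_measurable (lborel \<Otimes>\<^sub>M \<Omega>)" using w by (simp only: case_prod_beta')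
  have pm: "path_mass \<epsilon> \<in> borel_measurable \<Omega>"
    unfolding path_mass_def[abs_def] using measurable_compose[OF measurable_pair_swap' w]
    by (intro lborel.borel_measurable_nn_integral) (simp only: case_prod_beta' fst_conv snd_conv)
  have "(\<integral>\<^sup>+x. path_mass \<epsilon> x \<partial>\<Omega>) = (\<integral>\<^sup>+s. (\<integral>\<^sup>+x. field_exp \<epsilon> s x \<partial>\<Omega>) \<partial>lborel)"
    unfolding path_mass_def by (rule Q.Fubini'[OF w'])
  also have "\<dots> = (\<integral>\<^sup>+s. indicator {0<..<1::real} s \<partial>lborel)"
  proof (rule nn_integral_cong)
    fix s :: real
    have "(\<integral>\<^sup>+x. field_exp \<epsilon> s x \<partial>\<Omega>) = (\<integral>\<^sup>+x. ennreal (exp (clamped_field \<epsilon> s x)) \<partial>\<Omega>) * indicator {0<..<1} s"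
      unfolding field_exp_def using borel_measurable_clamped_field_section(2)[OF \<epsilon>]
      by (intro nn_integral_multc measurable_compose[OF _ measurable_ennreal] measurable_compose[OF _ borel_measurable_exp])
    then show "(\<integral>\<^sup>+x. field_exp \<epsilon> s x \<partial>\<Omega>) = indicator {0<..<1} s" by (simp add: nn_integral_exp_clamped_field[OF \<epsilon>])
  qed
  also have "\<dots> = 1" by simp
  finally have "(\<integral>\<^sup>+x. path_mass \<epsilon> x \<partial>\<Omega>) \<noteq> \<infinity>" by simp
  then have "AE x in \<Omega>. path_mass \<epsilon> x \<noteq> \<infinity>" by (rule nn_integral_PInf_AE[OF pm])
  with AE_space show ?thesis
  proof eventually_elim
    case (elim x)
    have sec: "(\<lambda>s. clamped_field \<epsilon> s x) \<in> borel_measurable lborel" by (rule borel_measurable_clamped_field_section(1)[OF \<epsilon> elim(1)])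
    have "total_mass P \<epsilon> x = (LINT s|lborel. indicator {0..1} s * exp (clamped_field \<epsilon> s x))"
      unfolding total_mass_def set_lebesgue_integral_def
      by (intro Bochner_Integration.integral_cong) (auto simp: indicator_def clamped_field_eq)
    also have "\<dots> = enn2real (\<integral>\<^sup>+s. ennreal (indicator {0..1} s * exp (clamped_field \<epsilon> s x)) \<partial>lborel)"
    proof (rule integral_eq_nn_integral)
      have "(\<lambda>s. exp (clamped_field \<epsilon> s x)) \<in> borel_measurable lborel" by (rule measurable_compose[OF sec borel_measurable_exp])
      moreover have "{0..1::real} \<in> sets lborel" by simp
      ultimately show "(\<lambda>s. indicator {0..1} s * exp (clamped_field \<epsilon> s x)) \<in> borel_measurable lborel"
        by (intro borel_measurable_times borel_measurable_indicator)
      show "AE s in lborel. 0 \<le> indicator {0..1} s * exp (clamped_field \<epsilon> s x)" by (rule AE_I2) (simp add: indicator_def)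
    qed
    also have "(\<integral>\<^sup>+s. ennreal (indicator {0..1} s * exp (clamped_field \<epsilon> s x)) \<partial>lborel) = path_mass \<epsilon> x"
      unfolding path_mass_def
    proof (rule nn_integral_cong_AE)
      show "AE s in lborel. ennreal (indicator {0..1} s * exp (clamped_field \<epsilon> s x)) = field_exp \<epsilon> s x"
        using AE_lborel_singleton[of 0] AE_lborel_singleton[of 1]
        by eventually_elim (auto simp: field_exp_def indicator_def)
    qed
    finally show ?case using elim(2) by (simp add: top.not_eq_extremum)
  qed
qed

lemma borel_measurable_total_mass:
  assumes \<epsilon>: "0 < \<epsilon>" "\<epsilon> \<le> 1"
  shows "total_mass P \<epsilon> \<in> borel_measurable \<Omega>"
proof -
  have "(\<lambda>z. indicator {0..1} (snd z) * exp (clamped_field \<epsilon> (snd z) (fst z))) \<in> borel_measurable (\<Omega> \<Otimes>\<^sub>M lborel)"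
  proof (intro borel_measurable_times measurable_compose[OF _ borel_measurable_exp])
    show "(\<lambda>z. clamped_field \<epsilon> (snd z) (fst z)) \<in> borel_measurable (\<Omega> \<Otimes>\<^sub>M lborel)"
      using measurable_compose[OF measurable_pair_swap' borel_measurable_clamped_field[OF \<epsilon>]] by (simp only: case_prod_beta' fst_conv snd_conv)
    show "(\<lambda>z. indicator {0..1} (snd z) :: real) \<in> borel_measurable (\<Omega> \<Otimes>\<^sub>M (lborel :: real measure))"
      by (rule measurable_compose[OF measurable_snd borel_measurable_indicator]) simp
  qed
  then have "(\<lambda>x. LINT s|lborel. indicator {0..1} s * exp (clamped_field \<epsilon> s x)) \<in> borel_measurable \<Omega>"
    by (intro lborel.borel_measurable_lebesgue_integral) (simp only: case_prod_beta' fst_conv snd_conv)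
  also have "(\<lambda>x. LINT s|lborel. indicator {0..1} s * exp (clamped_field \<epsilon> s x)) = total_mass P \<epsilon>"
    unfolding total_mass_def set_lebesgue_integral_def
    by (intro ext Bochner_Integration.integral_cong) (auto simp: indicator_def clamped_field_eq)
  finally show ?thesis .
qed

lemma total_mass_nonneg: "0 \<le> total_mass P \<epsilon> x"
  unfolding total_mass_def set_lebesgue_integral_def by (intro integral_nonneg_AE AE_I2) (auto simp: indicator_def)

lemma borel_measurable_moment_density:
  assumes \<epsilon>: "0 < \<epsilon>" "\<epsilon> \<le> 1"
  shows "moment_density P n k \<epsilon> s \<in> borel_measurable \<Omega>"
proof -
  have "omega_field P \<epsilon> u \<in> borel_measurable \<Omega>" for u
    unfolding omega_field_def by (intro P_measurable sets_log_cone emeasure_log_cone_finite \<epsilon>)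
  then show ?thesis unfolding moment_density_def[abs_def] using borel_measurable_total_mass[OF \<epsilon>]
    by (intro borel_measurable_times borel_measurable_power measurable_compose[OF _ borel_measurable_exp] borel_measurable_sum)
qed

lemma moment_density_nonneg: "0 \<le> moment_density P n k \<epsilon> s x"
  unfolding moment_density_def by (intro mult_nonneg_nonneg zero_le_power total_mass_nonneg) auto

abbreviation mrg :: "nat \<Rightarrow> (nat \<Rightarrow> real) \<Rightarrow> (nat \<Rightarrow> real) \<Rightarrow> nat \<Rightarrow> real" where
  "mrg k s t \<equiv> merge {1..k} {k+1..n} (s, t)"

abbreviation rest :: "nat \<Rightarrow> (nat \<Rightarrow> real) measure" where
  "rest k \<equiv> PiM {k+1..n} (\<lambda>_. lborel)"

text \<open>Joint exponential moment of the field with s fixed, as a function of the n - k points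
  that the power of the total mass integrates over.\<close>

definition cond_moment :: "nat \<Rightarrow> real \<Rightarrow> (nat \<Rightarrow> real) \<Rightarrow> (nat \<Rightarrow> real) \<Rightarrow> ennreal" where
  "cond_moment k \<epsilon> s t = (\<integral>\<^sup>+x. ennreal (exp (\<Sum>i\<in>{1..n}. omega_field P \<epsilon> (mrg k s t i) x)) \<partial>\<Omega>) * indicator (unit_cube {k+1..n}) t"

text \<open>The power of the total mass is an integral over n - k separate variables; Tonelli
  exchanges it with the expectation. The joint measurability of the integrand gives the
  measurability of \<open>cond_moment\<close> along the way.\<close>

lemma moment_density_integral:
  assumes k: "k \<le> n" and s: "s \<in> ordered_simplex k" and \<epsilon>: "0 < \<epsilon>" "\<epsilon> \<le> 1"
  shows "(\<integral>\<^sup>+x. ennreal (moment_density P n k \<epsilon> s x) \<partial>\<Omega>) = (\<integral>\<^sup>+t. cond_moment k \<epsilon> s t \<partial>rest k)"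
    and "cond_moment k \<epsilon> s \<in> borel_measurable (rest k)"
proof -
  let ?J = "{k+1..n}"
  interpret J: finite_product_sigma_finite "\<lambda>_::nat. lborel :: real measure" ?J by standard simp
  interpret Q: pair_sigma_finite \<Omega> "rest k" ..
  note w = borel_measurable_field_exp[OF \<epsilon>]
  define e where "e x = ennreal (exp (\<Sum>i\<in>{1..k}. clamped_field \<epsilon> (s i) x))" for x
  define h where "h x t = (\<Prod>j\<in>?J. field_exp \<epsilon> (t j) x) * e x" for x and t :: "nat \<Rightarrow> real"
  have em: "e \<in> borel_measurable \<Omega>" unfolding e_def[abs_def] using borel_measurable_clamped_field_section(2)[OF \<epsilon>]
    by (intro measurable_compose[OF _ measurable_ennreal] measurable_compose[OF _ borel_measurable_exp] borel_measurable_sum)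
  have hm: "(\<lambda>z. h (fst z) (snd z)) \<in> borel_measurable (\<Omega> \<Otimes>\<^sub>M rest k)"
    unfolding h_def
  proof (intro borel_measurable_times_ennreal borel_measurable_prod_ennreal measurable_compose[OF measurable_fst em])
    fix j assume j: "j \<in> ?J"
    have "(\<lambda>z. snd z j) \<in> measurable (\<Omega> \<Otimes>\<^sub>M rest k) lborel"
      by (rule measurable_compose[OF measurable_snd measurable_component_singleton[OF j]])
    then have "(\<lambda>z. (snd z j, fst z)) \<in> measurable (\<Omega> \<Otimes>\<^sub>M rest k) (lborel \<Otimes>\<^sub>M \<Omega>)"
      by (intro measurable_Pair measurable_fst)
    from measurable_compose[OF this w] show "(\<lambda>z. field_exp \<epsilon> (snd z j) (fst z)) \<in> borel_measurable (\<Omega> \<Otimes>\<^sub>M rest k)"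
      by (simp only: fst_conv snd_conv)
  qed
  have inner: "(\<integral>\<^sup>+x. h x t \<partial>\<Omega>) = cond_moment k \<epsilon> s t" if t: "t \<in> space (rest k)" for t
  proof (cases "t \<in> unit_cube ?J")
    case True
    have "h x t = ennreal (exp (\<Sum>i\<in>{1..n}. omega_field P \<epsilon> (mrg k s t i) x))" for x
    proof -
      have t01: "0 < t j \<and> t j < 1" if "j \<in> ?J" for j using True that by (auto simp: unit_cube_def PiE_iff)
      have "{1..n} = {1..k} \<union> ?J" using k by auto
      then have "(\<Sum>i\<in>{1..n}. omega_field P \<epsilon> (mrg k s t i) x) =
        (\<Sum>i\<in>{1..k}. omega_field P \<epsilon> (mrg k s t i) x) + (\<Sum>i\<in>?J. omega_field P \<epsilon> (mrg k s t i) x)"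
        by (simp only:) (rule sum.union_disjoint; auto)
      also have "(\<Sum>i\<in>{1..k}. omega_field P \<epsilon> (mrg k s t i) x) = (\<Sum>i\<in>{1..k}. clamped_field \<epsilon> (s i) x)"
        using ordered_simplexD[OF s] by (intro sum.cong) (auto simp: clamped_field_eq merge_def less_imp_le)
      also have "(\<Sum>i\<in>?J. omega_field P \<epsilon> (mrg k s t i) x) = (\<Sum>i\<in>?J. clamped_field \<epsilon> (t i) x)"
        using t01 by (intro sum.cong) (auto simp: clamped_field_eq merge_def less_imp_le)
      finally have "ennreal (exp (\<Sum>i\<in>{1..n}. omega_field P \<epsilon> (mrg k s t i) x)) = e x * (\<Prod>i\<in>?J. ennreal (exp (clamped_field \<epsilon> (t i) x)))"
        by (simp add: e_def exp_add exp_sum ennreal_mult prod_nonneg prod_ennreal)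
      also have "(\<Prod>i\<in>?J. ennreal (exp (clamped_field \<epsilon> (t i) x))) = (\<Prod>i\<in>?J. field_exp \<epsilon> (t i) x)"
        using t01 by (intro prod.cong) (auto simp: field_exp_def)
      finally show ?thesis by (simp add: h_def mult.commute)
    qed
    then have "(\<lambda>x. h x t) = (\<lambda>x. ennreal (exp (\<Sum>i\<in>{1..n}. omega_field P \<epsilon> (mrg k s t i) x)))" by (rule ext)
    then show ?thesis using True unfolding cond_moment_def by (simp only: indicator_simps mult_1_right)
  next
    case False
    then obtain j where "j \<in> ?J" "t j \<notin> {0<..<1}" using t by (auto simp: unit_cube_def PiE_iff space_PiM)
    then have w0: "\<exists>j\<in>?J. field_exp \<epsilon> (t j) x = 0" for x
      by (intro bexI[of _ j]) (simp_all add: field_exp_def)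
    have "h x t = 0" for x unfolding h_def using prod_zero[OF _ w0[of x]] by (simp only: finite_atLeastAtMost mult_zero_left)
    then have "(\<lambda>x. h x t) = (\<lambda>_. 0)" by (rule ext)
    then show ?thesis using False unfolding cond_moment_def by simp
  qed
  have "AE x in \<Omega>. ennreal (moment_density P n k \<epsilon> s x) = (\<integral>\<^sup>+t. h x t \<partial>rest k)"
    using AE_total_mass[OF \<epsilon>] AE_space
  proof eventually_elim
    case (elim x)
    have sec: "(\<lambda>s. field_exp \<epsilon> s x) \<in> borel_measurable lborel"
      using measurable_compose[OF measurable_Pair2'[OF elim(2)] w] by (simp only: fst_conv snd_conv)
    have "ennreal (moment_density P n k \<epsilon> s x) = ennreal (total_mass P \<epsilon> x) ^ (n - k) * e x"
    proof -
      have "(\<Sum>i\<in>{1..k}. omega_field P \<epsilon> (s i) x) = (\<Sum>i\<in>{1..k}. clamped_field \<epsilon> (s i) x)"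
        using ordered_simplexD[OF s] by (intro sum.cong) (auto simp: clamped_field_eq less_imp_le)
      then show ?thesis unfolding moment_density_def e_def
        by (simp add: ennreal_mult'' ennreal_power total_mass_nonneg)
    qed
    also have "\<dots> = (\<Prod>j\<in>?J. path_mass \<epsilon> x) * e x" using elim(1) by simp
    also have "(\<Prod>j\<in>?J. path_mass \<epsilon> x) = (\<integral>\<^sup>+t. (\<Prod>j\<in>?J. field_exp \<epsilon> (t j) x) \<partial>rest k)"
      unfolding path_mass_def using sec by (intro lborel_PiM.product_nn_integral_prod[symmetric]) auto
    also have "\<dots> * e x = (\<integral>\<^sup>+t. h x t \<partial>rest k)"
      unfolding h_def
    proof (intro nn_integral_multc[symmetric] borel_measurable_prod_ennreal)
      fix j assume j: "j \<in> ?J"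
      show "(\<lambda>t. field_exp \<epsilon> (t j) x) \<in> borel_measurable (rest k)"
        by (rule measurable_compose[OF measurable_component_singleton[OF j] sec])
    qed
    finally show ?case .
  qed
  then have "(\<integral>\<^sup>+x. ennreal (moment_density P n k \<epsilon> s x) \<partial>\<Omega>) = (\<integral>\<^sup>+x. (\<integral>\<^sup>+t. h x t \<partial>rest k) \<partial>\<Omega>)"
    by (rule nn_integral_cong_AE)
  also have "\<dots> = (\<integral>\<^sup>+t. (\<integral>\<^sup>+x. h x t \<partial>\<Omega>) \<partial>rest k)"
    using hm by (intro Q.Fubini'[symmetric]) (simp only: case_prod_beta')
  also have "\<dots> = (\<integral>\<^sup>+t. cond_moment k \<epsilon> s t \<partial>rest k)" by (intro nn_integral_cong inner)
  finally show "(\<integral>\<^sup>+x. ennreal (moment_density P n k \<epsilon> s x) \<partial>\<Omega>) = (\<integral>\<^sup>+t. cond_moment k \<epsilon> s t \<partial>rest k)" .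
  have "(\<lambda>t. \<integral>\<^sup>+x. h x t \<partial>\<Omega>) \<in> borel_measurable (rest k)"
    using measurable_compose[OF measurable_pair_swap' hm]
    by (intro borel_measurable_nn_integral) (simp only: case_prod_beta' fst_conv snd_conv)
  also have "?this \<longleftrightarrow> cond_moment k \<epsilon> s \<in> borel_measurable (rest k)"
    by (rule measurable_cong[OF inner])
  finally show "cond_moment k \<epsilon> s \<in> borel_measurable (rest k)" .
qed

text \<open>The moment formula requires distinct points, and with s fixed almost every choice of the
  free points provides them.\<close>

lemma AE_merge_inj:
  assumes s: "s \<in> ordered_simplex k" and k: "k \<le> n"
  shows "AE t in rest k. inj_on (mrg k s t) {1..n}"
proof -
  have "AE t in rest k. inj_on t {k+1..n} \<and> (\<forall>i\<in>{k+1..n}. t i \<notin> s ` {1..k})"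
    by (rule AE_lborel_PiM_inj_avoid) auto
  then show ?thesis
  proof eventually_elim
    case (elim t)
    have sinj: "inj_on s {1..k}" using s by (auto simp: ordered_simplex_def intro: strict_mono_on_imp_inj_on)
    have M: "mrg k s t i = (if i \<le> k then s i else t i)" if "i \<in> {1..n}" for i
      using that by (auto simp: merge_def)
    show ?case
    proof (rule inj_onI)
      fix i j assume i: "i \<in> {1..n}" and j: "j \<in> {1..n}" and eq: "mrg k s t i = mrg k s t j"
      have eq': "(if i \<le> k then s i else t i) = (if j \<le> k then s j else t j)"
        using eq unfolding M[OF i] M[OF j] .
      have tin: "inj_on t {k+1..n}" and ts: "\<And>l. l \<in> {k+1..n} \<Longrightarrow> t l \<notin> s ` {1..k}" using elim by blast+
      consider "i \<le> k" "j \<le> k" | "i \<le> k" "\<not> j \<le> k" | "\<not> i \<le> k" "j \<le> k" | "\<not> i \<le> k" "\<not> j \<le> k" by blast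
      then show "i = j"
      proof cases
        case 1
        then have "s i = s j" using eq' by simp
        then show ?thesis by (rule inj_onD[OF sinj]) (use 1 i j in auto)
      next
        case 2
        then have "s i = t j" using eq' by simp
        moreover have "s i \<in> s ` {1..k}" using 2 i by (intro imageI) auto
        moreover have "j \<in> {k+1..n}" using 2 j by auto
        ultimately show ?thesis using ts[of j] by simp
      next
        case 3
        then have "s j = t i" using eq' by simp
        moreover have "s j \<in> s ` {1..k}" using 3 j by (intro imageI) auto
        moreover have "i \<in> {k+1..n}" using 3 i by auto
        ultimately show ?thesis using ts[of i] by simp
      next
        case 4
        then have "t i = t j" using eq' by simp
        then show ?thesis by (rule inj_onD[OF tin]) (use 4 i j in auto)
      qed
    qed
  qed
qed

section \<open>Monotone passage to the limit \<epsilon> -> 0\<close>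

lemma mrg_in_unit: "s \<in> ordered_simplex k \<Longrightarrow> t \<in> unit_cube {k+1..n} \<Longrightarrow> i \<in> {1..n} \<Longrightarrow> 0 < mrg k s t i \<and> mrg k s t i < 1"
  using ordered_simplexD[of s k i] unfolding unit_cube_def PiE_iff by (auto simp: merge_def)

lemma AE_cond_moment:
  assumes s: "s \<in> ordered_simplex k" and k: "k \<le> n" and \<epsilon>: "0 < \<epsilon>" "\<epsilon> \<le> 1"
  shows "AE t in rest k. cond_moment k \<epsilon> s t = ennreal (exp (log_moment \<epsilon> {1..n} (mrg k s t))) * indicator (unit_cube {k+1..n}) t"
  using AE_merge_inj[OF s k] by eventually_elim (simp add: cond_moment_def nn_integral_exp_field \<epsilon>)

text \<open>Candidate for the limit of the expectations, kept in \<open>ennreal\<close> because it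
  may be infinite for exceptional s.\<close>

definition limit_moment :: "nat \<Rightarrow> (nat \<Rightarrow> real) \<Rightarrow> ennreal" where
  "limit_moment k s = (\<integral>\<^sup>+t. ennreal (exp (log_limit {1..n} (mrg k s t))) * indicator (unit_cube {k+1..n}) t \<partial>rest k)"

definition moment :: "nat \<Rightarrow> real \<Rightarrow> (nat \<Rightarrow> real) \<Rightarrow> ennreal" where
  "moment k \<epsilon> s = (\<integral>\<^sup>+x. ennreal (moment_density P n k \<epsilon> s x) \<partial>\<Omega>)"

lemma moment_eq:
  assumes "k \<le> n" "s \<in> ordered_simplex k" "0 < \<epsilon>" "\<epsilon> \<le> 1"
  shows "moment k \<epsilon> s = (\<integral>\<^sup>+t. ennreal (exp (log_moment \<epsilon> {1..n} (mrg k s t))) * indicator (unit_cube {k+1..n}) t \<partial>rest k)"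
  unfolding moment_def moment_density_integral(1)[OF assms]
  by (rule nn_integral_cong_AE[OF AE_cond_moment]) (use assms in auto)

lemma moment_antimono:
  assumes "k \<le> n" "s \<in> ordered_simplex k" "0 < \<epsilon>" "\<epsilon> \<le> \<epsilon>'" "\<epsilon>' \<le> 1"
  shows "moment k \<epsilon>' s \<le> moment k \<epsilon> s"
  using assms by (subst (1 2) moment_eq) (auto intro!: nn_integral_mono mult_right_mono ennreal_leI log_moment_antimono)

lemma emeasure_unit_cube: "emeasure (rest k) (unit_cube {k+1..n}) = 1"
  unfolding unit_cube_def by (subst lborel_PiM.emeasure_PiM) auto

lemma moment_finite:
  assumes "k \<le> n" "s \<in> ordered_simplex k" "0 < \<epsilon>" "\<epsilon> \<le> 1"
  shows "moment k \<epsilon> s < \<infinity>"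
proof -
  define C where "C = real (card {1..n}) * real (card {1..n}) * (\<mu> * (\<Sum>m\<le>card {1..n}. d m) * measure \<rho> (log_cone \<epsilon> 0))"
  have "moment k \<epsilon> s \<le> (\<integral>\<^sup>+t. ennreal (exp C) * indicator (unit_cube {k+1..n}) t \<partial>rest k)"
    unfolding moment_eq[OF assms]
  proof (intro nn_integral_mono mult_right_mono ennreal_leI)
    fix t
    have "log_moment \<epsilon> {1..n} (mrg k s t) \<le> C" unfolding C_def by (rule log_moment_bounded[OF _ assms(3,4)]) simp
    then show "exp (log_moment \<epsilon> {1..n} (mrg k s t)) \<le> exp C" by simp
  qed simp
  also have "\<dots> = ennreal (exp C)"
    by (subst nn_integral_cmult_indicator) (auto simp: emeasure_unit_cube[simplified] intro: sets_unit_cube)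
  also have "\<dots> < \<infinity>" by simp
  finally show ?thesis .
qed

text \<open>Monotone convergence along the sequence 1/(j + 1). Outside a single null set of t,
  common to all j, the moment formula holds for every term.\<close>

lemma SUP_moment:
  assumes k: "k \<le> n" and s: "s \<in> ordered_simplex k"
  shows "(SUP j::nat. moment k (1 / real (Suc j)) s) = limit_moment k s"
proof -
  define e where "e j = 1 / real (Suc j)" for j
  have e: "0 < e j" "e j \<le> 1" "e (Suc j) \<le> e j" for j by (auto simp: e_def frac_le)
  have "limit_moment k s = (\<integral>\<^sup>+t. (SUP j. cond_moment k (e j) s t) \<partial>rest k)"
    unfolding limit_moment_def
  proof (rule nn_integral_cong_AE)
    have "AE t in rest k. \<forall>j. cond_moment k (e j) s t = ennreal (exp (log_moment (e j) {1..n} (mrg k s t))) * indicator (unit_cube {k+1..n}) t"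
      unfolding AE_all_countable using AE_cond_moment[OF s k e(1,2)] by blast
    then show "AE t in rest k. ennreal (exp (log_limit {1..n} (mrg k s t))) * indicator (unit_cube {k+1..n}) t = (SUP j. cond_moment k (e j) s t)"
    proof eventually_elim
      case (elim t)
      show ?case
      proof (cases "t \<in> unit_cube {k+1..n}")
        case True
        note t01 = mrg_in_unit[OF s True]
        obtain \<epsilon>0 where \<epsilon>0: "0 < \<epsilon>0" "\<And>\<epsilon>. 0 < \<epsilon> \<Longrightarrow> \<epsilon> \<le> \<epsilon>0 \<Longrightarrow> log_moment \<epsilon> {1..n} (mrg k s t) = log_limit {1..n} (mrg k s t)"
          using eventually_log_moment_eq_limit[of "{1..n}" "mrg k s t"] t01 by blast
        \<comment> \<open>Beyond this index the exponent equals its limit, so the supremum is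
          attained.\<close>
        obtain j where j: "e j < \<epsilon>0" using \<epsilon>0(1) unfolding e_def by (metis inverse_eq_divide reals_Archimedean)
        have "(SUP j. ennreal (exp (log_moment (e j) {1..n} (mrg k s t)))) = ennreal (exp (log_limit {1..n} (mrg k s t)))"
        proof (rule antisym)
          show "(SUP j. ennreal (exp (log_moment (e j) {1..n} (mrg k s t)))) \<le> ennreal (exp (log_limit {1..n} (mrg k s t)))"
            by (intro SUP_least ennreal_leI exp_le_cancel_iff[THEN iffD2] log_moment_le_limit t01 e) simp_all
          show "ennreal (exp (log_limit {1..n} (mrg k s t))) \<le> (SUP j. ennreal (exp (log_moment (e j) {1..n} (mrg k s t))))"
            using \<epsilon>0(2)[OF e(1)[of j]] j by (intro SUP_upper2[of j]) auto
        qed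
        then show ?thesis unfolding elim[rule_format] using True by simp
      qed (use elim in simp)
    qed
  qed
  also have "\<dots> = (SUP j. \<integral>\<^sup>+t. cond_moment k (e j) s t \<partial>rest k)"
  proof (rule nn_integral_monotone_convergence_SUP_AE)
    show "cond_moment k (e j) s \<in> borel_measurable (rest k)" for j by (rule moment_density_integral(2)[OF k s e(1,2)])
    show "AE t in rest k. cond_moment k (e j) s t \<le> cond_moment k (e (Suc j)) s t" for j
      using AE_cond_moment[OF s k e(1,2), of j] AE_cond_moment[OF s k e(1,2), of "Suc j"]
    proof eventually_elim
      case (elim t)
      show ?case unfolding elim by (intro mult_right_mono ennreal_leI) (auto intro!: log_moment_antimono e)
    qed
  qed
  also have "\<dots> = (SUP j. moment k (e j) s)"
    unfolding moment_def by (simp only: moment_density_integral(1)[OF k s e(1,2)])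
  finally show ?thesis by (simp add: e_def)
qed

text \<open>Monotonicity in \<epsilon> upgrades the limit along the sequence to the limit over all
  \<epsilon>.\<close>

lemma moment_tendsto:
  assumes k: "k \<le> n" and s: "s \<in> ordered_simplex k"
  shows "((\<lambda>\<epsilon>. moment k \<epsilon> s) \<longlongrightarrow> limit_moment k s) (at_right 0)"
proof (rule order_tendstoI)
  have ev: "\<forall>\<^sub>F \<epsilon> in at_right 0. 0 < \<epsilon> \<and> \<epsilon> \<le> b" if "0 < b" for b :: real
    unfolding eventually_at_right_field using that by (intro exI[of _ b]) auto
  fix a assume "a < limit_moment k s"
  then obtain j :: nat where j: "a < moment k (1 / real (Suc j)) s"
    unfolding SUP_moment[OF k s, symmetric] less_SUP_iff by blast
  show "\<forall>\<^sub>F \<epsilon> in at_right 0. a < moment k \<epsilon> s"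
    using ev[of "1 / real (Suc j)"]
  proof (rule eventually_mono)
    fix \<epsilon> :: real assume "0 < \<epsilon> \<and> \<epsilon> \<le> 1 / real (Suc j)"
    then have "moment k (1 / real (Suc j)) s \<le> moment k \<epsilon> s" by (intro moment_antimono k s) auto
    then show "a < moment k \<epsilon> s" using j by (rule less_le_trans[rotated])
  qed simp
next
  have ev: "\<forall>\<^sub>F \<epsilon> in at_right 0. 0 < \<epsilon> \<and> \<epsilon> \<le> (1::real)"
    unfolding eventually_at_right_field by (intro exI[of _ 1]) auto
  fix a assume a: "limit_moment k s < a"
  show "\<forall>\<^sub>F \<epsilon> in at_right 0. moment k \<epsilon> s < a"
    using ev
  proof eventually_elim
    case (elim \<epsilon>)
    then obtain j where j: "1 / real (Suc j) < \<epsilon>" by (metis inverse_eq_divide reals_Archimedean)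
    have "moment k \<epsilon> s \<le> moment k (1 / real (Suc j)) s" using elim j by (intro moment_antimono k s) auto
    also have "\<dots> \<le> limit_moment k s" unfolding SUP_moment[OF k s, symmetric] by (rule SUP_upper) simp
    finally show ?case using a by simp
  qed
qed

lemma integrable_moment_density:
  assumes "k \<le> n" "s \<in> ordered_simplex k" "0 < \<epsilon>" "\<epsilon> \<le> 1"
  shows "integrable \<Omega> (moment_density P n k \<epsilon> s)"
proof (rule integrableI_nonneg)
  show "moment_density P n k \<epsilon> s \<in> borel_measurable \<Omega>" by (rule borel_measurable_moment_density[OF assms(3,4)])
  show "AE x in \<Omega>. 0 \<le> moment_density P n k \<epsilon> s x" by (rule AE_I2[OF moment_density_nonneg])
  show "(\<integral>\<^sup>+x. ennreal (moment_density P n k \<epsilon> s x) \<partial>\<Omega>) < \<infinity>" using moment_finite[OF assms] unfolding moment_def .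
qed

lemma expectation_eq_moment:
  assumes "0 < \<epsilon>" "\<epsilon> \<le> 1"
  shows "(LINT x|\<Omega>. moment_density P n k \<epsilon> s x) = enn2real (moment k \<epsilon> s)"
  unfolding moment_def
  by (rule integral_eq_nn_integral[OF borel_measurable_moment_density[OF assms] AE_I2[OF moment_density_nonneg]])

text \<open>The expectations are finite for each \<epsilon>, so convergence in the reals is
  convergence in \<open>ennreal\<close> to a finite value. The equivalence for arbitrary l
  determines \<open>Lim\<close> also where the expectations diverge.\<close>

lemma expectation_tendsto_iff:
  assumes k: "k \<le> n" and s: "s \<in> ordered_simplex k"
  shows "((\<lambda>\<epsilon>. LINT x|\<Omega>. moment_density P n k \<epsilon> s x) \<longlongrightarrow> l) (at_right 0) \<longleftrightarrow>
    limit_moment k s < \<infinity> \<and> l = enn2real (limit_moment k s)"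
proof -
  have ev: "\<forall>\<^sub>F \<epsilon> in at_right 0. 0 < \<epsilon> \<and> \<epsilon> \<le> (1::real)"
    unfolding eventually_at_right_field by (intro exI[of _ 1]) auto
  have ev1: "\<forall>\<^sub>F \<epsilon> in at_right 0. ennreal (LINT x|\<Omega>. moment_density P n k \<epsilon> s x) = moment k \<epsilon> s"
    using ev
  proof eventually_elim
    case (elim \<epsilon>)
    then show ?case using moment_finite[OF k s, of \<epsilon>] by (simp add: expectation_eq_moment)
  qed
  have lim: "((\<lambda>\<epsilon>. ennreal (LINT x|\<Omega>. moment_density P n k \<epsilon> s x)) \<longlongrightarrow> limit_moment k s) (at_right 0)"
    using tendsto_cong[OF ev1] moment_tendsto[OF k s] by simp
  have E0: "0 \<le> (LINT x|\<Omega>. moment_density P n k \<epsilon> s x)" for \<epsilon>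
    by (intro integral_nonneg_AE AE_I2 moment_density_nonneg)
  show ?thesis
  proof
    assume l: "((\<lambda>\<epsilon>. LINT x|\<Omega>. moment_density P n k \<epsilon> s x) \<longlongrightarrow> l) (at_right 0)"
    have "0 \<le> l" by (rule tendsto_lowerbound[OF l]) (auto simp: E0)
    moreover have "ennreal l = limit_moment k s"
      by (rule tendsto_unique[OF _ tendsto_ennrealI[OF l] lim]) simp
    ultimately show "limit_moment k s < \<infinity> \<and> l = enn2real (limit_moment k s)"
      by (metis enn2real_ennreal ennreal_less_top infinity_ennreal_def)
  next
    assume r: "limit_moment k s < \<infinity> \<and> l = enn2real (limit_moment k s)"
    then have "limit_moment k s = ennreal l" by simp
    then have "((\<lambda>\<epsilon>. ennreal (LINT x|\<Omega>. moment_density P n k \<epsilon> s x)) \<longlongrightarrow> ennreal l) (at_right 0)" using lim by simp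
    from tendsto_enn2real[OF this] r show "((\<lambda>\<epsilon>. LINT x|\<Omega>. moment_density P n k \<epsilon> s x) \<longlongrightarrow> l) (at_right 0)"
      by (simp add: E0)
  qed
qed

end

section \<open>The derivative identity\<close>

lemma (in levy) d_coeff_binomial:
  assumes m: "1 \<le> m" "m + 1 \<le> n"
  shows "d_coeff \<sigma>2 \<nu> m = \<sigma>2 + (\<Sum>k\<in>{2..n}. real ((m - 1) choose (k - 2)) * (LINT u|\<nu>. (exp u - 1) ^ k))"
proof -
  have "(LINT u|\<nu>. exp ((real m - 1) * u) * (exp u - 1)\<^sup>2) = (LINT u|\<nu>. (\<Sum>k\<in>{2..n}. real ((m - 1) choose (k - 2)) * (exp u - 1) ^ k))"
  proof (rule Bochner_Integration.integral_cong[OF refl])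
    fix u :: real
    have "exp ((real m - 1) * u) = ((exp u - 1) + 1) ^ (m - 1)"
      using m by (simp add: exp_of_nat_mult[symmetric] of_nat_diff)
    also have "\<dots> = (\<Sum>l\<le>m - 1. real ((m - 1) choose l) * (exp u - 1) ^ l)"
      unfolding binomial_ring by simp
    finally have e: "exp ((real m - 1) * u) = (\<Sum>l\<le>m - 1. real ((m - 1) choose l) * (exp u - 1) ^ l)" .
    have "exp ((real m - 1) * u) * (exp u - 1)\<^sup>2 = (\<Sum>l\<le>m - 1. real ((m - 1) choose l) * (exp u - 1) ^ (l + 2))"
      by (simp only: e sum_distrib_right power_add mult.assoc)
    also have "\<dots> = (\<Sum>k\<in>{2..m + 1}. real ((m - 1) choose (k - 2)) * (exp u - 1) ^ k)"
      using m by (intro sum.reindex_bij_witness[of _ "\<lambda>k. k - 2" "\<lambda>l. l + 2"]) auto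
    \<comment> \<open>Vanishing binomials extend the sum to a range independent of m, so that the
      sums over pairs and over k can later be interchanged.\<close>
    also have "\<dots> = (\<Sum>k\<in>{2..n}. real ((m - 1) choose (k - 2)) * (exp u - 1) ^ k)"
      using m by (intro sum.mono_neutral_left) (auto simp: binomial_eq_0)
    finally show "exp ((real m - 1) * u) * (exp u - 1)\<^sup>2 = (\<Sum>k\<in>{2..n}. real ((m - 1) choose (k - 2)) * (exp u - 1) ^ k)" .
  qed
  also have "\<dots> = (\<Sum>k\<in>{2..n}. LINT u|\<nu>. real ((m - 1) choose (k - 2)) * (exp u - 1) ^ k)"
    by (intro Bochner_Integration.integral_sum integrable_mult_right integrable_power_expm1) auto
  also have "\<dots> = (\<Sum>k\<in>{2..n}. real ((m - 1) choose (k - 2)) * (LINT u|\<nu>. (exp u - 1) ^ k))" by simp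
  finally show ?thesis unfolding d_coeff_def by simp
qed

section \<open>Integrability of the limit weight\<close>

context cascade
begin

definition W :: "(nat \<Rightarrow> real) \<Rightarrow> ennreal" where "W t = ennreal (exp (log_limit {1..n} t))"

text \<open>The kernel -log r(y - x) for x < y, truncated through \<open>L0\<close> so as to be
  Borel on the plane.\<close>

definition Gk :: "real \<Rightarrow> real \<Rightarrow> ennreal" where "Gk x y = ennreal (- L0 (y - x))"

lemma borel_measurable_W: "W \<in> borel_measurable (lborel_vec n)"
  unfolding W_def[abs_def]
  by (intro measurable_compose[OF _ measurable_ennreal] measurable_compose[OF _ borel_measurable_exp] borel_measurable_log_limit) simp

lemma borel_measurable_Gk: "(\<lambda>(x, y). Gk x y) \<in> borel_measurable (borel \<Otimes>\<^sub>M borel)"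
  unfolding Gk_def case_prod_beta'
  by (intro measurable_compose[OF _ measurable_ennreal] borel_measurable_uminus measurable_compose[OF _ borel_measurable_L0]
     borel_measurable_diff measurable_fst measurable_snd)

lemma L0_nonpos: "L0 x \<le> 0" using L_nonpos by (simp add: L0_def)

lemma r_le_1: "0 < x \<Longrightarrow> x < 1 \<Longrightarrow> r x \<le> 1"
  using L_nonpos[of x] r_pos[of x] by (simp add: L_def)

lemma simplex_diff:
  assumes "t \<in> ordered_simplex n" "1 \<le> i" "i < j" "j \<le> n"
  shows "0 < t j - t i" "t j - t i < 1"
proof -
  have "strict_mono_on {1..n} t" using assms by (auto simp: ordered_simplex_def)
  then have "t i < t j" using assms by (intro strict_mono_onD[of "{1..n}" t]) auto
  then show "0 < t j - t i" by simp
  show "t j - t i < 1" using ordered_simplexD[OF assms(1), of i] ordered_simplexD[OF assms(1), of j] assms by auto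
qed

lemma log_kernel_eq: 
  assumes "0 < y - x" "y - x < 1"
  shows "log_kernel r y x = - L0 (y - x)" "log_kernel r x y = - L0 (y - x)"
  using assms r_even[of "y - x"] by (auto simp: log_kernel_def L0_def L_def)

text \<open>One product of powers of distances dominates both the limit weight and its product with
  any -log r(t_j - t_i), and its exponents are still subcritical for every cluster.\<close>

lemma weight_bound:
  obtains b C where "\<And>j. 0 \<le> b j" "0 \<le> C"
    "\<And>a c. a < c \<Longrightarrow> c - a < n \<Longrightarrow> gap_weight b a c < real (c - a)"
    "\<And>t. t \<in> ordered_simplex n \<Longrightarrow> exp (log_limit {1..n} t) \<le> C * (\<Prod>p\<in>{1..n}. \<Prod>k\<in>{1..<p}. (t p - t k) powr (- b (p - k)))"
    "\<And>t i j. t \<in> ordered_simplex n \<Longrightarrow> 1 \<le> i \<Longrightarrow> i < j \<Longrightarrow> j \<le> n \<Longrightarrow>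
       exp (log_limit {1..n} t) * (- L0 (t j - t i)) \<le> C * (\<Prod>p\<in>{1..n}. \<Prod>k\<in>{1..<p}. (t p - t k) powr (- b (p - k)))"
proof -
  have c: "\<mu> * pair_exponent d n < real n - 1"
    using crit Phi_eq_pair_exponent[of n \<sigma>2] by (simp add: Phi_def)
  obtain \<delta> where \<delta>: "0 < \<delta>"
    "\<And>m. 2 \<le> m \<Longrightarrow> m \<le> n \<Longrightarrow> pair_exponent (\<lambda>j. (1 + \<delta>) * (\<mu> * d j + \<delta>)) m < real m - 1"
    using pair_exponent_subcritical[of d \<mu> n, OF d_nonneg less_imp_le[OF \<mu>] c] by blast
  obtain C0 where C0: "0 < C0" "\<And>x. 0 < x \<Longrightarrow> x < 1 \<Longrightarrow> C0 * x powr (1 + \<delta>) \<le> r x"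
    using r_lower_bound[OF \<delta>(1)] by blast
  \<comment> \<open>Raising each exponent of 1/r by \<delta> makes room for the logarithm; the
    factor 1 + \<delta> in \<open>b\<close> arises when r(x) is replaced by its lower bound C0 x^(1
    + \<delta>).\<close>
  define a where "a j = \<mu> * d j + \<delta>" for j
  define b where "b j = (1 + \<delta>) * a j" for j
  have a0: "0 \<le> a j" for j using \<mu> d_nonneg \<delta>(1) by (simp add: a_def)
  define C1 where "C1 = (\<Prod>p\<in>{1..n}. \<Prod>k\<in>{1..<p}. C0 powr (- a (p - k)))"
  have C1: "0 \<le> C1" unfolding C1_def by (intro prod_nonneg) auto
  let ?K = "\<lambda>t. \<Prod>p\<in>{1..n}. \<Prod>k\<in>{1..<p}. (t p - t k) powr (- b (p - k)) :: real"
  let ?R = "\<lambda>t. \<Prod>p\<in>{1..n}. \<Prod>k\<in>{1..<p}. r (t p - t k) powr (- a (p - k))"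
  have RK: "?R t \<le> C1 * ?K t" if t: "t \<in> ordered_simplex n" for t
  proof -
    have "?R t \<le> (\<Prod>p\<in>{1..n}. \<Prod>k\<in>{1..<p}. C0 powr (- a (p - k)) * (t p - t k) powr (- b (p - k)))"
    proof (intro prod_mono conjI prod_nonneg)
      fix p k assume pk: "p \<in> {1..n}" "k \<in> {1..<p}"
      let ?x = "t p - t k"
      have x: "0 < ?x" "?x < 1" using simplex_diff[OF t, of k p] pk by auto
      have "r ?x powr (- a (p - k)) \<le> (C0 * ?x powr (1 + \<delta>)) powr (- a (p - k))"
        using C0(1) C0(2)[OF x] x a0 by (intro powr_mono2') auto
      also have "\<dots> = C0 powr (- a (p - k)) * ?x powr (- b (p - k))"
        using C0(1) x by (simp add: powr_mult powr_powr b_def)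
      finally show "r ?x powr (- a (p - k)) \<le> C0 powr (- a (p - k)) * ?x powr (- b (p - k))" .
    qed auto
    then show ?thesis by (simp add: C1_def prod.distrib)
  qed
  have e1: "exp (log_limit {1..n} t) \<le> ?R t" if t: "t \<in> ordered_simplex n" for t
    unfolding exp_log_limit_simplex[OF t]
  proof (intro prod_mono conjI prod_nonneg)
    fix p k assume pk: "p \<in> {1..n}" "k \<in> {1..<p}"
    let ?x = "t p - t k"
    have x: "0 < ?x" "?x < 1" using simplex_diff[OF t, of k p] pk by auto
    show "r ?x powr (- \<mu> * d (p - k)) \<le> r ?x powr (- a (p - k))"
      using r_pos[OF x] r_le_1[OF x] \<delta>(1) by (intro powr_mono') (auto simp: a_def)
  qed auto
  have e2: "exp (log_limit {1..n} t) * (- L0 (t j - t i)) \<le> 1 / \<delta> * ?R t"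
    if t: "t \<in> ordered_simplex n" and ij: "1 \<le> i" "i < j" "j \<le> n" for t i j
  proof -
    let ?q = "\<lambda>p k. r (t p - t k) powr (- \<delta>)"
    have q1: "1 \<le> ?q p k" if "p \<in> {1..n}" "k \<in> {1..<p}" for p k
    proof -
      have x: "0 < t p - t k" "t p - t k < 1" using simplex_diff[OF t, of k p] that by auto
      have "1 powr (- \<delta>) \<le> ?q p k" using r_pos[OF x] r_le_1[OF x] \<delta>(1) by (intro powr_mono2') auto
      then show ?thesis by simp
    qed
    have x: "0 < t j - t i" "t j - t i < 1" using simplex_diff[OF t ij] by auto
    \<comment> \<open>The inequality ln q \<le> q for q = r^(-\<delta>). Since r \<le> 1, the
      corresponding factors of all other pairs are at least 1 and may be multiplied in.\<close>
    have "- L0 (t j - t i) * \<delta> = ln (?q j i)"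
      using x r_pos[OF x] by (simp add: L0_def L_def ln_powr)
    also have "\<dots> \<le> ?q j i" using r_pos[OF x] ln_bound[of "?q j i"] by simp
    also have "\<dots> \<le> (\<Prod>k\<in>{1..<j}. ?q j k)" using ij q1 by (intro member_le_prod[of _ _ "?q j"]) auto
    also have "\<dots> \<le> (\<Prod>p\<in>{1..n}. \<Prod>k\<in>{1..<p}. ?q p k)"
      using ij q1 by (intro member_le_prod[of _ _ "\<lambda>p. \<Prod>k\<in>{1..<p}. ?q p k"] prod_ge_1) auto
    finally have "- L0 (t j - t i) \<le> 1 / \<delta> * (\<Prod>p\<in>{1..n}. \<Prod>k\<in>{1..<p}. ?q p k)"
      using \<delta>(1) by (simp add: field_simps)
    then have "exp (log_limit {1..n} t) * (- L0 (t j - t i)) \<le> exp (log_limit {1..n} t) * (1 / \<delta> * (\<Prod>p\<in>{1..n}. \<Prod>k\<in>{1..<p}. ?q p k))"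
      by (intro mult_left_mono) auto
    also have "\<dots> = 1 / \<delta> * (exp (log_limit {1..n} t) * (\<Prod>p\<in>{1..n}. \<Prod>k\<in>{1..<p}. ?q p k))" by simp
    also have "exp (log_limit {1..n} t) * (\<Prod>p\<in>{1..n}. \<Prod>k\<in>{1..<p}. ?q p k) = ?R t"
      unfolding exp_log_limit_simplex[OF t] prod.distrib[symmetric]
      by (intro prod.cong refl) (simp add: a_def powr_add[symmetric])
    finally show ?thesis .
  qed
  have K0: "0 \<le> ?K t" for t by (intro prod_nonneg) auto
  \<comment> \<open>Large enough for both bounds, whose constants are \<open>C1\<close> and
    \<open>C1\<close> / \<delta>.\<close>
  define C where "C = (1 + 1 / \<delta>) * C1"
  have C01: "C1 \<le> C" "1 / \<delta> * C1 \<le> C" using C1 \<delta>(1) by (auto simp: C_def algebra_simps)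
  show thesis
  proof (rule that[of b C])
    show "0 \<le> b j" for j using a0 \<delta>(1) by (simp add: b_def)
    show "0 \<le> C" using C1 C01 by simp
    show "gap_weight b a' c < real (c - a')" if "a' < c" "c - a' < n" for a' c
    proof -
      have b': "b = (\<lambda>j. (1 + \<delta>) * (\<mu> * d j + \<delta>))" by (simp add: b_def a_def fun_eq_iff)
      have "gap_weight b a' c = pair_exponent b (Suc (c - a'))" using that by (intro gap_weight_eq_pair_exponent) simp
      also have "\<dots> < real (Suc (c - a')) - 1" unfolding b' using that by (intro \<delta>(2)) auto
      finally show ?thesis by simp
    qed
    show "exp (log_limit {1..n} t) \<le> C * ?K t" if t: "t \<in> ordered_simplex n" for t
      using order_trans[OF e1[OF t] RK[OF t]] mult_right_mono[OF C01(1) K0[of t]] by linarith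
    show "exp (log_limit {1..n} t) * (- L0 (t j - t i)) \<le> C * ?K t"
      if t: "t \<in> ordered_simplex n" and ij: "1 \<le> i" "i < j" "j \<le> n" for t i j
    proof -
      have "1 / \<delta> * ?R t \<le> 1 / \<delta> * (C1 * ?K t)" using RK[OF t] \<delta>(1) by (intro mult_left_mono) auto
      then show ?thesis using e2[OF t ij] mult_right_mono[OF C01(2) K0[of t]] by (simp add: mult.assoc) 
    qed
  qed
qed

text \<open>The unknowns in which the two sides of the identity are compared; what remains then is
  algebra of their coefficients.\<close>

definition pair_integral :: "nat \<Rightarrow> nat \<Rightarrow> ennreal" where
  "pair_integral i j = (\<integral>\<^sup>+t. W t * Gk (t i) (t j) * indicator (ordered_simplex n) t \<partial>lborel_vec n)"

lemma W_integrals_finite: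
  shows "(\<integral>\<^sup>+t. W t * indicator (ordered_simplex n) t \<partial>lborel_vec n) < \<infinity>"
    and "1 \<le> i \<Longrightarrow> i < j \<Longrightarrow> j \<le> n \<Longrightarrow> pair_integral i j < \<infinity>"
proof -
  obtain b C where b: "\<And>j. 0 \<le> b j" and C: "0 \<le> C"
    and w: "\<And>a c. a < c \<Longrightarrow> c - a < n \<Longrightarrow> gap_weight b a c < real (c - a)"
    and B1: "\<And>t. t \<in> ordered_simplex n \<Longrightarrow> exp (log_limit {1..n} t) \<le> C * (\<Prod>p\<in>{1..n}. \<Prod>k\<in>{1..<p}. (t p - t k) powr (- b (p - k)))"
    and B2: "\<And>t i j. t \<in> ordered_simplex n \<Longrightarrow> 1 \<le> i \<Longrightarrow> i < j \<Longrightarrow> j \<le> n \<Longrightarrow>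
       exp (log_limit {1..n} t) * (- L0 (t j - t i)) \<le> C * (\<Prod>p\<in>{1..n}. \<Prod>k\<in>{1..<p}. (t p - t k) powr (- b (p - k)))"
    using weight_bound by blast
  let ?K = "\<lambda>t. \<Prod>p\<in>{1..n}. \<Prod>k\<in>{1..<p}. (t p - t k) powr (- b (p - k)) :: real"
  have K0: "0 \<le> ?K t" for t by (intro prod_nonneg) auto
  have fin: "(\<integral>\<^sup>+t. ennreal (?K t) * indicator (ordered_simplex n) t \<partial>lborel_vec n) < \<infinity>"
    using n_ge by (intro nn_integral_simplex_prod_powr_finite[OF b _ w sets_ordered_simplex]) auto
  have Km: "(\<lambda>t. ennreal (?K t) * indicator (ordered_simplex n) t) \<in> borel_measurable (lborel_vec n)"
    by (intro borel_measurable_times_ennreal measurable_compose[OF _ measurable_ennreal] borel_measurable_prod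
        powr_real_measurable borel_measurable_diff measurable_PiM_component_real borel_measurable_const
        borel_measurable_indicator sets_ordered_simplex) auto
  have "(\<integral>\<^sup>+t. ennreal C * (ennreal (?K t) * indicator (ordered_simplex n) t) \<partial>lborel_vec n) < \<infinity>"
    using fin unfolding nn_integral_cmult[OF Km] by (simp add: ennreal_mult_less_top)
  note CK = this
  have le: "(\<integral>\<^sup>+t. f t * indicator (ordered_simplex n) t \<partial>lborel_vec n) < \<infinity>"
    if "\<And>t. t \<in> ordered_simplex n \<Longrightarrow> f t \<le> ennreal (C * ?K t)" for f
  proof (rule le_less_trans[OF nn_integral_mono CK])
    fix t
    show "f t * indicator (ordered_simplex n) t \<le> ennreal C * (ennreal (?K t) * indicator (ordered_simplex n) t)"
      using that[of t] C K0[of t] by (auto simp: indicator_def ennreal_mult')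
  qed
  show "(\<integral>\<^sup>+t. W t * indicator (ordered_simplex n) t \<partial>lborel_vec n) < \<infinity>"
    unfolding W_def by (intro le ennreal_leI B1)
  assume ij: "1 \<le> i" "i < j" "j \<le> n"
  show "pair_integral i j < \<infinity>"
    unfolding pair_integral_def
  proof (rule le)
    fix t assume t: "t \<in> ordered_simplex n"
    have "W t * Gk (t i) (t j) = ennreal (exp (log_limit {1..n} t) * (- L0 (t j - t i)))"
      unfolding W_def Gk_def using L0_nonpos by (intro ennreal_mult[symmetric]) auto
    then show "W t * Gk (t i) (t j) \<le> ennreal (C * ?K t)" using B2[OF t ij] by (simp add: ennreal_leI)
  qed
qed

abbreviation pairs :: "nat \<Rightarrow> (nat \<times> nat) set" where
  "pairs k \<equiv> {(i, j). 1 \<le> i \<and> i < j \<and> j \<le> n \<and> k - 1 \<le> j - i}"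

text \<open>The prefix identity for the limit weight, which is symmetric. The constant kernel will
  give almost sure finiteness, the kernel \<open>Gk\<close> the value of the right-hand
  integrals.\<close>

lemma nn_integral_limit_moment:
  assumes k: "2 \<le> k" "k \<le> n" and G: "(\<lambda>(x, y). G x y) \<in> borel_measurable (borel \<Otimes>\<^sub>M borel)"
  shows "(\<integral>\<^sup>+s. G (s 1) (s k) * limit_moment k s * indicator (ordered_simplex k) s \<partial>lborel_vec k) =
    of_nat (fact (n - k)) * (\<integral>\<^sup>+t. W t * (\<Sum>(i, j)\<in>pairs k. of_nat ((j - i - 1) choose (k - 2)) * G (t i) (t j)) *
        indicator (ordered_simplex n) t \<partial>lborel_vec n)"
  unfolding limit_moment_def W_def[symmetric]
  by (rule nn_integral_ordered_prefix[OF k borel_measurable_W _ G]) (simp only: W_def log_limit_permute)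

lemma finite_pairs: "finite (pairs k)"
  by (rule finite_subset[of _ "{1..n} \<times> {1..n}"]) auto

lemma borel_measurable_limit_moment:
  assumes "k \<le> n" shows "limit_moment k \<in> borel_measurable (lborel_vec k)"
proof -
  interpret J: finite_product_sigma_finite "\<lambda>_::nat. lborel :: real measure" "{k+1..n}" by standard simp
  have un: "{1..k} \<union> {k+1..n} = {1..n}" using assms by auto
  have "(\<lambda>z. W (merge {1..k} {k+1..n} z)) \<in> borel_measurable (lborel_vec k \<Otimes>\<^sub>M rest k)"
    using measurable_compose[OF measurable_merge[of "{1..k}" "{k+1..n}" "\<lambda>_. lborel :: real measure"], of W borel] borel_measurable_W
    unfolding un by blast
  then have "(\<lambda>z. W (merge {1..k} {k+1..n} z) * indicator (unit_cube {k+1..n}) (snd z)) \<in> borel_measurable (lborel_vec k \<Otimes>\<^sub>M rest k)"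
    by (intro borel_measurable_times_ennreal measurable_compose[OF measurable_snd borel_measurable_indicator] sets_unit_cube) auto
  then show ?thesis unfolding limit_moment_def[abs_def] W_def[symmetric]
    by (intro J.borel_measurable_nn_integral) (simp only: case_prod_beta' prod.collapse)
qed

text \<open>With the constant kernel 1 the integral of \<open>limit_moment\<close> over the simplex
  is a finite multiple of the finite integral of \<open>W\<close>.\<close>

lemma AE_limit_moment_finite:
  assumes k: "2 \<le> k" "k \<le> n"
  shows "AE s in lborel_vec k. s \<in> ordered_simplex k \<longrightarrow> limit_moment k s < \<infinity>"
proof -
  have "(\<integral>\<^sup>+s. 1 * limit_moment k s * indicator (ordered_simplex k) s \<partial>lborel_vec k) =
    of_nat (fact (n - k)) * (\<integral>\<^sup>+t. W t * (\<Sum>(i, j)\<in>pairs k. of_nat ((j - i - 1) choose (k - 2)) * 1) *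
        indicator (ordered_simplex n) t \<partial>lborel_vec n)"
    by (rule nn_integral_limit_moment[OF k, of "\<lambda>_ _. 1"]) simp
  also have "(\<integral>\<^sup>+t. W t * (\<Sum>(i, j)\<in>pairs k. of_nat ((j - i - 1) choose (k - 2)) * 1) *
        indicator (ordered_simplex n) t \<partial>lborel_vec n) =
     (\<integral>\<^sup>+t. (\<Sum>(i, j)\<in>pairs k. of_nat ((j - i - 1) choose (k - 2))) * (W t * indicator (ordered_simplex n) t) \<partial>lborel_vec n)"
    by (intro nn_integral_cong) (simp add: ac_simps)
  also have "\<dots> = (\<Sum>(i, j)\<in>pairs k. of_nat ((j - i - 1) choose (k - 2))) * (\<integral>\<^sup>+t. W t * indicator (ordered_simplex n) t \<partial>lborel_vec n)"
    by (intro nn_integral_cmult borel_measurable_times_ennreal borel_measurable_W borel_measurable_indicator sets_ordered_simplex)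
  also have "of_nat (fact (n - k)) * \<dots> < \<infinity>"
  proof -
    have "(\<Sum>(i, j)\<in>pairs k. of_nat ((j - i - 1) choose (k - 2)) :: ennreal) < \<infinity>"
    proof -
      have "(\<Sum>(i, j)\<in>pairs k. of_nat ((j - i - 1) choose (k - 2)) :: ennreal) = of_nat (\<Sum>(i, j)\<in>pairs k. (j - i - 1) choose (k - 2))"
        by (simp add: case_prod_beta')
      then show ?thesis by (simp only: of_nat_less_top infinity_ennreal_def)
    qed
    moreover have "of_nat (fact (n - k)) < (top :: ennreal)" by (rule of_nat_less_top)
    ultimately show ?thesis using W_integrals_finite(1) by (simp add: ennreal_mult_less_top)
  qed
  finally have fin: "(\<integral>\<^sup>+s. limit_moment k s * indicator (ordered_simplex k) s \<partial>lborel_vec k) \<noteq> \<infinity>" by simp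
  have "(\<lambda>s. limit_moment k s * indicator (ordered_simplex k) s) \<in> borel_measurable (lborel_vec k)"
    by (intro borel_measurable_times_ennreal borel_measurable_limit_moment k borel_measurable_indicator sets_ordered_simplex)
  from nn_integral_PInf_AE[OF this fin] show ?thesis
    by eventually_elim (auto simp: indicator_def less_top[symmetric])
qed

lemma ennreal_pair_integral: "1 \<le> i \<Longrightarrow> i < j \<Longrightarrow> j \<le> n \<Longrightarrow> pair_integral i j = ennreal (enn2real (pair_integral i j))"
  using W_integrals_finite(2)[of i j] by simp

lemma nn_integral_kernel_limit_moment:
  assumes k: "2 \<le> k" "k \<le> n"
  shows "(\<integral>\<^sup>+s. Gk (s 1) (s k) * limit_moment k s * indicator (ordered_simplex k) s \<partial>lborel_vec k) =
    ennreal (fact (n - k) * (\<Sum>(i, j)\<in>pairs k. real ((j - i - 1) choose (k - 2)) * enn2real (pair_integral i j)))"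
proof -
  have m: "(\<lambda>t. W t * Gk (t i) (t j) * indicator (ordered_simplex n) t) \<in> borel_measurable (lborel_vec n)"
    if "i \<in> {1..n}" "j \<in> {1..n}" for i j
  proof -
    have "(\<lambda>t. Gk (t i) (t j)) \<in> borel_measurable (lborel_vec n)"
      unfolding Gk_def using that
      by (intro measurable_compose[OF _ measurable_ennreal] borel_measurable_uminus measurable_compose[OF _ borel_measurable_L0]
        borel_measurable_diff measurable_PiM_component_real)
    then show ?thesis by (intro borel_measurable_times_ennreal borel_measurable_W borel_measurable_indicator sets_ordered_simplex)
  qed
  have "(\<integral>\<^sup>+t. W t * (\<Sum>(i, j)\<in>pairs k. of_nat ((j - i - 1) choose (k - 2)) * Gk (t i) (t j)) * indicator (ordered_simplex n) t \<partial>lborel_vec n)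
    = (\<integral>\<^sup>+t. (\<Sum>z\<in>pairs k. of_nat ((snd z - fst z - 1) choose (k - 2)) * (W t * Gk (t (fst z)) (t (snd z)) * indicator (ordered_simplex n) t)) \<partial>lborel_vec n)"
    by (intro nn_integral_cong) (simp add: sum_distrib_left sum_distrib_right case_prod_beta' ac_simps)
  also have "\<dots> = (\<Sum>z\<in>pairs k. \<integral>\<^sup>+t. of_nat ((snd z - fst z - 1) choose (k - 2)) * (W t * Gk (t (fst z)) (t (snd z)) * indicator (ordered_simplex n) t) \<partial>lborel_vec n)"
    by (intro nn_integral_sum borel_measurable_times_ennreal[OF borel_measurable_const] m) auto
  also have "\<dots> = (\<Sum>z\<in>pairs k. of_nat ((snd z - fst z - 1) choose (k - 2)) * pair_integral (fst z) (snd z))"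
    unfolding pair_integral_def by (intro sum.cong refl nn_integral_cmult m) auto
  also have "\<dots> = (\<Sum>z\<in>pairs k. ennreal (real ((snd z - fst z - 1) choose (k - 2)) * enn2real (pair_integral (fst z) (snd z))))"
  proof (intro sum.cong refl)
    fix z assume "z \<in> pairs k"
    then have "pair_integral (fst z) (snd z) = ennreal (enn2real (pair_integral (fst z) (snd z)))" by (intro ennreal_pair_integral) auto
    then show "of_nat ((snd z - fst z - 1) choose (k - 2)) * pair_integral (fst z) (snd z) =
      ennreal (real ((snd z - fst z - 1) choose (k - 2)) * enn2real (pair_integral (fst z) (snd z)))"
      by (metis ennreal_mult enn2real_nonneg ennreal_of_nat_eq_real_of_nat of_nat_0_le_iff)
  qed
  also have "\<dots> = ennreal (\<Sum>z\<in>pairs k. real ((snd z - fst z - 1) choose (k - 2)) * enn2real (pair_integral (fst z) (snd z)))"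
    by (intro sum_ennreal) auto
  finally show ?thesis unfolding nn_integral_limit_moment[OF k borel_measurable_Gk]
    by (simp add: case_prod_beta' ennreal_mult sum_nonneg ennreal_of_nat_eq_real_of_nat)
qed

end

section \<open>Both sides as linear combinations of the pair integrals\<close>

context cascade
begin

abbreviation E :: "nat \<Rightarrow> real \<Rightarrow> (nat \<Rightarrow> real) \<Rightarrow> real" where
  "E k \<epsilon> s \<equiv> LINT x|\<Omega>. moment_density P n k \<epsilon> s x"

text \<open>Where the expectations diverge, \<open>Lim\<close> takes the fixed junk value \<open>THE l. False\<close>, so that the
  integrand is measurable although the exceptional set need not be empty.\<close>

lemma Lim_expectation:
  assumes "k \<le> n" "s \<in> ordered_simplex k"
  shows "Lim (at_right 0) (\<lambda>\<epsilon>. E k \<epsilon> s) = (if limit_moment k s < \<infinity> then enn2real (limit_moment k s) else (THE l. False))"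
  unfolding t2_space_class.Lim_def expectation_tendsto_iff[OF assms] by simp

text \<open>Almost everywhere on the simplex the limit is the finite value of
  \<open>limit_moment\<close>, so the nonnegative integral computed before settles integrability and
  value at once.\<close>

lemma rhs_integrand:
  assumes k: "2 \<le> k" "k \<le> n"
  shows "set_integrable (lborel_vec k) (ordered_simplex k) (\<lambda>s. Lim (at_right 0) (\<lambda>\<epsilon>. E k \<epsilon> s) * log_kernel r (s 1) (s k))" (is ?int)
    and "(LINT s:ordered_simplex k|lborel_vec k. Lim (at_right 0) (\<lambda>\<epsilon>. E k \<epsilon> s) * log_kernel r (s 1) (s k)) =
      fact (n - k) * (\<Sum>(i, j)\<in>pairs k. real ((j - i - 1) choose (k - 2)) * enn2real (pair_integral i j))" (is "?I = ?v")
proof -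
  define f where "f s = indicator (ordered_simplex k) s *
     ((if limit_moment k s < \<infinity> then enn2real (limit_moment k s) else (THE l. False)) * (- L0 (s k - s 1)))" for s
  have lk: "log_kernel r (s 1) (s k) = - L0 (s k - s 1)" if s: "s \<in> ordered_simplex k" for s
  proof -
    have "strict_mono_on {1..k} s" using s by (auto simp: ordered_simplex_def)
    then have "s 1 < s k" using k by (intro strict_mono_onD[of "{1..k}" s]) auto
    moreover have "s k - s 1 < 1" using ordered_simplexD[OF s, of 1] ordered_simplexD[OF s, of k] k by auto
    ultimately show ?thesis by (intro log_kernel_eq) auto
  qed
  have feq: "(\<lambda>s. indicator (ordered_simplex k) s *\<^sub>R (Lim (at_right 0) (\<lambda>\<epsilon>. E k \<epsilon> s) * log_kernel r (s 1) (s k))) = f"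
  proof
    fix s
    show "indicator (ordered_simplex k) s *\<^sub>R (Lim (at_right 0) (\<lambda>\<epsilon>. E k \<epsilon> s) * log_kernel r (s 1) (s k)) = f s"
    proof (cases "s \<in> ordered_simplex k")
      case True
      show ?thesis unfolding f_def Lim_expectation[OF k(2) True] lk[OF True] by simp
    qed (simp add: f_def)
  qed
  have lm: "limit_moment k \<in> borel_measurable (lborel_vec k)" by (rule borel_measurable_limit_moment[OF k(2)])
  have km: "(\<lambda>s. - L0 (s k - s 1)) \<in> borel_measurable (lborel_vec k)"
    using k by (intro borel_measurable_uminus measurable_compose[OF _ borel_measurable_L0] borel_measurable_diff measurable_PiM_component_real) auto
  have fm: "f \<in> borel_measurable (lborel_vec k)"
    unfolding f_def
  proof (intro borel_measurable_times borel_measurable_indicator sets_ordered_simplex km)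
    have "{s \<in> space (lborel_vec k). limit_moment k s < \<infinity>} \<in> sets (lborel_vec k)"
      by (rule borel_measurable_less[OF lm borel_measurable_const])
    then show "(\<lambda>s. if limit_moment k s < \<infinity> then enn2real (limit_moment k s) else (THE l. False)) \<in> borel_measurable (lborel_vec k)"
      by (rule measurable_If[OF borel_measurable_enn2real[OF lm] borel_measurable_const])
  qed
  have AE1: "AE s in lborel_vec k. ennreal (f s) = Gk (s 1) (s k) * limit_moment k s * indicator (ordered_simplex k) s \<and> 0 \<le> f s"
    using AE_limit_moment_finite[OF k]
  proof eventually_elim
    case (elim s)
    show ?case
    proof (cases "s \<in> ordered_simplex k")
      case True
      then have fin: "limit_moment k s < \<infinity>" using elim by simp
      then have fs: "f s = (- L0 (s k - s 1)) * enn2real (limit_moment k s)" using True by (simp add: f_def)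
      have L: "0 \<le> - L0 (s k - s 1)" using L0_nonpos by simp
      have "ennreal (f s) = Gk (s 1) (s k) * ennreal (enn2real (limit_moment k s))"
        unfolding fs Gk_def by (rule ennreal_mult[OF L enn2real_nonneg])
      moreover have "0 \<le> f s" unfolding fs by (rule mult_nonneg_nonneg[OF L enn2real_nonneg])
      ultimately show ?thesis using fin True by simp
    qed (simp add: f_def)
  qed
  have "0 \<le> ?v" by (intro mult_nonneg_nonneg sum_nonneg) auto
  have nn: "(\<integral>\<^sup>+s. ennreal (f s) \<partial>lborel_vec k) = ennreal ?v"
    unfolding nn_integral_kernel_limit_moment[OF k, symmetric]
    using AE1 by (intro nn_integral_cong_AE) (auto elim: eventually_mono)
  have AE0: "AE s in lborel_vec k. 0 \<le> f s" using AE1 by (auto elim: eventually_mono)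
  show ?int unfolding set_integrable_def feq
    by (rule integrableI_nonneg[OF fm AE0]) (subst nn, simp)
  have "?I = (LINT s|lborel_vec k. f s)" unfolding set_lebesgue_integral_def feq ..
  also have "\<dots> = enn2real (\<integral>\<^sup>+s. ennreal (f s) \<partial>lborel_vec k)" by (rule integral_eq_nn_integral[OF fm AE0])
  also have "\<dots> = ?v" unfolding nn using \<open>0 \<le> ?v\<close> by (rule enn2real_ennreal)
  finally show "?I = ?v" .
qed

text \<open>On the simplex the product of powers of r is the limit weight; each pair contributes an
  integrable term, so the finite double sum may be taken out of the integral.\<close>

lemma lhs_integrand:
  fixes lhs :: "(nat \<Rightarrow> real) \<Rightarrow> real"
  defines "lhs \<equiv> \<lambda>t. (\<Sum>p\<in>{1..n}. \<Sum>k\<in>{1..<p}. d (p - k) * log_kernel r (t p) (t k)) *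
     (\<Prod>p\<in>{1..n}. \<Prod>k\<in>{1..<p}. r (t p - t k) powr (- \<mu> * d (p - k)))"
  shows "set_integrable (lborel_vec n) (ordered_simplex n) lhs"
    and "(LINT t:ordered_simplex n|lborel_vec n. lhs t) = (\<Sum>p\<in>{1..n}. \<Sum>k\<in>{1..<p}. d (p - k) * enn2real (pair_integral k p))"
proof -
  define f where "f k p t = exp (log_limit {1..n} t) * (- L0 (t p - t k)) * indicator (ordered_simplex n) t" for k p :: nat and t
  have f0: "0 \<le> f k p t" for k p t unfolding f_def using L0_nonpos[of "t p - t k"] by (intro mult_nonneg_nonneg) auto
  have fm: "f k p \<in> borel_measurable (lborel_vec n)" if "k \<in> {1..n}" "p \<in> {1..n}" for k p
    unfolding f_def[abs_def] using that
    by (intro borel_measurable_times measurable_compose[OF _ borel_measurable_exp] borel_measurable_log_limit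
      borel_measurable_uminus measurable_compose[OF _ borel_measurable_L0] borel_measurable_diff measurable_PiM_component_real
      borel_measurable_indicator sets_ordered_simplex) auto
  have fA: "(\<integral>\<^sup>+t. ennreal (f k p t) \<partial>lborel_vec n) = pair_integral k p" for k p
    unfolding pair_integral_def
  proof (rule nn_integral_cong)
    fix t
    have "0 \<le> - L0 (t p - t k)" using L0_nonpos by simp
    then have e: "ennreal (exp (log_limit {1..n} t) * (- L0 (t p - t k))) = W t * Gk (t k) (t p)"
      unfolding W_def Gk_def by (intro ennreal_mult) auto
    show "ennreal (f k p t) = W t * Gk (t k) (t p) * indicator (ordered_simplex n) t"
    proof (cases "t \<in> ordered_simplex n")
      case True
      then show ?thesis by (simp only: f_def indicator_simps mult_1_right e)
    qed (simp add: f_def)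
  qed
  have fi: "integrable (lborel_vec n) (f k p)" and fI: "(LINT t|lborel_vec n. f k p t) = enn2real (pair_integral k p)"
    if "1 \<le> k" "k < p" "p \<le> n" for k p
  proof -
    have m: "f k p \<in> borel_measurable (lborel_vec n)" using that by (intro fm) auto
    show "integrable (lborel_vec n) (f k p)"
      by (rule integrableI_nonneg[OF m]) (use f0 fA W_integrals_finite(2)[OF that] in auto)
    show "(LINT t|lborel_vec n. f k p t) = enn2real (pair_integral k p)"
      unfolding fA[symmetric] by (rule integral_eq_nn_integral[OF m]) (simp add: f0)
  qed
  have eq: "(\<lambda>t. indicator (ordered_simplex n) t *\<^sub>R lhs t) = (\<lambda>t. \<Sum>p\<in>{1..n}. \<Sum>k\<in>{1..<p}. d (p - k) * f k p t)"
  proof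
    fix t
    show "indicator (ordered_simplex n) t *\<^sub>R lhs t = (\<Sum>p\<in>{1..n}. \<Sum>k\<in>{1..<p}. d (p - k) * f k p t)"
    proof (cases "t \<in> ordered_simplex n")
      case True
      have "lhs t = (\<Sum>p\<in>{1..n}. \<Sum>k\<in>{1..<p}. d (p - k) * log_kernel r (t p) (t k) * exp (log_limit {1..n} t))"
        unfolding lhs_def exp_log_limit_simplex[OF True] sum_distrib_right ..
      also have "\<dots> = (\<Sum>p\<in>{1..n}. \<Sum>k\<in>{1..<p}. d (p - k) * f k p t)"
      proof (intro sum.cong refl)
        fix p k assume pk: "p \<in> {1..n}" "k \<in> {1..<p}"
        then have "log_kernel r (t p) (t k) = - L0 (t p - t k)"
          using simplex_diff[OF True, of k p] by (intro log_kernel_eq) auto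
        then show "d (p - k) * log_kernel r (t p) (t k) * exp (log_limit {1..n} t) = d (p - k) * f k p t"
          using True by (simp add: f_def)
      qed
      finally show ?thesis using True by simp
    qed (simp add: f_def)
  qed
  show "set_integrable (lborel_vec n) (ordered_simplex n) lhs"
    unfolding set_integrable_def eq by (intro Bochner_Integration.integrable_sum integrable_mult_right fi) auto
  have "(LINT t:ordered_simplex n|lborel_vec n. lhs t) = (\<Sum>p\<in>{1..n}. LINT t|lborel_vec n. (\<Sum>k\<in>{1..<p}. d (p - k) * f k p t))"
    unfolding set_lebesgue_integral_def eq
    by (intro Bochner_Integration.integral_sum Bochner_Integration.integrable_sum integrable_mult_right fi) auto
  also have "\<dots> = (\<Sum>p\<in>{1..n}. \<Sum>k\<in>{1..<p}. LINT t|lborel_vec n. d (p - k) * f k p t)"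
    by (intro sum.cong refl Bochner_Integration.integral_sum integrable_mult_right fi) auto
  also have "\<dots> = (\<Sum>p\<in>{1..n}. \<Sum>k\<in>{1..<p}. d (p - k) * enn2real (pair_integral k p))"
  proof (intro sum.cong refl)
    fix p k assume "p \<in> {1..n}" "k \<in> {1..<p}"
    then have "(LINT t|lborel_vec n. f k p t) = enn2real (pair_integral k p)" by (intro fI) auto
    then show "(LINT t|lborel_vec n. d (p - k) * f k p t) = d (p - k) * enn2real (pair_integral k p)"
      by (simp only: integral_mult_right_zero)
  qed
  finally show "(LINT t:ordered_simplex n|lborel_vec n. lhs t) = (\<Sum>p\<in>{1..n}. \<Sum>k\<in>{1..<p}. d (p - k) * enn2real (pair_integral k p))" .
qed

text \<open>Expand each d(m) into powers of e^u - 1 and interchange the sums. The \<sigma>^2 part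
  has coefficient 1 for every pair, which is the binomial of k = 2; this is why it meets the
  integral over the two-dimensional simplex.\<close>

lemma moment_identity:
  "fact n * (\<Sum>p\<in>{1..n}. \<Sum>k\<in>{1..<p}. d (p - k) * enn2real (pair_integral k p)) =
    \<sigma>2 * real n * (real n - 1) * (fact (n - 2) * (\<Sum>(i, j)\<in>pairs 2. real ((j - i - 1) choose (2 - 2)) * enn2real (pair_integral i j)))
    + (\<Sum>k\<in>{2..n}. fact n / fact (n - k) * (LINT u|\<nu>. (exp u - 1) ^ k) *
        (fact (n - k) * (\<Sum>(i, j)\<in>pairs k. real ((j - i - 1) choose (k - 2)) * enn2real (pair_integral i j))))"
proof -
  \<comment> \<open>All pairs i < j: with k = 0 the truncated k - 1 is 0 and imposes no
    distance.\<close>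
  let ?T = "pairs 0"
  define a where "a z = enn2real (pair_integral (fst z) (snd z))" for z
  define m where "m z = snd z - fst z" for z :: "nat \<times> nat"
  define Ik where "Ik k = (LINT u|\<nu>. (exp u - 1) ^ k)" for k
  \<comment> \<open>Pairs too close for k points have a vanishing binomial, so the sum may run over
    a set of pairs independent of k.\<close>
  have P: "(\<Sum>(i, j)\<in>pairs k. real ((j - i - 1) choose (k - 2)) * enn2real (pair_integral i j)) = (\<Sum>z\<in>?T. real ((m z - 1) choose (k - 2)) * a z)"
    if k: "2 \<le> k" for k
  proof -
    have "(\<Sum>(i, j)\<in>pairs k. real ((j - i - 1) choose (k - 2)) * enn2real (pair_integral i j)) = (\<Sum>z\<in>pairs k. real ((m z - 1) choose (k - 2)) * a z)"
      by (rule sum.cong) (auto simp: m_def a_def)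
    also have "\<dots> = (\<Sum>z\<in>?T. real ((m z - 1) choose (k - 2)) * a z)"
    proof (rule sum.mono_neutral_left[OF finite_pairs])
      show "\<forall>z\<in>?T - pairs k. real ((m z - 1) choose (k - 2)) * a z = 0"
      proof
        fix z assume "z \<in> ?T - pairs k"
        then have "m z - 1 < k - 2" using k by (auto simp: m_def)
        then show "real ((m z - 1) choose (k - 2)) * a z = 0" by (simp add: binomial_eq_0)
      qed
    qed auto
    finally show ?thesis .
  qed
  have fn: "real n * (real n - 1) * fact (n - 2) = fact n"
  proof -
    obtain l where "n = Suc (Suc l)" using n_ge by (metis add_2_eq_Suc le_Suc_ex)
    then show ?thesis by simp
  qed
  have "(\<Sum>p\<in>{1..n}. \<Sum>k\<in>{1..<p}. d (p - k) * enn2real (pair_integral k p)) = (\<Sum>(p, k)\<in>Sigma {1..n} (\<lambda>p. {1..<p}). d (p - k) * enn2real (pair_integral k p))"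
    by (rule sum.Sigma) auto
  also have "\<dots> = (\<Sum>z\<in>?T. d (m z) * a z)"
    unfolding m_def a_def by (rule sum.reindex_bij_witness[of _ "\<lambda>(i, j). (j, i)" "\<lambda>(i, j). (j, i)"]) auto
  also have "\<dots> = (\<Sum>z\<in>?T. \<sigma>2 * a z + (\<Sum>k\<in>{2..n}. Ik k * (real ((m z - 1) choose (k - 2)) * a z)))"
  proof (rule sum.cong[OF refl])
    fix z assume "z \<in> ?T"
    then have "d (m z) = \<sigma>2 + (\<Sum>k\<in>{2..n}. real ((m z - 1) choose (k - 2)) * Ik k)"
      unfolding Ik_def by (intro d_coeff_binomial) (auto simp: m_def)
    moreover have "(\<Sum>k\<in>{2..n}. real ((m z - 1) choose (k - 2)) * Ik k) * a z = (\<Sum>k\<in>{2..n}. Ik k * (real ((m z - 1) choose (k - 2)) * a z))"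
      unfolding sum_distrib_right by (intro sum.cong) (simp_all add: ac_simps)
    ultimately show "d (m z) * a z = \<sigma>2 * a z + (\<Sum>k\<in>{2..n}. Ik k * (real ((m z - 1) choose (k - 2)) * a z))"
      by (simp only: distrib_right)
  qed
  also have "\<dots> = \<sigma>2 * (\<Sum>z\<in>?T. a z) + (\<Sum>k\<in>{2..n}. Ik k * (\<Sum>z\<in>?T. real ((m z - 1) choose (k - 2)) * a z))"
    unfolding sum.distrib sum_distrib_left by (subst (2) sum.swap) (rule refl)
  finally have "fact n * (\<Sum>p\<in>{1..n}. \<Sum>k\<in>{1..<p}. d (p - k) * enn2real (pair_integral k p)) =
    fact n * (\<sigma>2 * (\<Sum>z\<in>?T. a z)) + (\<Sum>k\<in>{2..n}. fact n * (Ik k * (\<Sum>z\<in>?T. real ((m z - 1) choose (k - 2)) * a z)))"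
    by (simp add: distrib_left sum_distrib_left)
  also have "fact n * (\<sigma>2 * (\<Sum>z\<in>?T. a z)) = \<sigma>2 * real n * (real n - 1) * (fact (n - 2) * (\<Sum>z\<in>?T. a z))"
    unfolding fn[symmetric] by (simp add: ac_simps)
  also have "(\<Sum>z\<in>?T. a z) = (\<Sum>(i, j)\<in>pairs 2. real ((j - i - 1) choose (2 - 2)) * enn2real (pair_integral i j))"
    by (subst P) auto
  also have "(\<Sum>k\<in>{2..n}. fact n * (Ik k * (\<Sum>z\<in>?T. real ((m z - 1) choose (k - 2)) * a z))) =
    (\<Sum>k\<in>{2..n}. fact n / fact (n - k) * Ik k * (fact (n - k) * (\<Sum>(i, j)\<in>pairs k. real ((j - i - 1) choose (k - 2)) * enn2real (pair_integral i j))))"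
    by (intro sum.cong refl) (subst P, auto)
  finally show ?thesis unfolding Ik_def .
qed

end

theorem theorem3p7:
  shows
  "(\<forall>(n::nat) (k::nat) (\<omega> :: real \<Rightarrow> real) (g :: real \<Rightarrow> real \<Rightarrow> real).
      2 \<le> n \<and> 2 \<le> k \<and> k \<le> n \<and>
      continuous_on {0..1} \<omega> \<and> continuous_on ({0..1} \<times> {0..1}) (\<lambda>(x, y). g x y) \<longrightarrow>
      1 / fact (n - k) * (LINT s:{0..1}|lborel. exp (\<omega> s)) ^ (n - k) *
        (LINT s:ordered_simplex k|lborel_vec k. exp (\<Sum>i\<in>{1..k}. \<omega> (s i)) * g (s 1) (s k))
      = (LINT s:ordered_simplex n|lborel_vec n. exp (\<Sum>i\<in>{1..n}. \<omega> (s i)) *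
          (\<Sum>(i, j)\<in>{(i, j). 1 \<le> i \<and> i < j \<and> j \<le> n \<and> k - 1 \<le> j - i}.
             real ((j - i - 1) choose (k - 2)) * g (s i) (s j))))
   \<and>
   (\<forall>(\<Omega> :: 'a measure) (P :: (real \<times> real) set \<Rightarrow> 'a \<Rightarrow> real)
      (\<sigma>2 :: real) (\<nu> :: real measure) (r :: real \<Rightarrow> real) (\<mu> :: real) (n :: nat).
      0 \<le> \<sigma>2 \<and> levy_measure \<nu> \<and> set_integrable \<nu> {1..} (\<lambda>u. exp (real n * u)) \<and>
      admissible_scale r \<and> 0 < \<mu> \<and> nondegenerate \<mu> \<sigma>2 \<nu> \<and>
      id_random_measure \<Omega> (intensity_measure r) (\<lambda>q. of_real \<mu> * id_exponent \<sigma>2 \<nu> q) P \<and>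
      measurable_field \<Omega> P \<and>
      2 \<le> n \<and> real n - \<mu> * Re (id_exponent \<sigma>2 \<nu> (- \<i> * of_nat n)) > 1 \<longrightarrow>
      (let g = log_kernel r; d = d_coeff \<sigma>2 \<nu>;
           lhs_integrand = (\<lambda>t. (\<Sum>p\<in>{1..n}. \<Sum>k\<in>{1..<p}. d (p - k) * g (t p) (t k)) *
             (\<Prod>p\<in>{1..n}. \<Prod>k\<in>{1..<p}. r (t p - t k) powr (- \<mu> * d (p - k))));
           E = (\<lambda>k \<epsilon> s. LINT x|\<Omega>. moment_density P n k \<epsilon> s x);
           rhs_integrand = (\<lambda>k s. Lim (at_right 0) (\<lambda>\<epsilon>. E k \<epsilon> s) * g (s 1) (s k))
       in
         \<comment> \<open>the expectations, limits and integrals in the identity exist\<close>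
         set_integrable (lborel_vec n) (ordered_simplex n) lhs_integrand \<and>
         (\<forall>k\<in>{2..n}.
            (\<forall>\<epsilon>\<in>{0<..1}. \<forall>s\<in>ordered_simplex k. integrable \<Omega> (moment_density P n k \<epsilon> s)) \<and>
            (AE s in lborel_vec k. s \<in> ordered_simplex k \<longrightarrow>
               (\<exists>L. ((\<lambda>\<epsilon>. E k \<epsilon> s) \<longlongrightarrow> L) (at_right 0))) \<and>
            set_integrable (lborel_vec k) (ordered_simplex k) (rhs_integrand k)) \<and>
         \<comment> \<open>the identity\<close>
         fact n * (LINT t:ordered_simplex n|lborel_vec n. lhs_integrand t)
         = \<sigma>2 * real n * (real n - 1) *
             (LINT s:ordered_simplex 2|lborel_vec 2. rhs_integrand 2 s)
           + (\<Sum>k\<in>{2..n}. fact n / fact (n - k) * (LINT u|\<nu>. (exp u - 1) ^ k) *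
               (LINT s:ordered_simplex k|lborel_vec k. rhs_integrand k s))))"
proof (intro conjI allI impI; elim conjE)
  fix n k :: nat and \<omega> :: "real \<Rightarrow> real" and g :: "real \<Rightarrow> real \<Rightarrow> real"
  assume "2 \<le> k" "k \<le> n" "continuous_on {0..1} \<omega>" "continuous_on ({0..1} \<times> {0..1}) (\<lambda>(x, y). g x y)"
  then show "1 / fact (n - k) * (LINT s:{0..1}|lborel. exp (\<omega> s)) ^ (n - k) *
        (LINT s:ordered_simplex k|lborel_vec k. exp (\<Sum>i\<in>{1..k}. \<omega> (s i)) * g (s 1) (s k))
      = (LINT s:ordered_simplex n|lborel_vec n. exp (\<Sum>i\<in>{1..n}. \<omega> (s i)) *
          (\<Sum>(i, j)\<in>{(i, j). 1 \<le> i \<and> i < j \<and> j \<le> n \<and> k - 1 \<le> j - i}.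
             real ((j - i - 1) choose (k - 2)) * g (s i) (s j)))"
    by (rule simplex_exp_identity)
next
  fix \<Omega> :: "'a measure" and P :: "(real \<times> real) set \<Rightarrow> 'a \<Rightarrow> real" and \<sigma>2 :: real and \<nu> :: "real measure"
    and r :: "real \<Rightarrow> real" and \<mu> :: real and n :: nat
  assume "0 \<le> \<sigma>2" "levy_measure \<nu>" "set_integrable \<nu> {1..} (\<lambda>u. exp (real n * u))" "admissible_scale r" "0 < \<mu>"
    "id_random_measure \<Omega> (intensity_measure r) (\<lambda>q. of_real \<mu> * id_exponent \<sigma>2 \<nu> q) P" "measurable_field \<Omega> P"
    "2 \<le> n" "real n - \<mu> * Re (id_exponent \<sigma>2 \<nu> (- \<i> * of_nat n)) > 1"
  then interpret cascade \<nu> n r \<Omega> \<mu> \<sigma>2 P by unfold_locales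
  show "let g = log_kernel r; d = d_coeff \<sigma>2 \<nu>;
           lhs_integrand = (\<lambda>t. (\<Sum>p\<in>{1..n}. \<Sum>k\<in>{1..<p}. d (p - k) * g (t p) (t k)) *
             (\<Prod>p\<in>{1..n}. \<Prod>k\<in>{1..<p}. r (t p - t k) powr (- \<mu> * d (p - k))));
           E = (\<lambda>k \<epsilon> s. LINT x|\<Omega>. moment_density P n k \<epsilon> s x);
           rhs_integrand = (\<lambda>k s. Lim (at_right 0) (\<lambda>\<epsilon>. E k \<epsilon> s) * g (s 1) (s k))
       in
         set_integrable (lborel_vec n) (ordered_simplex n) lhs_integrand \<and>
         (\<forall>k\<in>{2..n}.
            (\<forall>\<epsilon>\<in>{0<..1}. \<forall>s\<in>ordered_simplex k. integrable \<Omega> (moment_density P n k \<epsilon> s)) \<and>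
            (AE s in lborel_vec k. s \<in> ordered_simplex k \<longrightarrow>
               (\<exists>L. ((\<lambda>\<epsilon>. E k \<epsilon> s) \<longlongrightarrow> L) (at_right 0))) \<and>
            set_integrable (lborel_vec k) (ordered_simplex k) (rhs_integrand k)) \<and>
         fact n * (LINT t:ordered_simplex n|lborel_vec n. lhs_integrand t)
         = \<sigma>2 * real n * (real n - 1) *
             (LINT s:ordered_simplex 2|lborel_vec 2. rhs_integrand 2 s)
           + (\<Sum>k\<in>{2..n}. fact n / fact (n - k) * (LINT u|\<nu>. (exp u - 1) ^ k) *
               (LINT s:ordered_simplex k|lborel_vec k. rhs_integrand k s))"
    unfolding Let_def
  proof (intro conjI ballI)
    fix k assume "k \<in> {2..n}"
    then have k: "2 \<le> k" "k \<le> n" by auto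
    show "integrable \<Omega> (moment_density P n k \<epsilon> s)" if "\<epsilon> \<in> {0<..1}" "s \<in> ordered_simplex k" for \<epsilon> s
      using that k by (intro integrable_moment_density) auto
    show "AE s in lborel_vec k. s \<in> ordered_simplex k \<longrightarrow>
        (\<exists>L. ((\<lambda>\<epsilon>. LINT x|\<Omega>. moment_density P n k \<epsilon> s x) \<longlongrightarrow> L) (at_right 0))"
      using AE_limit_moment_finite[OF k] by eventually_elim (simp add: expectation_tendsto_iff[OF k(2)])
    show "set_integrable (lborel_vec k) (ordered_simplex k)
        (\<lambda>s. Lim (at_right 0) (\<lambda>\<epsilon>. LINT x|\<Omega>. moment_density P n k \<epsilon> s x) * log_kernel r (s 1) (s k))"
      by (rule rhs_integrand(1)[OF k])
  next
    have R: "(LINT s:ordered_simplex k|lborel_vec k. Lim (at_right 0) (\<lambda>\<epsilon>. LINT x|\<Omega>. moment_density P n k \<epsilon> s x) * log_kernel r (s 1) (s k))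
        = fact (n - k) * (\<Sum>(i, j)\<in>pairs k. real ((j - i - 1) choose (k - 2)) * enn2real (pair_integral i j))"
      if "k \<in> {2..n}" for k using that by (intro rhs_integrand(2)) auto
    have S: "(\<Sum>k\<in>{2..n}. fact n / fact (n - k) * (LINT u|\<nu>. (exp u - 1) ^ k) *
        (LINT s:ordered_simplex k|lborel_vec k. Lim (at_right 0) (\<lambda>\<epsilon>. LINT x|\<Omega>. moment_density P n k \<epsilon> s x) * log_kernel r (s 1) (s k)))
      = (\<Sum>k\<in>{2..n}. fact n / fact (n - k) * (LINT u|\<nu>. (exp u - 1) ^ k) *
        (fact (n - k) * (\<Sum>(i, j)\<in>pairs k. real ((j - i - 1) choose (k - 2)) * enn2real (pair_integral i j))))"
      by (intro sum.cong refl arg_cong2[where f = "(*)"] R)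
    \<comment> \<open>The member k = 2 also evaluates the integral in the \<sigma>^2 term.\<close>
    have "2 \<in> {2..n}" using n_ge by simp
    from R[OF this] show "fact n * (LINT t:ordered_simplex n|lborel_vec n. (\<Sum>p\<in>{1..n}. \<Sum>k\<in>{1..<p}. d_coeff \<sigma>2 \<nu> (p - k) * log_kernel r (t p) (t k)) *
             (\<Prod>p\<in>{1..n}. \<Prod>k\<in>{1..<p}. r (t p - t k) powr (- \<mu> * d_coeff \<sigma>2 \<nu> (p - k))))
         = \<sigma>2 * real n * (real n - 1) *
             (LINT s:ordered_simplex 2|lborel_vec 2. Lim (at_right 0) (\<lambda>\<epsilon>. LINT x|\<Omega>. moment_density P n 2 \<epsilon> s x) * log_kernel r (s 1) (s 2))
           + (\<Sum>k\<in>{2..n}. fact n / fact (n - k) * (LINT u|\<nu>. (exp u - 1) ^ k) *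
               (LINT s:ordered_simplex k|lborel_vec k. Lim (at_right 0) (\<lambda>\<epsilon>. LINT x|\<Omega>. moment_density P n k \<epsilon> s x) * log_kernel r (s 1) (s k)))"
      unfolding S lhs_integrand(2) by (simp only: moment_identity)
  qed (rule lhs_integrand(1))
qed

end
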